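(* Let $M$ be a compact Riemannian manifold and let $\Lambda$ be a hyperbolic set for a $C^1$ diffeomorphism $f : M \to M$ with hyperbolicity exponent $\lambda\in(0,1)$ and constant $c>0$. There exists $\varepsilon_0>0$, depending on $\lambda$, $c$, and bounds on $\|Df\|$ and $\|Df^{-1}\|$, such that for any $C^1$ diffeomorphism $g$ with $\|f-g\|_{C^1}<\varepsilon_0$ there exists a unique hyperbolic set $\Lambda_g$ for $g$ such that: (i) $\Lambda_g$ is homeomorphic to $\Lambda$ via a homeomorphism $h:\Lambda\to\Lambda_g$ close to the identity. (ii) $h\circ f = g\circ h$ on $\Lambda$. (iii) $\Lambda_g$ has hyperbolicity exponent $\lambda'\in(\lambda,1)$ with $\lambda'\to\lambda$ as $\|f-g\|_{C^1}\to 0$.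
   Context: Hyperbolic set with exponent $\lambda\in(0,1)$ and constant $c>0$: a compact $f$-invariant set $\Lambda$ with a continuous $Df$-invariant splitting $T_\Lambda M=E^s\oplus E^u$ such that $\|Df^n_xv\|\le c\lambda^n\|v\|$ for $v\in E^s_x$ and $\|Df^{-n}_xv\|\le c\lambda^n\|v\|$ for $v\in E^u_x$, for all $x\in\Lambda$, $n\ge0$.
   Formalization: ε₀ is allowed to depend also on the modulus of continuity of Df, besides λ, c and the bounds on ‖Df‖ and ‖Df⁻¹‖; with those alone the claim fails (f(x) = x + (a/n) sin nx on the circle, Λ = {0}, g = f + 2a/n has no fixed point). *)

theory Defs
  imports "HOL-Analysis.Analysis"
begin

subsection \<open>Compact smooth manifolds\<close>

text \<open>
  The manifold is the whole of a Hausdorff type \<open>'a\<close>, modelled on a Euclidean space \<open>'e\<close>;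
  it has no boundary.  A chart is a pair of an open domain and a coordinate map.
  Second countability need not be required: it follows from compactness.
\<close>

type_synonym ('a, 'e) chart = "'a set \<times> ('a \<Rightarrow> 'e)"

abbreviation cdom :: "('a, 'e) chart \<Rightarrow> 'a set" where "cdom \<equiv> fst"
abbreviation cmap :: "('a, 'e) chart \<Rightarrow> 'a \<Rightarrow> 'e" where "cmap \<equiv> snd"
abbreviation cinv :: "('a, 'e) chart \<Rightarrow> 'e \<Rightarrow> 'a" where "cinv c \<equiv> inv_into (cdom c) (cmap c)"

text \<open>
  Class \<open>C\<^sup>k\<close> on an open subset of a Euclidean space: all iterated directional derivatives
  of order less than \<open>k\<close> are differentiable, and those of order \<open>k\<close> are continuous.
\<close>

primrec Ck_on :: "nat \<Rightarrow> 'b::euclidean_space set \<Rightarrow> ('b \<Rightarrow> 'c::real_normed_vector) \<Rightarrow> bool" where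
  "Ck_on 0 S F \<longleftrightarrow> continuous_on S F"
| "Ck_on (Suc k) S F \<longleftrightarrow> (\<forall>y\<in>S. F differentiable (at y)) \<and>
     (\<forall>u. Ck_on k S (\<lambda>y. frechet_derivative F (at y) u))"

definition smooth_on :: "'b::euclidean_space set \<Rightarrow> ('b \<Rightarrow> 'c::real_normed_vector) \<Rightarrow> bool" where
  "smooth_on S F \<longleftrightarrow> (\<forall>k. Ck_on k S F)"

definition smooth_atlas :: "('a::t2_space, 'e::euclidean_space) chart set \<Rightarrow> bool" where
  "smooth_atlas A \<longleftrightarrow>
     (\<forall>c\<in>A. open (cdom c) \<and> open (cmap c ` cdom c) \<and>
        homeomorphism (cdom c) (cmap c ` cdom c) (cmap c) (cinv c)) \<and>
     (\<Union>c\<in>A. cdom c) = UNIV \<and>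
     (\<forall>c\<in>A. \<forall>d\<in>A. smooth_on (cmap c ` (cdom c \<inter> cdom d)) (cmap d \<circ> cinv c))"

subsection \<open>Tangent vectors, derivatives and Riemannian metrics\<close>

text \<open>
  The tangent space at \<open>x\<close> is identified with \<open>'e\<close> by means of one chosen chart around \<open>x\<close>.
  The choice is arbitrary and need not vary continuously with \<open>x\<close>; whenever tangent vectors at
  different points are compared, they are first expressed in a common chart \<open>c\<close> by
  \<open>tcoord A c x\<close>.
\<close>

definition chart_at :: "('a, 'e) chart set \<Rightarrow> 'a \<Rightarrow> ('a, 'e) chart" where
  "chart_at A x = (SOME c. c \<in> A \<and> x \<in> cdom c)"

text \<open>The components with respect to \<open>d\<close> of the vector at \<open>x\<close> with components \<open>u\<close>
  with respect to \<open>c\<close>.\<close>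

definition tchange ::
  "('a, 'e::real_normed_vector) chart \<Rightarrow> ('a, 'e) chart \<Rightarrow> 'a \<Rightarrow> 'e \<Rightarrow> 'e" where
  "tchange c d x = frechet_derivative (cmap d \<circ> cinv c) (at (cmap c x))"

definition tcoord ::
  "('a, 'e::real_normed_vector) chart set \<Rightarrow> ('a, 'e) chart \<Rightarrow> 'a \<Rightarrow> 'e \<Rightarrow> 'e" where
  "tcoord A c x = tchange (chart_at A x) c x"

definition C1_map :: "('a::t2_space, 'e::euclidean_space) chart set \<Rightarrow> ('a \<Rightarrow> 'a) \<Rightarrow> bool" where
  "C1_map A f \<longleftrightarrow> continuous_on UNIV f \<and>
     (\<forall>c\<in>A. \<forall>d\<in>A. Ck_on 1 (cmap c ` (cdom c \<inter> f -` cdom d)) (cmap d \<circ> f \<circ> cinv c))"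

definition C1_diffeo :: "('a::t2_space, 'e::euclidean_space) chart set \<Rightarrow> ('a \<Rightarrow> 'a) \<Rightarrow> bool" where
  "C1_diffeo A f \<longleftrightarrow> bij f \<and> C1_map A f \<and> C1_map A (inv f)"

definition tderiv ::
  "('a, 'e::real_normed_vector) chart set \<Rightarrow> ('a \<Rightarrow> 'a) \<Rightarrow> 'a \<Rightarrow> 'e \<Rightarrow> 'e" where
  "tderiv A f x = frechet_derivative (cmap (chart_at A (f x)) \<circ> f \<circ> cinv (chart_at A x))
                    (at (cmap (chart_at A x) x))"

text \<open>The metric \<open>G\<close> written in the coordinates of the chart \<open>c\<close>.\<close>

definition chart_metric :: "('a, 'e::real_normed_vector) chart set \<Rightarrow> ('a \<Rightarrow> 'e \<Rightarrow> 'e \<Rightarrow> real) \<Rightarrow>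
    ('a, 'e) chart \<Rightarrow> 'e \<Rightarrow> 'e \<Rightarrow> 'e \<Rightarrow> real" where
  "chart_metric A G c y u v =
     (let x = cinv c y
      in G x (tchange c (chart_at A x) x u) (tchange c (chart_at A x) x v))"

definition riemannian_metric ::
  "('a::t2_space, 'e::euclidean_space) chart set \<Rightarrow> ('a \<Rightarrow> 'e \<Rightarrow> 'e \<Rightarrow> real) \<Rightarrow> bool" where
  "riemannian_metric A G \<longleftrightarrow>
     (\<forall>x. bilinear (G x) \<and> (\<forall>u v. G x u v = G x v u) \<and> (\<forall>v. v \<noteq> 0 \<longrightarrow> G x v v > 0)) \<and>
     (\<forall>c\<in>A. \<forall>u v. smooth_on (cmap c ` cdom c) (\<lambda>y. chart_metric A G c y u v))"

definition compact_riemannian_manifold ::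
  "('a::t2_space, 'e::euclidean_space) chart set \<Rightarrow> ('a \<Rightarrow> 'e \<Rightarrow> 'e \<Rightarrow> real) \<Rightarrow> bool" where
  "compact_riemannian_manifold A G \<longleftrightarrow>
     compact (UNIV :: 'a set) \<and> smooth_atlas A \<and> riemannian_metric A G"

definition rnorm :: "('a \<Rightarrow> 'e \<Rightarrow> 'e \<Rightarrow> real) \<Rightarrow> 'a \<Rightarrow> 'e \<Rightarrow> real" where
  "rnorm G x v = sqrt (G x v v)"

subsection \<open>Riemannian distance and parallel transport\<close>

definition C1_curve_on ::
  "('a, 'e::real_normed_vector) chart set \<Rightarrow> real set \<Rightarrow> (real \<Rightarrow> 'a) \<Rightarrow> bool" where
  "C1_curve_on A I \<gamma> \<longleftrightarrow>
     (\<forall>c\<in>A. \<exists>\<gamma>'. continuous_on {t\<in>I. \<gamma> t \<in> cdom c} \<gamma>' \<and>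
        (\<forall>t\<in>{t\<in>I. \<gamma> t \<in> cdom c}. ((cmap c \<circ> \<gamma>) has_vector_derivative \<gamma>' t) (at t within I)))"

definition pw_C1_curve ::
  "('a::t2_space, 'e::euclidean_space) chart set \<Rightarrow> (real \<Rightarrow> 'a) \<Rightarrow> bool" where
  "pw_C1_curve A \<gamma> \<longleftrightarrow> path \<gamma> \<and>
     (\<exists>S. finite S \<and>
        (\<forall>a b. 0 \<le> a \<and> a < b \<and> b \<le> 1 \<and> {a<..<b} \<inter> S = {} \<longrightarrow> C1_curve_on A {a..b} \<gamma>))"

definition curves ::
  "('a::t2_space, 'e::euclidean_space) chart set \<Rightarrow> 'a \<Rightarrow> 'a \<Rightarrow> (real \<Rightarrow> 'a) set" where
  "curves A x y = {\<gamma>. pw_C1_curve A \<gamma> \<and> pathstart \<gamma> = x \<and> pathfinish \<gamma> = y}"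

definition curve_length :: "('a, 'e::euclidean_space) chart set \<Rightarrow>
    ('a \<Rightarrow> 'e \<Rightarrow> 'e \<Rightarrow> real) \<Rightarrow> (real \<Rightarrow> 'a) \<Rightarrow> real" where
  "curve_length A G \<gamma> = integral {0..1}
     (\<lambda>t. rnorm G (\<gamma> t) (vector_derivative (cmap (chart_at A (\<gamma> t)) \<circ> \<gamma>) (at t)))"

text \<open>Points in different components have distance \<open>\<infinity>\<close>.\<close>

definition riem_dist :: "('a::t2_space, 'e::euclidean_space) chart set \<Rightarrow>
    ('a \<Rightarrow> 'e \<Rightarrow> 'e \<Rightarrow> real) \<Rightarrow> 'a \<Rightarrow> 'a \<Rightarrow> ennreal" where
  "riem_dist A G x y = (INF \<gamma>\<in>curves A x y. ennreal (curve_length A G \<gamma>))"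

text \<open>
  The Levi-Civita connection in the chart \<open>c\<close>: the value at \<open>y\<close> of \<open>\<nabla>\<^sub>u v\<close> for constant
  coordinate fields \<open>u\<close> and \<open>v\<close>, given by the Koszul formula.
\<close>

definition christoffel :: "('a, 'e::euclidean_space) chart set \<Rightarrow> ('a \<Rightarrow> 'e \<Rightarrow> 'e \<Rightarrow> real) \<Rightarrow>
    ('a, 'e) chart \<Rightarrow> 'e \<Rightarrow> 'e \<Rightarrow> 'e \<Rightarrow> 'e" where
  "christoffel A G c y u v =
     (THE z. \<forall>w. 2 * chart_metric A G c y z w =
          frechet_derivative (\<lambda>y. chart_metric A G c y v w) (at y) u
        + frechet_derivative (\<lambda>y. chart_metric A G c y u w) (at y) v
        - frechet_derivative (\<lambda>y. chart_metric A G c y u v) (at y) w)"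

text \<open>Here \<open>V t\<close> is a tangent vector at \<open>\<gamma> t\<close>; the set \<open>S\<close> absorbs the corners of \<open>\<gamma>\<close>.\<close>

definition parallel_along :: "('a, 'e::euclidean_space) chart set \<Rightarrow> ('a \<Rightarrow> 'e \<Rightarrow> 'e \<Rightarrow> real) \<Rightarrow>
    (real \<Rightarrow> 'a) \<Rightarrow> (real \<Rightarrow> 'e) \<Rightarrow> bool" where
  "parallel_along A G \<gamma> V \<longleftrightarrow>
     (\<exists>S. finite S \<and>
       (\<forall>c\<in>A. continuous_on {t\<in>{0..1}. \<gamma> t \<in> cdom c} (\<lambda>t. tcoord A c (\<gamma> t) (V t)) \<and>
          (\<forall>t\<in>{0<..<1} - S. \<gamma> t \<in> cdom c \<longrightarrow>
             ((\<lambda>t. tcoord A c (\<gamma> t) (V t)) has_vector_derivative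
                - christoffel A G c (cmap c (\<gamma> t)) (vector_derivative (cmap c \<circ> \<gamma>) (at t))
                    (tcoord A c (\<gamma> t) (V t))) (at t))))"

definition transport :: "('a, 'e::euclidean_space) chart set \<Rightarrow> ('a \<Rightarrow> 'e \<Rightarrow> 'e \<Rightarrow> real) \<Rightarrow>
    (real \<Rightarrow> 'a) \<Rightarrow> 'e \<Rightarrow> 'e" where
  "transport A G \<gamma> v = (THE w. \<exists>V. parallel_along A G \<gamma> V \<and> V 0 = v \<and> V 1 = w)"

subsection \<open>The \<open>C\<^sup>1\<close> distance\<close>

text \<open>
  The \<open>C\<^sup>1\<close> size of \<open>f - g\<close>.  The points \<open>f x\<close> and \<open>g x\<close> are joined by a curve, along which
  the derivative of \<open>f\<close> at \<open>x\<close> is transported to the tangent space at \<open>g x\<close>, where it is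
  compared with the derivative of \<open>g\<close> in operator norm.
\<close>

definition C1_dist :: "('a::t2_space, 'e::euclidean_space) chart set \<Rightarrow>
    ('a \<Rightarrow> 'e \<Rightarrow> 'e \<Rightarrow> real) \<Rightarrow> ('a \<Rightarrow> 'a) \<Rightarrow> ('a \<Rightarrow> 'a) \<Rightarrow> ennreal" where
  "C1_dist A G f g =
     (SUP x. INF \<gamma>\<in>curves A (f x) (g x).
        ennreal (curve_length A G \<gamma>) +
        (SUP v\<in>{v. rnorm G x v \<le> 1}.
           ennreal (rnorm G (g x) (transport A G \<gamma> (tderiv A f x v) - tderiv A g x v))))"

text \<open>The modulus of continuity of the derivative of \<open>f\<close>: how much it can vary along a curve
  of length at most \<open>r\<close>.  The size of the admissible perturbations of \<open>f\<close> depends on it, and not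
  only on \<open>\<lambda>\<close>, \<open>c\<close> and bounds on the derivatives: on the circle of length \<open>2\<pi>\<close>, the map
  \<open>f(x) = x + (a/n) sin(nx)\<close> with \<open>0 < a < 1\<close> has the hyperbolic fixed point \<open>0\<close>, with data independent
  of \<open>n\<close>, but \<open>f + 2a/n\<close> has no fixed point if \<open>n\<close> is large.\<close>

definition deriv_modulus :: "('a::t2_space, 'e::euclidean_space) chart set \<Rightarrow>
    ('a \<Rightarrow> 'e \<Rightarrow> 'e \<Rightarrow> real) \<Rightarrow> ('a \<Rightarrow> 'a) \<Rightarrow> real \<Rightarrow> ennreal" where
  "deriv_modulus A G f r =
     (SUP \<gamma>\<in>{\<gamma>. pw_C1_curve A \<gamma> \<and> curve_length A G \<gamma> \<le> r}.
      SUP v\<in>{v. rnorm G (\<gamma> 0) v \<le> 1}.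
        ennreal (rnorm G (f (\<gamma> 1))
          (transport A G (f \<circ> \<gamma>) (tderiv A f (\<gamma> 0) v) - tderiv A f (\<gamma> 1) (transport A G \<gamma> v))))"

definition deriv_bounded :: "('a, 'e::real_normed_vector) chart set \<Rightarrow>
    ('a \<Rightarrow> 'e \<Rightarrow> 'e \<Rightarrow> real) \<Rightarrow> ('a \<Rightarrow> 'a) \<Rightarrow> real \<Rightarrow> bool" where
  "deriv_bounded A G f K \<longleftrightarrow> (\<forall>x v. rnorm G (f x) (tderiv A f x v) \<le> K * rnorm G x v)"

subsection \<open>Hyperbolic sets\<close>

text \<open>A continuous vector subbundle of the tangent bundle over \<open>\<Lambda>\<close>, described by continuous
  local frames.\<close>

definition continuous_subbundle :: "('a::t2_space, 'e::euclidean_space) chart set \<Rightarrow> 'a set \<Rightarrow>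
    ('a \<Rightarrow> 'e set) \<Rightarrow> bool" where
  "continuous_subbundle A \<Lambda> E \<longleftrightarrow>
     (\<forall>x\<in>\<Lambda>. \<exists>U k (b :: nat \<Rightarrow> 'a \<Rightarrow> 'e). open U \<and> x \<in> U \<and>
        (\<forall>i<k. \<forall>c\<in>A. continuous_on (\<Lambda> \<inter> U \<inter> cdom c) (\<lambda>y. tcoord A c y (b i y))) \<and>
        (\<forall>y\<in>\<Lambda> \<inter> U. inj_on (\<lambda>i. b i y) {..<k} \<and> independent ((\<lambda>i. b i y) ` {..<k}) \<and>
           span ((\<lambda>i. b i y) ` {..<k}) = E y))"

definition hyperbolic_set :: "('a::t2_space, 'e::euclidean_space) chart set \<Rightarrow>
    ('a \<Rightarrow> 'e \<Rightarrow> 'e \<Rightarrow> real) \<Rightarrow> ('a \<Rightarrow> 'a) \<Rightarrow> real \<Rightarrow> real \<Rightarrow> 'a set \<Rightarrow> bool" where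
  "hyperbolic_set A G f lam c \<Lambda> \<longleftrightarrow>
     0 < lam \<and> lam < 1 \<and> 0 < c \<and> compact \<Lambda> \<and> f ` \<Lambda> = \<Lambda> \<and>
     (\<exists>Es Eu.
        continuous_subbundle A \<Lambda> Es \<and> continuous_subbundle A \<Lambda> Eu \<and>
        (\<forall>x\<in>\<Lambda>. Es x \<inter> Eu x = {0} \<and> {u + v |u v. u \<in> Es x \<and> v \<in> Eu x} = UNIV) \<and>
        (\<forall>x\<in>\<Lambda>. tderiv A f x ` Es x = Es (f x) \<and> tderiv A f x ` Eu x = Eu (f x)) \<and>
        (\<forall>x\<in>\<Lambda>. \<forall>n.
           (\<forall>v\<in>Es x. rnorm G ((f ^^ n) x) (tderiv A (f ^^ n) x v) \<le> c * lam ^ n * rnorm G x v) \<and>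
           (\<forall>v\<in>Eu x. rnorm G ((inv f ^^ n) x) (tderiv A (inv f ^^ n) x v)
                        \<le> c * lam ^ n * rnorm G x v)))"

text \<open>\<open>h\<close> is a homeomorphism of \<open>\<Lambda>\<close> onto \<open>\<Lambda>'\<close> that conjugates \<open>f\<close> to \<open>g\<close> and is uniformly
  \<open>\<delta>\<close>-close to the identity.\<close>

definition close_conjugacy :: "('a::t2_space, 'e::euclidean_space) chart set \<Rightarrow>
    ('a \<Rightarrow> 'e \<Rightarrow> 'e \<Rightarrow> real) \<Rightarrow> real \<Rightarrow> ('a \<Rightarrow> 'a) \<Rightarrow> 'a set \<Rightarrow> ('a \<Rightarrow> 'a) \<Rightarrow> 'a set \<Rightarrow>
    ('a \<Rightarrow> 'a) \<Rightarrow> bool" where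
  "close_conjugacy A G \<delta> f \<Lambda> g \<Lambda>' h \<longleftrightarrow>
     (\<exists>k. homeomorphism \<Lambda> \<Lambda>' h k) \<and>
     (\<forall>x\<in>\<Lambda>. riem_dist A G (h x) x < ennreal \<delta>) \<and>
     (\<forall>x\<in>\<Lambda>. h (f x) = g (h x))"

end

theory Submission imports Defs begin

text \<open>In charts of uniform size around the points of an orbit of \<open>f\<close> in \<open>\<Lambda>\<close>, the derivative of \<open>f\<close> is a
  bounded sequence of linear maps \<open>L\<^sub>n\<close>, and hyperbolicity provides a Green kernel, that is, an
  exponentially decaying inverse of \<open>w \<mapsto> (w\<^sub>n - L\<^sub>n\<^sub>-\<^sub>1 w\<^sub>n\<^sub>-\<^sub>1)\<^sub>n\<close>, with constants that depend only on
  \<open>lam\<close>, \<open>c\<close> and the bound on the derivative. If \<open>g\<close> is \<open>C\<^sup>1\<close>-close to \<open>f\<close>, the equation for a \<open>g\<close>-orbit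
  near an \<open>f\<close>-orbit is a small Lipschitz perturbation of this linear equation; a contraction gives a
  unique solution, and \<open>h x\<close> is its entry at time \<open>0\<close>. The same estimate on long finite windows gives
  continuity and injectivity of \<open>h\<close>, and applied to the linearisation of \<open>g\<close> in weighted sup
  norms it shows that the vectors with bounded forward, respectively backward, orbits split
  the tangent spaces over \<open>h ` \<Lambda>\<close>, with any rate above \<open>lam\<close> once \<open>g\<close> is close enough.

  The \<open>C\<^sup>1\<close>-distance compares derivatives by parallel transport; along short curves transport is
  close to the identity in charts, which converts it into uniform estimates on coordinate derivatives.\<close>

subsection \<open>Families of linear maps\<close>

text \<open>The theorem fixes \<open>\<epsilon>\<^sub>0\<close> as a function of \<open>lam\<close>,
  \<open>c\<close>, the derivative bounds and the modulus of the derivative before \<open>f\<close>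
  and \<open>\<Lambda>\<close> are given, so all radii must be chosen from these data alone. The
  delicate constant is the norm of the projections onto the two subspaces, which hyperbolicity does
  not mention; it comes from comparing growth rates over a number of steps determined by
  \<open>lam\<close>, \<open>c\<close> and the charts. A kernel with decay rate \<open>lam\<close>
  inverts the linear equation in every sup norm whose weight changes by a factor below
  \<open>1 / lam\<close> per step. Constant weights give existence, weights growing away from time 0
  give statements on windows, decaying weights give the new splitting with its rate. The equations
  involve single orbits only, never sections over \<open>\<Lambda>\<close>, so charts may jump from
  point to point; continuity is recovered afterwards, that of the splitting from a closed graph.
  Parallel transport is a definite description, hence without content until existence and uniqueness
  of parallel fields are known. Both are proved for short curves only, and a small
  \<open>C\<^sup>1\<close> distance supplies short curves.\<close>

lemma linear_Basis_expansion:
  fixes f :: "'e::euclidean_space \<Rightarrow> 'b::real_vector"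
  assumes "linear f"
  shows "f v = (\<Sum>b\<in>Basis. (v \<bullet> b) *\<^sub>R f b)"
proof -
  have "f v = f (\<Sum>b\<in>Basis. (v \<bullet> b) *\<^sub>R b)" by (simp add: euclidean_representation)
  also have "\<dots> = (\<Sum>b\<in>Basis. (v \<bullet> b) *\<^sub>R f b)"
    by (simp add: linear_sum[OF assms] linear_cmul[OF assms])
  finally show ?thesis .
qed

text \<open>Families of operators are handled through their values on basis vectors, in accordance
  with \<open>Ck_on\<close>, which speaks of directional derivatives only. No topology on a space of
  operators is involved.\<close>

lemma continuous_on_linear_family:
  fixes F :: "'p::topological_space \<Rightarrow> 'e::euclidean_space \<Rightarrow> 'b::real_normed_vector"
  assumes "\<And>t. t \<in> T \<Longrightarrow> linear (F t)" "\<And>b. b \<in> Basis \<Longrightarrow> continuous_on T (\<lambda>t. F t b)"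
    and "continuous_on T w"
  shows "continuous_on T (\<lambda>t. F t (w t))"
proof -
  have "continuous_on T (\<lambda>t. \<Sum>b\<in>Basis. (w t \<bullet> b) *\<^sub>R F t b)"
    using assms by (intro continuous_intros) auto
  then show ?thesis
    by (rule continuous_on_eq) (simp add: linear_Basis_expansion[OF assms(1)])
qed

lemma continuous_on_bilinear_family:
  fixes B :: "'p::topological_space \<Rightarrow> 'e::euclidean_space \<Rightarrow> 'e \<Rightarrow> 'b::real_normed_vector"
  assumes "\<And>t. t \<in> T \<Longrightarrow> bilinear (B t)"
    and "\<And>a b. a \<in> Basis \<Longrightarrow> b \<in> Basis \<Longrightarrow> continuous_on T (\<lambda>t. B t a b)"
    and "continuous_on T v" "continuous_on T w"
  shows "continuous_on T (\<lambda>t. B t (v t) (w t))"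
proof (rule continuous_on_linear_family[OF _ _ assms(4)])
  show "linear (B t (v t))" if "t \<in> T" for t
    using assms(1)[OF that] by (simp add: bilinear_def)
  show "continuous_on T (\<lambda>t. B t (v t) b)" if "b \<in> Basis" for b
    by (rule continuous_on_linear_family[where F="\<lambda>t v. B t v b", OF _ _ assms(3)])
       (use assms that in \<open>auto simp: bilinear_def\<close>)
qed

lemma has_derivative_linear_family:
  fixes F :: "'p::real_normed_vector \<Rightarrow> 'e::euclidean_space \<Rightarrow> 'b::real_normed_vector"
  assumes U: "open U" "t0 \<in> U" and lin: "\<And>t. t \<in> U \<Longrightarrow> linear (F t)"
    and F': "\<And>b. b \<in> Basis \<Longrightarrow> ((\<lambda>t. F t b) has_derivative F' b) (at t0)"
    and w: "(w has_derivative w') (at t0)"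
  shows "((\<lambda>t. F t (w t)) has_derivative
     (\<lambda>h. (\<Sum>b\<in>Basis. (w t0 \<bullet> b) *\<^sub>R F' b h) + F t0 (w' h))) (at t0)"
proof -
  have "((\<lambda>t. \<Sum>b\<in>Basis. (w t \<bullet> b) *\<^sub>R F t b) has_derivative
     (\<lambda>h. \<Sum>b\<in>Basis. (w t0 \<bullet> b) *\<^sub>R F' b h + (w' h \<bullet> b) *\<^sub>R F t0 b)) (at t0)"
    by (intro has_derivative_sum has_derivative_scaleR F' has_derivative_inner_left w)
  moreover have "(\<Sum>b\<in>Basis. (w t0 \<bullet> b) *\<^sub>R F' b h + (w' h \<bullet> b) *\<^sub>R F t0 b)
      = (\<Sum>b\<in>Basis. (w t0 \<bullet> b) *\<^sub>R F' b h) + F t0 (w' h)" for h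
    by (simp add: sum.distrib linear_Basis_expansion[OF lin[OF U(2)], of "w' h"])
  ultimately have "((\<lambda>t. \<Sum>b\<in>Basis. (w t \<bullet> b) *\<^sub>R F t b) has_derivative
     (\<lambda>h. (\<Sum>b\<in>Basis. (w t0 \<bullet> b) *\<^sub>R F' b h) + F t0 (w' h))) (at t0)" by simp
  then show ?thesis
    by (rule has_derivative_transform_within_open[OF _ U])
       (simp add: linear_Basis_expansion[OF lin])
qed

lemma has_vector_derivative_linear_family:
  fixes F :: "real \<Rightarrow> 'e::euclidean_space \<Rightarrow> 'b::real_normed_vector"
  assumes U: "open U" "t0 \<in> U" and lin: "\<And>t. t \<in> U \<Longrightarrow> linear (F t)"
    and F': "\<And>b. b \<in> Basis \<Longrightarrow> ((\<lambda>t. F t b) has_vector_derivative F' b) (at t0)"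
    and w: "(w has_vector_derivative w') (at t0)"
  shows "((\<lambda>t. F t (w t)) has_vector_derivative
     (\<Sum>b\<in>Basis. (w t0 \<bullet> b) *\<^sub>R F' b) + F t0 w') (at t0)"
proof -
  have "(\<lambda>h. (\<Sum>b\<in>Basis. (w t0 \<bullet> b) *\<^sub>R h *\<^sub>R F' b) + F t0 (h *\<^sub>R w'))
     = (\<lambda>h. h *\<^sub>R ((\<Sum>b\<in>Basis. (w t0 \<bullet> b) *\<^sub>R F' b) + F t0 w'))"
    by (simp add: linear_cmul[OF lin[OF U(2)]] scaleR_sum_right scaleR_add_right mult.commute)
  then show ?thesis
    using has_derivative_linear_family[OF U lin F'[unfolded has_vector_derivative_def]
        w[unfolded has_vector_derivative_def]]
    by (simp add: has_vector_derivative_def)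
qed

text \<open>At \<open>t0\<close> the map expands by at least \<open>m\<close>. For \<open>t\<close>
  nearby, replacing \<open>L t\<close> by \<open>L t0\<close> costs at most half of
  \<open>m * norm (z t - z t0)\<close>, which is absorbed; so continuity of the solution follows
  without forming inverses.\<close>

lemma continuous_on_linear_solve:
  fixes L :: "'p::topological_space \<Rightarrow> 'e::euclidean_space \<Rightarrow> 'e"
  assumes lin: "\<And>t. t \<in> T \<Longrightarrow> linear (L t)" and inj: "\<And>t. t \<in> T \<Longrightarrow> inj (L t)"
    and cont: "\<And>b. b \<in> Basis \<Longrightarrow> continuous_on T (\<lambda>t. L t b)"
    and k: "continuous_on T k" and sol: "\<And>t. t \<in> T \<Longrightarrow> L t (z t) = k t"
  shows "continuous_on T z"
  unfolding continuous_on_def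
proof
  fix t0 assume t0: "t0 \<in> T"
  obtain m where m: "m > 0" "\<And>x. m * norm x \<le> norm (L t0 x)"
    using linear_inj_bounded_below_pos[OF lin[OF t0] inj[OF t0]] by blast
  define E where "E t = (\<Sum>b\<in>Basis. norm (L t b - L t0 b))" for t
  have "continuous_on T E" unfolding E_def by (intro continuous_intros cont)
  then have "(E \<longlongrightarrow> E t0) (at t0 within T)" using t0 by (simp add: continuous_on_def)
  then have "(E \<longlongrightarrow> 0) (at t0 within T)" by (simp add: E_def)
  then have evE: "eventually (\<lambda>t. E t < m / 2) (at t0 within T)"
    using m by (intro order_tendstoD) auto
  have bound: "norm (L t x - L t0 x) \<le> E t * norm x" if "t \<in> T" for t x
  proof -
    have eq: "L t x - L t0 x = (\<Sum>b\<in>Basis. (x \<bullet> b) *\<^sub>R (L t b - L t0 b))"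
      using linear_Basis_expansion[OF lin[OF that], of x] linear_Basis_expansion[OF lin[OF t0], of x]
      by (simp add: sum_subtractf scaleR_diff_right)
    have "norm (L t x - L t0 x) \<le> (\<Sum>b\<in>Basis. norm ((x \<bullet> b) *\<^sub>R (L t b - L t0 b)))"
      unfolding eq by (rule norm_sum)
    also have "\<dots> \<le> (\<Sum>b\<in>Basis. norm x * norm (L t b - L t0 b))"
      by (intro sum_mono) (simp add: mult_right_mono Basis_le_norm)
    finally show ?thesis by (simp add: E_def sum_distrib_left mult.commute)
  qed
  have "continuous_on T (\<lambda>t. 2 / m * norm (k t - L t (z t0)))"
    by (intro continuous_on_mult continuous_on_const continuous_on_norm continuous_on_diff k)
       (rule continuous_on_linear_family[OF lin cont continuous_on_const])
  then have "((\<lambda>t. 2 / m * norm (k t - L t (z t0))) \<longlongrightarrow> 2 / m * norm (k t0 - L t0 (z t0))) (at t0 within T)"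
    using t0 by (auto simp: continuous_on_def)
  then have lim: "((\<lambda>t. 2 / m * norm (k t - L t (z t0))) \<longlongrightarrow> 0) (at t0 within T)"
    by (simp add: sol[OF t0])
  have "((\<lambda>t. z t - z t0) \<longlongrightarrow> 0) (at t0 within T)"
  proof (rule Lim_null_comparison[OF _ lim])
    have "eventually (\<lambda>t. t \<in> T) (at t0 within T)"
      by (auto simp: eventually_at_topological)
    with evE show "eventually (\<lambda>t. norm (z t - z t0) \<le> 2 / m * norm (k t - L t (z t0))) (at t0 within T)"
    proof eventually_elim
      case (elim t)
      have "m * norm (z t - z t0) \<le> norm (L t0 (z t - z t0))" by (rule m)
      also have "\<dots> \<le> norm (L t (z t - z t0)) + norm (L t (z t - z t0) - L t0 (z t - z t0))"
        by norm
      also have "\<dots> \<le> norm (k t - L t (z t0)) + m / 2 * norm (z t - z t0)"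
      proof (intro add_mono)
        show "norm (L t (z t - z t0)) \<le> norm (k t - L t (z t0))"
          using elim by (simp add: linear_diff[OF lin] sol)
        have "norm (L t (z t - z t0) - L t0 (z t - z t0)) \<le> E t * norm (z t - z t0)"
          by (rule bound) (use elim in auto)
        also have "\<dots> \<le> m / 2 * norm (z t - z t0)"
          using elim by (intro mult_right_mono) auto
        finally show "norm (L t (z t - z t0) - L t0 (z t - z t0)) \<le> m / 2 * norm (z t - z t0)" .
      qed
      finally show ?case using m by (simp add: field_simps)
    qed
  qed
  then show "(z \<longlongrightarrow> z t0) (at t0 within T)" by (simp add: LIM_zero_iff)
qed

text \<open>Riesz representation for a positive definite bilinear form: \<open>L\<close> collects
  the values of \<open>g z\<close> on the basis, is injective by positivity at \<open>w = z\<close>,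
  hence onto by dimension. Uniqueness is what gives the definite description in
  \<open>christoffel\<close> a value.\<close>

lemma positive_definite_represents:
  fixes g :: "'e::euclidean_space \<Rightarrow> 'e \<Rightarrow> real"
  assumes g: "bilinear g" "\<And>v. v \<noteq> 0 \<Longrightarrow> g v v > 0" and k: "linear k"
  shows "\<exists>!z. \<forall>w. g z w = k w"
proof -
  define L where "L z = (\<Sum>b\<in>Basis. g z b *\<^sub>R b)" for z
  have gl: "linear (\<lambda>x. g x y)" and gr: "linear (g x)" for x y using g by (auto simp: bilinear_def)
  have lin: "linear L" unfolding L_def
    by (intro linear_compose_sum ballI linear_compose[OF gl, of "\<lambda>r. r *\<^sub>R _", unfolded o_def])
       (auto simp: linear_iff scaleR_left_distrib)
  have Lb: "L z \<bullet> b = g z b" if "b \<in> Basis" for z b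
    unfolding L_def using that by (simp add: inner_sum_left inner_Basis if_distrib cong: if_cong)
  have eq: "g z w = (\<Sum>b\<in>Basis. (w \<bullet> b) * (L z \<bullet> b))" for z w
    using linear_Basis_expansion[OF gr, of z w] Lb by simp
  have "inj L"
  proof (rule linear_injective_0[OF lin, THEN iffD2], intro allI impI)
    fix x assume "L x = 0"
    then have "g x x = 0" by (simp add: eq)
    then show "x = 0" using g(2)[of x] by force
  qed
  then have "surj L" using linear_injective_imp_surjective[OF lin] by simp
  then obtain z where z: "L z = (\<Sum>b\<in>Basis. k b *\<^sub>R b)" by (metis surjD)
  show ?thesis
  proof (intro ex1I[of _ z] allI)
    show "g z w = k w" for w
      unfolding eq z linear_Basis_expansion[OF k, of w]
      by (simp add: inner_sum_left inner_Basis if_distrib cong: if_cong)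
    fix y assume y: "\<forall>w. g y w = k w"
    have "L y = L z" unfolding L_def using y \<open>\<And>w. g z w = k w\<close> by simp
    then show "y = z" using \<open>inj L\<close> by (simp add: inj_eq)
  qed
qed

lemma continuous_on_represents:
  fixes g :: "'p::topological_space \<Rightarrow> 'e::euclidean_space \<Rightarrow> 'e \<Rightarrow> real"
  assumes g: "\<And>t. t \<in> T \<Longrightarrow> bilinear (g t)" "\<And>t v. t \<in> T \<Longrightarrow> v \<noteq> 0 \<Longrightarrow> g t v v > 0"
    and cg: "\<And>a b. a \<in> Basis \<Longrightarrow> b \<in> Basis \<Longrightarrow> continuous_on T (\<lambda>t. g t a b)"
    and ck: "\<And>b. b \<in> Basis \<Longrightarrow> continuous_on T (\<lambda>t. k t b)"
    and sol: "\<And>t w. t \<in> T \<Longrightarrow> g t (z t) w = k t w"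
  shows "continuous_on T z"
proof -
  have gl: "linear (\<lambda>x. g t x y)" if "t \<in> T" for t y using g(1)[OF that] by (auto simp: bilinear_def)
  have gr: "linear (g t y)" if "t \<in> T" for t y using g(1)[OF that] by (auto simp: bilinear_def)
  define L where "L t z = (\<Sum>b\<in>Basis. g t z b *\<^sub>R b)" for t z
  have lin: "linear (L t)" if "t \<in> T" for t unfolding L_def
    by (intro linear_compose_sum ballI linear_compose[OF gl[OF that], of "\<lambda>r. r *\<^sub>R _", unfolded o_def])
       (auto simp: linear_iff scaleR_left_distrib)
  show ?thesis
  proof (rule continuous_on_linear_solve[of T L "\<lambda>t. \<Sum>b\<in>Basis. k t b *\<^sub>R b", OF lin])
    show "inj (L t)" if t: "t \<in> T" for t
    proof (rule linear_injective_0[OF lin[OF t], THEN iffD2], intro allI impI)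
      fix x assume x: "L t x = 0"
      have "g t x b = L t x \<bullet> b" if "b \<in> Basis" for b
        unfolding L_def using that by (simp add: inner_sum_left inner_Basis if_distrib cong: if_cong)
      then have "g t x x = 0"
        using linear_Basis_expansion[OF gr[OF t], of x x] x by simp
      then show "x = 0" using g(2)[OF t, of x] by force
    qed
    show "continuous_on T (\<lambda>t. L t b)" if "b \<in> Basis" for b
      unfolding L_def using that by (intro continuous_intros cg) auto
    show "continuous_on T (\<lambda>t. \<Sum>b\<in>Basis. k t b *\<^sub>R b)"
      by (intro continuous_intros ck) auto
    show "L t (z t) = (\<Sum>b\<in>Basis. k t b *\<^sub>R b)" if "t \<in> T" for t
      unfolding L_def using sol[OF that] by simp
  qed
qed

subsection \<open>Second derivatives\<close>

text \<open>The mean value theorem twice: first along \<open>u\<close>, for the increment in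
  direction \<open>v\<close>; then along \<open>v\<close>, for the derivative in direction
  \<open>u\<close>.\<close>

lemma second_difference_mean_value:
  fixes f :: "'e::euclidean_space \<Rightarrow> real"
  assumes S: "ball y d \<subseteq> S" and s: "s > 0" "s * (norm u + norm v) < d"
    and fu: "\<And>z. z \<in> S \<Longrightarrow> (f has_derivative f' z) (at z)"
    and fuv: "\<And>z. z \<in> S \<Longrightarrow> ((\<lambda>z. f' z u) has_derivative f'' z) (at z)"
  shows "\<exists>p\<in>ball y d. f (y + s *\<^sub>R u + s *\<^sub>R v) - f (y + s *\<^sub>R u) - f (y + s *\<^sub>R v) + f y = s * s * f'' p v"
proof -
  have inb: "y + a *\<^sub>R u + b *\<^sub>R v \<in> ball y d" if "0 \<le> a" "a \<le> s" "0 \<le> b" "b \<le> s" for a b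
  proof -
    have "norm (a *\<^sub>R u + b *\<^sub>R v) \<le> a * norm u + b * norm v"
      using that by (metis abs_of_nonneg norm_scaleR norm_triangle_ineq)
    also have "\<dots> \<le> s * norm u + s * norm v" using that by (intro add_mono mult_right_mono) auto
    also have "\<dots> < d" using s by (simp add: distrib_left)
    finally have "norm (a *\<^sub>R u + b *\<^sub>R v) < d" .
    moreover have "y - (y + a *\<^sub>R u + b *\<^sub>R v) = - (a *\<^sub>R u + b *\<^sub>R v)" by simp
    ultimately show ?thesis by (simp only: mem_ball dist_norm norm_minus_cancel)
  qed
  have lc: "f' z (h *\<^sub>R u) = f' z u * h" if "z \<in> S" for z h
    using linear_cmul[OF has_derivative_linear[OF fu[OF that]]] by simp
  define g where "g t = f (y + t *\<^sub>R u + s *\<^sub>R v) - f (y + t *\<^sub>R u)" for t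
  have dg: "(g has_real_derivative f' (y + t *\<^sub>R u + s *\<^sub>R v) u - f' (y + t *\<^sub>R u) u) (at t)"
    if t: "0 \<le> t" "t \<le> s" for t
  proof -
    have 1: "y + t *\<^sub>R u + s *\<^sub>R v \<in> S" "y + t *\<^sub>R u \<in> S"
      using inb[of t s] inb[of t 0] t s S by auto
    have "((\<lambda>t. f (y + t *\<^sub>R u + s *\<^sub>R v)) has_derivative (\<lambda>h. f' (y + t *\<^sub>R u + s *\<^sub>R v) (h *\<^sub>R u))) (at t)"
      by (rule has_derivative_compose[where g=f and f="\<lambda>t. y + t *\<^sub>R u + s *\<^sub>R v", OF _ fu[OF 1(1)]]) (auto intro!: derivative_eq_intros)
    moreover have "((\<lambda>t. f (y + t *\<^sub>R u)) has_derivative (\<lambda>h. f' (y + t *\<^sub>R u) (h *\<^sub>R u))) (at t)"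
      by (rule has_derivative_compose[where g=f and f="\<lambda>t. y + t *\<^sub>R u", OF _ fu[OF 1(2)]]) (auto intro!: derivative_eq_intros)
    ultimately have "(g has_derivative (\<lambda>h. f' (y + t *\<^sub>R u + s *\<^sub>R v) (h *\<^sub>R u) - f' (y + t *\<^sub>R u) (h *\<^sub>R u))) (at t)"
      unfolding g_def by (rule has_derivative_diff)
    then show ?thesis unfolding has_field_derivative_def
      by (rule has_derivative_eq_rhs)
         (simp add: fun_eq_iff lc[OF 1(1)] lc[OF 1(2)] left_diff_distrib)
  qed
  obtain a where a: "0 < a" "a < s" "g s - g 0 = s * (f' (y + a *\<^sub>R u + s *\<^sub>R v) u - f' (y + a *\<^sub>R u) u)"
    using MVT2[of 0 s g "\<lambda>t. f' (y + t *\<^sub>R u + s *\<^sub>R v) u - f' (y + t *\<^sub>R u) u"] dg s by auto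
  have "((\<lambda>b. f' (y + a *\<^sub>R u + b *\<^sub>R v) u) has_real_derivative f'' (y + a *\<^sub>R u + b *\<^sub>R v) v) (at b)"
    if b: "0 \<le> b" "b \<le> s" for b
  proof -
    have 1: "y + a *\<^sub>R u + b *\<^sub>R v \<in> S" using inb[of a b] a b S by auto
    have "((\<lambda>b. f' (y + a *\<^sub>R u + b *\<^sub>R v) u) has_derivative (\<lambda>h. f'' (y + a *\<^sub>R u + b *\<^sub>R v) (h *\<^sub>R v))) (at b)"
      by (rule has_derivative_compose[where g="\<lambda>z. f' z u" and f="\<lambda>b. y + a *\<^sub>R u + b *\<^sub>R v", OF _ fuv[OF 1]]) (auto intro!: derivative_eq_intros)
    moreover have "f'' (y + a *\<^sub>R u + b *\<^sub>R v) (h *\<^sub>R v) = f'' (y + a *\<^sub>R u + b *\<^sub>R v) v * h" for h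
      using linear_cmul[OF has_derivative_linear[OF fuv[OF 1]]] by simp
    ultimately show ?thesis unfolding has_field_derivative_def
      by (elim has_derivative_eq_rhs) (simp add: fun_eq_iff)
  qed
  then obtain b where b: "0 < b" "b < s"
      "f' (y + a *\<^sub>R u + s *\<^sub>R v) u - f' (y + a *\<^sub>R u) u = s * f'' (y + a *\<^sub>R u + b *\<^sub>R v) v"
    using MVT2[of 0 s "\<lambda>b. f' (y + a *\<^sub>R u + b *\<^sub>R v) u" "\<lambda>b. f'' (y + a *\<^sub>R u + b *\<^sub>R v) v"] s by auto
  have "g s - g 0 = s * s * f'' (y + a *\<^sub>R u + b *\<^sub>R v) v" using a b by simp
  then show ?thesis
    using inb[of a b] a b by (intro bexI[of _ "y + a *\<^sub>R u + b *\<^sub>R v"]) (auto simp: g_def)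
qed

text \<open>Schwarz's theorem: the second difference does not change when \<open>u\<close> and
  \<open>v\<close> are exchanged, while each order expresses it by a mixed derivative at some point
  near \<open>y\<close>. By continuity both values are close to those at \<open>y\<close>.\<close>

lemma symmetric_second_derivative_real:
  fixes f :: "'e::euclidean_space \<Rightarrow> real"
  assumes S: "open S" "y \<in> S"
    and f': "\<And>z. z \<in> S \<Longrightarrow> (f has_derivative f' z) (at z)"
    and f'': "\<And>z u. z \<in> S \<Longrightarrow> ((\<lambda>z. f' z u) has_derivative f'' u z) (at z)"
    and cont: "\<And>u v. continuous_on S (\<lambda>z. f'' u z v)"
  shows "f'' u y v = f'' v y u"
proof (rule ccontr)
  assume ne: "f'' u y v \<noteq> f'' v y u"
  define e where "e = \<bar>f'' u y v - f'' v y u\<bar> / 2"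
  have e: "e > 0" using ne by (simp add: e_def)
  have "continuous (at y) (\<lambda>z. f'' u z v)" "continuous (at y) (\<lambda>z. f'' v z u)"
    using cont S continuous_on_eq_continuous_at by blast+
  then obtain d1 d2 where d1: "d1 > 0" "\<And>z. dist z y < d1 \<Longrightarrow> \<bar>f'' u z v - f'' u y v\<bar> < e"
    and d2: "d2 > 0" "\<And>z. dist z y < d2 \<Longrightarrow> \<bar>f'' v z u - f'' v y u\<bar> < e"
    using e unfolding continuous_at_eps_delta dist_real_def by metis
  obtain d3 where d3: "d3 > 0" "ball y d3 \<subseteq> S" using S openE by blast
  define d where "d = min d1 (min d2 d3)"
  have d: "d > 0" "ball y d \<subseteq> S" using d1 d2 d3 by (auto simp: d_def)
  \<comment> \<open>The summand 1 keeps the denominator positive even if both vectors vanish; the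
    factor 2 keeps the parallelogram strictly inside the ball.\<close>
  define s where "s = d / (2 * (norm u + norm v + 1))"
  have pos: "norm u + norm v + 1 > 0" by (simp add: add_nonneg_pos)
  have s: "s > 0" using d pos unfolding s_def by simp
  have "s * (norm u + norm v) \<le> s * (norm u + norm v + 1)" using s by simp
  also have "\<dots> = d / 2" using pos unfolding s_def by (simp add: field_simps)
  also have "\<dots> < d" using d by simp
  finally have s2: "s * (norm u + norm v) < d" .
  obtain p where p: "p \<in> ball y d"
    "f (y + s *\<^sub>R u + s *\<^sub>R v) - f (y + s *\<^sub>R u) - f (y + s *\<^sub>R v) + f y = s * s * f'' u p v"
    using second_difference_mean_value[OF d(2) s s2 f' f''] by blast
  obtain q where q: "q \<in> ball y d"
    "f (y + s *\<^sub>R v + s *\<^sub>R u) - f (y + s *\<^sub>R v) - f (y + s *\<^sub>R u) + f y = s * s * f'' v q u"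
    using second_difference_mean_value[OF d(2) s _ f' f'', of v u] s2 by (auto simp: add.commute)
  have "s * s * f'' u p v = s * s * f'' v q u"
    using p(2) q(2) by (simp add: algebra_simps)
  then have eq: "f'' u p v = f'' v q u" using s by simp
  have "\<bar>f'' u y v - f'' v y u\<bar> \<le> \<bar>f'' u p v - f'' u y v\<bar> + \<bar>f'' v q u - f'' v y u\<bar>"
    unfolding eq by linarith
  also have "\<dots> < e + e"
    using d1(2)[of p] p(1) d2(2)[of q] q(1) by (intro add_strict_mono) (auto simp: d_def dist_commute)
  also have "\<dots> = \<bar>f'' u y v - f'' v y u\<bar>" by (simp add: e_def)
  finally show False by simp
qed

lemma Ck_on_1D:
  assumes "Ck_on 1 S F" "y \<in> S"
  shows "(F has_derivative frechet_derivative F (at y)) (at y)"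
  using assms frechet_derivative_works by auto

lemma Ck_on_2D:
  assumes "Ck_on 2 S F" "y \<in> S"
  shows "(F has_derivative frechet_derivative F (at y)) (at y)"
    "((\<lambda>y. frechet_derivative F (at y) u) has_derivative
        frechet_derivative (\<lambda>y. frechet_derivative F (at y) u) (at y)) (at y)"
  using assms by (auto simp: numeral_2_eq_2 intro!: iffD1[OF frechet_derivative_works])

text \<open>Applied to transition maps, this makes the second-order terms cancel in the
  transformation law of the connection.\<close>

lemma symmetric_second_derivative:
  fixes F :: "'e::euclidean_space \<Rightarrow> 'b::euclidean_space"
  assumes S: "open S" "y \<in> S" and F: "Ck_on 2 S F"
  shows "frechet_derivative (\<lambda>y. frechet_derivative F (at y) u) (at y) v
       = frechet_derivative (\<lambda>y. frechet_derivative F (at y) v) (at y) u"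
proof (rule euclidean_eqI)
  fix b :: 'b assume b: "b \<in> Basis"
  show "frechet_derivative (\<lambda>y. frechet_derivative F (at y) u) (at y) v \<bullet> b
       = frechet_derivative (\<lambda>y. frechet_derivative F (at y) v) (at y) u \<bullet> b"
  proof (rule symmetric_second_derivative_real[OF S, where f="\<lambda>y. F y \<bullet> b"
        and f'="\<lambda>y u. frechet_derivative F (at y) u \<bullet> b"
        and f''="\<lambda>u y v. frechet_derivative (\<lambda>y. frechet_derivative F (at y) u) (at y) v \<bullet> b"])
    show "((\<lambda>y. F y \<bullet> b) has_derivative (\<lambda>u. frechet_derivative F (at z) u \<bullet> b)) (at z)" if "z \<in> S" for z
      by (intro has_derivative_inner_left Ck_on_2D(1)[OF F that])
    show "((\<lambda>z. frechet_derivative F (at z) u \<bullet> b) has_derivative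
          (\<lambda>v. frechet_derivative (\<lambda>y. frechet_derivative F (at y) u) (at z) v \<bullet> b)) (at z)"
      if "z \<in> S" for z u
      by (intro has_derivative_inner_left Ck_on_2D(2)[OF F that])
    show "continuous_on S (\<lambda>z. frechet_derivative (\<lambda>y. frechet_derivative F (at y) u) (at z) v \<bullet> b)" for u v
      using F by (intro continuous_intros) (auto simp: numeral_2_eq_2)
  qed
qed

subsection \<open>Piecewise continuous integrands and linear differential equations\<close>

text \<open>Induction on the number of exceptional points strictly inside the interval, splitting at
  one of them.\<close>

lemma integrable_on_pieces:
  fixes f :: "real \<Rightarrow> 'b::banach"
  assumes "finite S"
    and "\<And>a b. \<lbrakk>l \<le> a; a < b; b \<le> r; {a<..<b} \<inter> S = {}\<rbrakk> \<Longrightarrow> f integrable_on {a..b}"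
    and "l \<le> a" "a \<le> b" "b \<le> r"
  shows "f integrable_on {a..b}"
  using assms(3-)
proof (induction "card ({a<..<b} \<inter> S)" arbitrary: a b rule: less_induct)
  case less
  show ?case
  proof (cases "{a<..<b} \<inter> S = {}")
    case True
    then show ?thesis using assms(2)[of a b] less.prems integrable_on_refl[of f a]
      by (cases "a = b") (auto simp: cbox_interval)
  next
    case False
    then obtain s where s: "a < s" "s < b" "s \<in> S" by auto
    have "{a<..<s} \<inter> S \<subset> {a<..<b} \<inter> S" "{s<..<b} \<inter> S \<subset> {a<..<b} \<inter> S" using s by auto
    then have 1: "card ({a<..<s} \<inter> S) < card ({a<..<b} \<inter> S)" and 2: "card ({s<..<b} \<inter> S) < card ({a<..<b} \<inter> S)"
      using psubset_card_mono[of "{a<..<b} \<inter> S"] assms(1) by blast+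
    have "f integrable_on {a..s}" by (rule less.hyps[OF 1]) (use s less.prems in linarith)+
    moreover have "f integrable_on {s..b}" by (rule less.hyps[OF 2]) (use s less.prems in linarith)+
    ultimately show ?thesis 
      by (intro Henstock_Kurzweil_Integration.integrable_combine[of a s b f]) (use s in auto)
  qed
qed

lemma norm_integral_le_off_finite:
  fixes f :: "real \<Rightarrow> 'b::euclidean_space"
  assumes f: "(f has_integral i) {a..b}" and g: "g integrable_on {a..b}" and S: "finite S"
    and le: "\<And>x. x \<in> {a..b} - S \<Longrightarrow> norm (f x) \<le> g x"
  shows "norm i \<le> integral {a..b} g"
proof -
  have 1: "((\<lambda>x. if x \<in> S then 0 else f x) has_integral i) {a..b}"
    by (rule has_integral_spike_finite[OF S _ f]) auto
  have 2: "((\<lambda>x. if x \<in> S then 0 else g x) has_integral integral {a..b} g) {a..b}"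
    by (rule has_integral_spike_finite[OF S _ integrable_integral[OF g]]) auto
  have "norm (integral {a..b} (\<lambda>x. if x \<in> S then 0 else f x))
      \<le> integral {a..b} (\<lambda>x. if x \<in> S then 0 else g x)"
    by (rule integral_norm_bound_integral[OF has_integral_integrable[OF 1] has_integral_integrable[OF 2]])
       (simp add: le)
  then show ?thesis unfolding integral_unique[OF 1] integral_unique[OF 2] .
qed

text \<open>Continuity off a finite set gives measurability, and domination gives integrability; no
  one-sided limits at the exceptional points are required.\<close>

lemma integrable_off_finite:
  fixes f :: "real \<Rightarrow> 'b::euclidean_space"
  assumes S: "finite S" and cont: "continuous_on ({a..b} - S) f"
    and le: "\<And>t. t \<in> {a..b} - S \<Longrightarrow> norm (f t) \<le> \<beta> t" and \<beta>: "\<beta> integrable_on {a..b}"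
  shows "f integrable_on {a..b}"
proof -
  have neg: "negligible {x \<in> {a..b} - ({a..b} - S). h x \<noteq> 0}"
    "negligible {x \<in> ({a..b} - S) - {a..b}. h x \<noteq> 0}" for h :: "real \<Rightarrow> 'c::zero"
    by (rule negligible_subset[OF negligible_finite[OF S]], auto)+
  have leb: "{a..b} - S \<in> sets lebesgue"
    using S by (intro sets.Diff) (auto simp: negligible_finite negligible_imp_sets)
  have "f integrable_on ({a..b} - S)"
  proof (rule measurable_bounded_by_integrable_imp_integrable[OF _ _ le leb])
    show "f \<in> borel_measurable (lebesgue_on ({a..b} - S))"
      by (rule continuous_imp_measurable_on_sets_lebesgue[OF cont leb])
    show "\<beta> integrable_on {a..b} - S"
      by (rule integrable_spike_set[OF \<beta> neg])
  qed
  then show ?thesis by (rule integrable_spike_set[OF _ neg(2,1)])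
qed

text \<open>In place of Gronwall's inequality: if \<open>m\<close> is the maximum of the norm, the
  integral equation gives \<open>m \<le> norm (w 0) + l * m\<close>, and \<open>l \<le> 1/2\<close>
  allows absorption. For \<open>w 0 = 0\<close> this is uniqueness.\<close>

lemma linear_ode_growth:
  fixes w :: "real \<Rightarrow> 'b::euclidean_space"
  assumes S: "finite S" and cont: "continuous_on {0..1} w"
    and der: "\<And>t. t \<in> {0<..<1} - S \<Longrightarrow> (w has_vector_derivative w' t) (at t)"
    and le: "\<And>t. t \<in> {0<..<1} - S \<Longrightarrow> norm (w' t) \<le> \<beta> t * norm (w t)"
    and \<beta>: "\<And>t. \<beta> t \<ge> 0" "\<beta> integrable_on {0..1}" "integral {0..1} \<beta> \<le> l" and l: "l \<le> 1/2"
    and t: "t \<in> {0..1}"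
  shows "norm (w t - w 0) \<le> 2 * l * norm (w 0)"
proof -
  obtain t1 where t1: "t1 \<in> {0..1}" "\<And>t. t \<in> {0..1} \<Longrightarrow> norm (w t) \<le> norm (w t1)"
    using continuous_attains_sup[of "{0..1}" "\<lambda>t. norm (w t)"] cont continuous_on_norm by fastforce
  define m where "m = norm (w t1)"
  have step: "norm (w t - w 0) \<le> l * m" if t: "t \<in> {0..1}" for t
  proof -
    have "{0..t} \<subseteq> {0..1}" using t by auto
    note sub = this
    have 1: "(w' has_integral (w t - w 0)) {0..t}"
      by (rule fundamental_theorem_of_calculus_interior_strong[OF S])
         (use t der continuous_on_subset[OF cont sub] in auto)
    have \<beta>t: "\<beta> integrable_on {0..t}" using \<beta>(2) sub integrable_on_subinterval by blast
    have "norm (w t - w 0) \<le> integral {0..t} (\<lambda>s. \<beta> s * m)"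
    proof (rule norm_integral_le_off_finite[OF 1, where S="S \<union> {0,1}"])
      show "(\<lambda>s. \<beta> s * m) integrable_on {0..t}" using \<beta>t by (simp add: integrable_on_mult_left)
      show "norm (w' s) \<le> \<beta> s * m" if "s \<in> {0..t} - (S \<union> {0,1})" for s
      proof -
        have s: "s \<in> {0<..<1} - S" "s \<in> {0..1}" using that t by auto
        have "\<beta> s * norm (w s) \<le> \<beta> s * m" unfolding m_def using s by (intro mult_left_mono t1 \<beta>)
        then show ?thesis using le[OF s(1)] by simp
      qed
    qed (use S in auto)
    also have "\<dots> = integral {0..t} \<beta> * m" by simp
    also have "\<dots> \<le> l * m"
    proof (rule mult_right_mono)
      have "integral {0..t} \<beta> \<le> integral {0..1} \<beta>"
        by (rule integral_subset_le[OF sub \<beta>t \<beta>(2)]) (simp add: \<beta>)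
      then show "integral {0..t} \<beta> \<le> l" using \<beta> by simp
    qed (simp add: m_def)
    finally show ?thesis .
  qed
  have m0: "m \<ge> 0" by (simp add: m_def)
  have "integral {0..1} \<beta> \<ge> 0" by (rule integral_nonneg) (use \<beta> in auto)
  then have l0: "l \<ge> 0" using \<beta> by simp
  have "m \<le> norm (w 0) + norm (w t1 - w 0)" unfolding m_def by (metis add.commute diff_add_cancel norm_triangle_ineq)
  also have "\<dots> \<le> norm (w 0) + l * m" using step[OF t1(1)] by simp
  also have "l * m \<le> 1/2 * m" using l m0 by (intro mult_right_mono) auto
  finally have "m \<le> 2 * norm (w 0)" by simp
  then have "l * m \<le> l * (2 * norm (w 0))" using l0 by (rule mult_left_mono)
  then show ?thesis using step[OF t] by simp
qed

lemma linear_ode_exists: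
  fixes A :: "real \<Rightarrow> 'b::euclidean_space \<Rightarrow> 'b"
  assumes S: "finite S" and lin: "\<And>t. t \<in> {0..1} - S \<Longrightarrow> linear (A t)"
    and cont: "\<And>b. b \<in> Basis \<Longrightarrow> continuous_on ({0..1} - S) (\<lambda>t. A t b)"
    and le: "\<And>t v. t \<in> {0..1} - S \<Longrightarrow> norm (A t v) \<le> \<beta> t * norm v"
    and \<beta>: "\<And>t. \<beta> t \<ge> 0" "\<beta> integrable_on {0..1}" "integral {0..1} \<beta> \<le> 1/2"
  shows "\<exists>w. continuous_on {0..1} w \<and> w 0 = w0 \<and>
    (\<forall>t\<in>{0<..<1} - S. (w has_vector_derivative A t (w t)) (at t))"
proof -
  \<comment> \<open>Time is clamped to the unit interval so that the fixed point can be sought among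
    bounded continuous functions on the whole line, which form a complete type.\<close>
  define c :: "real \<Rightarrow> real" where "c t = max 0 (min 1 t)" for t
  have c: "c t \<in> {0..1}" "{0..c t} \<subseteq> {0..1}" "t \<in> {0..1} \<Longrightarrow> c t = t" for t by (auto simp: c_def)
  define I where "I W t = integral {0..t} (\<lambda>s. A s (apply_bcontfun W s))" for W :: "real \<Rightarrow>\<^sub>C 'b" and t
  have cA: "continuous_on ({0..1} - S) (\<lambda>s. A s (apply_bcontfun W s))" for W
    by (rule continuous_on_linear_family[OF lin cont]) auto
  have AW: "norm (A s (apply_bcontfun W s)) \<le> norm W * \<beta> s" if "s \<in> {0..1} - S" for s W
  proof -
    have "norm (A s (apply_bcontfun W s)) \<le> \<beta> s * norm (apply_bcontfun W s)" by (rule le[OF that])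
    also have "\<dots> \<le> \<beta> s * norm W" by (intro mult_left_mono norm_bounded \<beta>)
    finally show ?thesis by (simp add: mult.commute)
  qed
  have int: "(\<lambda>s. A s (apply_bcontfun W s)) integrable_on {0..1}" for W
    by (rule integrable_off_finite[OF S cA AW]) (use \<beta> in \<open>auto intro: integrable_on_mult_right\<close>)
  have intt: "(\<lambda>s. A s (apply_bcontfun W s)) integrable_on {0..c t}" for W t
    using integrable_on_subinterval[OF int] c by blast
  have I_le: "norm i \<le> 1/2 * D"
    if "(f has_integral i) {0..c t}" "\<And>s. s \<in> {0..1} - S \<Longrightarrow> norm (f s) \<le> D * \<beta> s" "D \<ge> 0"
    for f :: "real \<Rightarrow> 'b" and D t i
  proof -
    have \<beta>t: "\<beta> integrable_on {0..c t}" using integrable_on_subinterval[OF \<beta>(2)] c by blast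
    have "norm i \<le> integral {0..c t} (\<lambda>s. D * \<beta> s)"
      by (rule norm_integral_le_off_finite[OF that(1) _ S])
         (use \<beta>t that(2) c(2)[of t] in \<open>auto intro: integrable_on_mult_right\<close>)
    also have "\<dots> = D * integral {0..c t} \<beta>" by simp
    also have "\<dots> \<le> D * (1/2)"
    proof (rule mult_left_mono[OF _ that(3)])
      have "integral {0..c t} \<beta> \<le> integral {0..1} \<beta>"
        by (rule integral_subset_le[OF c(2) \<beta>t \<beta>(2)]) (simp add: \<beta>)
      then show "integral {0..c t} \<beta> \<le> 1/2" using \<beta> by simp
    qed
    finally show ?thesis by simp
  qed
  define T where "T W = Bcontfun (\<lambda>t. w0 + I W (c t))" for W
  have TW: "apply_bcontfun (T W) t = w0 + I W (c t)" for W t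
  proof -
    have "continuous_on UNIV c" unfolding c_def by (intro continuous_intros)
    have "continuous_on {0..1} (I W)" unfolding I_def by (rule indefinite_integral_continuous_1[OF int])
    from continuous_on_compose2[OF this \<open>continuous_on UNIV c\<close>]
    have "continuous_on UNIV (\<lambda>t. I W (c t))" using c(1) by blast
    then have "continuous_on UNIV (\<lambda>t. w0 + I W (c t))"
      by (intro continuous_on_add continuous_on_const)
    moreover have "norm (w0 + I W (c t)) \<le> norm w0 + 1/2 * norm W" for t
    proof -
      have "norm (I W (c t)) \<le> 1/2 * norm W"
        unfolding I_def by (rule I_le[OF integrable_integral[OF intt] AW]) auto
      then show ?thesis using norm_triangle_ineq[of w0 "I W (c t)"] by simp
    qed
    ultimately have "(\<lambda>t. w0 + I W (c t)) \<in> bcontfun" by (rule bcontfun_normI)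
    then show ?thesis unfolding T_def by (simp add: Bcontfun_inverse)
  qed
  have "dist (T W) (T W') \<le> 1/2 * dist W W'" for W W'
  proof (rule dist_bound)
    fix t
    have "((\<lambda>s. A s (apply_bcontfun W s) - A s (apply_bcontfun W' s)) has_integral I W (c t) - I W' (c t)) {0..c t}"
      unfolding I_def by (intro has_integral_diff integrable_integral intt)
    moreover have "norm (A s (apply_bcontfun W s) - A s (apply_bcontfun W' s)) \<le> dist W W' * \<beta> s"
      if "s \<in> {0..1} - S" for s
      using AW[OF that, of "W - W'"] linear_diff[OF lin[OF that]] by (simp add: dist_norm)
    ultimately have "norm (I W (c t) - I W' (c t)) \<le> 1/2 * dist W W'" by (rule I_le) auto
    then show "dist (apply_bcontfun (T W) t) (apply_bcontfun (T W') t) \<le> 1/2 * dist W W'"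
      by (simp add: TW dist_norm)
  qed
  then have "\<exists>!W. T W = W" by (rule_tac banach_fix_type[of "1/2"]) auto
  then obtain W where W: "T W = W" by blast
  have We: "apply_bcontfun W t = w0 + I W (c t)" for t using TW[of W t] W by simp
  show ?thesis
  proof (intro exI[of _ "apply_bcontfun W"] conjI ballI)
    show "apply_bcontfun W 0 = w0" by (subst We) (simp add: I_def c_def)
    fix t assume t: "t \<in> {0<..<1} - S"
    have op: "open ({0<..<1} - S)" by (intro open_Diff open_greaterThanLessThan finite_imp_closed S)
    have t': "t \<in> {0..1} - S" using t by auto
    have "continuous (at t within {0..1} - S) (\<lambda>s. A s (apply_bcontfun W s))"
      by (rule bspec[OF cA[of W, unfolded continuous_on_eq_continuous_within] t'])
    from integral_has_vector_derivative_continuous_at[OF int t' S this]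
    have "((\<lambda>u. I W u) has_vector_derivative A t (apply_bcontfun W t)) (at t within ({0..1} - S))"
      unfolding I_def .
    moreover have "t \<in> interior ({0..1} - S)"
      by (rule interiorI[OF op t]) auto
    note at_within_interior[OF this]
    ultimately have "((\<lambda>u. I W u) has_vector_derivative A t (apply_bcontfun W t)) (at t)"
      by (simp only:)
    from has_vector_derivative_add[OF has_vector_derivative_const[of w0] this]
    have "((\<lambda>u. w0 + I W u) has_vector_derivative A t (apply_bcontfun W t)) (at t)" by simp
    then show "(apply_bcontfun W has_vector_derivative A t (apply_bcontfun W t)) (at t)"
      by (rule has_vector_derivative_transform_within_open[OF _ op t]) (subst We, subst c(3), auto)
  qed (rule continuous_on_apply_bcontfun)
qed

lemma continuous_on_locallyI:
  fixes f :: "'a::t2_space \<Rightarrow> 'b::topological_space"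
  assumes "\<And>x. x \<in> S \<Longrightarrow> \<exists>U. open U \<and> x \<in> U \<and> continuous_on (S \<inter> U) f"
  shows "continuous_on S f"
  unfolding continuous_on_eq_continuous_within
proof
  fix x assume x: "x \<in> S"
  then obtain U where U: "open U" "x \<in> U" "continuous_on (S \<inter> U) f" using assms by blast
  have "continuous (at x within S \<inter> U) f"
    using U x by (simp add: continuous_on_eq_continuous_within)
  moreover have "at x within S = at x within S \<inter> U"
    by (rule at_within_nhd[OF U(2,1)]) auto
  ultimately show "continuous (at x within S) f" by simp
qed

subsection \<open>Charts\<close>

text \<open>Change of coordinates (\<open>f = id\<close>) and the tangent map are both instances, so
  that one chain rule and one continuity lemma serve for all of \<open>tchange\<close>,
  \<open>tcoord\<close> and \<open>tderiv\<close>.\<close>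

definition lderiv ::
  "('a, 'e::real_normed_vector) chart \<Rightarrow> ('a, 'e) chart \<Rightarrow> ('a \<Rightarrow> 'a) \<Rightarrow> 'a \<Rightarrow> 'e \<Rightarrow> 'e" where
  "lderiv c d f x = frechet_derivative (cmap d \<circ> f \<circ> cinv c) (at (cmap c x))"

lemma tchange_lderiv: "tchange c d x = lderiv c d id x"
  by (simp add: tchange_def lderiv_def)

lemma tcoord_lderiv: "tcoord A c x = lderiv (chart_at A x) c id x"
  by (simp add: tcoord_def tchange_lderiv)

lemma tderiv_lderiv: "tderiv A f x = lderiv (chart_at A x) (chart_at A (f x)) f x"
  by (simp add: tderiv_def lderiv_def)

locale smooth_manifold =
  fixes A :: "('a::t2_space, 'e::euclidean_space) chart set"
  assumes atlas: "smooth_atlas A"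
begin

lemma chart_open: "c \<in> A \<Longrightarrow> open (cdom c)" "c \<in> A \<Longrightarrow> open (cmap c ` cdom c)"
  using atlas by (auto simp: smooth_atlas_def)

lemma chart_homeomorphism:
  "c \<in> A \<Longrightarrow> homeomorphism (cdom c) (cmap c ` cdom c) (cmap c) (cinv c)"
  using atlas by (auto simp: smooth_atlas_def)

lemma cinv_cmap: "c \<in> A \<Longrightarrow> x \<in> cdom c \<Longrightarrow> cinv c (cmap c x) = x"
  using chart_homeomorphism by (auto simp: homeomorphism_def)

lemma cmap_cinv: "y \<in> cmap c ` cdom c \<Longrightarrow> cmap c (cinv c y) = y"
  by (rule f_inv_into_f)

lemma cinv_in: "y \<in> cmap c ` cdom c \<Longrightarrow> cinv c y \<in> cdom c"
  by (rule inv_into_into)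

lemma continuous_on_cmap: "c \<in> A \<Longrightarrow> continuous_on (cdom c) (cmap c)"
  and continuous_on_cinv: "c \<in> A \<Longrightarrow> continuous_on (cmap c ` cdom c) (cinv c)"
  using chart_homeomorphism by (auto simp: homeomorphism_def)

lemma open_cmap_image:
  assumes "c \<in> A" "open U" "U \<subseteq> cdom c"
  shows "open (cmap c ` U)"
proof -
  have "openin (top_of_set (cdom c)) U"
    using assms chart_open by (auto simp: openin_open_eq)
  then have "openin (top_of_set (cmap c ` cdom c)) (cmap c ` U)"
    using homeomorphism_imp_open_map[OF chart_homeomorphism[OF assms(1)]] by blast
  then show ?thesis using chart_open(2)[OF assms(1)] by (auto simp: openin_open_eq)
qed

lemma open_cinv_image:
  assumes "c \<in> A" "open V" "V \<subseteq> cmap c ` cdom c"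
  shows "open (cinv c ` V)"
proof -
  have "openin (top_of_set (cmap c ` cdom c)) V"
    using assms chart_open by (auto simp: openin_open_eq)
  then have "openin (top_of_set (cdom c)) (cinv c ` V)"
    using homeomorphism_imp_open_map[OF homeomorphism_symD[OF chart_homeomorphism[OF assms(1)]]] by blast
  then show ?thesis using chart_open(1)[OF assms(1)] by (auto simp: openin_open_eq)
qed

lemma chart_at: "chart_at A x \<in> A" "x \<in> cdom (chart_at A x)"
proof -
  have "x \<in> (\<Union>c\<in>A. cdom c)" using atlas unfolding smooth_atlas_def by (elim conjE) simp
  then have "\<exists>c. c \<in> A \<and> x \<in> cdom c" by blast
  then have "chart_at A x \<in> A \<and> x \<in> cdom (chart_at A x)"
    unfolding chart_at_def by (rule someI_ex)
  then show "chart_at A x \<in> A" "x \<in> cdom (chart_at A x)" by auto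
qed

lemma open_lderiv_domain:
  assumes "continuous_on UNIV f" "c \<in> A" "d \<in> A"
  shows "open (cdom c \<inter> f -` cdom d)" "open (cmap c ` (cdom c \<inter> f -` cdom d))"
proof -
  show "open (cdom c \<inter> f -` cdom d)"
    using assms chart_open by (intro open_Int open_vimage) auto
  then show "open (cmap c ` (cdom c \<inter> f -` cdom d))"
    by (rule open_cmap_image[OF assms(2)]) auto
qed

lemma C1_map_continuous: "C1_map A f \<Longrightarrow> continuous_on UNIV f"
  by (simp add: C1_map_def)

lemma Ck_transition:
  assumes "c \<in> A" "d \<in> A"
  shows "Ck_on k (cmap c ` (cdom c \<inter> cdom d)) (cmap d \<circ> cinv c)"
  using atlas assms unfolding smooth_atlas_def smooth_on_def by blast

lemma C1_map_id: "C1_map A id"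
  unfolding C1_map_def using Ck_transition[of _ _ 1] by simp

lemma has_derivative_lderiv:
  assumes "C1_map A f" "c \<in> A" "d \<in> A" "x \<in> cdom c" "f x \<in> cdom d"
  shows "((cmap d \<circ> f \<circ> cinv c) has_derivative lderiv c d f x) (at (cmap c x))"
  unfolding lderiv_def
  by (rule Ck_on_1D[of "cmap c ` (cdom c \<inter> f -` cdom d)"]) (use assms in \<open>auto simp: C1_map_def\<close>)

lemma linear_lderiv:
  assumes "C1_map A f" "c \<in> A" "d \<in> A" "x \<in> cdom c" "f x \<in> cdom d"
  shows "linear (lderiv c d f x)"
  using has_derivative_lderiv[OF assms] has_derivative_linear by blast

lemma lderiv_comp:
  assumes f: "C1_map A f" and g: "C1_map A g" and A: "c \<in> A" "d \<in> A" "e \<in> A"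
    and x: "x \<in> cdom c" "f x \<in> cdom d" "g (f x) \<in> cdom e"
  shows "((cmap e \<circ> (g \<circ> f) \<circ> cinv c) has_derivative lderiv d e g (f x) \<circ> lderiv c d f x) (at (cmap c x))"
    and "lderiv c e (g \<circ> f) x = lderiv d e g (f x) \<circ> lderiv c d f x"
proof -
  let ?S = "cmap c ` (cdom c \<inter> f -` cdom d)"
  have fx: "(cmap d \<circ> f \<circ> cinv c) (cmap c x) = cmap d (f x)" using x A by (simp add: cinv_cmap)
  have "((cmap e \<circ> g \<circ> cinv d) \<circ> (cmap d \<circ> f \<circ> cinv c) has_derivative
      lderiv d e g (f x) \<circ> lderiv c d f x) (at (cmap c x))"
    by (rule diff_chain_at[OF has_derivative_lderiv[OF f A(1,2) x(1,2)]])
       (unfold fx, rule has_derivative_lderiv[OF g A(2,3) x(2,3)])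
  then show 1: "((cmap e \<circ> (g \<circ> f) \<circ> cinv c) has_derivative lderiv d e g (f x) \<circ> lderiv c d f x) (at (cmap c x))"
  proof (rule has_derivative_transform_within_open[of _ _ _ _ ?S])
    show "open ?S" by (rule open_lderiv_domain(2)[OF C1_map_continuous[OF f] A(1,2)])
  qed (use x A in \<open>auto simp: cinv_cmap\<close>)
  show "lderiv c e (g \<circ> f) x = lderiv d e g (f x) \<circ> lderiv c d f x"
    unfolding lderiv_def[of c e] using frechet_derivative_at[OF 1] by simp
qed

lemma lderiv_id_self:
  assumes "c \<in> A" "x \<in> cdom c"
  shows "lderiv c c id x = id"
proof -
  have "((\<lambda>y. y) has_derivative id) (at (cmap c x))" by (simp add: id_def)
  then have "((cmap c \<circ> id \<circ> cinv c) has_derivative id) (at (cmap c x))"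
    by (rule has_derivative_transform_within_open[OF _ chart_open(2)[OF assms(1)]])
       (use assms in \<open>auto simp: cmap_cinv\<close>)
  then show ?thesis unfolding lderiv_def using frechet_derivative_at by metis
qed

lemma continuous_on_lderiv:
  fixes p :: "'p::topological_space \<Rightarrow> 'a"
  assumes f: "C1_map A f" and A: "c \<in> A" "d \<in> A" and p: "continuous_on T p"
    and pT: "\<And>t. t \<in> T \<Longrightarrow> p t \<in> cdom c" "\<And>t. t \<in> T \<Longrightarrow> f (p t) \<in> cdom d"
    and w: "continuous_on T w"
  shows "continuous_on T (\<lambda>t. lderiv c d f (p t) (w t))"
proof (rule continuous_on_linear_family[OF _ _ w])
  show "linear (lderiv c d f (p t))" if "t \<in> T" for t
    using linear_lderiv f A pT that by blast
  fix b :: 'e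
  have 1: "continuous_on (cmap c ` (cdom c \<inter> f -` cdom d))
      (\<lambda>y. frechet_derivative (cmap d \<circ> f \<circ> cinv c) (at y) b)"
    using f A by (auto simp: C1_map_def)
  have 2: "continuous_on T (\<lambda>t. cmap c (p t))"
    by (rule continuous_on_compose2[OF continuous_on_cmap[OF A(1)] p]) (use pT in auto)
  show "continuous_on T (\<lambda>t. lderiv c d f (p t) b)"
    unfolding lderiv_def by (rule continuous_on_compose2[OF 1 2]) (use pT in auto)
qed

text \<open>The intermediate chart has to vary with the point, so differentiability and continuity
  of the derivative are checked locally, with the chart chosen at \<open>f x\<close>.\<close>

lemma C1_map_comp:
  assumes f: "C1_map A f" and g: "C1_map A g"
  shows "C1_map A (g \<circ> f)"
proof -
  have cf: "continuous_on UNIV f" and cg: "continuous_on UNIV g" using f g by (auto simp: C1_map_def)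
  have cgf: "continuous_on UNIV (g \<circ> f)" using cf cg continuous_on_compose continuous_on_subset by blast
  have "Ck_on 1 (cmap c ` (cdom c \<inter> (g \<circ> f) -` cdom e)) (cmap e \<circ> (g \<circ> f) \<circ> cinv c)"
    if A: "c \<in> A" "e \<in> A" for c e
  proof -
    let ?S = "cmap c ` (cdom c \<inter> (g \<circ> f) -` cdom e)"
    let ?F = "cmap e \<circ> (g \<circ> f) \<circ> cinv c"
    have "?F differentiable (at y)" if y: "y \<in> ?S" for y
    proof -
      obtain x where x: "y = cmap c x" "x \<in> cdom c" "g (f x) \<in> cdom e" using y by auto
      show ?thesis unfolding x
        using lderiv_comp(1)[OF f g A(1) chart_at(1) A(2) x(2) chart_at(2) x(3)]
        by (auto simp: differentiable_def)
    qed
    moreover have "continuous_on ?S (\<lambda>y. frechet_derivative ?F (at y) u)" for u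
    proof (rule continuous_on_locallyI)
      fix y assume "y \<in> ?S"
      then obtain x where x: "y = cmap c x" "x \<in> cdom c" "g (f x) \<in> cdom e" by auto
      let ?d = "chart_at A (f x)"
      let ?U = "cmap c ` (cdom c \<inter> f -` cdom ?d)"
      have U: "open ?U" by (rule open_lderiv_domain[OF cf A(1) chart_at(1)])
      have "y \<in> ?U" using x chart_at(2)[of "f x"] by auto
      have inv: "continuous_on (?S \<inter> ?U) (cinv c)"
        by (rule continuous_on_subset[OF continuous_on_cinv[OF A(1)]]) auto
      have finv: "continuous_on (?S \<inter> ?U) (\<lambda>y. f (cinv c y))"
        by (rule continuous_on_compose2[OF cf inv]) auto
      have pts: "cinv c y \<in> cdom c \<and> f (cinv c y) \<in> cdom ?d \<and> g (f (cinv c y)) \<in> cdom e \<and> cmap c (cinv c y) = y"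
        if y: "y \<in> ?S \<inter> ?U" for y
      proof -
        obtain x1 x2 where "x1 \<in> cdom c" "g (f x1) \<in> cdom e" "y = cmap c x1"
          "x2 \<in> cdom c" "f x2 \<in> cdom ?d" "y = cmap c x2"
          using y by auto
        moreover from this have "x1 = x2" by (metis cinv_cmap A(1))
        ultimately show ?thesis by (simp add: cinv_cmap A(1))
      qed
      have "continuous_on (?S \<inter> ?U) (\<lambda>y. lderiv ?d e g (f (cinv c y)) (lderiv c ?d f (cinv c y) u))"
      proof (rule continuous_on_lderiv[OF g chart_at(1) A(2) finv])
        show "continuous_on (?S \<inter> ?U) (\<lambda>y. lderiv c ?d f (cinv c y) u)"
          by (rule continuous_on_lderiv[OF f A(1) chart_at(1) inv]) (use pts in auto)
      qed (use pts in auto)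
      moreover have "lderiv ?d e g (f (cinv c y)) (lderiv c ?d f (cinv c y) u) = frechet_derivative ?F (at y) u"
        if y: "y \<in> ?S \<inter> ?U" for y
        using lderiv_comp(2)[OF f g A(1) chart_at(1) A(2), of "cinv c y" "f x"] pts[OF y]
        by (simp add: lderiv_def fun_eq_iff)
      ultimately have "continuous_on (?S \<inter> ?U) (\<lambda>y. frechet_derivative ?F (at y) u)"
        by (rule continuous_on_eq)
      then show "\<exists>U. open U \<and> y \<in> U \<and> continuous_on (?S \<inter> U) (\<lambda>y. frechet_derivative ?F (at y) u)"
        using U \<open>y \<in> ?U\<close> by blast
    qed
    ultimately show ?thesis by simp
  qed
  then show ?thesis using cgf by (simp add: C1_map_def)
qed

lemma C1_map_funpow: "C1_map A f \<Longrightarrow> C1_map A (f ^^ n)"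
proof (induction n)
  case 0 then show ?case using C1_map_id by (simp only: funpow.simps)
next
  case (Suc n) then show ?case using C1_map_comp[of "f ^^ n" f] by (simp only: funpow.simps)
qed

subsection \<open>Tangent vectors\<close>

lemma linear_tcoord: "c \<in> A \<Longrightarrow> x \<in> cdom c \<Longrightarrow> linear (tcoord A c x)"
  unfolding tcoord_lderiv using linear_lderiv[OF C1_map_id chart_at(1)] chart_at(2) by simp

lemma linear_tchange: "c \<in> A \<Longrightarrow> d \<in> A \<Longrightarrow> x \<in> cdom c \<Longrightarrow> x \<in> cdom d \<Longrightarrow> linear (tchange c d x)"
  unfolding tchange_lderiv using linear_lderiv[OF C1_map_id] by simp

lemma linear_tderiv: "C1_map A f \<Longrightarrow> linear (tderiv A f x)"
  unfolding tderiv_lderiv using linear_lderiv chart_at by blast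

lemma tchange_tchange:
  assumes "c \<in> A" "d \<in> A" "e \<in> A" "x \<in> cdom c" "x \<in> cdom d" "x \<in> cdom e"
  shows "tchange d e x (tchange c d x v) = tchange c e x v"
  unfolding tchange_lderiv using lderiv_comp(2)[OF C1_map_id C1_map_id assms(1-3), of x] assms(4-) by simp

lemma tchange_self: "c \<in> A \<Longrightarrow> x \<in> cdom c \<Longrightarrow> tchange c c x v = v"
  by (simp add: tchange_lderiv lderiv_id_self)

lemma tchange_tcoord:
  "c \<in> A \<Longrightarrow> d \<in> A \<Longrightarrow> x \<in> cdom c \<Longrightarrow> x \<in> cdom d \<Longrightarrow> tchange c d x (tcoord A c x v) = tcoord A d x v"
  unfolding tcoord_def by (rule tchange_tchange[OF chart_at(1) _ _ chart_at(2)])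

lemma tcoord_inverse:
  assumes "c \<in> A" "x \<in> cdom c"
  shows "tcoord A c x (tchange c (chart_at A x) x v) = v" "tchange c (chart_at A x) x (tcoord A c x v) = v"
  unfolding tcoord_def using assms chart_at by (simp_all add: tchange_tchange tchange_self)

text \<open>The charts chosen arbitrarily at \<open>x\<close> and \<open>f x\<close> disappear: the
  chain rule with \<open>id\<close> on either side replaces them by \<open>c\<close> and
  \<open>d\<close>.\<close>

lemma tcoord_tderiv:
  assumes f: "C1_map A f" and A: "c \<in> A" "d \<in> A" and x: "x \<in> cdom c" "f x \<in> cdom d"
  shows "tcoord A d (f x) (tderiv A f x v) = lderiv c d f x (tcoord A c x v)"
proof -
  have "tcoord A d (f x) (tderiv A f x v) = lderiv (chart_at A x) d (id \<circ> f) x v"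
    unfolding tcoord_lderiv tderiv_lderiv
    using lderiv_comp(2)[OF f C1_map_id chart_at(1) chart_at(1) A(2) chart_at(2) chart_at(2), of x] x by simp
  also have "\<dots> = lderiv (chart_at A x) d (f \<circ> id) x v" by simp
  also have "\<dots> = lderiv c d f x (tcoord A c x v)"
    unfolding tcoord_lderiv
    using lderiv_comp(2)[OF C1_map_id f chart_at(1) A(1,2) chart_at(2), of x] x by simp
  finally show ?thesis .
qed

lemma tderiv_comp:
  assumes "C1_map A f" "C1_map A g"
  shows "tderiv A (g \<circ> f) x v = tderiv A g (f x) (tderiv A f x v)"
  unfolding tderiv_lderiv
  using lderiv_comp(2)[OF assms chart_at(1)[of x] chart_at(1)[of "f x"] chart_at(1)[of "g (f x)"]
      chart_at(2) chart_at(2) chart_at(2)]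
  by simp

lemma tderiv_id: "tderiv A id x v = v"
  by (simp add: tderiv_lderiv lderiv_id_self chart_at)

lemma tderiv_funpow:
  assumes "C1_map A f"
  shows "tderiv A (f ^^ 0) x v = v"
    "tderiv A (f ^^ Suc n) x v = tderiv A f ((f ^^ n) x) (tderiv A (f ^^ n) x v)"
    "tderiv A (f ^^ Suc n) x v = tderiv A (f ^^ n) (f x) (tderiv A f x v)"
proof -
  show "tderiv A (f ^^ 0) x v = v" using tderiv_id by (simp add: id_def[symmetric])
  show "tderiv A (f ^^ Suc n) x v = tderiv A f ((f ^^ n) x) (tderiv A (f ^^ n) x v)"
    using tderiv_comp[OF C1_map_funpow[OF assms] assms] by simp
  show "tderiv A (f ^^ Suc n) x v = tderiv A (f ^^ n) (f x) (tderiv A f x v)"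
    using tderiv_comp[OF assms C1_map_funpow[OF assms], of n x v] by (simp add: funpow_swap1 funpow_Suc_right del: funpow.simps)
qed

lemma tderiv_inv:
  assumes "C1_diffeo A f"
  shows "tderiv A (inv f) (f x) (tderiv A f x v) = v" "tderiv A f (inv f x) (tderiv A (inv f) x v) = v"
proof -
  have b: "bij f" and C: "C1_map A f" "C1_map A (inv f)" using assms by (auto simp: C1_diffeo_def)
  have "inv f \<circ> f = id" using b by (simp add: bij_is_inj)
  moreover have "f \<circ> inv f = id" using b bij_is_surj surj_iff by blast
  ultimately show "tderiv A (inv f) (f x) (tderiv A f x v) = v" "tderiv A f (inv f x) (tderiv A (inv f) x v) = v"
    using tderiv_comp[OF C] tderiv_comp[OF C(2,1)] tderiv_id by metis+
qed

subsection \<open>Velocities of curves\<close>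

text \<open>The derivative is taken within \<open>I\<close> so that it is one-sided at the corners
  of a piecewise smooth curve. The chart jumps with \<open>t\<close>; only \<open>tcoord A c\<close>
  of a velocity is expected to be continuous.\<close>

definition velocity :: "real set \<Rightarrow> (real \<Rightarrow> 'a) \<Rightarrow> real \<Rightarrow> 'e" where
  "velocity I \<gamma> t = vector_derivative (cmap (chart_at A (\<gamma> t)) \<circ> \<gamma>) (at t within I)"

lemma has_vector_derivative_lderiv:
  assumes f: "C1_map A f" and A: "c \<in> A" "d \<in> A" and x: "\<gamma> t \<in> cdom c" "f (\<gamma> t) \<in> cdom d"
    and cont: "continuous (at t within I) \<gamma>" and t: "t \<in> I"
    and der: "(cmap c \<circ> \<gamma> has_vector_derivative w) (at t within I)"
  shows "(cmap d \<circ> (f \<circ> \<gamma>) has_vector_derivative lderiv c d f (\<gamma> t) w) (at t within I)"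
proof -
  have "((cmap d \<circ> f \<circ> cinv c) has_derivative lderiv c d f (\<gamma> t)) (at ((cmap c \<circ> \<gamma>) t))"
    using has_derivative_lderiv[OF f A x] by simp
  from has_derivative_compose[OF der[unfolded has_vector_derivative_def] this]
  have "((\<lambda>s. (cmap d \<circ> f \<circ> cinv c) ((cmap c \<circ> \<gamma>) s)) has_derivative
      (\<lambda>h. lderiv c d f (\<gamma> t) (h *\<^sub>R w))) (at t within I)" .
  moreover have "eventually (\<lambda>s. (cmap d \<circ> f \<circ> cinv c) ((cmap c \<circ> \<gamma>) s) = (cmap d \<circ> (f \<circ> \<gamma>)) s) (at t within I)"
  proof -
    have "eventually (\<lambda>s. \<gamma> s \<in> cdom c) (at t within I)"
      using cont chart_open(1)[OF A(1)] x(1) unfolding continuous_within by (rule topological_tendstoD)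
    then show ?thesis by eventually_elim (simp add: cinv_cmap A)
  qed
  ultimately have "((cmap d \<circ> (f \<circ> \<gamma>)) has_derivative (\<lambda>h. lderiv c d f (\<gamma> t) (h *\<^sub>R w))) (at t within I)"
    by (rule has_derivative_transform_eventually) (use t x A in \<open>auto simp: cinv_cmap\<close>)
  then show ?thesis
    unfolding has_vector_derivative_def linear_cmul[OF linear_lderiv[OF f A x]] .
qed

context
  fixes a b :: real and \<gamma> :: "real \<Rightarrow> 'a"
  assumes ab: "a < b" and cont: "continuous_on {a..b} \<gamma>" and C1: "C1_curve_on A {a..b} \<gamma>"
begin

lemma vector_derivative_velocity:
  assumes "c \<in> A" "t \<in> {a..b}" "\<gamma> t \<in> cdom c"
  shows "(cmap c \<circ> \<gamma> has_vector_derivative tcoord A c (\<gamma> t) (velocity {a..b} \<gamma> t)) (at t within {a..b})"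
proof -
  let ?d = "chart_at A (\<gamma> t)"
  obtain \<gamma>' where "\<forall>t\<in>{t\<in>{a..b}. \<gamma> t \<in> cdom ?d}. ((cmap ?d \<circ> \<gamma>) has_vector_derivative \<gamma>' t) (at t within {a..b})"
    using C1 chart_at(1)[of "\<gamma> t"] unfolding C1_curve_on_def by blast
  then have 1: "((cmap ?d \<circ> \<gamma>) has_vector_derivative \<gamma>' t) (at t within {a..b})"
    using assms chart_at by blast
  then have 2: "velocity {a..b} \<gamma> t = \<gamma>' t"
    unfolding velocity_def using assms ab by (intro vector_derivative_within_closed_interval) auto
  have "continuous (at t within {a..b}) \<gamma>"
    using cont assms by (simp add: continuous_on_eq_continuous_within)
  from has_vector_derivative_lderiv[OF C1_map_id chart_at(1) assms(1) chart_at(2) _ this assms(2) 1]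
  show ?thesis using assms by (simp add: 2 tcoord_lderiv)
qed

lemma continuous_on_velocity:
  assumes "c \<in> A"
  shows "continuous_on {t\<in>{a..b}. \<gamma> t \<in> cdom c} (\<lambda>t. tcoord A c (\<gamma> t) (velocity {a..b} \<gamma> t))"
proof -
  obtain \<gamma>' where \<gamma>': "continuous_on {t\<in>{a..b}. \<gamma> t \<in> cdom c} \<gamma>'"
    "\<forall>t\<in>{t\<in>{a..b}. \<gamma> t \<in> cdom c}. ((cmap c \<circ> \<gamma>) has_vector_derivative \<gamma>' t) (at t within {a..b})"
    using C1 assms unfolding C1_curve_on_def by blast
  show ?thesis
  proof (rule continuous_on_eq[OF \<gamma>'(1)])
    fix t assume t: "t \<in> {t\<in>{a..b}. \<gamma> t \<in> cdom c}"
    show "\<gamma>' t = tcoord A c (\<gamma> t) (velocity {a..b} \<gamma> t)"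
      by (rule vector_derivative_unique_within_closed_interval[OF ab, of t])
         (use t \<gamma>'(2) vector_derivative_velocity[OF assms] in auto)
  qed
qed

lemma open_curve_preimage:
  assumes "open U"
  obtains V where "open V" "{t\<in>{a..b}. \<gamma> t \<in> U} = {a..b} \<inter> V"
proof -
  from continuous_on_open_invariant[THEN iffD1, OF cont, rule_format, OF assms]
  obtain V where V: "open V" "V \<inter> {a..b} = \<gamma> -` U \<inter> {a..b}" by blast
  show thesis by (rule that[OF V(1)]) (use V(2) in blast)
qed

lemma C1_curve_on_comp:
  assumes f: "C1_map A f"
  shows "C1_curve_on A {a..b} (f \<circ> \<gamma>)"
  unfolding C1_curve_on_def
proof (intro ballI exI conjI)
  fix d assume d: "d \<in> A"
  let ?\<gamma>' = "\<lambda>t. lderiv (chart_at A (\<gamma> t)) d f (\<gamma> t) (velocity {a..b} \<gamma> t)"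
  let ?T = "{t\<in>{a..b}. (f \<circ> \<gamma>) t \<in> cdom d}"
  have eq: "lderiv c d f (\<gamma> t) (tcoord A c (\<gamma> t) v) = lderiv (chart_at A (\<gamma> t)) d f (\<gamma> t) v"
    if "c \<in> A" "\<gamma> t \<in> cdom c" "f (\<gamma> t) \<in> cdom d" for c t v
    unfolding tcoord_lderiv
    using lderiv_comp(2)[OF C1_map_id f chart_at(1) that(1) d chart_at(2), of "\<gamma> t"] that by simp
  show "continuous_on ?T ?\<gamma>'"
  proof (rule continuous_on_locallyI)
    fix t0 assume t0: "t0 \<in> ?T"
    \<comment> \<open>The chart in \<open>?\<gamma>'\<close> jumps with \<open>t\<close>; by
      \<open>eq\<close> it may be replaced by the fixed chart at \<open>\<gamma> t0\<close> for all
      \<open>t\<close> near \<open>t0\<close>.\<close>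
    let ?c = "chart_at A (\<gamma> t0)"
    obtain V where V: "open V" "{t\<in>{a..b}. \<gamma> t \<in> cdom ?c} = {a..b} \<inter> V"
      using open_curve_preimage[OF chart_open(1)[OF chart_at(1)]] by blast
    have "t0 \<in> {t\<in>{a..b}. \<gamma> t \<in> cdom ?c}" using t0 chart_at(2)[of "\<gamma> t0"] by auto
    then have t0V: "t0 \<in> V" unfolding V(2) by blast
    have TV: "?T \<inter> V \<subseteq> {t\<in>{a..b}. \<gamma> t \<in> cdom ?c}" unfolding V(2) by blast
    have "continuous_on (?T \<inter> V) (\<lambda>t. lderiv ?c d f (\<gamma> t) (tcoord A ?c (\<gamma> t) (velocity {a..b} \<gamma> t)))"
      by (rule continuous_on_lderiv[OF f chart_at(1) d continuous_on_subset[OF cont]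
            _ _ continuous_on_subset[OF continuous_on_velocity[OF chart_at(1)] TV]])
         (use subsetD[OF TV] in auto)
    then have "continuous_on (?T \<inter> V) ?\<gamma>'"
      by (rule continuous_on_eq) (use subsetD[OF TV] in \<open>auto intro!: eq chart_at(1)\<close>)
    then show "\<exists>U. open U \<and> t0 \<in> U \<and> continuous_on (?T \<inter> U) ?\<gamma>'" using V(1) t0V by blast
  qed
  fix t assume t: "t \<in> ?T"
  have "continuous (at t within {a..b}) \<gamma>"
    using cont t by (simp add: continuous_on_eq_continuous_within)
  from has_vector_derivative_lderiv[OF f chart_at(1) d chart_at(2) _ this _
      vector_derivative_velocity[OF chart_at(1) _ chart_at(2)]]
  show "(cmap d \<circ> (f \<circ> \<gamma>) has_vector_derivative ?\<gamma>' t) (at t within {a..b})"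
    using t by (simp add: tcoord_def tchange_self chart_at)
qed

end

lemma pw_C1_curve_comp:
  assumes f: "C1_map A f" and \<gamma>: "pw_C1_curve A \<gamma>"
  shows "pw_C1_curve A (f \<circ> \<gamma>)"
proof -
  obtain S where p: "path \<gamma>" and S: "finite S"
    "\<And>a b. 0 \<le> a \<and> a < b \<and> b \<le> 1 \<and> {a<..<b} \<inter> S = {} \<Longrightarrow> C1_curve_on A {a..b} \<gamma>"
    using \<gamma> unfolding pw_C1_curve_def by blast
  have "C1_curve_on A {a..b} (f \<circ> \<gamma>)" if "0 \<le> a \<and> a < b \<and> b \<le> 1 \<and> {a<..<b} \<inter> S = {}" for a b
  proof (rule C1_curve_on_comp[OF _ _ S(2)[OF that] f])
    show "continuous_on {a..b} \<gamma>" by (rule continuous_on_subset[OF p[unfolded path_def]]) (use that in auto)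
  qed (use that in auto)
  moreover have "path (f \<circ> \<gamma>)"
    using p C1_map_continuous[OF f] unfolding path_def
    by (intro continuous_on_compose) (auto intro: continuous_on_subset)
  ultimately show ?thesis using S(1) unfolding pw_C1_curve_def by blast
qed

end

subsection \<open>Riemannian metrics and lengths of curves\<close>

locale riemannian = smooth_manifold A for A :: "('a::t2_space, 'e::euclidean_space) chart set" +
  fixes G :: "'a \<Rightarrow> 'e \<Rightarrow> 'e \<Rightarrow> real"
  assumes metric: "riemannian_metric A G"
begin

lemma G: "bilinear (G x)" "G x u v = G x v u" "v \<noteq> 0 \<Longrightarrow> G x v v > 0"
  using metric by (auto simp: riemannian_metric_def)

lemma G_zero: "G x 0 v = 0" "G x v 0 = 0"
  using G(1) by (simp_all add: bilinear_lzero bilinear_rzero)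

lemma rnorm_nonneg: "rnorm G x v \<ge> 0"
  using G(3)[of v x] by (cases "v = 0") (auto simp: rnorm_def G_zero)

lemma chart_metric_eq:
  assumes "c \<in> A" "x \<in> cdom c"
  shows "chart_metric A G c (cmap c x) u v = G x (tchange c (chart_at A x) x u) (tchange c (chart_at A x) x v)"
  using assms by (simp add: chart_metric_def cinv_cmap)

lemma chart_metric_change:
  assumes "c \<in> A" "d \<in> A" "x \<in> cdom c" "x \<in> cdom d"
  shows "chart_metric A G c (cmap c x) u v = chart_metric A G d (cmap d x) (tchange c d x u) (tchange c d x v)"
  using assms chart_at by (simp add: chart_metric_eq tchange_tchange)

lemma rnorm_chart:
  assumes "c \<in> A" "x \<in> cdom c"
  shows "rnorm G x v = sqrt (chart_metric A G c (cmap c x) (tcoord A c x v) (tcoord A c x v))"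
  using assms by (simp add: chart_metric_eq tcoord_inverse rnorm_def)

lemma chart_metric_bilinear:
  assumes "c \<in> A" "y \<in> cmap c ` cdom c"
  shows "bilinear (chart_metric A G c y)"
proof -
  obtain x where x: "x \<in> cdom c" "y = cmap c x" using assms by auto
  have 1: "linear (tchange c (chart_at A x) x)" using assms x chart_at linear_tchange by blast
  have 2: "linear (\<lambda>u. G x u v)" "linear (\<lambda>v. G x u v)" for u v
    using G(1)[of x] by (auto simp: bilinear_def)
  show ?thesis unfolding bilinear_def x(2) chart_metric_eq[OF assms(1) x(1)]
    using linear_compose[OF 1 2(1)] linear_compose[OF 1 2(2)] by (auto simp: o_def)
qed

lemma chart_metric_sym:
  assumes "c \<in> A" "y \<in> cmap c ` cdom c"
  shows "chart_metric A G c y u v = chart_metric A G c y v u"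
  using assms G(2) by (auto simp: chart_metric_eq)

lemma chart_metric_pos:
  assumes "c \<in> A" "y \<in> cmap c ` cdom c" "v \<noteq> 0"
  shows "chart_metric A G c y v v > 0"
proof -
  obtain x where x: "x \<in> cdom c" "y = cmap c x" using assms by auto
  have "tchange c (chart_at A x) x v \<noteq> 0"
    using tcoord_inverse(1)[OF assms(1) x(1), of v] assms(3) linear_0[OF linear_tcoord[OF assms(1) x(1)]] by auto
  then show ?thesis using G(3) by (simp add: x chart_metric_eq assms)
qed

lemma Ck_chart_metric:
  "c \<in> A \<Longrightarrow> Ck_on k (cmap c ` cdom c) (\<lambda>y. chart_metric A G c y u v)"
  using metric unfolding riemannian_metric_def smooth_on_def by blast

lemma continuous_on_chart_metric:
  "c \<in> A \<Longrightarrow> continuous_on (cmap c ` cdom c) (\<lambda>y. chart_metric A G c y u v)"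
  using Ck_chart_metric[of c 0] by simp

text \<open>On the compact set of pairs of a point of \<open>K\<close> and a Euclidean unit vector,
  the quadratic form attains a positive minimum and a maximum; homogeneity does the rest.\<close>

lemma chart_norm_bounds:
  assumes c: "c \<in> A" and K: "compact K" "K \<subseteq> cmap c ` cdom c"
  obtains C where "C \<ge> 1"
    "\<And>x v. x \<in> cdom c \<Longrightarrow> cmap c x \<in> K \<Longrightarrow> norm (tcoord A c x v) \<le> C * rnorm G x v"
    "\<And>x v. x \<in> cdom c \<Longrightarrow> cmap c x \<in> K \<Longrightarrow> rnorm G x v \<le> C * norm (tcoord A c x v)"
proof (cases "K = {}")
  case True
  then show ?thesis using that[of 1] by simp
next
  case False
  let ?T = "K \<times> sphere 0 1 :: ('e \<times> 'e) set"
  let ?Q = "\<lambda>t. chart_metric A G c (fst t) (snd t) (snd t)"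
  have cQ: "continuous_on ?T ?Q"
  proof (rule continuous_on_bilinear_family[where B="\<lambda>t. chart_metric A G c (fst t)" and v=snd and w=snd])
    show "bilinear (chart_metric A G c (fst t))" if "t \<in> ?T" for t
      using that K by (intro chart_metric_bilinear[OF c]) auto
    show "continuous_on ?T (\<lambda>t. chart_metric A G c (fst t) a b)" for a b
      by (rule continuous_on_compose2[OF continuous_on_chart_metric[OF c] continuous_on_fst[OF continuous_on_id]])
         (use K in auto)
  qed (rule continuous_on_snd[OF continuous_on_id])+
  have cT: "compact ?T" by (rule compact_Times[OF K(1) compact_sphere])
  have nT: "?T \<noteq> {}" using False by simp
  obtain t1 where t1: "t1 \<in> ?T" "\<And>t. t \<in> ?T \<Longrightarrow> ?Q t1 \<le> ?Q t"
    using continuous_attains_inf[OF cT nT cQ] by blast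
  obtain t2 where t2: "t2 \<in> ?T" "\<And>t. t \<in> ?T \<Longrightarrow> ?Q t \<le> ?Q t2"
    using continuous_attains_sup[OF cT nT cQ] by blast
  have nz: "snd t1 \<noteq> 0" using t1(1) by auto
  have m: "?Q t1 > 0" using t1(1) K by (intro chart_metric_pos[OF c _ nz]) auto
  define C where "C = max 1 (max (sqrt (?Q t2)) (1 / sqrt (?Q t1)))"
  have C: "C \<ge> 1" "C \<ge> sqrt (?Q t2)" "C \<ge> 1 / sqrt (?Q t1)" by (auto simp: C_def)
  have key: "norm (tcoord A c x v) \<le> C * rnorm G x v \<and> rnorm G x v \<le> C * norm (tcoord A c x v)"
    if x: "x \<in> cdom c" "cmap c x \<in> K" for x v
  proof (cases "tcoord A c x v = 0")
    case True
    have "chart_metric A G c (cmap c x) 0 0 = 0"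
      using chart_metric_bilinear[OF c, of "cmap c x"] x by (auto simp: bilinear_lzero)
    then show ?thesis unfolding rnorm_chart[OF c x(1)] True by simp
  next
    case False
    define w where "w = tcoord A c x v"
    define u where "u = (1 / norm w) *\<^sub>R w"
    have w: "w = norm w *\<^sub>R u" "norm w > 0" using False by (auto simp: u_def w_def)
    have u: "(cmap c x, u) \<in> ?T" using x False by (auto simp: u_def w_def)
    have b: "bilinear (chart_metric A G c (cmap c x))" using chart_metric_bilinear[OF c] x by auto
    have "chart_metric A G c (cmap c x) (norm w *\<^sub>R u) (norm w *\<^sub>R u) = (norm w)\<^sup>2 * ?Q (cmap c x, u)"
      by (simp add: bilinear_lmul[OF b] bilinear_rmul[OF b] power2_eq_square)
    then have "chart_metric A G c (cmap c x) w w = (norm w)\<^sup>2 * ?Q (cmap c x, u)"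
      unfolding w(1)[symmetric] .
    then have r: "rnorm G x v = norm w * sqrt (?Q (cmap c x, u))"
      unfolding rnorm_chart[OF c x(1)] w_def[symmetric] by (simp add: real_sqrt_mult)
    have q1: "sqrt (?Q t1) \<le> sqrt (?Q (cmap c x, u))" and q2: "sqrt (?Q (cmap c x, u)) \<le> sqrt (?Q t2)"
      by (rule real_sqrt_le_mono[OF t1(2)[OF u]], rule real_sqrt_le_mono[OF t2(2)[OF u]])
    have "1 \<le> C * sqrt (?Q t1)" using C(3) m by (simp add: field_simps)
    also have "\<dots> \<le> C * sqrt (?Q (cmap c x, u))" by (rule mult_left_mono[OF q1]) (use C(1) in linarith)
    finally have "1 \<le> C * sqrt (?Q (cmap c x, u))" .
    moreover have "sqrt (?Q (cmap c x, u)) \<le> C" by (rule order_trans[OF q2 C(2)])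
    ultimately have "sqrt (?Q (cmap c x, u)) \<le> C" "1 \<le> C * sqrt (?Q (cmap c x, u))" by blast+
    then have "norm w * sqrt (?Q (cmap c x, u)) \<le> norm w * C" "norm w * 1 \<le> norm w * (C * sqrt (?Q (cmap c x, u)))"
      using w(2) by (auto intro: mult_left_mono)
    then show ?thesis unfolding r w_def[symmetric] by (simp add: mult_ac)
  qed
  then show ?thesis using that[OF C(1)] by blast
qed

definition speed :: "(real \<Rightarrow> 'a) \<Rightarrow> real \<Rightarrow> real" where
  "speed \<gamma> t = rnorm G (\<gamma> t) (velocity UNIV \<gamma> t)"

lemma curve_length_speed: "curve_length A G \<gamma> = integral {0..1} (speed \<gamma>)"
  by (simp add: curve_length_def speed_def[abs_def] velocity_def)

lemma speed_nonneg: "speed \<gamma> t \<ge> 0"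
  by (simp add: speed_def rnorm_nonneg)

lemma velocity_interior:
  assumes "a < t" "t < b" shows "velocity {a..b} \<gamma> t = velocity UNIV \<gamma> t"
  unfolding velocity_def using assms by (simp add: at_within_Icc_at)

text \<open>Adding the end points to the exceptional set leaves only interior times, where the
  one-sided velocity of the surrounding piece is the two-sided one.\<close>

lemma pw_C1_curveE:
  assumes "pw_C1_curve A \<gamma>"
  obtains S where "finite S" "{0,1} \<subseteq> S" "continuous_on {0..1} \<gamma>"
    "\<And>t c. t \<in> {0..1} - S \<Longrightarrow> c \<in> A \<Longrightarrow> \<gamma> t \<in> cdom c \<Longrightarrow>
      (cmap c \<circ> \<gamma> has_vector_derivative tcoord A c (\<gamma> t) (velocity UNIV \<gamma> t)) (at t)"
    "\<And>c. c \<in> A \<Longrightarrow> continuous_on {t\<in>{0..1} - S. \<gamma> t \<in> cdom c} (\<lambda>t. tcoord A c (\<gamma> t) (velocity UNIV \<gamma> t))"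
    "speed \<gamma> integrable_on {0..1}"
proof -
  obtain S where p: "path \<gamma>" and S: "finite S"
    "\<And>a b. 0 \<le> a \<and> a < b \<and> b \<le> 1 \<and> {a<..<b} \<inter> S = {} \<Longrightarrow> C1_curve_on A {a..b} \<gamma>"
    using assms unfolding pw_C1_curve_def by blast
  have cont: "continuous_on {0..1} \<gamma>" using p by (simp add: path_def)
  have piece: "\<exists>a b. a < t \<and> t < b \<and> 0 \<le> a \<and> b \<le> 1 \<and> {a<..<b} \<inter> S = {}" if t: "t \<in> {0..1} - (S \<union> {0,1})" for t
  proof -
    have "open ({0<..<1} - S)" by (intro open_Diff open_greaterThanLessThan finite_imp_closed S)
    moreover have "t \<in> {0<..<1} - S" using t by auto
    ultimately obtain e where e: "e > 0" "ball t e \<subseteq> {0<..<1} - S" using openE by blast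
    have "{t - e<..<t + e} \<subseteq> {0<..<1} - S" using e(2) by (simp add: ball_eq_greaterThanLessThan)
    moreover have "{t - e/2..t + e/2} \<subseteq> {t - e<..<t + e}" using e(1) by auto
    ultimately have sub: "{t - e/2..t + e/2} \<subseteq> {0<..<1} - S" by blast
    have "t - e/2 \<in> {t - e/2..t + e/2}" "t + e/2 \<in> {t - e/2..t + e/2}" using e(1) by auto
    then have "t - e/2 \<in> {0<..<1} - S" "t + e/2 \<in> {0<..<1} - S" using sub by blast+
    moreover have "{t - e/2<..<t + e/2} \<inter> S = {}"
      using subset_trans[OF greaterThanLessThan_subseteq_atLeastAtMost_iff[THEN iffD2, of "t - e/2" "t + e/2" "t - e/2" "t + e/2"] sub]
      by auto
    ultimately show ?thesis using e(1) by (intro exI[of _ "t - e/2"] exI[of _ "t + e/2"]) auto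
  qed
  show ?thesis
  proof (rule that[of "S \<union> {0,1}"])
    show "finite (S \<union> {0,1})" "{0,1} \<subseteq> S \<union> {0,1}" "continuous_on {0..1} \<gamma>" using S cont by auto
    show "(cmap c \<circ> \<gamma> has_vector_derivative tcoord A c (\<gamma> t) (velocity UNIV \<gamma> t)) (at t)"
      if t: "t \<in> {0..1} - (S \<union> {0,1})" and c: "c \<in> A" "\<gamma> t \<in> cdom c" for t c
    proof -
      obtain a b where ab: "a < t" "t < b" "0 \<le> a" "b \<le> 1" "{a<..<b} \<inter> S = {}" using piece[OF t] by blast
      have "(cmap c \<circ> \<gamma> has_vector_derivative tcoord A c (\<gamma> t) (velocity {a..b} \<gamma> t)) (at t within {a..b})"
        by (rule vector_derivative_velocity[OF _ continuous_on_subset[OF cont] S(2)]) (use ab c in auto)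
      then show ?thesis using ab by (simp add: at_within_Icc_at velocity_interior)
    qed
    show "continuous_on {t\<in>{0..1} - (S \<union> {0,1}). \<gamma> t \<in> cdom c} (\<lambda>t. tcoord A c (\<gamma> t) (velocity UNIV \<gamma> t))"
      (is "continuous_on ?T ?v") if c: "c \<in> A" for c
    proof (rule continuous_on_locallyI)
      fix t assume t: "t \<in> ?T"
      obtain a b where ab: "a < t" "t < b" "0 \<le> a" "b \<le> 1" "{a<..<b} \<inter> S = {}" using piece[of t] t by blast
      have "continuous_on {t\<in>{a..b}. \<gamma> t \<in> cdom c} (\<lambda>t. tcoord A c (\<gamma> t) (velocity {a..b} \<gamma> t))"
        by (rule continuous_on_velocity[OF _ continuous_on_subset[OF cont] S(2) c]) (use ab in auto)
      then have "continuous_on (?T \<inter> {a<..<b}) (\<lambda>t. tcoord A c (\<gamma> t) (velocity {a..b} \<gamma> t))"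
        by (rule continuous_on_subset) auto
      then have "continuous_on (?T \<inter> {a<..<b}) ?v"
        by (rule continuous_on_eq) (auto simp: velocity_interior)
      then show "\<exists>U. open U \<and> t \<in> U \<and> continuous_on (?T \<inter> U) ?v"
        using ab by (intro exI[of _ "{a<..<b}"]) auto
    qed
    \<comment> \<open>On each smooth piece the speed within the piece is continuous, and it differs
      from \<open>speed\<close> at most at the two end points.\<close>
    show "speed \<gamma> integrable_on {0..1}"
    proof (rule integrable_on_pieces[OF S(1), of 0 1])
      fix a b :: real assume ab: "0 \<le> a" "a < b" "b \<le> 1" "{a<..<b} \<inter> S = {}"
      have C1: "C1_curve_on A {a..b} \<gamma>" using S(2) ab by blast
      have contab: "continuous_on {a..b} \<gamma>" by (rule continuous_on_subset[OF cont]) (use ab in auto)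
      let ?s = "\<lambda>t. rnorm G (\<gamma> t) (velocity {a..b} \<gamma> t)"
      have "continuous_on {a..b} ?s"
      proof (rule continuous_on_locallyI)
        fix t0 assume t0: "t0 \<in> {a..b}"
        let ?c = "chart_at A (\<gamma> t0)"
        let ?T = "{t\<in>{a..b}. \<gamma> t \<in> cdom ?c}"
        let ?v = "\<lambda>t. tcoord A ?c (\<gamma> t) (velocity {a..b} \<gamma> t)"
        obtain V where V: "open V" "?T = {a..b} \<inter> V"
          using open_curve_preimage[OF ab(2) contab C1 chart_open(1)[OF chart_at(1)]] by blast
        have vc: "continuous_on ?T ?v"
          by (rule continuous_on_velocity[OF ab(2) contab C1 chart_at(1)])
        have pc: "continuous_on ?T (\<lambda>t. cmap ?c (\<gamma> t))"
          by (rule continuous_on_compose2[OF continuous_on_cmap[OF chart_at(1)] continuous_on_subset[OF contab]]) auto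
        have "continuous_on ?T (\<lambda>t. chart_metric A G ?c (cmap ?c (\<gamma> t)) (?v t) (?v t))"
        proof (rule continuous_on_bilinear_family[where B="\<lambda>t. chart_metric A G ?c (cmap ?c (\<gamma> t))", OF _ _ vc vc])
          show "bilinear (chart_metric A G ?c (cmap ?c (\<gamma> t)))" if "t \<in> ?T" for t
            using that by (intro chart_metric_bilinear chart_at) auto
          show "continuous_on ?T (\<lambda>t. chart_metric A G ?c (cmap ?c (\<gamma> t)) u v)" for u v
            by (rule continuous_on_compose2[OF continuous_on_chart_metric[OF chart_at(1)] pc]) auto
        qed
        then have "continuous_on ?T (\<lambda>t. sqrt (chart_metric A G ?c (cmap ?c (\<gamma> t)) (?v t) (?v t)))"
          by (rule continuous_on_real_sqrt)
        then have "continuous_on ?T ?s"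
          by (rule continuous_on_eq, intro rnorm_chart[OF chart_at(1), symmetric]) simp
        then show "\<exists>U. open U \<and> t0 \<in> U \<and> continuous_on ({a..b} \<inter> U) ?s"
          using V(1) t0 chart_at(2)[of "\<gamma> t0"] unfolding V(2) by (intro exI[of _ V]) (use V(2) in blast)
      qed
      then have "?s integrable_on {a..b}" by (rule integrable_continuous_real)
      then show "speed \<gamma> integrable_on {a..b}"
        by (rule integrable_spike_finite[of "{a,b}", rotated 2]) (auto simp: speed_def velocity_interior)
    qed auto
  qed
qed

text \<open>True of every function \<open>\<gamma>\<close>, because the integral of a speed that is
  not integrable is \<open>0\<close>.\<close>

lemma curve_length_nonneg: "curve_length A G \<gamma> \<ge> 0"
proof (cases "speed \<gamma> integrable_on {0..1}")
  case True
  then show ?thesis unfolding curve_length_speed by (intro integral_nonneg) (auto simp: speed_nonneg)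
qed (simp add: curve_length_speed not_integrable_integral)

lemma curve_displacement:
  assumes \<gamma>: "pw_C1_curve A \<gamma>" and c: "c \<in> A" and t: "0 \<le> a" "a \<le> b" "b \<le> 1" and C: "C \<ge> 0"
    and dom: "\<And>t. t \<in> {a..b} \<Longrightarrow> \<gamma> t \<in> cdom c"
    and bd: "\<And>t v. t \<in> {a..b} \<Longrightarrow> norm (tcoord A c (\<gamma> t) v) \<le> C * rnorm G (\<gamma> t) v"
  shows "norm (cmap c (\<gamma> b) - cmap c (\<gamma> a)) \<le> C * curve_length A G \<gamma>"
proof -
  obtain S where S: "finite S" "{0,1} \<subseteq> S" "continuous_on {0..1} \<gamma>"
    "\<And>t c. t \<in> {0..1} - S \<Longrightarrow> c \<in> A \<Longrightarrow> \<gamma> t \<in> cdom c \<Longrightarrow>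
      (cmap c \<circ> \<gamma> has_vector_derivative tcoord A c (\<gamma> t) (velocity UNIV \<gamma> t)) (at t)"
    "\<And>c. c \<in> A \<Longrightarrow> continuous_on {t\<in>{0..1} - S. \<gamma> t \<in> cdom c} (\<lambda>t. tcoord A c (\<gamma> t) (velocity UNIV \<gamma> t))"
    "speed \<gamma> integrable_on {0..1}"
    by (rule pw_C1_curveE[OF \<gamma>], rule that)
  have sub: "{a..b} \<subseteq> {0..1}" using t by auto
  let ?v = "\<lambda>t. tcoord A c (\<gamma> t) (velocity UNIV \<gamma> t)"
  have int: "speed \<gamma> integrable_on {a..b}" using S(6) sub integrable_on_subinterval by blast
  have cc: "continuous_on {a..b} (cmap c \<circ> \<gamma>)"
    by (rule continuous_on_compose[OF continuous_on_subset[OF S(3) sub] continuous_on_subset[OF continuous_on_cmap[OF c]]])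
       (use dom in auto)
  have "(?v has_integral (cmap c \<circ> \<gamma>) b - (cmap c \<circ> \<gamma>) a) {a..b}"
    by (rule fundamental_theorem_of_calculus_interior_strong[OF S(1) t(2) S(4)[OF _ c] cc])
       (use dom t in auto)
  then have "norm ((cmap c \<circ> \<gamma>) b - (cmap c \<circ> \<gamma>) a) \<le> integral {a..b} (\<lambda>t. C * speed \<gamma> t)"
    by (rule norm_integral_le_off_finite[OF _ integrable_on_mult_right[OF int] S(1)])
       (use bd in \<open>auto simp: speed_def\<close>)
  also have "\<dots> = C * integral {a..b} (speed \<gamma>)" by simp
  also have "\<dots> \<le> C * curve_length A G \<gamma>"
    unfolding curve_length_speed
    by (intro mult_left_mono[OF integral_subset_le[OF sub int S(6)] C]) (simp add: speed_nonneg)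
  finally show ?thesis by simp
qed

text \<open>A first exit argument: up to the first time outside the open ball the curve lies in the
  closed ball, where the norm comparison bounds its displacement by less than the room that is left,
  so it cannot have left the open ball.\<close>

lemma curve_stays:
  assumes \<gamma>: "pw_C1_curve A \<gamma>" and c: "c \<in> A" and C: "C \<ge> 0"
    and R: "cball p R \<subseteq> cmap c ` cdom c"
    and bd: "\<And>x v. x \<in> cdom c \<Longrightarrow> cmap c x \<in> cball p R \<Longrightarrow> norm (tcoord A c x v) \<le> C * rnorm G x v"
    and start: "\<gamma> 0 \<in> cdom c" "norm (cmap c (\<gamma> 0) - p) + C * curve_length A G \<gamma> < R"
    and t: "t \<in> {0..1}"
  shows "\<gamma> t \<in> cdom c" "cmap c (\<gamma> t) \<in> cball p R"
    "norm (cmap c (\<gamma> t) - cmap c (\<gamma> 0)) \<le> C * curve_length A G \<gamma>"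
proof -
  let ?B = "cinv c ` ball p R" and ?K = "cinv c ` cball p R"
  have cont: "continuous_on {0..1} \<gamma>" by (rule pw_C1_curveE[OF \<gamma>])
  have B: "open ?B" by (rule open_cinv_image[OF c]) (use R in auto)
  have Kdom: "x \<in> cdom c \<and> cmap c x \<in> cball p R" if x: "x \<in> ?K" for x
  proof -
    obtain y where "y \<in> cball p R" "x = cinv c y" using x by auto
    then show ?thesis using R cinv_in[of y c] cmap_cinv[of y c] by auto
  qed
  have KI: "x \<in> ?B" if "x \<in> cdom c" "cmap c x \<in> ball p R" for x
    using that cinv_cmap[OF c] by (metis image_eqI)
  \<comment> \<open>Compactness yields closedness in the manifold, not merely in the chart domain;
    here the Hausdorff property enters.\<close>
  have "compact ?K"
    by (rule compact_continuous_image[OF continuous_on_subset[OF continuous_on_cinv[OF c] R]]) simp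
  then have K: "closed ?K" by (rule compact_imp_closed)
  have disp: "norm (cmap c (\<gamma> b) - cmap c (\<gamma> 0)) \<le> C * curve_length A G \<gamma>"
    if "b \<in> {0..1}" "\<And>s. s \<in> {0..b} \<Longrightarrow> \<gamma> s \<in> ?K" for b
    by (rule curve_displacement[OF \<gamma> c]) (use that C Kdom bd in auto)
  have C0: "0 \<le> C * curve_length A G \<gamma>" using C curve_length_nonneg by simp
  have "{t\<in>{0..1}. \<gamma> t \<notin> ?B} = {}"
  proof (rule ccontr)
    assume ne: "{t\<in>{0..1}. \<gamma> t \<notin> ?B} \<noteq> {}"
    have "closed ({0..1} \<inter> \<gamma> -` (- ?B))"
      by (rule continuous_closed_preimage[OF cont]) (use B in auto)
    moreover have eq: "{0..1} \<inter> \<gamma> -` (- ?B) = {t\<in>{0..1}. \<gamma> t \<notin> ?B}" by auto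
    ultimately have "compact {t\<in>{0..1}. \<gamma> t \<notin> ?B}"
      by (metis (no_types, lifting) bounded_subset bounded_closed_interval compact_eq_bounded_closed inf_le1)
    then obtain t1 where t1: "t1 \<in> {0..1}" "\<gamma> t1 \<notin> ?B" "\<And>s. s \<in> {0..1} \<Longrightarrow> \<gamma> s \<notin> ?B \<Longrightarrow> t1 \<le> s"
      using compact_attains_inf[OF _ ne] by blast
    have g0: "\<gamma> 0 \<in> ?B"
      by (rule KI[OF start(1)]) (use start(2) C0 in \<open>auto simp: dist_norm norm_minus_commute\<close>)
    then have "t1 \<noteq> 0" using t1(2) by auto
    then have pos: "t1 > 0" using t1(1) by simp
    have "{0..<t1} \<subseteq> {0..1} \<inter> \<gamma> -` ?K"
    proof
      fix s assume s: "s \<in> {0..<t1}"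
      then have "\<gamma> s \<in> ?B" using t1(1) t1(3)[of s] by (auto simp: not_le[symmetric])
      then show "s \<in> {0..1} \<inter> \<gamma> -` ?K" using s t1(1) by auto
    qed
    moreover have "closed ({0..1} \<inter> \<gamma> -` ?K)" by (rule continuous_closed_preimage[OF cont _ K]) simp
    ultimately have "closure {0..<t1} \<subseteq> {0..1} \<inter> \<gamma> -` ?K" by (rule closure_minimal)
    then have sub: "\<gamma> s \<in> ?K" if "s \<in> {0..t1}" for s using pos that by auto
    have "norm (cmap c (\<gamma> t1) - p) \<le> norm (cmap c (\<gamma> t1) - cmap c (\<gamma> 0)) + norm (cmap c (\<gamma> 0) - p)"
      using norm_triangle_ineq[of "cmap c (\<gamma> t1) - cmap c (\<gamma> 0)" "cmap c (\<gamma> 0) - p"] by simp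
    also have "\<dots> < R" using disp[OF t1(1) sub] start(2) by linarith
    finally have "\<gamma> t1 \<in> ?B"
      using Kdom[OF sub[of t1]] pos by (intro KI) (auto simp: dist_norm norm_minus_commute)
    then show False using t1(2) by simp
  qed
  then have inB: "\<gamma> s \<in> ?B" if "s \<in> {0..1}" for s using that by blast
  have inK: "\<gamma> s \<in> ?K" if "s \<in> {0..1}" for s
    by (rule subsetD[OF image_mono[OF ball_subset_cball] inB[OF that]])
  show "\<gamma> t \<in> cdom c" "cmap c (\<gamma> t) \<in> cball p R" using Kdom[OF inK[OF t]] by auto
  show "norm (cmap c (\<gamma> t) - cmap c (\<gamma> 0)) \<le> C * curve_length A G \<gamma>"
    by (rule disp[OF t inK]) (use t in auto)
qed

lemma velocity_comp:
  assumes f: "C1_map A f" and \<gamma>: "continuous_on {0..1} \<gamma>" and t: "0 < t" "t < 1"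
    and der: "(cmap (chart_at A (\<gamma> t)) \<circ> \<gamma> has_vector_derivative w) (at t)"
  shows "velocity UNIV (f \<circ> \<gamma>) t = tderiv A f (\<gamma> t) w"
proof -
  have "continuous (at t within {0..1}) \<gamma>" using \<gamma> t by (simp add: continuous_on_eq_continuous_within)
  then have "continuous (at t) \<gamma>" using t by (simp add: at_within_Icc_at)
  from has_vector_derivative_lderiv[OF f chart_at(1) chart_at(1)[of "f (\<gamma> t)"] chart_at(2) chart_at(2) this _ der]
  have "(cmap (chart_at A (f (\<gamma> t))) \<circ> (f \<circ> \<gamma>) has_vector_derivative tderiv A f (\<gamma> t) w) (at t)"
    by (simp add: tderiv_lderiv)
  then show ?thesis unfolding velocity_def by (simp add: vector_derivative_at)
qed

lemma curve_length_comp: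
  assumes f: "C1_map A f" and \<gamma>: "pw_C1_curve A \<gamma>" and K: "deriv_bounded A G f K"
  shows "curve_length A G (f \<circ> \<gamma>) \<le> K * curve_length A G \<gamma>"
proof -
  obtain S where S: "finite S" "{0,1} \<subseteq> S" "continuous_on {0..1} \<gamma>"
    "\<And>t c. t \<in> {0..1} - S \<Longrightarrow> c \<in> A \<Longrightarrow> \<gamma> t \<in> cdom c \<Longrightarrow>
      (cmap c \<circ> \<gamma> has_vector_derivative tcoord A c (\<gamma> t) (velocity UNIV \<gamma> t)) (at t)"
    "\<And>c. c \<in> A \<Longrightarrow> continuous_on {t\<in>{0..1} - S. \<gamma> t \<in> cdom c} (\<lambda>t. tcoord A c (\<gamma> t) (velocity UNIV \<gamma> t))"
    "speed \<gamma> integrable_on {0..1}"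
    by (rule pw_C1_curveE[OF \<gamma>], rule that)
  have int: "speed (f \<circ> \<gamma>) integrable_on {0..1}"
    by (rule pw_C1_curveE[OF pw_C1_curve_comp[OF f \<gamma>]])
  have "norm (curve_length A G (f \<circ> \<gamma>)) \<le> integral {0..1} (\<lambda>t. K * speed \<gamma> t)"
    unfolding curve_length_speed
  proof (rule norm_integral_le_off_finite[OF integrable_integral[OF int] _ S(1)])
    show "(\<lambda>t. K * speed \<gamma> t) integrable_on {0..1}" using S(6) by (rule integrable_on_mult_right)
    fix t assume t: "t \<in> {0..1} - S"
    then have t01: "0 < t" "t < 1" using S(2) by (auto simp: less_le)
    have "velocity UNIV (f \<circ> \<gamma>) t = tderiv A f (\<gamma> t) (tcoord A (chart_at A (\<gamma> t)) (\<gamma> t) (velocity UNIV \<gamma> t))"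
      by (rule velocity_comp[OF f S(3) t01 S(4)[OF t chart_at]])
    then show "norm (speed (f \<circ> \<gamma>) t) \<le> K * speed \<gamma> t"
      using K chart_at by (simp add: speed_def rnorm_nonneg tcoord_def tchange_self deriv_bounded_def)
  qed
  then show ?thesis using curve_length_nonneg by (simp add: curve_length_speed)
qed

lemma segment_curve:
  assumes c: "c \<in> A" and seg: "closed_segment y z \<subseteq> cmap c ` cdom c"
    and bd: "\<And>x v. x \<in> cdom c \<Longrightarrow> cmap c x \<in> closed_segment y z \<Longrightarrow> rnorm G x v \<le> C * norm (tcoord A c x v)"
  shows "pw_C1_curve A (cinv c \<circ> linepath y z)"
    "curve_length A G (cinv c \<circ> linepath y z) \<le> C * norm (z - y)"
proof -
  let ?\<gamma> = "cinv c \<circ> linepath y z"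
  have inseg: "linepath y z t \<in> closed_segment y z" if "t \<in> {0..1}" for t
    using that by (auto simp: linepath_image_01[symmetric])
  have dom: "?\<gamma> t \<in> cdom c" "cmap c (?\<gamma> t) = linepath y z t" if "t \<in> {0..1}" for t
    using cinv_in[OF subsetD[OF seg inseg[OF that]]] cmap_cinv[OF subsetD[OF seg inseg[OF that]]] by (auto simp: o_def)
  have cont: "continuous_on {0..1} ?\<gamma>"
    by (rule continuous_on_compose[OF continuous_on_linepath continuous_on_subset[OF continuous_on_cinv[OF c]]])
       (use inseg seg in auto)
  have lin: "(linepath y z has_vector_derivative z - y) (at t within I)" for t I
    by (rule has_vector_derivative_linepath_within)
  have der: "(cmap c \<circ> ?\<gamma> has_vector_derivative z - y) (at t within {a..b})"
    if "0 \<le> a" "b \<le> 1" "t \<in> {a..b}" for a b t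
    by (rule has_vector_derivative_transform[OF that(3) _ lin]) (use that dom in auto)
  have C1: "C1_curve_on A {a..b} ?\<gamma>" if ab: "0 \<le> a" "b \<le> 1" for a b
    unfolding C1_curve_on_def
  proof (intro ballI exI conjI)
    fix d assume d: "d \<in> A"
    let ?T = "{t\<in>{a..b}. ?\<gamma> t \<in> cdom d}"
    show "continuous_on ?T (\<lambda>t. lderiv c d id (?\<gamma> t) (z - y))"
      by (rule continuous_on_lderiv[OF C1_map_id c d continuous_on_subset[OF cont]])
         (use ab dom in \<open>auto simp del: o_apply\<close>)
    fix t assume t: "t \<in> ?T"
    have "continuous (at t within {a..b}) ?\<gamma>"
      by (rule bspec[OF continuous_on_subset[OF cont, of "{a..b}", unfolded continuous_on_eq_continuous_within]])
         (use ab t in auto)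
    from has_vector_derivative_lderiv[OF C1_map_id c d _ _ this _ der[OF ab]]
    show "(cmap d \<circ> ?\<gamma> has_vector_derivative lderiv c d id (?\<gamma> t) (z - y)) (at t within {a..b})"
      using t ab dom[of t] by (simp del: o_apply)
  qed
  show pw: "pw_C1_curve A ?\<gamma>"
    unfolding pw_C1_curve_def path_def using cont C1 by (intro conjI exI[of _ "{}"]) auto
  have int: "speed ?\<gamma> integrable_on {0..1}" by (rule pw_C1_curveE[OF pw])
  have "norm (curve_length A G ?\<gamma>) \<le> integral {0..1::real} (\<lambda>t. C * norm (z - y))"
    unfolding curve_length_speed
  proof (rule norm_integral_le_off_finite[OF integrable_integral[OF int]])
    show "finite {0, 1::real}" by simp
    fix t :: real assume t: "t \<in> {0..1} - {0,1}"
    then have t01: "0 < t" "t < 1" "t \<in> {0..1}" by auto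
    have "(cmap c \<circ> ?\<gamma> has_vector_derivative z - y) (at t)"
      using der[of 0 1 t] t01 by (simp add: at_within_Icc_at)
    moreover have "continuous (at t) ?\<gamma>"
      using bspec[OF cont[unfolded continuous_on_eq_continuous_within] t01(3)]
      unfolding at_within_Icc_at[OF t01(1,2)] .
    ultimately have "(cmap (chart_at A (?\<gamma> t)) \<circ> (id \<circ> ?\<gamma>) has_vector_derivative
        lderiv c (chart_at A (?\<gamma> t)) id (?\<gamma> t) (z - y)) (at t)"
      using chart_at dom(1)[OF t01(3)]
      by (intro has_vector_derivative_lderiv[OF C1_map_id c]) (auto simp del: o_apply)
    then have v: "velocity UNIV ?\<gamma> t = tchange c (chart_at A (?\<gamma> t)) (?\<gamma> t) (z - y)"
      unfolding velocity_def tchange_lderiv by (simp add: vector_derivative_at del: o_apply)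
    have "rnorm G (?\<gamma> t) (velocity UNIV ?\<gamma> t) \<le> C * norm (tcoord A c (?\<gamma> t) (velocity UNIV ?\<gamma> t))"
      by (rule bd) (use dom inseg t01 in \<open>simp_all del: o_apply\<close>)
    then show "norm (speed ?\<gamma> t) \<le> C * norm (z - y)"
      unfolding speed_def by (simp add: rnorm_nonneg v tcoord_inverse c dom(1)[OF t01(3)] del: o_apply)
  qed (rule integrable_const_ivl)
  then show "curve_length A G ?\<gamma> \<le> C * norm (z - y)" by simp
qed

lemma riem_dist_less_iff:
  "riem_dist A G x y < ennreal r \<longleftrightarrow> (\<exists>\<gamma>\<in>curves A x y. curve_length A G \<gamma> < r)"
  unfolding riem_dist_def INF_less_iff by (auto simp: ennreal_less_iff curve_length_nonneg)

end

subsection \<open>The Levi-Civita connection in charts\<close>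

lemma has_derivative_bilinear_family:
  fixes B :: "'p::real_normed_vector \<Rightarrow> 'e::euclidean_space \<Rightarrow> 'e \<Rightarrow> real"
  assumes U: "open U" "t0 \<in> U" and B: "\<And>t. t \<in> U \<Longrightarrow> bilinear (B t)"
    and B': "\<And>a b. ((\<lambda>t. B t a b) has_derivative B' a b) (at t0)" "\<And>h. bilinear (\<lambda>a b. B' a b h)"
    and v: "(v has_derivative v') (at t0)" and w: "(w has_derivative w') (at t0)"
  shows "((\<lambda>t. B t (v t) (w t)) has_derivative
    (\<lambda>h. B' (v t0) (w t0) h + B t0 (v' h) (w t0) + B t0 (v t0) (w' h))) (at t0)"
proof -
  have lB: "linear (\<lambda>x. B t x b)" "linear (B t x)" if "t \<in> U" for t x b
    using B[OF that] by (auto simp: bilinear_def)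
  have lB': "linear (\<lambda>x. B' x b h)" "linear (\<lambda>b. B' x b h)" for x b h
    using B'(2)[of h] by (auto simp: bilinear_def)
  have 1: "((\<lambda>t. B t (v t) b) has_derivative (\<lambda>h. B' (v t0) b h + B t0 (v' h) b)) (at t0)" for b
  proof -
    have "((\<lambda>t. B t (v t) b) has_derivative
      (\<lambda>h. (\<Sum>a\<in>Basis. (v t0 \<bullet> a) *\<^sub>R B' a b h) + B t0 (v' h) b)) (at t0)"
      by (rule has_derivative_linear_family[where F="\<lambda>t x. B t x b", OF U lB(1) B'(1) v])
    then show ?thesis unfolding linear_Basis_expansion[OF lB'(1), where v="v t0", symmetric] .
  qed
  have "((\<lambda>t. B t (v t) (w t)) has_derivative
      (\<lambda>h. (\<Sum>b\<in>Basis. (w t0 \<bullet> b) *\<^sub>R (B' (v t0) b h + B t0 (v' h) b)) + B t0 (v t0) (w' h))) (at t0)"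
    by (rule has_derivative_linear_family[where F="\<lambda>t x. B t (v t) x", OF U lB(2) 1 w])
  moreover have "(\<Sum>b\<in>Basis. (w t0 \<bullet> b) *\<^sub>R (B' (v t0) b h + B t0 (v' h) b))
      = B' (v t0) (w t0) h + B t0 (v' h) (w t0)" for h
    unfolding linear_Basis_expansion[OF lB'(2)[where x="v t0" and h=h], where v="w t0"]
      linear_Basis_expansion[OF lB(2)[OF U(2), where x="v' h"], where v="w t0"]
    by (simp add: scaleR_add_right distrib_left sum.distrib)
  ultimately show ?thesis by simp
qed

lemma bilinear_family_bound:
  fixes B :: "'p::topological_space \<Rightarrow> 'e::euclidean_space \<Rightarrow> 'e \<Rightarrow> 'b::real_normed_vector"
  assumes T: "compact T" and B: "\<And>t. t \<in> T \<Longrightarrow> bilinear (B t)"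
    and cont: "\<And>a b. a \<in> Basis \<Longrightarrow> b \<in> Basis \<Longrightarrow> continuous_on T (\<lambda>t. B t a b)"
  obtains C where "C \<ge> 0" "\<And>t u v. t \<in> T \<Longrightarrow> norm (B t u v) \<le> C * norm u * norm v"
proof -
  let ?c = "\<lambda>t. \<Sum>a\<in>Basis. \<Sum>b\<in>Basis. norm (B t a b)"
  have cc: "continuous_on T ?c" by (intro continuous_on_sum continuous_on_norm cont)
  have "bounded (?c ` T)" by (rule compact_imp_bounded[OF compact_continuous_image[OF cc T]])
  then obtain C where C: "\<And>t. t \<in> T \<Longrightarrow> norm (?c t) \<le> C" unfolding bounded_iff by blast
  have "norm (B t u v) \<le> max 0 C * norm u * norm v" if t: "t \<in> T" for t u v
  proof -
    have l: "linear (\<lambda>u. B t u v)" "\<And>a. linear (B t a)" for v using B[OF t] by (auto simp: bilinear_def)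
    have inner: "norm (B t a v) \<le> norm v * (\<Sum>b\<in>Basis. norm (B t a b))" for a
    proof -
      have "norm (B t a v) \<le> (\<Sum>b\<in>Basis. norm ((v \<bullet> b) *\<^sub>R B t a b))"
        unfolding linear_Basis_expansion[OF l(2), of a v] by (rule norm_sum)
      also have "\<dots> \<le> (\<Sum>b\<in>Basis. norm v * norm (B t a b))"
        by (intro sum_mono) (simp add: mult_right_mono Basis_le_norm)
      finally show ?thesis by (simp add: sum_distrib_left)
    qed
    have "norm (B t u v) \<le> (\<Sum>a\<in>Basis. norm ((u \<bullet> a) *\<^sub>R B t a v))"
      unfolding linear_Basis_expansion[OF l(1), of u v] by (rule norm_sum)
    also have "\<dots> \<le> (\<Sum>a\<in>Basis. norm u * (norm v * (\<Sum>b\<in>Basis. norm (B t a b))))"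
      by (intro sum_mono) (simp, intro mult_mono inner Basis_le_norm, auto)
    also have "\<dots> = norm u * norm v * ?c t" by (simp add: sum_distrib_left mult.assoc)
    also have "\<dots> \<le> norm u * norm v * max 0 C"
      using C[OF t] by (intro mult_left_mono) (auto simp: abs_le_iff)
    finally show ?thesis by (simp add: mult_ac)
  qed
  then show ?thesis using that[of "max 0 C"] by simp
qed

context riemannian
begin

definition dmetric :: "('a, 'e) chart \<Rightarrow> 'e \<Rightarrow> 'e \<Rightarrow> 'e \<Rightarrow> 'e \<Rightarrow> real" where
  "dmetric c y u v w = frechet_derivative (\<lambda>y. chart_metric A G c y v w) (at y) u"

text \<open>The Christoffel symbol of the first kind: the connection with its index lowered by the
  metric.\<close>

definition koszul :: "('a, 'e) chart \<Rightarrow> 'e \<Rightarrow> 'e \<Rightarrow> 'e \<Rightarrow> 'e \<Rightarrow> real" where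
  "koszul c y u v w = (dmetric c y u v w + dmetric c y v u w - dmetric c y w u v) / 2"

context
  fixes c assumes c: "c \<in> A"
begin

lemma has_derivative_dmetric:
  assumes "y \<in> cmap c ` cdom c"
  shows "((\<lambda>y. chart_metric A G c y v w) has_derivative (\<lambda>u. dmetric c y u v w)) (at y)"
  unfolding dmetric_def using Ck_on_1D[OF Ck_chart_metric[OF c] assms] by simp

text \<open>Linearity in \<open>v\<close> and \<open>w\<close> is inherited from the metric through
  uniqueness of derivatives.\<close>

lemma dmetric_linear:
  assumes y: "y \<in> cmap c ` cdom c"
  shows "linear (\<lambda>u. dmetric c y u v w)" "linear (\<lambda>v. dmetric c y u v w)" "linear (\<lambda>w. dmetric c y u v w)"
proof -
  note D = has_derivative_dmetric[OF y]
  show "linear (\<lambda>u. dmetric c y u v w)" for v w by (rule has_derivative_linear[OF D])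
  have uniq: "dmetric c y u v w = D' u"
    if "((\<lambda>y. f y) has_derivative D') (at y)"
      "\<And>y. y \<in> cmap c ` cdom c \<Longrightarrow> f y = chart_metric A G c y v w" for f D' v w u
  proof -
    have "((\<lambda>y. chart_metric A G c y v w) has_derivative D') (at y)"
      by (rule has_derivative_transform_within_open[OF that(1) chart_open(2)[OF c] y that(2)])
    then have "(\<lambda>u. dmetric c y u v w) = D'" using has_derivative_unique[OF D] by blast
    then show ?thesis by metis
  qed
  note b = chart_metric_bilinear[OF c]
  show "linear (\<lambda>v. dmetric c y u v w)"
  proof (rule linearI)
    show "dmetric c y u (v1 + v2) w = dmetric c y u v1 w + dmetric c y u v2 w" for v1 v2
      by (rule uniq[OF has_derivative_add[OF D D]]) (simp add: bilinear_ladd[OF b])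
    show "dmetric c y u (r *\<^sub>R v) w = r *\<^sub>R dmetric c y u v w" for r v
      by (rule uniq[OF has_derivative_scaleR_right[OF D]]) (simp add: bilinear_lmul[OF b])
  qed
  show "linear (\<lambda>w. dmetric c y u v w)"
  proof (rule linearI)
    show "dmetric c y u v (v1 + v2) = dmetric c y u v v1 + dmetric c y u v v2" for v1 v2
      by (rule uniq[OF has_derivative_add[OF D D]]) (simp add: bilinear_radd[OF b])
    show "dmetric c y u w (r *\<^sub>R v) = r *\<^sub>R dmetric c y u w v" for r v w
      by (rule uniq[OF has_derivative_scaleR_right[OF D]]) (simp add: bilinear_rmul[OF b])
  qed
qed

lemma continuous_on_dmetric: "continuous_on (cmap c ` cdom c) (\<lambda>y. dmetric c y u v w)"
  unfolding dmetric_def using Ck_chart_metric[OF c, of 1] by simp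

lemma koszul_linear:
  assumes y: "y \<in> cmap c ` cdom c"
  shows "linear (\<lambda>u. koszul c y u v w)" "linear (\<lambda>v. koszul c y u v w)" "linear (\<lambda>w. koszul c y u v w)"
proof -
  note l = dmetric_linear[OF y]
  have comb: "linear (\<lambda>x. (f x + g x - h x) / 2)" if "linear f" "linear g" "linear h" for f g h :: "'e \<Rightarrow> real"
    by (rule linearI)
       (simp_all add: linear_add[OF that(1)] linear_add[OF that(2)] linear_add[OF that(3)]
         linear_cmul[OF that(1)] linear_cmul[OF that(2)] linear_cmul[OF that(3)] field_simps)
  show "linear (\<lambda>u. koszul c y u v w)" "linear (\<lambda>v. koszul c y u v w)" "linear (\<lambda>w. koszul c y u v w)"
    unfolding koszul_def by (intro comb l)+
qed

text \<open>The definite description in \<open>christoffel\<close> has a value because the metric is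
  positive definite. All later properties of the connection are derived from this
  characterisation.\<close>

lemma christoffel_koszul:
  assumes y: "y \<in> cmap c ` cdom c"
  shows "chart_metric A G c y (christoffel A G c y u v) w = koszul c y u v w"
    "(\<And>w. chart_metric A G c y z w = koszul c y u v w) \<Longrightarrow> christoffel A G c y u v = z"
proof -
  have ex1: "\<exists>!z. \<forall>w. chart_metric A G c y z w = koszul c y u v w"
    by (rule positive_definite_represents[OF chart_metric_bilinear[OF c y] chart_metric_pos[OF c y] koszul_linear(3)[OF y]])
  have eq: "christoffel A G c y u v = (THE z. \<forall>w. chart_metric A G c y z w = koszul c y u v w)"
    unfolding christoffel_def koszul_def dmetric_def by (simp add: field_simps)
  show "chart_metric A G c y (christoffel A G c y u v) w = koszul c y u v w"
    using theI'[OF ex1] unfolding eq by blast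
  show "christoffel A G c y u v = z" if "\<And>w. chart_metric A G c y z w = koszul c y u v w"
    unfolding eq by (rule the1_equality[OF ex1]) (use that in blast)
qed

lemma christoffel_bilinear:
  assumes y: "y \<in> cmap c ` cdom c"
  shows "bilinear (christoffel A G c y)"
proof -
  note b = chart_metric_bilinear[OF c y] and k = koszul_linear[OF y] and ck = christoffel_koszul[OF y]
  show ?thesis unfolding bilinear_def
    by (intro conjI allI linearI ck(2))
       (simp_all add: bilinear_ladd[OF b] bilinear_lmul[OF b] ck(1)
         linear_add[OF k(1)] linear_cmul[OF k(1)] linear_add[OF k(2)] linear_cmul[OF k(2)])
qed

lemma continuous_on_christoffel: "continuous_on (cmap c ` cdom c) (\<lambda>y. christoffel A G c y u v)"
proof (rule continuous_on_represents[where g="chart_metric A G c" and k="\<lambda>y. koszul c y u v"])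
  show "continuous_on (cmap c ` cdom c) (\<lambda>y. koszul c y u v b)" for b
    unfolding koszul_def by (intro continuous_on_divide continuous_on_add continuous_on_diff continuous_on_dmetric continuous_on_const) simp
qed (auto intro: chart_metric_bilinear[OF c] chart_metric_pos[OF c] continuous_on_chart_metric[OF c] christoffel_koszul(1))

lemma christoffel_bound:
  assumes K: "compact K" "K \<subseteq> cmap c ` cdom c"
  obtains C where "C \<ge> 0" "\<And>y u v. y \<in> K \<Longrightarrow> norm (christoffel A G c y u v) \<le> C * norm u * norm v"
proof (rule bilinear_family_bound[OF K(1), of "christoffel A G c"])
  show "bilinear (christoffel A G c y)" if "y \<in> K" for y using K that by (intro christoffel_bilinear) auto
  show "continuous_on K (\<lambda>t. christoffel A G c t a b)" for a b
    by (rule continuous_on_subset[OF continuous_on_christoffel K(2)])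
qed (use that in blast)

end

section \<open>The metric and the connection under a change of charts\<close>

definition tchange2 :: "('a, 'e) chart \<Rightarrow> ('a, 'e) chart \<Rightarrow> 'e \<Rightarrow> 'e \<Rightarrow> 'e \<Rightarrow> 'e" where
  "tchange2 c d y v u = frechet_derivative (\<lambda>y. frechet_derivative (cmap d \<circ> cinv c) (at y) v) (at y) u"

context
  fixes c d assumes cd: "c \<in> A" "d \<in> A"
begin

lemma open_overlap: "open (cmap c ` (cdom c \<inter> cdom d))"
  by (rule open_cmap_image[OF cd(1)]) (use open_Int[OF chart_open(1)[OF cd(1)] chart_open(1)[OF cd(2)]] in auto)

lemma tchange2_sym:
  assumes "y \<in> cmap c ` (cdom c \<inter> cdom d)"
  shows "tchange2 c d y v u = tchange2 c d y u v"
  unfolding tchange2_def by (rule symmetric_second_derivative[OF open_overlap assms Ck_transition[OF cd]])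

lemma has_derivative_tchange2:
  assumes "y \<in> cmap c ` (cdom c \<inter> cdom d)"
  shows "((\<lambda>y. frechet_derivative (cmap d \<circ> cinv c) (at y) v) has_derivative tchange2 c d y v) (at y)"
  unfolding tchange2_def using Ck_on_2D(2)[OF Ck_transition[OF cd] assms] by (simp add: eta_contract_eq)

lemma linear_tchange2:
  assumes "y \<in> cmap c ` (cdom c \<inter> cdom d)"
  shows "linear (tchange2 c d y v)" "linear (\<lambda>v. tchange2 c d y v u)"
proof -
  show 1: "linear (tchange2 c d y v)" for v by (rule has_derivative_linear[OF has_derivative_tchange2[OF assms]])
  show "linear (\<lambda>v. tchange2 c d y v u)" unfolding tchange2_sym[OF assms, of _ u] by (simp add: 1)
qed

text \<open>The metric in \<open>c\<close> is the pullback of the metric in \<open>d\<close>; the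
  product rule produces one term with the derivative of the metric and two with second derivatives
  of the transition map.\<close>

lemma dmetric_change:
  assumes x: "x \<in> cdom c" "x \<in> cdom d"
  shows "dmetric c (cmap c x) u v w =
    dmetric d (cmap d x) (tchange c d x u) (tchange c d x v) (tchange c d x w)
    + chart_metric A G d (cmap d x) (tchange2 c d (cmap c x) v u) (tchange c d x w)
    + chart_metric A G d (cmap d x) (tchange c d x v) (tchange2 c d (cmap c x) w u)"
proof -
  let ?S = "cmap c ` (cdom c \<inter> cdom d)"
  let ?\<psi> = "cmap d \<circ> cinv c"
  let ?y = "cmap c x"
  have yS: "?y \<in> ?S" using x by auto
  have \<psi>y: "?\<psi> ?y = cmap d x" using x cd by (simp add: cinv_cmap)
  have D: "(?\<psi> has_derivative tchange c d x) (at ?y)"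
    using has_derivative_lderiv[OF C1_map_id cd x(1)] x(2) by (simp add: tchange_lderiv)
  have in_d: "?\<psi> y \<in> cmap d ` cdom d" if "y \<in> ?S" for y
    using that cd by (auto simp: cinv_cmap)
  have dm: "((\<lambda>z. chart_metric A G d z a b) has_derivative (\<lambda>h. dmetric d (cmap d x) h a b)) (at (?\<psi> ?y))" for a b
    unfolding \<psi>y by (rule has_derivative_dmetric[OF cd(2)]) (use x in auto)
  have "((\<lambda>y. chart_metric A G d (?\<psi> y) (frechet_derivative ?\<psi> (at y) v) (frechet_derivative ?\<psi> (at y) w)) has_derivative
     (\<lambda>h. dmetric d (cmap d x) (tchange c d x h) (frechet_derivative ?\<psi> (at ?y) v) (frechet_derivative ?\<psi> (at ?y) w)
       + chart_metric A G d (?\<psi> ?y) (tchange2 c d ?y v h) (frechet_derivative ?\<psi> (at ?y) w)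
       + chart_metric A G d (?\<psi> ?y) (frechet_derivative ?\<psi> (at ?y) v) (tchange2 c d ?y w h))) (at ?y)"
  proof (rule has_derivative_bilinear_family[where B="\<lambda>y. chart_metric A G d (?\<psi> y)"
        and B'="\<lambda>a b h. dmetric d (cmap d x) (tchange c d x h) a b", OF open_overlap yS])
    show "bilinear (chart_metric A G d (?\<psi> t))" if "t \<in> ?S" for t
      by (rule chart_metric_bilinear[OF cd(2) in_d[OF that]])
    show "((\<lambda>t. chart_metric A G d (?\<psi> t) a b) has_derivative (\<lambda>h. dmetric d (cmap d x) (tchange c d x h) a b)) (at ?y)" for a b
      by (rule has_derivative_compose[OF D dm])
    show "bilinear (\<lambda>a b. dmetric d (cmap d x) (tchange c d x h) a b)" for h
      unfolding bilinear_def using x by (auto intro!: dmetric_linear[OF cd(2)])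
  qed (rule has_derivative_tchange2[OF yS])+
  moreover have "chart_metric A G d (?\<psi> y) (frechet_derivative ?\<psi> (at y) v) (frechet_derivative ?\<psi> (at y) w)
      = chart_metric A G c y v w" if y: "y \<in> ?S" for y
  proof -
    obtain z where z: "z \<in> cdom c" "z \<in> cdom d" "y = cmap c z" using y by auto
    then show ?thesis using chart_metric_change[OF cd z(1,2)] by (simp add: cinv_cmap cd tchange_def)
  qed
  ultimately have "((\<lambda>y. chart_metric A G c y v w) has_derivative
     (\<lambda>h. dmetric d (cmap d x) (tchange c d x h) (tchange c d x v) (tchange c d x w)
       + chart_metric A G d (cmap d x) (tchange2 c d ?y v h) (tchange c d x w)
       + chart_metric A G d (cmap d x) (tchange c d x v) (tchange2 c d ?y w h))) (at ?y)"
    unfolding \<psi>y tchange_def[symmetric]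
    by (rule has_derivative_transform_within_open[OF _ open_overlap yS])
  from has_derivative_unique[OF this has_derivative_dmetric[OF cd(1)]] x(1) show ?thesis
    by (metis (no_types, lifting) imageI)
qed

text \<open>The Koszul combination of \<open>dmetric_change\<close> contains six terms with
  \<open>tchange2\<close>. By symmetry of \<open>tchange2\<close> and of the metric four of them
  cancel and two coincide, which leaves the inhomogeneous term.\<close>

lemma christoffel_change:
  assumes x: "x \<in> cdom c" "x \<in> cdom d"
  shows "tchange c d x (christoffel A G c (cmap c x) u v) =
    christoffel A G d (cmap d x) (tchange c d x u) (tchange c d x v) + tchange2 c d (cmap c x) v u"
proof -
  let ?y = "cmap c x" and ?T = "tchange c d x" and ?T2 = "tchange2 c d (cmap c x)"
  let ?g = "chart_metric A G d (cmap d x)"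
  let ?\<Gamma> = "christoffel A G c ?y u v"
  have yS: "?y \<in> cmap c ` (cdom c \<inter> cdom d)" and yc: "?y \<in> cmap c ` cdom c" and yd: "cmap d x \<in> cmap d ` cdom d"
    using x by auto
  note g = chart_metric_bilinear[OF cd(2) yd]
  have "christoffel A G d (cmap d x) (?T u) (?T v) = ?T ?\<Gamma> - ?T2 v u"
  proof (rule christoffel_koszul(2)[OF cd(2) yd])
    fix w'
    define w where "w = tchange d c x w'"
    have w': "w' = ?T w" using x cd by (simp add: w_def tchange_tchange tchange_self)
    have s: "?T2 a b = ?T2 b a" for a b by (rule tchange2_sym[OF yS])
    have gs: "?g a b = ?g b a" for a b by (rule chart_metric_sym[OF cd(2) yd])
    have "koszul c ?y u v w = koszul d (cmap d x) (?T u) (?T v) (?T w) + ?g (?T2 v u) (?T w)"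
      unfolding koszul_def dmetric_change[OF x]
      using s[of u v] s[of u w] s[of v w] gs[of "?T v" "?T2 w u"] gs[of "?T u" "?T2 w v"]
        gs[of "?T u" "?T2 v w"] by (simp add: field_simps)
    moreover have "?g (?T ?\<Gamma>) (?T w) = koszul c ?y u v w"
      using christoffel_koszul(1)[OF cd(1) yc, of u v w] chart_metric_change[OF cd x] by simp
    ultimately show "?g (?T ?\<Gamma> - ?T2 v u) w' = koszul d (cmap d x) (?T u) (?T v) w'"
      unfolding w' by (simp add: bilinear_lsub[OF g])
  qed
  then show ?thesis by simp
qed

end

subsection \<open>Parallel transport along short curves\<close>

text \<open>Evaluating \<open>transport\<close> requires a parallel field and its uniqueness. In the
  chart \<open>c\<close> both reduce to a linear equation whose coefficient has integral at most
  \<open>1/2\<close> on a short curve. But \<open>parallel_along\<close> demands the equation in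
  every chart, so the solution has to be carried over to an arbitrary chart
  \<open>d\<close>.\<close>

lemma transport_near_identity:
  assumes \<gamma>: "pw_C1_curve A \<gamma>" and c: "c \<in> A" and C: "Cn \<ge> 0" "C\<Gamma> \<ge> 0"
    and K: "K \<subseteq> cmap c ` cdom c"
    and dom: "\<And>t. t \<in> {0..1} \<Longrightarrow> \<gamma> t \<in> cdom c" "\<And>t. t \<in> {0..1} \<Longrightarrow> cmap c (\<gamma> t) \<in> K"
    and bd: "\<And>x v. x \<in> cdom c \<Longrightarrow> cmap c x \<in> K \<Longrightarrow> norm (tcoord A c x v) \<le> Cn * rnorm G x v"
    and \<Gamma>: "\<And>y u v. y \<in> K \<Longrightarrow> norm (christoffel A G c y u v) \<le> C\<Gamma> * norm u * norm v"
    and l: "C\<Gamma> * Cn * curve_length A G \<gamma> \<le> 1/2"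
  shows "norm (tcoord A c (\<gamma> 1) (transport A G \<gamma> v) - tcoord A c (\<gamma> 0) v)
    \<le> 2 * (C\<Gamma> * Cn * curve_length A G \<gamma>) * norm (tcoord A c (\<gamma> 0) v)"
proof -
  obtain S where S: "finite S" "{0,1} \<subseteq> S" "continuous_on {0..1} \<gamma>"
    "\<And>t c. t \<in> {0..1} - S \<Longrightarrow> c \<in> A \<Longrightarrow> \<gamma> t \<in> cdom c \<Longrightarrow>
      (cmap c \<circ> \<gamma> has_vector_derivative tcoord A c (\<gamma> t) (velocity UNIV \<gamma> t)) (at t)"
    "\<And>c. c \<in> A \<Longrightarrow> continuous_on {t\<in>{0..1} - S. \<gamma> t \<in> cdom c} (\<lambda>t. tcoord A c (\<gamma> t) (velocity UNIV \<gamma> t))"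
    "speed \<gamma> integrable_on {0..1}"
    by (rule pw_C1_curveE[OF \<gamma>], rule that)
  let ?vel = "\<lambda>t. tcoord A c (\<gamma> t) (velocity UNIV \<gamma> t)"
  define F where "F t w = - christoffel A G c (cmap c (\<gamma> t)) (?vel t) w" for t w
  define \<beta> where "\<beta> t = C\<Gamma> * Cn * speed \<gamma> t" for t
  have img: "cmap c (\<gamma> t) \<in> cmap c ` cdom c" if "t \<in> {0..1}" for t using dom(1)[OF that] by auto
  have bil: "bilinear (christoffel A G c (cmap c (\<gamma> t)))" if "t \<in> {0..1}" for t
    by (rule christoffel_bilinear[OF c img[OF that]])
  have Flin: "linear (F t)" if "t \<in> {0..1}" for t
    unfolding F_def using bil[OF that] by (intro linear_compose_neg) (auto simp: bilinear_def)
  have cc: "continuous_on {0..1} (\<lambda>t. cmap c (\<gamma> t))"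
    by (rule continuous_on_compose2[OF continuous_on_cmap[OF c] S(3)]) (use dom in auto)
  have Fcont: "continuous_on ({0..1} - S) (\<lambda>t. F t b)" for b
    unfolding F_def
  proof (rule continuous_on_minus, rule continuous_on_bilinear_family[where
        B="\<lambda>t. christoffel A G c (cmap c (\<gamma> t))" and v="?vel"])
    show "bilinear (christoffel A G c (cmap c (\<gamma> t)))" if "t \<in> {0..1} - S" for t using bil that by auto
    show "continuous_on ({0..1} - S) (\<lambda>t. christoffel A G c (cmap c (\<gamma> t)) a b)" for a b
      by (rule continuous_on_compose2[OF continuous_on_christoffel[OF c] continuous_on_subset[OF cc]]) (use img in auto)
    have "{t \<in> {0..1} - S. \<gamma> t \<in> cdom c} = {0..1} - S" using dom(1) by auto
    with S(5)[OF c] show "continuous_on ({0..1} - S) ?vel" by simp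
  qed (rule continuous_on_const)
  have \<beta>: "\<beta> t \<ge> 0" "\<beta> integrable_on {0..1}" "integral {0..1} \<beta> = C\<Gamma> * Cn * curve_length A G \<gamma>" for t
    unfolding \<beta>_def using C speed_nonneg S(6) by (auto simp: curve_length_speed intro: integrable_on_mult_right)
  have F\<beta>: "norm (F t w) \<le> \<beta> t * norm w" if t: "t \<in> {0..1}" for t w
  proof -
    have "norm (F t w) \<le> C\<Gamma> * norm (?vel t) * norm w" unfolding F_def using \<Gamma>[OF dom(2)[OF t]] by simp
    also have "\<dots> \<le> C\<Gamma> * (Cn * speed \<gamma> t) * norm w"
      unfolding speed_def using C by (intro mult_right_mono mult_left_mono bd dom t) auto
    finally show ?thesis by (simp add: \<beta>_def mult_ac)
  qed
  obtain w where w: "continuous_on {0..1} w" "w 0 = tcoord A c (\<gamma> 0) v"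
    "\<And>t. t \<in> {0<..<1} - S \<Longrightarrow> (w has_vector_derivative F t (w t)) (at t)"
    using linear_ode_exists[OF S(1) Flin Fcont F\<beta> \<beta>(1,2), of "tcoord A c (\<gamma> 0) v"] l \<beta>(3) by auto
  define V where "V t = tchange c (chart_at A (\<gamma> t)) (\<gamma> t) (w t)" for t
  have Vw: "tcoord A c (\<gamma> t) (V t) = w t" if "t \<in> {0..1}" for t
    unfolding V_def using dom(1)[OF that] c by (simp add: tcoord_inverse)
  have V0: "V 0 = v" unfolding V_def w(2) using dom(1)[of 0] c by (simp add: tcoord_inverse)
  have Vd: "tcoord A d (\<gamma> t) (V t) = tchange c d (\<gamma> t) (w t)" if "t \<in> {0..1}" "d \<in> A" "\<gamma> t \<in> cdom d" for t d
    using tchange_tcoord[OF c that(2) dom(1)[OF that(1)] that(3), of "V t"] Vw[OF that(1)] by simp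
  have vd: "vector_derivative (cmap d \<circ> \<gamma>) (at t) = tcoord A d (\<gamma> t) (velocity UNIV \<gamma> t)"
    if "t \<in> {0<..<1} - S" "d \<in> A" "\<gamma> t \<in> cdom d" for t d
    by (rule vector_derivative_at[OF S(4)]) (use that in auto)
  have par: "parallel_along A G \<gamma> V"
    unfolding parallel_along_def
  proof (intro exI[of _ S] conjI ballI impI S(1))
    fix d assume d: "d \<in> A"
    let ?T = "{t\<in>{0..1}. \<gamma> t \<in> cdom d}"
    have "continuous_on ?T (\<lambda>t. lderiv c d id (\<gamma> t) (w t))"
      by (rule continuous_on_lderiv[OF C1_map_id c d continuous_on_subset[OF S(3)] _ _ continuous_on_subset[OF w(1)]])
         (use dom in auto)
    then show "continuous_on ?T (\<lambda>t. tcoord A d (\<gamma> t) (V t))"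
      by (rule continuous_on_eq) (use d in \<open>simp add: Vd tchange_lderiv\<close>)
    fix t assume t: "t \<in> {0<..<1} - S" and td: "\<gamma> t \<in> cdom d"
    let ?y = "cmap c (\<gamma> t)" and ?\<psi> = "cmap d \<circ> cinv c"
    have t01: "t \<in> {0..1}" using t by auto
    have tc: "\<gamma> t \<in> cdom c" by (rule dom(1)[OF t01])
    have yS: "?y \<in> cmap c ` (cdom c \<inter> cdom d)" using tc td by auto
    define U where "U = {s\<in>{0<..<1}. \<gamma> s \<in> cdom d}"
    have "open ({0<..<1} \<inter> \<gamma> -` cdom d)"
      by (rule continuous_open_preimage[OF continuous_on_subset[OF S(3)]]) (use chart_open d in auto)
    moreover have "{0<..<1} \<inter> \<gamma> -` cdom d = U" by (auto simp: U_def)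
    ultimately have U: "open U" by simp
    have tU: "t \<in> U" using t td by (auto simp: U_def)
    have U01: "s \<in> {0..1}" "\<gamma> s \<in> cdom d" if "s \<in> U" for s using that by (auto simp: U_def)
    have lin: "linear (tchange c d (\<gamma> s))" if "s \<in> U" for s
      by (rule linear_tchange[OF c d dom(1) U01(2)]) (use that U01 in auto)
    have dc: "(cmap c \<circ> \<gamma> has_vector_derivative ?vel t) (at t)" using S(4) t c tc by auto
    have F': "((\<lambda>s. tchange c d (\<gamma> s) b) has_vector_derivative tchange2 c d ?y b (?vel t)) (at t)" for b
    proof -
      have "((\<lambda>y. frechet_derivative ?\<psi> (at y) b) has_derivative tchange2 c d ?y b) (at ((cmap c \<circ> \<gamma>) t))"
        using has_derivative_tchange2[OF c d yS] by simp
      from has_derivative_compose[OF dc[unfolded has_vector_derivative_def] this]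
      show ?thesis unfolding has_vector_derivative_def tchange_def o_def[of "cmap c" \<gamma>]
        by (simp add: linear_cmul[OF linear_tchange2(1)[OF c d yS]])
    qed
    have "((\<lambda>s. tchange c d (\<gamma> s) (w s)) has_vector_derivative
       (\<Sum>b\<in>Basis. (w t \<bullet> b) *\<^sub>R tchange2 c d ?y b (?vel t)) + tchange c d (\<gamma> t) (F t (w t))) (at t)"
      by (rule has_vector_derivative_linear_family[OF U tU lin F' w(3)[OF t]])
    then have "((\<lambda>s. tcoord A d (\<gamma> s) (V s)) has_vector_derivative
       (\<Sum>b\<in>Basis. (w t \<bullet> b) *\<^sub>R tchange2 c d ?y b (?vel t)) + tchange c d (\<gamma> t) (F t (w t))) (at t)"
      by (rule has_vector_derivative_transform_within_open[OF _ U tU]) (use U01 d in \<open>simp add: Vd\<close>)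
    \<comment> \<open>Differentiating the moving coordinate change contributes
      \<open>tchange2\<close>, which cancels the inhomogeneous term in the transformation law of the
      connection.\<close>
    moreover have "(\<Sum>b\<in>Basis. (w t \<bullet> b) *\<^sub>R tchange2 c d ?y b (?vel t)) + tchange c d (\<gamma> t) (F t (w t))
      = - christoffel A G d (cmap d (\<gamma> t)) (vector_derivative (cmap d \<circ> \<gamma>) (at t)) (tcoord A d (\<gamma> t) (V t))"
      unfolding linear_Basis_expansion[OF linear_tchange2(2)[OF c d yS], symmetric] F_def
        linear_neg[OF lin[OF tU]] christoffel_change[OF c d tc td] vd[OF t d td] Vd[OF t01 d td]
        tchange_tcoord[OF c d tc td] by simp
    ultimately show "((\<lambda>t. tcoord A d (\<gamma> t) (V t)) has_vector_derivative
        - christoffel A G d (cmap d (\<gamma> t)) (vector_derivative (cmap d \<circ> \<gamma>) (at t)) (tcoord A d (\<gamma> t) (V t))) (at t)"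
      by simp
  qed
  \<comment> \<open>A competing field may come with its own exceptional set. In the chart
    \<open>c\<close> the difference solves the same linear equation with initial value
    \<open>0\<close>, so the growth estimate makes it vanish at time 1.\<close>
  have uniq: "V' 1 = V 1" if V': "parallel_along A G \<gamma> V'" "V' 0 = v" for V'
  proof -
    have eq01: "{t\<in>{0..1}. \<gamma> t \<in> cdom c} = {0..1}" using dom(1) by auto
    obtain S' where fin: "finite S'" and all: "\<forall>d\<in>A. continuous_on {t\<in>{0..1}. \<gamma> t \<in> cdom d} (\<lambda>t. tcoord A d (\<gamma> t) (V' t)) \<and>
          (\<forall>t\<in>{0<..<1} - S'. \<gamma> t \<in> cdom d \<longrightarrow> ((\<lambda>t. tcoord A d (\<gamma> t) (V' t)) has_vector_derivative
             - christoffel A G d (cmap d (\<gamma> t)) (vector_derivative (cmap d \<circ> \<gamma>) (at t)) (tcoord A d (\<gamma> t) (V' t))) (at t))"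
      using V'(1) unfolding parallel_along_def by (elim exE conjE) (rule that)
    have S': "finite S'" "continuous_on {0..1} (\<lambda>t. tcoord A c (\<gamma> t) (V' t))"
      using fin bspec[OF all c] unfolding eq01 by simp_all
    have S'3: "((\<lambda>t. tcoord A c (\<gamma> t) (V' t)) has_vector_derivative
         - christoffel A G c (cmap c (\<gamma> t)) (vector_derivative (cmap c \<circ> \<gamma>) (at t)) (tcoord A c (\<gamma> t) (V' t))) (at t)"
      if t: "t \<in> {0<..<1} - S'" for t
    proof -
      have "t \<in> {0..1}" using t by simp
      then show ?thesis using conjunct2[OF bspec[OF all c], rule_format, OF t dom(1)] by blast
    qed
    define z where "z t = tcoord A c (\<gamma> t) (V' t) - w t" for t
    have z0: "z 0 = 0" using V'(2) w(2) by (simp add: z_def)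
    have "norm (z 1 - z 0) \<le> 2 * (C\<Gamma> * Cn * curve_length A G \<gamma>) * norm (z 0)"
    proof (rule linear_ode_growth[where S="S \<union> S'" and w'="\<lambda>t. F t (z t)", OF _ _ _ _ \<beta>(1,2)])
      show "continuous_on {0..1} z" unfolding z_def by (intro continuous_on_diff S'(2) w(1))
      fix t assume t: "t \<in> {0<..<1} - (S \<union> S')"
      then have t': "t \<in> {0<..<1} - S" "t \<in> {0<..<1} - S'" "t \<in> {0..1}" by auto
      have "(z has_vector_derivative F t (tcoord A c (\<gamma> t) (V' t)) - F t (w t)) (at t)"
        unfolding z_def
        using has_vector_derivative_diff[OF S'3[OF t'(2)] w(3)[OF t'(1)]] vd[OF t'(1) c dom(1)[OF t'(3)]]
        by (simp add: F_def)
      then show "(z has_vector_derivative F t (z t)) (at t)"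
        by (simp add: z_def linear_diff[OF Flin[OF t'(3)]])
      show "norm (F t (z t)) \<le> \<beta> t * norm (z t)" by (rule F\<beta>[OF t'(3)])
    qed (use S S' \<beta>(3) l in auto)
    then have "tcoord A c (\<gamma> 1) (V' 1) = tcoord A c (\<gamma> 1) (V 1)"
      using z0 Vw[of 1] by (simp add: z_def)
    then show ?thesis using tcoord_inverse(2)[OF c dom(1)[of 1]] by (metis atLeastAtMost_iff order_refl zero_le_one)
  qed
  have "transport A G \<gamma> v = V 1"
    unfolding transport_def by (rule the_equality) (use par V0 uniq in blast)+
  then have "tcoord A c (\<gamma> 1) (transport A G \<gamma> v) = w 1" using Vw[of 1] by simp
  moreover have "norm (w 1 - w 0) \<le> 2 * (C\<Gamma> * Cn * curve_length A G \<gamma>) * norm (w 0)"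
    by (rule linear_ode_growth[where w'="\<lambda>t. F t (w t)", OF S(1) w(1) w(3) _ \<beta>(1,2) _ l]) (use F\<beta> \<beta>(3) in auto)
  ultimately show ?thesis by (simp add: w(2))
qed

end

subsection \<open>Uniform charts\<close>

text \<open>Each condition holds for all sufficiently small positive \<open>r\<close>. Unneeded
  slots are filled with trivial conditions such as \<open>r * 0 < 1\<close>.\<close>

lemma ex_small:
  fixes X1 X2 X3 X4 Y1 Y2 Y3 Y4 :: real
  assumes "Y1 > 0" "Y2 > 0" "Y3 > 0" "Y4 > 0"
  shows "\<exists>r>0. r * X1 < Y1 \<and> r * X2 < Y2 \<and> r * X3 < Y3 \<and> r * X4 < Y4"
proof -
  have ev: "eventually (\<lambda>r. r * X < Y) (at_right 0)" if "Y > 0" for X Y :: real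
  proof -
    have "((\<lambda>r. r * X) \<longlongrightarrow> 0 * X) (at_right 0)" by (intro tendsto_mult tendsto_ident_at tendsto_const)
    then show ?thesis using that by (intro order_tendstoD(2)) auto
  qed
  have "eventually (\<lambda>r::real. r > 0 \<and> r * X1 < Y1 \<and> r * X2 < Y2 \<and> r * X3 < Y3 \<and> r * X4 < Y4) (at_right 0)"
    by (intro eventually_conj ev assms eventually_at_right_less)
  then show ?thesis using eventually_happens[of _ "at_right (0::real)"] by auto
qed

lemma onorm_basis_bound:
  fixes L M :: "'e::euclidean_space \<Rightarrow> 'b::real_normed_vector"
  assumes "linear L" "linear M"
  shows "norm (L a - M a) \<le> (\<Sum>b\<in>Basis. norm (L b - M b)) * norm a"
proof -
  have eq: "L a - M a = (\<Sum>b\<in>Basis. (a \<bullet> b) *\<^sub>R (L b - M b))"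
    using linear_Basis_expansion[OF assms(1), of a] linear_Basis_expansion[OF assms(2), of a]
    by (simp add: sum_subtractf scaleR_diff_right)
  have "norm (L a - M a) \<le> (\<Sum>b\<in>Basis. norm ((a \<bullet> b) *\<^sub>R (L b - M b)))"
    unfolding eq by (rule norm_sum)
  also have "\<dots> \<le> (\<Sum>b\<in>Basis. norm a * norm (L b - M b))"
    by (intro sum_mono) (simp add: mult_right_mono Basis_le_norm)
  finally show ?thesis by (simp add: sum_distrib_left mult.commute)
qed

text \<open>One constant \<open>C\<close> compares Euclidean and Riemannian norms in both directions
  and bounds the connection, on balls of one radius \<open>R\<close>. The map
  \<open>\<kappa>\<close> is not assumed continuous. The base point need not sit at the origin of
  its chart, so displacements are measured from \<open>cmap (\<kappa> x) x\<close>.\<close>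

locale uniform_charts = riemannian A G
  for A :: "('a::t2_space, 'e::euclidean_space) chart set" and G +
  fixes \<kappa> :: "'a \<Rightarrow> ('a, 'e) chart" and R C :: real
  assumes compact_M: "compact (UNIV :: 'a set)"
    and R: "R > 0" and C: "C \<ge> 1"
    and \<kappa>: "\<kappa> x \<in> A" "x \<in> cdom (\<kappa> x)"
    and \<kappa>_ball: "cball (cmap (\<kappa> x) x) R \<subseteq> cmap (\<kappa> x) ` cdom (\<kappa> x)"
    and \<kappa>_norm: "y \<in> cdom (\<kappa> x) \<Longrightarrow> cmap (\<kappa> x) y \<in> cball (cmap (\<kappa> x) x) R \<Longrightarrow> norm (tcoord A (\<kappa> x) y v) \<le> C * rnorm G y v"
      "y \<in> cdom (\<kappa> x) \<Longrightarrow> cmap (\<kappa> x) y \<in> cball (cmap (\<kappa> x) x) R \<Longrightarrow> rnorm G y v \<le> C * norm (tcoord A (\<kappa> x) y v)"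
    and \<kappa>_christoffel: "z \<in> cball (cmap (\<kappa> x) x) R \<Longrightarrow> norm (christoffel A G (\<kappa> x) z u v) \<le> C * norm u * norm v"

text \<open>The bounds are available on the coordinate ball of radius \<open>2 * r p\<close> around
  \<open>p\<close>, but the manifold is covered by the balls of radius \<open>r p\<close>. A point
  of the smaller ball keeps a ball of radius \<open>r p\<close> inside the larger one, and
  \<open>R\<close> is the least of finitely many \<open>r p\<close>.\<close>

lemma (in riemannian) ex_uniform_charts:
  assumes M: "compact (UNIV :: 'a set)"
  shows "\<exists>\<kappa> R C. uniform_charts A G \<kappa> R C"
proof -
  let ?c = "chart_at A"
  have "\<exists>r C1 C2. r > 0 \<and> C1 \<ge> 1 \<and> cball (cmap (?c p) p) (2 * r) \<subseteq> cmap (?c p) ` cdom (?c p) \<and>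
    (\<forall>y v. y \<in> cdom (?c p) \<longrightarrow> cmap (?c p) y \<in> cball (cmap (?c p) p) (2 * r) \<longrightarrow>
       norm (tcoord A (?c p) y v) \<le> C1 * rnorm G y v \<and> rnorm G y v \<le> C1 * norm (tcoord A (?c p) y v)) \<and>
    (\<forall>z u v. z \<in> cball (cmap (?c p) p) (2 * r) \<longrightarrow> norm (christoffel A G (?c p) z u v) \<le> C2 * norm u * norm v)" for p
  proof -
    have "cmap (?c p) p \<in> cmap (?c p) ` cdom (?c p)" using chart_at(2) by auto
    then obtain e where e: "e > 0" "cball (cmap (?c p) p) e \<subseteq> cmap (?c p) ` cdom (?c p)"
      using chart_open(2)[OF chart_at(1)] open_contains_cball by blast
    define K where "K = cball (cmap (?c p) p) (2 * (e / 2))"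
    have K: "compact K" "K \<subseteq> cmap (?c p) ` cdom (?c p)" using e by (auto simp: K_def)
    obtain C1 where C1: "C1 \<ge> 1"
      "\<And>x v. x \<in> cdom (?c p) \<Longrightarrow> cmap (?c p) x \<in> K \<Longrightarrow> norm (tcoord A (?c p) x v) \<le> C1 * rnorm G x v"
      "\<And>x v. x \<in> cdom (?c p) \<Longrightarrow> cmap (?c p) x \<in> K \<Longrightarrow> rnorm G x v \<le> C1 * norm (tcoord A (?c p) x v)"
      by (rule chart_norm_bounds[OF chart_at(1) K], rule that)
    obtain C2 where C2: "C2 \<ge> 0" "\<And>y u v. y \<in> K \<Longrightarrow> norm (christoffel A G (?c p) y u v) \<le> C2 * norm u * norm v"
      by (rule christoffel_bound[OF chart_at(1) K], rule that)
    show ?thesis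
    proof (rule exI[of _ "e/2"], rule exI[of _ C1], rule exI[of _ C2], unfold K_def[symmetric], intro conjI allI impI)
      show "e / 2 > 0" using e(1) by simp
    qed (use C1 C2 K in auto)
  qed
  then obtain r C1 C2 where r: "\<And>p. r p > 0" "\<And>p. C1 p \<ge> (1::real)"
    "\<And>p. cball (cmap (?c p) p) (2 * r p) \<subseteq> cmap (?c p) ` cdom (?c p)"
    and nb: "\<And>p y v. y \<in> cdom (?c p) \<Longrightarrow> cmap (?c p) y \<in> cball (cmap (?c p) p) (2 * r p) \<Longrightarrow>
       norm (tcoord A (?c p) y v) \<le> C1 p * rnorm G y v \<and> rnorm G y v \<le> C1 p * norm (tcoord A (?c p) y v)"
    and cb: "\<And>p z u v. z \<in> cball (cmap (?c p) p) (2 * r p) \<Longrightarrow> norm (christoffel A G (?c p) z u v) \<le> C2 p * norm u * norm v"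
    by metis
  define U where "U p = cinv (?c p) ` ball (cmap (?c p) p) (r p)" for p
  have sub: "ball (cmap (?c p) p) (r p) \<subseteq> cmap (?c p) ` cdom (?c p)" for p
    using r(1)[of p] by (intro subset_trans[OF _ r(3)[of p]]) auto
  have oU: "open (U p)" for p unfolding U_def by (rule open_cinv_image[OF chart_at(1) open_ball sub])
  have pU: "p \<in> U p" for p
    unfolding U_def by (rule image_eqI[of _ _ "cmap (?c p) p"]) (use r(1) chart_at cinv_cmap in auto)
  have cov: "UNIV \<subseteq> (\<Union>p\<in>UNIV. U p)" using pU by (intro subsetI UN_I UNIV_I)
  obtain F where F: "finite F" "UNIV \<subseteq> (\<Union>p\<in>F. U p)"
    by (rule compactE_image[OF M oU cov], rule that)
  have Fne: "F \<noteq> {}" using F(2) by auto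
  have "\<exists>p\<in>F. x \<in> U p" for x using F(2) by blast
  then obtain q where q: "\<And>x. q x \<in> F" "\<And>x. x \<in> U (q x)" by metis
  define R where "R = Min (r ` F)"
  define C where "C = Max ((\<lambda>p. max (C1 p) (C2 p)) ` F)"
  have R: "R > 0" "\<And>x. R \<le> r (q x)" using r(1) F(1) Fne q(1) by (auto simp: R_def)
  have Cq: "max (C1 (q x)) (C2 (q x)) \<le> C" for x unfolding C_def using F(1) q(1) by (intro Max_ge) auto
  have C: "C \<ge> 1" using Cq[of undefined] r(2)[of "q undefined"] by simp
  have qx: "x \<in> cdom (?c (q x))" "cmap (?c (q x)) x \<in> ball (cmap (?c (q x)) (q x)) (r (q x))" for x
  proof -
    obtain y where y: "y \<in> ball (cmap (?c (q x)) (q x)) (r (q x))" "x = cinv (?c (q x)) y"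
      using q(2)[of x] unfolding U_def by blast
    then have "y \<in> cmap (?c (q x)) ` cdom (?c (q x))" using sub by blast
    from cinv_in[OF this] cmap_cinv[OF this]
    show "x \<in> cdom (?c (q x))" "cmap (?c (q x)) x \<in> ball (cmap (?c (q x)) (q x)) (r (q x))"
      using y by simp_all
  qed
  have bb: "cball (cmap (?c (q x)) x) R \<subseteq> cball (cmap (?c (q x)) (q x)) (2 * r (q x))" for x
  proof
    fix z assume "z \<in> cball (cmap (?c (q x)) x) R"
    then show "z \<in> cball (cmap (?c (q x)) (q x)) (2 * r (q x))"
      using qx(2)[of x] R(2)[of x] dist_triangle[of "cmap (?c (q x)) (q x)" z "cmap (?c (q x)) x"] by simp
  qed
  have "uniform_charts A G (\<lambda>x. ?c (q x)) R C"
  proof unfold_locales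
    show "compact (UNIV :: 'a set)" by (rule M)
    fix x y v
    show "?c (q x) \<in> A" by (rule chart_at)
    show "x \<in> cdom (?c (q x))" by (rule qx)
    show "cball (cmap (?c (q x)) x) R \<subseteq> cmap (?c (q x)) ` cdom (?c (q x))"
      using bb r(3) by blast
    assume y: "y \<in> cdom (?c (q x))" "cmap (?c (q x)) y \<in> cball (cmap (?c (q x)) x) R"
    have "C1 (q x) \<le> C" using Cq[of x] by simp
    then have "C1 (q x) * rnorm G y v \<le> C * rnorm G y v" "C1 (q x) * norm (tcoord A (?c (q x)) y v) \<le> C * norm (tcoord A (?c (q x)) y v)"
      by (auto intro!: mult_right_mono simp: rnorm_nonneg)
    then show "norm (tcoord A (?c (q x)) y v) \<le> C * rnorm G y v" "rnorm G y v \<le> C * norm (tcoord A (?c (q x)) y v)"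
      using nb[OF y(1) subsetD[OF bb y(2)], of v] by auto
  next
    fix z x u v assume "z \<in> cball (cmap (?c (q x)) x) R"
    then have "norm (christoffel A G (?c (q x)) z u v) \<le> C2 (q x) * norm u * norm v" by (rule cb[OF subsetD[OF bb]])
    also have "\<dots> \<le> C * norm u * norm v" using Cq[of x] by (intro mult_right_mono) auto
    finally show "norm (christoffel A G (?c (q x)) z u v) \<le> C * norm u * norm v" .
  qed (rule R C)+
  then show ?thesis by blast
qed

section \<open>Displacements from a base point, short curves and derivatives in uniform
  charts\<close>

context uniform_charts
begin

definition loc :: "'a \<Rightarrow> 'a \<Rightarrow> 'e" where "loc x y = cmap (\<kappa> x) y - cmap (\<kappa> x) x"
definition unloc :: "'a \<Rightarrow> 'e \<Rightarrow> 'a" where "unloc x u = cinv (\<kappa> x) (cmap (\<kappa> x) x + u)"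
definition nbh :: "'a \<Rightarrow> real \<Rightarrow> 'a set" where "nbh x s = {y \<in> cdom (\<kappa> x). norm (loc x y) \<le> s}"

lemma loc_self: "loc x x = 0" by (simp add: loc_def)

lemma nbh_self: "s \<ge> 0 \<Longrightarrow> x \<in> nbh x s" by (simp add: nbh_def loc_self \<kappa>)

lemma nbh_mono: "s \<le> t \<Longrightarrow> y \<in> nbh x s \<Longrightarrow> y \<in> nbh x t" by (auto simp: nbh_def)

lemma nbhD: "y \<in> nbh x s \<Longrightarrow> y \<in> cdom (\<kappa> x)" "y \<in> nbh x s \<Longrightarrow> norm (loc x y) \<le> s"
  "y \<in> nbh x s \<Longrightarrow> cmap (\<kappa> x) y \<in> cball (cmap (\<kappa> x) x) s"
  by (auto simp: nbh_def loc_def dist_norm norm_minus_commute)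

lemma unloc:
  assumes "norm u \<le> R"
  shows "unloc x u \<in> cdom (\<kappa> x)" "loc x (unloc x u) = u" "norm u \<le> s \<Longrightarrow> unloc x u \<in> nbh x s"
proof -
  have "cmap (\<kappa> x) x + u \<in> cmap (\<kappa> x) ` cdom (\<kappa> x)"
    using assms by (intro subsetD[OF \<kappa>_ball]) (simp add: dist_norm)
  then show "unloc x u \<in> cdom (\<kappa> x)" "loc x (unloc x u) = u"
    unfolding unloc_def loc_def by (simp_all add: cinv_in cmap_cinv)
  then show "norm u \<le> s \<Longrightarrow> unloc x u \<in> nbh x s" by (simp add: nbh_def)
qed

lemma unloc_loc: "y \<in> cdom (\<kappa> x) \<Longrightarrow> unloc x (loc x y) = y"
  by (simp add: unloc_def loc_def cinv_cmap \<kappa>)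

lemma loc_inj: "y \<in> cdom (\<kappa> x) \<Longrightarrow> z \<in> cdom (\<kappa> x) \<Longrightarrow> loc x y = loc x z \<Longrightarrow> y = z"
  using unloc_loc by metis

lemma open_nbh: "\<exists>U. open U \<and> x \<in> U \<and> U \<subseteq> nbh x s" if "s > 0" for s
proof (intro exI conjI)
  let ?r = "min s R"
  let ?U = "cinv (\<kappa> x) ` ball (cmap (\<kappa> x) x) ?r"
  have sub: "ball (cmap (\<kappa> x) x) ?r \<subseteq> cmap (\<kappa> x) ` cdom (\<kappa> x)"
    by (rule subset_trans[OF _ \<kappa>_ball]) auto
  show "open ?U" by (rule open_cinv_image[OF \<kappa>(1) _ sub]) simp
  show "x \<in> ?U" by (rule image_eqI[of _ _ "cmap (\<kappa> x) x"]) (use \<kappa> cinv_cmap that R in auto)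
  show "?U \<subseteq> nbh x s"
  proof
    fix y assume "y \<in> ?U"
    then obtain z where z: "z \<in> ball (cmap (\<kappa> x) x) ?r" "y = cinv (\<kappa> x) z" by blast
    then have "z \<in> cmap (\<kappa> x) ` cdom (\<kappa> x)" using sub by blast
    from cinv_in[OF this] cmap_cinv[OF this] show "y \<in> nbh x s"
      using z(1) unfolding z(2) by (simp add: nbh_def loc_def dist_norm norm_minus_commute)
  qed
qed

lemma segment:
  assumes s: "s \<le> R" and y: "y \<in> nbh x s" and z: "z \<in> nbh x s"
  obtains \<gamma> where "\<gamma> \<in> curves A y z" "pw_C1_curve A \<gamma>" "\<gamma> 0 = y" "\<gamma> 1 = z"
    "curve_length A G \<gamma> \<le> C * norm (loc x z - loc x y)"
    "\<And>t. t \<in> {0..1} \<Longrightarrow> \<gamma> t \<in> nbh x s"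
proof -
  let ?y = "cmap (\<kappa> x) y" and ?z = "cmap (\<kappa> x) z"
  let ?\<gamma> = "cinv (\<kappa> x) \<circ> linepath ?y ?z"
  have seg: "closed_segment ?y ?z \<subseteq> cball (cmap (\<kappa> x) x) s"
    by (rule closed_segment_subset) (use y z nbhD in auto)
  have seg2: "closed_segment ?y ?z \<subseteq> cmap (\<kappa> x) ` cdom (\<kappa> x)"
    using seg s \<kappa>_ball[of x] by (meson cball_subset_cball_iff order_trans subset_cball)
  have bd: "rnorm G w v \<le> C * norm (tcoord A (\<kappa> x) w v)" if "w \<in> cdom (\<kappa> x)" "cmap (\<kappa> x) w \<in> closed_segment ?y ?z" for w v
    by (rule \<kappa>_norm(2)[OF that(1)]) (use seg s that(2) subset_cball[OF s] in blast)
  have e: "?\<gamma> 0 = y" "?\<gamma> 1 = z" using nbhD(1) y z \<kappa> by (auto simp: linepath_def cinv_cmap)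
  have pw: "pw_C1_curve A ?\<gamma>" and len: "curve_length A G ?\<gamma> \<le> C * norm (?z - ?y)"
    using segment_curve[OF \<kappa>(1) seg2 bd] by blast+
  show ?thesis
  proof (rule that[OF _ pw e])
    show "?\<gamma> \<in> curves A y z" using pw e by (simp add: curves_def pathstart_def pathfinish_def)
    show "curve_length A G ?\<gamma> \<le> C * norm (loc x z - loc x y)" using len by (simp add: loc_def)
    fix t :: real assume "t \<in> {0..1}"
    then have t: "linepath ?y ?z t \<in> closed_segment ?y ?z" by (simp add: linepath_in_path)
    then have "?\<gamma> t \<in> cdom (\<kappa> x)" "cmap (\<kappa> x) (?\<gamma> t) = linepath ?y ?z t"
      using subsetD[OF seg2 t] by (auto simp: cinv_in cmap_cinv)
    then show "?\<gamma> t \<in> nbh x s"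
      using subsetD[OF seg t] by (auto simp: nbh_def loc_def dist_norm norm_minus_commute)
  qed
qed

lemma stays:
  assumes \<gamma>: "pw_C1_curve A \<gamma>" and y: "\<gamma> 0 \<in> nbh x s" and s: "s + C * curve_length A G \<gamma> < R"
    and t: "t \<in> {0..1}"
  shows "\<gamma> t \<in> nbh x R" "norm (loc x (\<gamma> t) - loc x (\<gamma> 0)) \<le> C * curve_length A G \<gamma>"
    "\<gamma> t \<in> nbh x (s + C * curve_length A G \<gamma>)"
proof -
  have 0: "norm (cmap (\<kappa> x) (\<gamma> 0) - cmap (\<kappa> x) x) + C * curve_length A G \<gamma> < R"
    using y s by (auto simp: nbh_def loc_def)
  have C0: "C \<ge> 0" using C by simp
  note * = curve_stays[OF \<gamma> \<kappa>(1) C0 \<kappa>_ball \<kappa>_norm(1) nbhD(1)[OF y] 0 t]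
  show 1: "\<gamma> t \<in> nbh x R" using * by (auto simp: nbh_def loc_def dist_norm norm_minus_commute)
  show 2: "norm (loc x (\<gamma> t) - loc x (\<gamma> 0)) \<le> C * curve_length A G \<gamma>" using *(3) by (simp add: loc_def)
  show "\<gamma> t \<in> nbh x (s + C * curve_length A G \<gamma>)"
    using 2 nbhD(2)[OF y] *(1) norm_triangle_sub[of "loc x (\<gamma> t)" "loc x (\<gamma> 0)"] by (auto simp: nbh_def)
qed

lemma short_transport:
  assumes \<gamma>: "pw_C1_curve A \<gamma>" "\<And>t. t \<in> {0..1} \<Longrightarrow> \<gamma> t \<in> nbh x R" and l: "C * C * curve_length A G \<gamma> \<le> 1/2"
  shows "norm (tcoord A (\<kappa> x) (\<gamma> 1) (transport A G \<gamma> v) - tcoord A (\<kappa> x) (\<gamma> 0) v)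
    \<le> 2 * (C * C * curve_length A G \<gamma>) * norm (tcoord A (\<kappa> x) (\<gamma> 0) v)"
  using C nbhD[OF \<gamma>(2)]
  by (intro transport_near_identity[OF \<gamma>(1) \<kappa>(1) _ _ \<kappa>_ball _ _ \<kappa>_norm(1) \<kappa>_christoffel l]) auto

lemma tcoord_norm:
  assumes "y \<in> nbh x R"
  shows "norm (tcoord A (\<kappa> x) y v) \<le> C * rnorm G y v" "rnorm G y v \<le> C * norm (tcoord A (\<kappa> x) y v)"
  using nbhD[OF assms] \<kappa>_norm by auto

definition locd :: "'a \<Rightarrow> 'a \<Rightarrow> ('a \<Rightarrow> 'a) \<Rightarrow> 'a \<Rightarrow> 'e \<Rightarrow> 'e" where
  "locd x z f y = lderiv (\<kappa> x) (\<kappa> z) f y"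

lemma tcoord_onto:
  assumes "y \<in> nbh x s" obtains v where "tcoord A (\<kappa> x) y v = a"
  using tcoord_inverse(1)[OF \<kappa>(1) nbhD(1)[OF assms]] by blast

lemma locd_tcoord:
  assumes "C1_map A f" "y \<in> nbh x s" "f y \<in> nbh z t"
  shows "locd x z f y (tcoord A (\<kappa> x) y v) = tcoord A (\<kappa> z) (f y) (tderiv A f y v)"
  unfolding locd_def using tcoord_tderiv[OF assms(1) \<kappa>(1) \<kappa>(1)] nbhD assms by metis

lemma linear_locd:
  assumes "C1_map A f" "y \<in> nbh x s" "f y \<in> nbh z t"
  shows "linear (locd x z f y)"
  unfolding locd_def using linear_lderiv[OF assms(1) \<kappa>(1) \<kappa>(1)] nbhD assms by blast

lemma locd_bound:
  assumes f: "C1_map A f" "deriv_bounded A G f K" and K: "K \<ge> 0" and y: "y \<in> nbh x R" "f y \<in> nbh z R"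
  shows "norm (locd x z f y a) \<le> C * C * K * norm a"
proof -
  obtain v where v: "tcoord A (\<kappa> x) y v = a" using tcoord_onto[OF y(1)] by blast
  have "norm (locd x z f y a) \<le> C * rnorm G (f y) (tderiv A f y v)"
    unfolding v[symmetric] locd_tcoord[OF f(1) y] by (rule tcoord_norm(1)[OF y(2)])
  also have "\<dots> \<le> C * (K * (C * norm a))"
    using f(2) C K tcoord_norm(2)[OF y(1), of v] unfolding deriv_bounded_def v
    by (intro mult_left_mono order_trans[OF spec[OF spec[OF f(2)[unfolded deriv_bounded_def]]]]) auto
  finally show ?thesis by (simp add: mult_ac)
qed

text \<open>The intrinsic variation of the derivative along \<open>\<gamma>\<close> differs from the
  variation in coordinates only by the transports along \<open>\<gamma>\<close>, of length at most
  \<open>r\<close>, and along its image, of length at most \<open>K * r\<close>. Each is near the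
  identity by \<open>short_transport\<close>; the two errors carry \<open>K\<close> and
  \<open>K * K\<close>, whence \<open>K * (K + 1)\<close>.\<close>

lemma deriv_variation:
  assumes f: "C1_map A f" "deriv_bounded A G f K" and K: "K \<ge> 0"
    and \<gamma>: "pw_C1_curve A \<gamma>" "\<And>t. t \<in> {0..1} \<Longrightarrow> \<gamma> t \<in> nbh x R" "\<And>t. t \<in> {0..1} \<Longrightarrow> f (\<gamma> t) \<in> nbh z R"
    and len: "curve_length A G \<gamma> \<le> r" "C * C * r \<le> 1/2" "C * C * (K * r) \<le> 1/2"
  shows "norm ((tcoord A (\<kappa> z) (f (\<gamma> 1)) (transport A G (f \<circ> \<gamma>) (tderiv A f (\<gamma> 0) v) - tderiv A f (\<gamma> 1) (transport A G \<gamma> v)))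
     - (locd x z f (\<gamma> 0) (tcoord A (\<kappa> x) (\<gamma> 0) v) - locd x z f (\<gamma> 1) (tcoord A (\<kappa> x) (\<gamma> 0) v)))
     \<le> 2 * C ^ 4 * K * (K + 1) * r * norm (tcoord A (\<kappa> x) (\<gamma> 0) v)"
proof -
  let ?a = "tcoord A (\<kappa> x) (\<gamma> 0) v" and ?T = "tcoord A (\<kappa> x) (\<gamma> 1) (transport A G \<gamma> v)"
  let ?b = "tcoord A (\<kappa> z) (f (\<gamma> 1)) (transport A G (f \<circ> \<gamma>) (tderiv A f (\<gamma> 0) v))"
  have C0: "C \<ge> 0" "C * C \<ge> 0" using C by auto
  have n01: "\<gamma> 0 \<in> nbh x R" "\<gamma> 1 \<in> nbh x R" "f (\<gamma> 0) \<in> nbh z R" "f (\<gamma> 1) \<in> nbh z R" using \<gamma> by auto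
  have l0: "0 \<le> curve_length A G \<gamma>" by (rule curve_length_nonneg)
  have lf: "curve_length A G (f \<circ> \<gamma>) \<le> K * r"
    using curve_length_comp[OF f(1) \<gamma>(1) f(2)] mult_left_mono[OF len(1) K] by linarith
  have l1: "C * C * curve_length A G \<gamma> \<le> C * C * r" "C * C * curve_length A G (f \<circ> \<gamma>) \<le> C * C * (K * r)"
    using C0 len lf by (auto intro: mult_left_mono)
  have e2: "norm (?T - ?a) \<le> 2 * (C * C * r) * norm ?a"
    using short_transport[OF \<gamma>(1,2), where v=v] l1(1) len(2)
    by (meson mult_left_mono mult_right_mono norm_ge_zero order_trans zero_le_numeral)
  have L0: "tcoord A (\<kappa> z) (f (\<gamma> 0)) (tderiv A f (\<gamma> 0) v) = locd x z f (\<gamma> 0) ?a"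
    using locd_tcoord[OF f(1) n01(1,3)] by simp
  have L1: "tcoord A (\<kappa> z) (f (\<gamma> 1)) (tderiv A f (\<gamma> 1) (transport A G \<gamma> v)) = locd x z f (\<gamma> 1) ?T"
    using locd_tcoord[OF f(1) n01(2,4)] by simp
  have "norm (?b - locd x z f (\<gamma> 0) ?a) \<le> 2 * (C * C * curve_length A G (f \<circ> \<gamma>)) * norm (locd x z f (\<gamma> 0) ?a)"
    using short_transport[OF pw_C1_curve_comp[OF f(1) \<gamma>(1)], of z, where v="tderiv A f (\<gamma> 0) v"] \<gamma>(3) l1(2) len(3) L0 by simp
  also have "\<dots> \<le> 2 * (C * C * (K * r)) * (C * C * K * norm ?a)"
    using lf l1(2) C0 curve_length_nonneg[of "f \<circ> \<gamma>"] l0 len(1) K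
    by (intro mult_mono locd_bound[OF f K n01(1,3)]) auto
  finally have e1: "norm (?b - locd x z f (\<gamma> 0) ?a) \<le> 2 * (C * C * (K * r)) * (C * C * K * norm ?a)" .
  have lin1: "linear (locd x z f (\<gamma> 1))" by (rule linear_locd[OF f(1) n01(2,4)])
  have "norm (locd x z f (\<gamma> 1) (?T - ?a)) \<le> C * C * K * norm (?T - ?a)" by (rule locd_bound[OF f K n01(2,4)])
  also have "\<dots> \<le> C * C * K * (2 * (C * C * r) * norm ?a)" using C0 K by (intro mult_left_mono e2) auto
  finally have e3: "norm (locd x z f (\<gamma> 1) (?T - ?a)) \<le> C * C * K * (2 * (C * C * r) * norm ?a)" .
  have lt: "linear (tcoord A (\<kappa> z) (f (\<gamma> 1)))" by (rule linear_tcoord[OF \<kappa>(1) nbhD(1)[OF n01(4)]])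
  have "(tcoord A (\<kappa> z) (f (\<gamma> 1)) (transport A G (f \<circ> \<gamma>) (tderiv A f (\<gamma> 0) v) - tderiv A f (\<gamma> 1) (transport A G \<gamma> v)))
     - (locd x z f (\<gamma> 0) ?a - locd x z f (\<gamma> 1) ?a) = (?b - locd x z f (\<gamma> 0) ?a) - locd x z f (\<gamma> 1) (?T - ?a)"
    unfolding linear_diff[OF lt] linear_diff[OF lin1] L1 by simp
  then have "norm ((tcoord A (\<kappa> z) (f (\<gamma> 1)) (transport A G (f \<circ> \<gamma>) (tderiv A f (\<gamma> 0) v) - tderiv A f (\<gamma> 1) (transport A G \<gamma> v)))
     - (locd x z f (\<gamma> 0) ?a - locd x z f (\<gamma> 1) ?a))
     \<le> norm (?b - locd x z f (\<gamma> 0) ?a) + norm (locd x z f (\<gamma> 1) (?T - ?a))"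
    by (metis norm_triangle_ineq4)
  also have "\<dots> \<le> 2 * (C * C * (K * r)) * (C * C * K * norm ?a) + C * C * K * (2 * (C * C * r) * norm ?a)"
    using e1 e3 by simp
  also have "\<dots> = 2 * C ^ 4 * K * (K + 1) * r * norm ?a"
    by (simp add: power4_eq_xxxx algebra_simps)
  finally show ?thesis .
qed

end

text \<open>Vectors of coordinate norm \<open>1 / C\<close> represent tangent vectors of Riemannian
  norm at most 1, the range of the suprema in \<open>deriv_modulus\<close> and
  \<open>C1_dist\<close>; homogeneity extends the bound.\<close>

lemma linear_diff_scale:
  fixes L M :: "'e::euclidean_space \<Rightarrow> 'b::real_normed_vector"
  assumes lin: "linear L" "linear M" and C: "C > 0"
    and bd: "\<And>a. norm a = 1 / C \<Longrightarrow> norm (L a - M a) \<le> B"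
  shows "norm (L a - M a) \<le> C * B * norm a"
proof (cases "a = 0")
  case True
  then show ?thesis using linear_0[OF lin(1)] linear_0[OF lin(2)] by simp
next
  case False
  define k where "k = 1 / (C * norm a)"
  have k: "k > 0" "k * norm a = 1 / C" using False C by (auto simp: k_def field_simps)
  have "k * norm (L a - M a) = norm (L (k *\<^sub>R a) - M (k *\<^sub>R a))"
    using k by (simp add: linear_cmul[OF lin(1)] linear_cmul[OF lin(2)] flip: scaleR_diff_right)
  also have "\<dots> \<le> B" by (rule bd) (use k in simp)
  finally show ?thesis using False C unfolding k_def by (simp add: field_simps)
qed

section \<open>The modulus of the derivative and the \<open>C\<^sup>1\<close> distance in
  coordinates\<close>

context uniform_charts
begin

lemma nbh_in_open:
  assumes "open U" "x \<in> U"
  obtains s where "s > 0" "s \<le> R" "nbh x s \<subseteq> U"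
proof -
  have "open (cmap (\<kappa> x) ` (U \<inter> cdom (\<kappa> x)))"
    by (rule open_cmap_image[OF \<kappa>(1)]) (use assms chart_open(1)[OF \<kappa>(1)] in auto)
  moreover have "cmap (\<kappa> x) x \<in> cmap (\<kappa> x) ` (U \<inter> cdom (\<kappa> x))" using assms \<kappa> by auto
  ultimately obtain e where e: "e > 0" "cball (cmap (\<kappa> x) x) e \<subseteq> cmap (\<kappa> x) ` (U \<inter> cdom (\<kappa> x))"
    using open_contains_cball by blast
  have "nbh x (min e R) \<subseteq> U"
  proof
    fix y assume y: "y \<in> nbh x (min e R)"
    then have "y \<in> nbh x e" by (rule nbh_mono[rotated]) simp
    from subsetD[OF e(2) nbhD(3)[OF this]]
    obtain z where z: "z \<in> U" "z \<in> cdom (\<kappa> x)" "cmap (\<kappa> x) y = cmap (\<kappa> x) z" by blast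
    have "y = z" using z nbhD(1)[OF y] cinv_cmap[OF \<kappa>(1)] by metis
    then show "y \<in> U" using z by simp
  qed
  then show ?thesis using that[of "min e R"] e R by simp
qed

text \<open>Near each point this is continuity of the coordinate derivative plus the transport error
  of \<open>deriv_variation\<close>. Compactness makes it uniform: a curve is assigned to a member
  of a finite cover by its starting point, and \<open>r\<close> is so small that it stays where the
  local estimate holds.\<close>

lemma deriv_modulus_tendsto_0:
  assumes f: "C1_map A f" "deriv_bounded A G f K" and K: "K \<ge> 0" and \<eta>: "\<eta> > 0"
  shows "\<exists>r>0. deriv_modulus A G f r \<le> ennreal \<eta>"
proof -
  let ?D = "\<lambda>\<gamma> v. transport A G (f \<circ> \<gamma>) (tderiv A f (\<gamma> 0) v) - tderiv A f (\<gamma> 1) (transport A G \<gamma> v)"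
  have "\<exists>U r. open U \<and> x \<in> U \<and> r > 0 \<and> (\<forall>\<gamma> v. pw_C1_curve A \<gamma> \<longrightarrow> curve_length A G \<gamma> \<le> r \<longrightarrow> \<gamma> 0 \<in> U \<longrightarrow>
      rnorm G (\<gamma> 0) v \<le> 1 \<longrightarrow> rnorm G (f (\<gamma> 1)) (?D \<gamma> v) \<le> \<eta>)" for x
  proof -
    let ?L = "locd x (f x) f"
    \<comment> \<open>Two deviations of size \<open>\<eta>'\<close> enter the final estimate, each
      with a factor \<open>C * C\<close>; together they use a quarter of \<open>\<eta>\<close>, and
      the transport error may use half.\<close>
    define \<eta>' where "\<eta>' = \<eta> / (8 * C * C)"
    have \<eta>': "\<eta>' > 0" "C * (C * (2 * \<eta>')) = \<eta> / 4" using \<eta> C by (auto simp: \<eta>'_def field_simps)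
    let ?W = "cdom (\<kappa> x) \<inter> f -` cdom (\<kappa> (f x))"
    let ?E = "\<lambda>y. \<Sum>b\<in>Basis. norm (?L y b - ?L x b)"
    have W: "open ?W" by (rule open_lderiv_domain(1)[OF C1_map_continuous[OF f(1)] \<kappa>(1) \<kappa>(1)])
    have "continuous_on ?W (\<lambda>y. ?L y b)" for b
      unfolding locd_def
      by (rule continuous_on_lderiv[OF f(1) \<kappa>(1) \<kappa>(1) continuous_on_id]) auto
    then have "continuous_on ?W ?E"
      by (intro continuous_on_sum continuous_on_norm continuous_on_diff continuous_on_const)
    from continuous_open_preimage[OF this W, of "{..<\<eta>'}"]
    have U1: "open (?W \<inter> ?E -` {..<\<eta>'})" by simp
    obtain V where V: "open V" "f x \<in> V" "V \<subseteq> nbh (f x) R" using open_nbh[OF R, of "f x"] by blast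
    have U2: "open (f -` V)" by (rule open_vimage[OF V(1) C1_map_continuous[OF f(1)]])
    obtain s where s: "s > 0" "s \<le> R" "nbh x s \<subseteq> (?W \<inter> ?E -` {..<\<eta>'}) \<inter> f -` V"
      by (rule nbh_in_open[OF open_Int[OF U1 U2], of x]) (use \<kappa> V \<eta>' in auto)
    obtain U where U: "open U" "x \<in> U" "U \<subseteq> nbh x (s / 2)" using open_nbh[of "s/2" x] s by auto
    let ?M = "2 * C ^ 4 * K * (K + 1)"
    obtain r where r: "r > 0" "r * C < s / 2" "r * (C * C) < 1/2" "r * (C * C * K) < 1/2" "r * (C * (C * ?M)) < \<eta> / 2"
      using ex_small[of "s / 2" "1/2" "1/2" "\<eta> / 2" C "C * C" "C * C * K" "C * (C * ?M)"] s \<eta> by auto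
    have "rnorm G (f (\<gamma> 1)) (?D \<gamma> v) \<le> \<eta>"
      if \<gamma>: "pw_C1_curve A \<gamma>" "curve_length A G \<gamma> \<le> r" "\<gamma> 0 \<in> U" and v: "rnorm G (\<gamma> 0) v \<le> 1" for \<gamma> v
    proof -
      have Cl: "C * curve_length A G \<gamma> \<le> r * C" using \<gamma>(2) C by (simp add: mult.commute)
      have st: "s / 2 + C * curve_length A G \<gamma> < R" using Cl r(2) s by linarith
      have "\<gamma> 0 \<in> nbh x (s / 2)" using \<gamma>(3) U by blast
      note stays(3)[OF \<gamma>(1) this st]
      then have ns: "\<gamma> t \<in> nbh x s" if "t \<in> {0..1}" for t
        by (rule nbh_mono[rotated]) (use that Cl r(2) in auto)
      have nR: "\<gamma> t \<in> nbh x R" if "t \<in> {0..1}" for t by (rule nbh_mono[OF s(2) ns[OF that]])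
      have fR: "f (\<gamma> t) \<in> nbh (f x) R" if "t \<in> {0..1}" for t using s(3) ns[OF that] V(3) by blast
      have n0: "\<gamma> 0 \<in> nbh x s" and n1: "\<gamma> 1 \<in> nbh x s" and f0: "f (\<gamma> 0) \<in> nbh (f x) R" and f1: "f (\<gamma> 1) \<in> nbh (f x) R"
        using ns fR by auto
      let ?a = "tcoord A (\<kappa> x) (\<gamma> 0) v" and ?T = "tcoord A (\<kappa> (f x)) (f (\<gamma> 1)) (?D \<gamma> v)"
      have "norm ?a \<le> C * rnorm G (\<gamma> 0) v" by (rule tcoord_norm(1)[OF nbh_mono[OF s(2) n0]])
      also have "\<dots> \<le> C * 1" using C v by (intro mult_left_mono) auto
      finally have a: "norm ?a \<le> C" by simp
      have M0: "?M \<ge> 0" using C K by auto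
      have "norm (?T - (?L (\<gamma> 0) ?a - ?L (\<gamma> 1) ?a)) \<le> ?M * r * norm ?a"
        by (rule deriv_variation[OF f K \<gamma>(1) nR fR \<gamma>(2)]) (use r in \<open>auto simp: mult_ac\<close>)
      also have "\<dots> \<le> ?M * r * C" using a M0 r(1) by (intro mult_left_mono) auto
      finally have 1: "norm (?T - (?L (\<gamma> 0) ?a - ?L (\<gamma> 1) ?a)) \<le> ?M * r * C" .
      have lx: "linear (?L x)" by (rule linear_locd[OF f(1) nbh_self nbh_self, of 0 0]) auto
      have near: "norm (?L y ?a - ?L x ?a) \<le> \<eta>' * C" if y: "y \<in> nbh x s" "f y \<in> nbh (f x) R" for y
      proof -
        have "norm (?L y ?a - ?L x ?a) \<le> ?E y * norm ?a"
          by (rule onorm_basis_bound[OF linear_locd[OF f(1) y] lx])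
        also have "\<dots> \<le> \<eta>' * C" using subsetD[OF s(3) y(1)] a \<eta>' by (intro mult_mono) auto
        finally show ?thesis .
      qed
      have "norm ?T \<le> norm (?T - (?L (\<gamma> 0) ?a - ?L (\<gamma> 1) ?a)) + norm (?L (\<gamma> 0) ?a - ?L x ?a) + norm (?L (\<gamma> 1) ?a - ?L x ?a)"
      proof -
        let ?P = "?T - (?L (\<gamma> 0) ?a - ?L (\<gamma> 1) ?a)" and ?Q = "?L (\<gamma> 0) ?a - ?L x ?a" and ?Z = "?L (\<gamma> 1) ?a - ?L x ?a"
        have "?T = ?P + ?Q - ?Z" by simp
        then have "norm ?T = norm (?P + ?Q - ?Z)" by (rule arg_cong)
        then show ?thesis
          using norm_triangle_ineq4[of "?P + ?Q" ?Z] norm_triangle_ineq[of ?P ?Q] by linarith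
      qed
      also have "\<dots> \<le> ?M * r * C + \<eta>' * C + \<eta>' * C" by (intro add_mono 1 near n0 n1 f0 f1)
      finally have T: "norm ?T \<le> ?M * r * C + \<eta>' * C + \<eta>' * C" .
      have "rnorm G (f (\<gamma> 1)) (?D \<gamma> v) \<le> C * norm ?T" by (rule tcoord_norm(2)[OF f1])
      also have "\<dots> \<le> C * (?M * r * C + \<eta>' * C + \<eta>' * C)" using C by (intro mult_left_mono T) auto
      also have "\<dots> = r * (C * (C * ?M)) + C * (C * (2 * \<eta>'))" by (simp add: algebra_simps)
      also have "\<dots> \<le> \<eta>" unfolding \<eta>'(2) using r(5) \<eta> by linarith
      finally show ?thesis .
    qed
    then show ?thesis using U r(1) by blast
  qed
  then obtain U r where U: "\<And>x. open (U x)" "\<And>x. x \<in> U x" "\<And>x. r x > 0"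
    "\<And>x \<gamma> v. pw_C1_curve A \<gamma> \<Longrightarrow> curve_length A G \<gamma> \<le> r x \<Longrightarrow> \<gamma> 0 \<in> U x \<Longrightarrow>
      rnorm G (\<gamma> 0) v \<le> 1 \<Longrightarrow> rnorm G (f (\<gamma> 1)) (?D \<gamma> v) \<le> \<eta>"
    by metis
  have cov: "UNIV \<subseteq> (\<Union>x\<in>UNIV. U x)" using U(2) by (intro subsetI UN_I UNIV_I)
  obtain F where F: "finite F" "UNIV \<subseteq> (\<Union>x\<in>F. U x)"
    by (rule compactE_image[OF compact_M U(1) cov], rule that)
  have Fne: "F \<noteq> {}" using F(2) by auto
  define r0 where "r0 = Min (r ` F)"
  have r0: "r0 > 0" "\<And>x. x \<in> F \<Longrightarrow> r0 \<le> r x" using F(1) Fne U(3) by (auto simp: r0_def)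
  have "deriv_modulus A G f r0 \<le> ennreal \<eta>"
    unfolding deriv_modulus_def
  proof (intro SUP_least ennreal_leI)
    fix \<gamma> v assume g: "\<gamma> \<in> {\<gamma>. pw_C1_curve A \<gamma> \<and> curve_length A G \<gamma> \<le> r0}" and v: "v \<in> {v. rnorm G (\<gamma> 0) v \<le> 1}"
    obtain x where x: "x \<in> F" "\<gamma> 0 \<in> U x" using F(2) by blast
    show "rnorm G (f (\<gamma> 1)) (?D \<gamma> v) \<le> \<eta>"
      by (rule U(4)[of \<gamma> x v, OF _ _ x(2)]) (use g v r0(2)[OF x(1)] in auto)
  qed
  then show ?thesis using r0(1) by blast
qed

text \<open>The converse passage from the intrinsic modulus to coordinates: the modulus is applied
  to the coordinate segment from \<open>x\<close> to \<open>y\<close>, whose length is at most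
  \<open>C * s\<close>.\<close>

lemma locd_variation:
  assumes f: "C1_map A f" "deriv_bounded A G f K" and K: "K \<ge> 0"
    and mod: "deriv_modulus A G f r \<le> ennreal \<eta>" and \<eta>: "\<eta> \<ge> 0"
    and y: "y \<in> nbh x s" and s: "s \<le> R" "C * s \<le> r" "C * C * (C * s) \<le> 1/2" "C * C * (K * (C * s)) \<le> 1/2" "C * (K * (C * s)) < R"
  shows "f y \<in> nbh (f x) (C * (K * (C * s)))"
    "norm (locd x (f x) f y a - locd x (f x) f x a) \<le> (C * C * \<eta> + 2 * C ^ 4 * K * (K + 1) * (C * s)) * norm a"
proof -
  have s0: "s \<ge> 0" using nbhD(2)[OF y] norm_ge_zero order_trans by blast
  obtain \<gamma> where \<gamma>: "\<gamma> \<in> curves A x y" "pw_C1_curve A \<gamma>" "\<gamma> 0 = x" "\<gamma> 1 = y"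
    "curve_length A G \<gamma> \<le> C * norm (loc x y - loc x x)" "\<And>t. t \<in> {0..1} \<Longrightarrow> \<gamma> t \<in> nbh x s"
    by (rule segment[OF s(1) nbh_self[OF s0] y], rule that)
  have "C * norm (loc x y - loc x x) \<le> C * s" using nbhD(2)[OF y] C by (simp add: loc_self)
  then have len: "curve_length A G \<gamma> \<le> C * s" using \<gamma>(5) by linarith
  have "curve_length A G (f \<circ> \<gamma>) \<le> K * (C * s)"
    using curve_length_comp[OF f(1) \<gamma>(2) f(2)] mult_left_mono[OF len K] by linarith
  then have lf: "C * curve_length A G (f \<circ> \<gamma>) \<le> C * (K * (C * s))" using C by (intro mult_left_mono) auto
  have "(f \<circ> \<gamma>) 0 \<in> nbh (f x) 0" using \<gamma>(3) nbh_self[of 0] by simp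
  note st = stays[OF pw_C1_curve_comp[OF f(1) \<gamma>(2)] this]
  have lR: "0 + C * curve_length A G (f \<circ> \<gamma>) < R" using lf s(5) by linarith
  have fR: "f (\<gamma> t) \<in> nbh (f x) R" if "t \<in> {0..1}" for t using st(1)[OF lR that] by simp
  have "f y \<in> nbh (f x) (0 + C * curve_length A G (f \<circ> \<gamma>))"
  proof -
    have "(f \<circ> \<gamma>) 1 \<in> nbh (f x) (0 + C * curve_length A G (f \<circ> \<gamma>))" by (rule st(3)[OF lR]) simp
    then show ?thesis by (simp only: comp_apply \<gamma>(4))
  qed
  then show "f y \<in> nbh (f x) (C * (K * (C * s)))" by (rule nbh_mono[rotated]) (use lf in simp)
  have nR: "\<gamma> t \<in> nbh x R" if "t \<in> {0..1}" for t by (rule nbh_mono[OF s(1) \<gamma>(6)[OF that]])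
  have xR: "x \<in> nbh x R" "y \<in> nbh x R" "f x \<in> nbh (f x) R" "f y \<in> nbh (f x) R"
    using nR[of 0] nR[of 1] fR[of 0] fR[of 1] \<gamma>(3,4) by auto
  let ?L = "locd x (f x) f"
  let ?D = "\<lambda>v. transport A G (f \<circ> \<gamma>) (tderiv A f (\<gamma> 0) v) - tderiv A f (\<gamma> 1) (transport A G \<gamma> v)"
  let ?M = "2 * C ^ 4 * K * (K + 1) * (C * s)"
  \<comment> \<open>For vectors of norm \<open>1 / C\<close> the modulus, read in coordinates, gives
    \<open>C * \<eta>\<close>, and the transports along the segment and its image give
    \<open>?M / C\<close>; rescaling multiplies by \<open>C\<close>.\<close>
  have "norm (?L y a - ?L x a) \<le> C * (C * \<eta> + ?M / C) * norm a"
  proof (rule linear_diff_scale[OF linear_locd[OF f(1) xR(2,4)] linear_locd[OF f(1) xR(1,3)]])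
    show "C > 0" using C by simp
    fix a :: 'e assume a: "norm a = 1 / C"
    obtain v where v: "tcoord A (\<kappa> x) x v = a" using tcoord_onto[OF xR(1)] by blast
    have "rnorm G x v \<le> 1" using tcoord_norm(2)[OF xR(1), of v] C unfolding v a by simp
    moreover have "curve_length A G \<gamma> \<le> r" using len s(2) by linarith
    ultimately have "ennreal (rnorm G (f (\<gamma> 1)) (?D v)) \<le> deriv_modulus A G f r"
      unfolding deriv_modulus_def using \<gamma>(2,3)
      by (intro SUP_upper2[of \<gamma>] SUP_upper2[of v]) auto
    then have D: "rnorm G (f (\<gamma> 1)) (?D v) \<le> \<eta>" using mod \<eta> ennreal_le_iff order_trans by blast
    let ?T = "tcoord A (\<kappa> (f x)) (f (\<gamma> 1)) (?D v)"
    have "norm ?T \<le> C * rnorm G (f (\<gamma> 1)) (?D v)" by (rule tcoord_norm(1)) (use fR in auto)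
    also have "\<dots> \<le> C * \<eta>" using C D by (intro mult_left_mono) auto
    finally have T: "norm ?T \<le> C * \<eta>" .
    have "norm (?T - (?L (\<gamma> 0) (tcoord A (\<kappa> x) (\<gamma> 0) v) - ?L (\<gamma> 1) (tcoord A (\<kappa> x) (\<gamma> 0) v)))
        \<le> ?M * norm (tcoord A (\<kappa> x) (\<gamma> 0) v)"
      by (rule deriv_variation[OF f K \<gamma>(2) nR fR len s(3,4)])
    then have "norm (?T - (?L x a - ?L y a)) \<le> ?M * (1 / C)" unfolding \<gamma>(3,4) v a .
    moreover have "norm (?L y a - ?L x a) \<le> norm (?T - (?L x a - ?L y a)) + norm ?T"
      using norm_triangle_ineq4[of "?T - (?L x a - ?L y a)" ?T] by simp
    ultimately show "norm (?L y a - ?L x a) \<le> C * \<eta> + ?M / C" using T by simp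
  qed
  also have "C * (C * \<eta> + ?M / C) = C * C * \<eta> + ?M" using C by (simp add: distrib_left)
  finally show "norm (?L y a - ?L x a) \<le> (C * C * \<eta> + ?M) * norm a" .
qed

text \<open>The infimum lies strictly below \<open>\<epsilon>\<close>, so one curve realises the
  bound on the length and, for all unit vectors at once, the bound on the derivatives.\<close>

lemma C1_dist_curve:
  assumes "C1_dist A G f g < ennreal \<epsilon>"
  obtains \<gamma> where "pw_C1_curve A \<gamma>" "\<gamma> 0 = f x" "\<gamma> 1 = g x" "curve_length A G \<gamma> < \<epsilon>"
    "\<And>v. rnorm G x v \<le> 1 \<Longrightarrow> rnorm G (g x) (transport A G \<gamma> (tderiv A f x v) - tderiv A g x v) < \<epsilon>"
proof -
  let ?S = "\<lambda>\<gamma>. SUP v\<in>{v. rnorm G x v \<le> 1}. ennreal (rnorm G (g x) (transport A G \<gamma> (tderiv A f x v) - tderiv A g x v))"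
  have "(INF \<gamma>\<in>curves A (f x) (g x). ennreal (curve_length A G \<gamma>) + ?S \<gamma>) \<le> C1_dist A G f g"
    unfolding C1_dist_def by (rule SUP_upper) simp
  then have "(INF \<gamma>\<in>curves A (f x) (g x). ennreal (curve_length A G \<gamma>) + ?S \<gamma>) < ennreal \<epsilon>"
    using assms by (rule le_less_trans)
  then obtain \<gamma> where \<gamma>: "\<gamma> \<in> curves A (f x) (g x)" "ennreal (curve_length A G \<gamma>) + ?S \<gamma> < ennreal \<epsilon>"
    unfolding INF_less_iff by blast
  show ?thesis
  proof (rule that[of \<gamma>])
    show "pw_C1_curve A \<gamma>" "\<gamma> 0 = f x" "\<gamma> 1 = g x"
      using \<gamma>(1) by (auto simp: curves_def pathstart_def pathfinish_def)
    have "ennreal (curve_length A G \<gamma>) \<le> ennreal (curve_length A G \<gamma>) + ?S \<gamma>" by simp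
    from le_less_trans[OF this \<gamma>(2)] show "curve_length A G \<gamma> < \<epsilon>"
      by (simp add: ennreal_less_iff curve_length_nonneg)
    fix v assume v: "rnorm G x v \<le> 1"
    have "ennreal (rnorm G (g x) (transport A G \<gamma> (tderiv A f x v) - tderiv A g x v)) \<le> ?S \<gamma>"
      by (rule SUP_upper) (use v in simp)
    also have "\<dots> \<le> ennreal (curve_length A G \<gamma>) + ?S \<gamma>" by simp
    finally have "ennreal (rnorm G (g x) (transport A G \<gamma> (tderiv A f x v) - tderiv A g x v)) < ennreal \<epsilon>"
      using \<gamma>(2) by (rule le_less_trans)
    then show "rnorm G (g x) (transport A G \<gamma> (tderiv A f x v) - tderiv A g x v) < \<epsilon>"
      by (simp add: ennreal_less_iff rnorm_nonneg)
  qed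
qed

text \<open>The curve from \<open>f y\<close> to \<open>g y\<close> is shorter than
  \<open>\<epsilon>\<close>, so it stays in the chart and moves coordinates by at most
  \<open>C * \<epsilon>\<close>. In the last bound \<open>C * C\<close> stems from comparing
  derivatives at \<open>g y\<close>, and \<open>2 * C ^ 4 * K\<close> from replacing transport by
  the identity.\<close>

lemma C1_dist_locd:
  assumes f: "C1_map A f" "deriv_bounded A G f K" and K: "K \<ge> 0" and g: "C1_map A g"
    and d: "C1_dist A G f g < ennreal \<epsilon>" and \<epsilon>: "C * C * \<epsilon> \<le> 1/2" "t + C * \<epsilon> < R"
    and y: "y \<in> nbh x R" "f y \<in> nbh z t"
  shows "g y \<in> nbh z R" "norm (loc z (g y) - loc z (f y)) \<le> C * \<epsilon>"
    "norm (locd x z g y a - locd x z f y a) \<le> (C * C + 2 * C ^ 4 * K) * \<epsilon> * norm a"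
proof -
  obtain \<gamma> where \<gamma>: "pw_C1_curve A \<gamma>" "\<gamma> 0 = f y" "\<gamma> 1 = g y" "curve_length A G \<gamma> < \<epsilon>"
    "\<And>v. rnorm G y v \<le> 1 \<Longrightarrow> rnorm G (g y) (transport A G \<gamma> (tderiv A f y v) - tderiv A g y v) < \<epsilon>"
    using C1_dist_curve[OF d, of y] by blast
  have e0: "\<epsilon> > 0" using \<gamma>(4) curve_length_nonneg[of \<gamma>] by linarith
  have Cl: "C * curve_length A G \<gamma> \<le> C * \<epsilon>" using \<gamma>(4) C by (intro mult_left_mono) auto
  have st: "t + C * curve_length A G \<gamma> < R" using Cl \<epsilon>(2) by linarith
  have n0: "\<gamma> 0 \<in> nbh z t" using y(2) \<gamma>(2) by simp
  note s = stays[OF \<gamma>(1) n0 st]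
  show gR: "g y \<in> nbh z R" using s(1)[of 1] \<gamma>(3) by simp
  show "norm (loc z (g y) - loc z (f y)) \<le> C * \<epsilon>" using s(2)[of 1] \<gamma>(2,3) Cl by simp
  have fR: "f y \<in> nbh z R" using s(1)[of 0] \<gamma>(2) by simp
  have l: "C * C * curve_length A G \<gamma> \<le> C * C * \<epsilon>" using \<gamma>(4) C by (intro mult_left_mono) auto
  have "norm (locd x z g y a - locd x z f y a) \<le> C * (C * \<epsilon> + 2 * (C * C * \<epsilon>) * (C * K)) * norm a"
  proof (rule linear_diff_scale[OF linear_locd[OF g y(1) gR] linear_locd[OF f(1) y]])
    show "C > 0" using C by simp
    fix a :: 'e assume a: "norm a = 1 / C"
    obtain v where v: "tcoord A (\<kappa> x) y v = a" using tcoord_onto[OF y(1)] by blast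
    have "rnorm G y v \<le> 1" using tcoord_norm(2)[OF y(1), of v] C unfolding v a by simp
    note D = \<gamma>(5)[OF this]
    let ?w = "tderiv A f y v"
    have lf: "locd x z f y a = tcoord A (\<kappa> z) (f y) ?w" and lg: "locd x z g y a = tcoord A (\<kappa> z) (g y) (tderiv A g y v)"
      using locd_tcoord[OF f(1) y, of v] locd_tcoord[OF g y(1) gR, of v] unfolding v by simp_all
    have lt: "linear (tcoord A (\<kappa> z) (g y))" by (rule linear_tcoord[OF \<kappa>(1) nbhD(1)[OF gR]])
    have "norm (tcoord A (\<kappa> z) (g y) (transport A G \<gamma> ?w - tderiv A g y v)) \<le> C * rnorm G (g y) (transport A G \<gamma> ?w - tderiv A g y v)"
      by (rule tcoord_norm(1)[OF gR])
    also have "\<dots> \<le> C * \<epsilon>" using C D by (intro mult_left_mono) auto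
    finally have 1: "norm (tcoord A (\<kappa> z) (g y) (transport A G \<gamma> ?w) - locd x z g y a) \<le> C * \<epsilon>"
      unfolding linear_diff[OF lt] lg .
    have "norm (tcoord A (\<kappa> z) (\<gamma> 1) (transport A G \<gamma> ?w) - tcoord A (\<kappa> z) (\<gamma> 0) ?w)
        \<le> 2 * (C * C * curve_length A G \<gamma>) * norm (tcoord A (\<kappa> z) (\<gamma> 0) ?w)"
      by (rule short_transport[OF \<gamma>(1) s(1)]) (use l \<epsilon>(1) in auto)
    then have "norm (tcoord A (\<kappa> z) (g y) (transport A G \<gamma> ?w) - locd x z f y a)
        \<le> 2 * (C * C * curve_length A G \<gamma>) * norm (locd x z f y a)" unfolding \<gamma>(2,3) lf .
    also have "\<dots> \<le> 2 * (C * C * \<epsilon>) * (C * C * K * norm a)"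
      using l C e0 curve_length_nonneg[of \<gamma>] by (intro mult_mono locd_bound[OF f K y(1) fR]) auto
    also have "C * C * K * norm a = C * K" unfolding a using C by simp
    finally have 2: "norm (tcoord A (\<kappa> z) (g y) (transport A G \<gamma> ?w) - locd x z f y a) \<le> 2 * (C * C * \<epsilon>) * (C * K)" .
    have "norm (locd x z g y a - locd x z f y a) \<le>
        norm (tcoord A (\<kappa> z) (g y) (transport A G \<gamma> ?w) - locd x z g y a) + norm (tcoord A (\<kappa> z) (g y) (transport A G \<gamma> ?w) - locd x z f y a)"
      using norm_triangle_ineq4[of "tcoord A (\<kappa> z) (g y) (transport A G \<gamma> ?w) - locd x z f y a"
          "tcoord A (\<kappa> z) (g y) (transport A G \<gamma> ?w) - locd x z g y a"] by simp
    then show "norm (locd x z g y a - locd x z f y a) \<le> C * \<epsilon> + 2 * (C * C * \<epsilon>) * (C * K)" using 1 2 by linarith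
  qed
  also have "C * (C * \<epsilon> + 2 * (C * C * \<epsilon>) * (C * K)) = (C * C + 2 * C ^ 4 * K) * \<epsilon>"
    by (simp add: power4_eq_xxxx algebra_simps)
  finally show "norm (locd x z g y a - locd x z f y a) \<le> (C * C + 2 * C ^ 4 * K) * \<epsilon> * norm a" .
qed

text \<open>The form in which smallness enters the dynamics. The derivative of \<open>g\<close> at
  \<open>y\<close> is compared with that of \<open>f\<close> at the centre \<open>x\<close>, one
  constant linear map for the whole ball, so that the nonlinear part of \<open>g\<close> has
  Lipschitz constant \<open>\<eta>\<close> there. The case \<open>g = f\<close> controls the
  variation of \<open>f\<close> itself.\<close>

definition near :: "('a \<Rightarrow> 'a) \<Rightarrow> ('a \<Rightarrow> 'a) \<Rightarrow> real \<Rightarrow> real \<Rightarrow> bool" where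
  "near f g s \<eta> \<longleftrightarrow> (\<forall>x y. y \<in> nbh x s \<longrightarrow> g y \<in> nbh (f x) R \<and>
     (\<forall>a. norm (locd x (f x) g y a - locd x (f x) f x a) \<le> \<eta> * norm a))"

text \<open>The radius \<open>s\<close> and the size \<open>\<epsilon>\<close> are chosen from
  \<open>K\<close> and the modulus \<open>\<omega>\<close>, before \<open>f\<close> and
  \<open>g\<close>. The displacement bound is linear in \<open>\<rho>\<close>; this later makes the
  conjugacy tend to the identity.\<close>

lemma ex_near:
  assumes K: "K \<ge> 0" and \<omega>: "\<And>\<eta>. \<eta> > 0 \<Longrightarrow> \<exists>r>0. \<omega> r \<le> ennreal \<eta>" and \<eta>: "\<eta> > 0"
  obtains s \<epsilon> where "s > 0" "s \<le> R" "\<epsilon> > 0" "C * \<epsilon> < R"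
    "\<And>f. C1_map A f \<Longrightarrow> deriv_bounded A G f K \<Longrightarrow> deriv_modulus A G f = \<omega> \<Longrightarrow> near f f s \<eta>"
    "\<And>f g. C1_map A f \<Longrightarrow> deriv_bounded A G f K \<Longrightarrow> deriv_modulus A G f = \<omega> \<Longrightarrow> C1_map A g \<Longrightarrow>
       C1_dist A G f g < ennreal \<epsilon> \<Longrightarrow> near f g s \<eta>"
    "\<And>f g x \<rho>. C1_map A f \<Longrightarrow> deriv_bounded A G f K \<Longrightarrow> C1_map A g \<Longrightarrow> \<rho> \<le> \<epsilon> \<Longrightarrow>
       C1_dist A G f g < ennreal \<rho> \<Longrightarrow> norm (loc (f x) (g x)) \<le> C * \<rho>"
proof -
  \<comment> \<open>Half of \<open>\<eta>\<close> is spent on the variation of \<open>f\<close>: a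
    quarter for the modulus, through \<open>\<eta>1\<close>, and a quarter for transport, through
    \<open>s2\<close>. The other half, and half of the radius \<open>R\<close>, is left for passing
    from \<open>f\<close> to \<open>g\<close>.\<close>
  define \<eta>1 where "\<eta>1 = \<eta> / (4 * C * C)"
  have \<eta>1: "\<eta>1 > 0" "C * C * \<eta>1 = \<eta> / 4" using \<eta> C by (auto simp: \<eta>1_def field_simps)
  obtain r where r: "r > 0" "\<omega> r \<le> ennreal \<eta>1" using \<omega>[OF \<eta>1(1)] by blast
  let ?M = "2 * C ^ 4 * K * (K + 1)"
  obtain s1 where s1: "s1 > 0" "s1 * C < r" "s1 * (C * C * C) < 1/2" "s1 * (C * C * K * C) < 1/2" "s1 * (C * K * C) < R / 2"
    using ex_small[of r "1/2" "1/2" "R/2" C "C * C * C" "C * C * K * C" "C * K * C"] r R by auto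
  obtain s2 where s2: "s2 > 0" "s2 * (?M * C) < \<eta> / 4"
    using ex_small[of "\<eta>/4" 1 1 1 "?M * C" 0 0 0] \<eta> by auto
  define s where "s = min (min s1 s2) R"
  have s: "s > 0" "s \<le> s1" "s \<le> s2" "s \<le> R" using s1 s2 R by (auto simp: s_def)
  have up: "s * X \<le> s1 * X" "s * X \<le> s2 * X" if "X \<ge> 0" for X using s that by (auto intro: mult_right_mono)
  have sb: "C * s \<le> r" "C * C * (C * s) \<le> 1/2" "C * C * (K * (C * s)) \<le> 1/2" "C * (K * (C * s)) < R / 2" "?M * (C * s) \<le> \<eta> / 4"
  proof -
    have nn: "C \<ge> 0" "C * C * C \<ge> 0" "C * C * K * C \<ge> 0" "C * K * C \<ge> 0" "?M * C \<ge> 0" using C K by auto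
    have eq: "C * s = s * C" "C * C * (s * C) = s * (C * C * C)" "C * C * (K * (s * C)) = s * (C * C * K * C)"
      "C * (K * (s * C)) = s * (C * K * C)" "?M * (s * C) = s * (?M * C)"
      by (simp_all only: mult_ac)
    show "C * s \<le> r" unfolding eq using up(1)[OF nn(1)] s1(2) by linarith
    show "C * C * (C * s) \<le> 1/2" unfolding eq using up(1)[OF nn(2)] s1(3) by linarith
    show "C * C * (K * (C * s)) \<le> 1/2" unfolding eq using up(1)[OF nn(3)] s1(4) by linarith
    show "C * (K * (C * s)) < R / 2" unfolding eq using up(1)[OF nn(4)] s1(5) by linarith
    show "?M * (C * s) \<le> \<eta> / 4" unfolding eq using up(2)[OF nn(5)] s2(2) by linarith
  qed
  obtain \<epsilon> where \<epsilon>: "\<epsilon> > 0" "\<epsilon> * C < R / 2" "\<epsilon> * (C * C) < 1/2" "\<epsilon> * (C * C + 2 * C ^ 4 * K) < \<eta> / 4"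
    using ex_small[of "R/2" "1/2" "\<eta>/4" 1 C "C * C" "C * C + 2 * C ^ 4 * K" 0] R \<eta> by auto
  have var: "f y \<in> nbh (f x) (R/2) \<and> norm (locd x (f x) f y a - locd x (f x) f x a) \<le> (\<eta> / 2) * norm a"
    if f: "C1_map A f" "deriv_bounded A G f K" "deriv_modulus A G f = \<omega>" and y: "y \<in> nbh x s" for f x y a
  proof
    have m: "deriv_modulus A G f r \<le> ennreal \<eta>1" using r f(3) by simp
    have R2: "C * (K * (C * s)) < R" using sb(4) R by linarith
    note * = locd_variation[OF f(1,2) K m _ y s(4) sb(1-3) R2]
    show "f y \<in> nbh (f x) (R/2)" by (rule nbh_mono[OF _ *(1)]) (use sb(4) \<eta>1 in auto)
    have "(C * C * \<eta>1 + ?M * (C * s)) * norm a \<le> (\<eta> / 2) * norm a"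
      using sb(5) \<eta>1(2) by (intro mult_right_mono) auto
    then show "norm (locd x (f x) f y a - locd x (f x) f x a) \<le> (\<eta> / 2) * norm a"
      using *(2)[of a] \<eta>1(1) by linarith
  qed
  show ?thesis
  proof (rule that[OF s(1) s(4) \<epsilon>(1)])
    show "C * \<epsilon> < R" using \<epsilon>(2) R by (simp add: mult.commute)
    fix f assume f: "C1_map A f" "deriv_bounded A G f K" "deriv_modulus A G f = \<omega>"
    show "near f f s \<eta>"
      unfolding near_def
    proof (intro allI impI conjI)
      fix x y and a :: 'e assume y: "y \<in> nbh x s"
      show "f y \<in> nbh (f x) R" by (rule nbh_mono[OF _ conjunct1[OF var[OF f y]]]) (use R in auto)
      have "(\<eta> / 2) * norm a \<le> \<eta> * norm a" using \<eta> by (intro mult_right_mono) auto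
      then show "norm (locd x (f x) f y a - locd x (f x) f x a) \<le> \<eta> * norm a"
        using conjunct2[OF var[OF f y], of a] by linarith
    qed
    fix g assume g: "C1_map A g" "C1_dist A G f g < ennreal \<epsilon>"
    show "near f g s \<eta>"
      unfolding near_def
    proof (intro allI impI conjI)
      fix x y and a :: 'e assume y: "y \<in> nbh x s"
      have e: "C * C * \<epsilon> \<le> 1/2" "R/2 + C * \<epsilon> < R" using \<epsilon>(2,3) by (auto simp: mult.commute)
      note * = C1_dist_locd[OF f(1,2) K g e nbh_mono[OF s(4) y] conjunct1[OF var[OF f y]]]
      show "g y \<in> nbh (f x) R" by (rule *)
      have "norm (locd x (f x) g y a - locd x (f x) f x a) \<le>
        norm (locd x (f x) g y a - locd x (f x) f y a) + norm (locd x (f x) f y a - locd x (f x) f x a)"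
        using norm_triangle_ineq[of "locd x (f x) g y a - locd x (f x) f y a" "locd x (f x) f y a - locd x (f x) f x a"] by simp
      also have "\<dots> \<le> (C * C + 2 * C ^ 4 * K) * \<epsilon> * norm a + (\<eta> / 2) * norm a"
        using *(3)[of a] conjunct2[OF var[OF f y], of a] by (rule add_mono)
      also have "(C * C + 2 * C ^ 4 * K) * \<epsilon> * norm a \<le> (\<eta> / 2) * norm a"
        using \<epsilon>(4) \<eta> by (intro mult_right_mono) (auto simp: mult.commute)
      finally show "norm (locd x (f x) g y a - locd x (f x) f x a) \<le> \<eta> * norm a" by simp
    qed
  next
    fix f g x \<rho> assume f: "C1_map A f" "deriv_bounded A G f K" and g: "C1_map A g"
      and \<rho>: "\<rho> \<le> \<epsilon>" "C1_dist A G f g < ennreal \<rho>"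
    have "C * C * \<rho> \<le> C * C * \<epsilon>" "C * \<rho> \<le> C * \<epsilon>" using C \<rho>(1) by (auto intro: mult_left_mono)
    then have e: "C * C * \<rho> \<le> 1/2" "0 + C * \<rho> < R" using \<epsilon>(2,3) R by (auto simp: mult.commute)
    have "x \<in> nbh x R" "f x \<in> nbh (f x) 0" using R by (auto intro: nbh_self)
    from C1_dist_locd(2)[OF f K g \<rho>(2) e this] show "norm (loc (f x) (g x)) \<le> C * \<rho>" by (simp add: loc_self)
  qed
qed

end

subsection \<open>Green kernels of sequences of linear maps\<close>

text \<open>Two one-sided geometric series, the left one without its leading term.\<close>

lemma has_sum_geometric_int:
  fixes n :: int and \<theta> :: real
  assumes "0 \<le> \<theta>" "\<theta> < 1"
  shows "((\<lambda>k. \<theta> ^ nat \<bar>n - k\<bar>) has_sum (1 + \<theta>) / (1 - \<theta>)) UNIV"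
proof -
  have geo: "((\<lambda>j::nat. \<theta> ^ j) has_sum 1 / (1 - \<theta>)) UNIV"
    by (rule norm_summable_imp_has_sum) (use assms in \<open>auto intro: geometric_sums simp: norm_power\<close>)
  have "((\<lambda>k. \<theta> ^ nat \<bar>n - k\<bar>) has_sum 1 / (1 - \<theta>)) (range (\<lambda>j::nat. n + int j))"
    by (subst has_sum_reindex) (use geo in \<open>auto simp: inj_on_def o_def\<close>)
  moreover have "((\<lambda>k. \<theta> ^ nat \<bar>n - k\<bar>) has_sum \<theta> * (1 / (1 - \<theta>))) (range (\<lambda>j::nat. n - int j - 1))"
  proof (subst has_sum_reindex)
    have "nat \<bar>n - (n - int j - 1)\<bar> = Suc j" for j by simp
    then show "((\<lambda>k. \<theta> ^ nat \<bar>n - k\<bar>) \<circ> (\<lambda>j. n - int j - 1) has_sum \<theta> * (1 / (1 - \<theta>))) UNIV"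
      using has_sum_cmult_right[OF geo, of \<theta>] by (simp add: o_def)
  qed (auto simp: inj_on_def)
  moreover have "range (\<lambda>j::nat. n + int j) \<inter> range (\<lambda>j::nat. n - int j - 1) = {}" by auto
  moreover have "range (\<lambda>j::nat. n + int j) \<union> range (\<lambda>j::nat. n - int j - 1) = UNIV"
  proof -
    have "k \<in> range (\<lambda>j::nat. n + int j) \<union> range (\<lambda>j::nat. n - int j - 1)" for k
    proof (cases "n \<le> k")
      case True
      then have "k = n + int (nat (k - n))" by simp
      then show ?thesis by blast
    next
      case False
      then have "k = n - int (nat (n - k - 1)) - 1" by simp
      then show ?thesis by blast
    qed
    then show ?thesis by blast
  qed
  ultimately have "((\<lambda>k. \<theta> ^ nat \<bar>n - k\<bar>) has_sum 1 / (1 - \<theta>) + \<theta> * (1 / (1 - \<theta>))) UNIV"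
    using has_sum_Un_disjoint by metis
  then show ?thesis by (simp add: add_divide_distrib)
qed

lemma has_sum_difference:
  fixes f g :: "'i \<Rightarrow> 'b::real_normed_vector"
  assumes "(f has_sum a) S" "(g has_sum b) S"
  shows "((\<lambda>x. f x - g x) has_sum a - b) S"
  using has_sum_add[OF assms(1) has_sum_bounded_linear[OF bounded_linear_minus[OF bounded_linear_ident] assms(2)]]
  by simp

text \<open>The kernel is a two-sided inverse of \<open>w \<mapsto> (w\<^sub>n - L\<^sub>n\<^sub>-\<^sub>1 w\<^sub>n\<^sub>-\<^sub>1)\<^sub>n\<close>; its existence is
  equivalent to hyperbolicity of the sequence, and it makes no reference to invariant subspaces.\<close>

locale green_kernel =
  fixes L :: "int \<Rightarrow> 'e::euclidean_space \<Rightarrow> 'e" and Gk :: "int \<Rightarrow> int \<Rightarrow> 'e \<Rightarrow> 'e" and D lam B :: real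
  assumes lam: "0 < lam" "lam < 1" and D: "D > 0" and B: "B \<ge> 0"
    and linear_L: "linear (L n)" and L_le: "norm (L n v) \<le> B * norm v"
    and linear_Gk: "linear (Gk n k)" and Gk_le: "norm (Gk n k v) \<le> D * lam ^ nat \<bar>n - k\<bar> * norm v"
    and Gk_left: "Gk (n + 1) k v = L n (Gk n k v) + (if k = n + 1 then v else 0)"
    and Gk_right: "Gk n k v = Gk n (k + 1) (L k v) + (if k = n then v else 0)"

text \<open>A step in time changes the weight by a factor of at most \<open>1 / \<mu>\<close>, so a
  kernel of decay \<open>lam\<close> acts on weighted sequences like one of decay
  \<open>lam / \<mu> < 1\<close>. The value \<open>\<mu> = 1\<close> forces a constant
  weight.\<close>

locale weighted_green_kernel = green_kernel L Gk D lam B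
  for L :: "int \<Rightarrow> 'e::euclidean_space \<Rightarrow> 'e" and Gk D lam B +
  fixes a :: "int \<Rightarrow> real" and \<mu> :: real
  assumes \<mu>: "lam < \<mu>" "\<mu> \<le> 1"
    and a_pos: "a n > 0" and a_le: "a k \<le> (1 / \<mu>) ^ nat \<bar>n - k\<bar> * a n"
begin

text \<open>Bound for the inverse operator in the weighted sup norm: the sum
  \<open>(1 + \<theta>) / (1 - \<theta>)\<close> of the two-sided geometric series with
  \<open>\<theta> = lam / \<mu>\<close>, its numerator rounded up to 2.\<close>

definition D1 :: real where "D1 = D * (2 / (1 - lam / \<mu>))"

lemma \<mu>_pos: "\<mu> > 0" using \<mu> lam by linarith

lemma ratio: "0 \<le> lam / \<mu>" "lam / \<mu> < 1" using \<mu>_pos \<mu> lam by auto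

lemma D1_pos: "D1 > 0" using D ratio by (simp add: D1_def)

lemma a_Suc: "a n \<le> 1 / \<mu> * a (n + 1)" "a (n + 1) \<le> 1 / \<mu> * a n"
  using a_le[of n "n + 1"] a_le[of "n + 1" n] by simp_all

section \<open>Inversion of the linear equation in weighted sup norms\<close>

definition solve :: "(int \<Rightarrow> 'e) \<Rightarrow> int \<Rightarrow> 'e" where
  "solve \<xi> n = (\<Sum>\<^sub>\<infinity>k. Gk n k (\<xi> k))"

lemma kernel_term_le:
  assumes "\<And>k. norm (\<xi> k) \<le> M * a k" "M \<ge> 0"
  shows "norm (Gk n k (\<xi> k)) \<le> D * M * a n * (lam / \<mu>) ^ nat \<bar>n - k\<bar>"
proof -
  have "norm (Gk n k (\<xi> k)) \<le> D * lam ^ nat \<bar>n - k\<bar> * norm (\<xi> k)" by (rule Gk_le)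
  also have "\<dots> \<le> D * lam ^ nat \<bar>n - k\<bar> * (M * ((1 / \<mu>) ^ nat \<bar>n - k\<bar> * a n))"
    using assms a_le[of k n] D lam by (intro mult_left_mono order_trans[OF assms(1)]) auto
  also have "\<dots> = D * M * a n * (lam / \<mu>) ^ nat \<bar>n - k\<bar>" by (simp add: power_divide)
  finally show ?thesis .
qed

lemma kernel_sum:
  assumes "\<And>k. norm (\<xi> k) \<le> M * a k" "M \<ge> 0"
  shows "((\<lambda>k. Gk n k (\<xi> k)) has_sum solve \<xi> n) UNIV" "norm (solve \<xi> n) \<le> D1 * M * a n"
proof -
  note geo = has_sum_cmult_right[OF has_sum_geometric_int[OF ratio, of n], of "D * M * a n"]
  have "(\<lambda>k. norm (Gk n k (\<xi> k))) summable_on UNIV"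
    by (rule Infinite_Sum.abs_summable_on_comparison_test'[OF has_sum_imp_summable[OF geo] kernel_term_le[OF assms]])
  then have "(\<lambda>k. Gk n k (\<xi> k)) summable_on UNIV" by (rule abs_summable_summable)
  then show s: "((\<lambda>k. Gk n k (\<xi> k)) has_sum solve \<xi> n) UNIV"
    unfolding solve_def by (rule has_sum_infsum)
  have "norm (solve \<xi> n) \<le> D * M * a n * ((1 + lam / \<mu>) / (1 - lam / \<mu>))"
    by (rule norm_infsum_le[OF s geo kernel_term_le[OF assms]])
  also have "\<dots> \<le> D * M * a n * (2 / (1 - lam / \<mu>))"
    using D assms(2) a_pos[of n] ratio by (intro mult_left_mono divide_right_mono) auto
  finally show "norm (solve \<xi> n) \<le> D1 * M * a n" by (simp add: D1_def mult_ac)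
qed

text \<open>\<open>Gk_left\<close>, summed over \<open>k\<close>: the kernel is a right
  inverse.\<close>

lemma solve_Suc:
  assumes "\<And>k. norm (\<xi> k) \<le> M * a k" "M \<ge> 0"
  shows "solve \<xi> (n + 1) = L n (solve \<xi> n) + \<xi> (n + 1)"
proof -
  have "((\<lambda>k. L n (Gk n k (\<xi> k))) has_sum L n (solve \<xi> n)) UNIV"
    by (rule has_sum_bounded_linear[OF _ kernel_sum(1)[OF assms]])
       (use linear_L in \<open>simp add: linear_conv_bounded_linear\<close>)
  moreover have "((\<lambda>k. if k = n + 1 then \<xi> k else 0) has_sum \<xi> (n + 1)) UNIV"
    by (rule has_sum_finite_neutralI[of "{n + 1}"]) auto
  ultimately have "((\<lambda>k. L n (Gk n k (\<xi> k)) + (if k = n + 1 then \<xi> k else 0)) has_sum L n (solve \<xi> n) + \<xi> (n + 1)) UNIV"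
    by (rule has_sum_add)
  then have "((\<lambda>k. Gk (n + 1) k (\<xi> k)) has_sum L n (solve \<xi> n) + \<xi> (n + 1)) UNIV"
    unfolding Gk_left[of n] .
  then show ?thesis using kernel_sum(1)[OF assms, of "n + 1"] has_sum_unique by blast
qed

lemma solve_diff:
  assumes "\<And>k. norm (\<xi> k) \<le> M * a k" "\<And>k. norm (\<xi>' k) \<le> M * a k" "M \<ge> 0"
    and "\<And>k. norm (\<xi> k - \<xi>' k) \<le> M' * a k" "M' \<ge> 0"
  shows "norm (solve \<xi> n - solve \<xi>' n) \<le> D1 * M' * a n"
proof -
  have "((\<lambda>k. Gk n k (\<xi> k) - Gk n k (\<xi>' k)) has_sum solve \<xi> n - solve \<xi>' n) UNIV"
    by (rule has_sum_difference[OF kernel_sum(1)[OF assms(1,3)] kernel_sum(1)[OF assms(2,3)]])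
  then have "((\<lambda>k. Gk n k (\<xi> k - \<xi>' k)) has_sum solve \<xi> n - solve \<xi>' n) UNIV"
    by (simp add: linear_diff[OF linear_Gk])
  then have "solve \<xi> n - solve \<xi>' n = solve (\<lambda>k. \<xi> k - \<xi>' k) n"
    using kernel_sum(1)[OF assms(4,5), of n] has_sum_unique by blast
  then show ?thesis using kernel_sum(2)[OF assms(4,5)] by simp
qed

text \<open>\<open>Gk_right\<close> makes the kernel a left inverse: the sums for \<open>w\<close>
  and for its image under \<open>L\<close> both converge by the a priori bound \<open>M\<close>, and
  after a shift of the index of the second they differ in the term at \<open>n\<close> alone. So
  \<open>w\<close> is recovered from its defect, with a bound free of \<open>M\<close>.\<close>

lemma defect_bound:
  assumes w: "\<And>n. norm (w n) \<le> M * a n" "M \<ge> 0"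
    and defect: "\<And>n. norm (w (n + 1) - L n (w n)) \<le> M' * a (n + 1)" "M' \<ge> 0"
  shows "norm (w n) \<le> D1 * M' * a n"
proof -
  define \<xi> where "\<xi> k = w k - L (k - 1) (w (k - 1))" for k
  have \<xi>: "norm (\<xi> k) \<le> M' * a k" for k using defect(1)[of "k - 1"] by (simp add: \<xi>_def)
  let ?Lw = "\<lambda>k. L (k - 1) (w (k - 1))"
  have Lw: "norm (?Lw k) \<le> (M + M') * a k" for k
  proof -
    have "norm (?Lw k) \<le> norm (w k) + norm (\<xi> k)"
      unfolding \<xi>_def by (metis add_diff_cancel_left' diff_add_cancel norm_triangle_ineq4 uminus_add_conv_diff add.commute)
    also have "\<dots> \<le> M * a k + M' * a k" by (intro add_mono w \<xi>)
    finally show ?thesis by (simp add: distrib_right)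
  qed
  have s1: "((\<lambda>k. Gk n k (w k)) has_sum solve w n) UNIV" by (rule kernel_sum(1)[OF w])
  have s2: "((\<lambda>k. Gk n k (?Lw k)) has_sum solve ?Lw n) UNIV"
    by (rule kernel_sum(1)[OF Lw]) (use w defect in simp)
  have "bij_betw (\<lambda>k. k + 1) (UNIV :: int set) UNIV" by (rule bij_betwI[of _ _ _ "\<lambda>k. k - 1"]) auto
  from has_sum_reindex_bij_betw[OF this, of "\<lambda>k. Gk n k (?Lw k)" "solve ?Lw n"] s2
  have "((\<lambda>k. Gk n (k + 1) (L k (w k))) has_sum solve ?Lw n) UNIV" by simp
  from has_sum_difference[OF s1 this]
  have "((\<lambda>k. Gk n k (w k) - Gk n (k + 1) (L k (w k))) has_sum solve w n - solve ?Lw n) UNIV" .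
  moreover have "Gk n k (w k) - Gk n (k + 1) (L k (w k)) = (if k = n then w k else 0)" for k
    by (subst Gk_right) simp
  ultimately have "((\<lambda>k. if k = n then w k else 0) has_sum solve w n - solve ?Lw n) UNIV" by simp
  moreover have "((\<lambda>k. if k = n then w k else 0) has_sum w n) UNIV"
    by (rule has_sum_finite_neutralI[of "{n}"]) auto
  ultimately have eq: "w n = solve w n - solve ?Lw n" using has_sum_unique by blast
  have "norm (solve w n - solve ?Lw n) \<le> D1 * M' * a n"
  proof (rule solve_diff[where M="M + M'"])
    show "norm (w k) \<le> (M + M') * a k" for k
    proof -
      have "M * a k \<le> (M + M') * a k" using defect(2) a_pos[of k] by (intro mult_right_mono) auto
      then show ?thesis using w(1)[of k] by linarith
    qed
    show "norm (w k - ?Lw k) \<le> M' * a k" for k using \<xi>[of k] by (simp add: \<xi>_def)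
  qed (use Lw w defect in auto)
  then show ?thesis by (simp flip: eq)
qed

text \<open>Orbits of \<open>F\<close> are the fixed points of \<open>T\<close>, which applies the
  kernel to the nonlinear part. The first smallness condition makes \<open>T\<close> contract by
  \<open>1/2\<close>, the second makes it preserve the ball of radius \<open>\<rho>\<close>. The
  factor \<open>1 / \<mu>\<close> arises because the source at time \<open>k\<close> uses
  \<open>w\<close> at time \<open>k - 1\<close>, where the weight may be larger by that
  factor.\<close>

lemma ex_perturbed_orbit:
  assumes \<rho>: "\<rho> \<ge> 0" and \<eta>: "\<eta> \<ge> 0" "D1 * \<eta> / \<mu> \<le> 1/2" and \<beta>: "\<beta> \<ge> 0" "D1 * \<beta> \<le> \<rho> / 2"
    and lip: "\<And>n u v. norm u \<le> \<rho> * a n \<Longrightarrow> norm v \<le> \<rho> * a n \<Longrightarrow> norm (F n u - F n v - L n (u - v)) \<le> \<eta> * norm (u - v)"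
    and F0: "\<And>n. norm (F n 0) \<le> \<beta> * a (n + 1)"
  shows "\<exists>w. (\<forall>n. norm (w n) \<le> \<rho> * a n) \<and> (\<forall>n. w (n + 1) = F n (w n))"
proof -
  define X where "X = {w :: int \<Rightarrow> 'e. \<forall>n. norm (w n) \<le> \<rho> * a n}"
  define src where "src w k = F (k - 1) (w (k - 1)) - L (k - 1) (w (k - 1))" for w :: "int \<Rightarrow> 'e" and k :: int
  define T where "T w = solve (src w)" for w
  have shift: "\<eta> * (Y * a (k - 1)) \<le> (\<eta> * Y / \<mu>) * a k" if "Y \<ge> 0" for Y k
  proof -
    have "(\<eta> * Y) * a (k - 1) \<le> (\<eta> * Y) * (1 / \<mu> * a k)"
      using a_Suc(1)[of "k - 1"] that \<eta> by (intro mult_left_mono) auto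
    then show ?thesis by simp
  qed
  have Z: "norm (0::'e) \<le> \<rho> * a n" for n using \<rho> a_pos[of n] by simp
  have src1: "norm (src w k) \<le> (\<beta> + \<eta> * \<rho> / \<mu>) * a k" if "w \<in> X" for w k
  proof -
    have w: "norm (w (k - 1)) \<le> \<rho> * a (k - 1)" using that by (simp add: X_def)
    have "norm (F (k - 1) (w (k - 1)) - F (k - 1) 0 - L (k - 1) (w (k - 1))) \<le> \<eta> * norm (w (k - 1))"
      using lip[OF w Z] by simp
    also have "\<dots> \<le> \<eta> * (\<rho> * a (k - 1))" using w \<eta> by (intro mult_left_mono) auto
    also have "\<dots> \<le> (\<eta> * \<rho> / \<mu>) * a k" by (rule shift[OF \<rho>])
    finally have 1: "norm (F (k - 1) (w (k - 1)) - F (k - 1) 0 - L (k - 1) (w (k - 1))) \<le> (\<eta> * \<rho> / \<mu>) * a k" .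
    have "src w k = (F (k - 1) (w (k - 1)) - F (k - 1) 0 - L (k - 1) (w (k - 1))) + F (k - 1) 0"
      by (simp add: src_def)
    then have "norm (src w k) \<le> (\<eta> * \<rho> / \<mu>) * a k + \<beta> * a k"
      using 1 F0[of "k - 1"] norm_triangle_mono[OF 1, of "F (k - 1) 0" "\<beta> * a k"] by simp
    then show ?thesis by (simp add: algebra_simps)
  qed
  have nn: "\<beta> + \<eta> * \<rho> / \<mu> \<ge> 0" using \<beta> \<eta> \<rho> \<mu>_pos by simp
  have TX: "T w \<in> X" if "w \<in> X" for w
  proof -
    have "norm (T w n) \<le> \<rho> * a n" for n
    proof -
      have "norm (T w n) \<le> D1 * (\<beta> + \<eta> * \<rho> / \<mu>) * a n"
        unfolding T_def by (rule kernel_sum(2)[OF src1[OF that] nn])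
      also have "D1 * (\<beta> + \<eta> * \<rho> / \<mu>) = D1 * \<beta> + (D1 * \<eta> / \<mu>) * \<rho>" by (simp add: distrib_left mult_ac)
      also have "(D1 * \<beta> + (D1 * \<eta> / \<mu>) * \<rho>) * a n \<le> (\<rho> / 2 + 1 / 2 * \<rho>) * a n"
        using \<beta> \<eta> \<rho> a_pos[of n] by (intro mult_right_mono add_mono) auto
      finally show ?thesis by simp
    qed
    then show ?thesis by (simp add: X_def)
  qed
  have contr: "norm (T w n - T w' n) \<le> (Y / 2) * a n"
    if w: "w \<in> X" "w' \<in> X" and Y: "\<And>k. norm (w k - w' k) \<le> Y * a k" "Y \<ge> 0" for w w' Y n
  proof -
    have "norm (src w k - src w' k) \<le> (\<eta> * Y / \<mu>) * a k" for k
    proof -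
      have b: "norm (w (k - 1)) \<le> \<rho> * a (k - 1)" "norm (w' (k - 1)) \<le> \<rho> * a (k - 1)" using w by (auto simp: X_def)
      have "src w k - src w' k = F (k - 1) (w (k - 1)) - F (k - 1) (w' (k - 1)) - L (k - 1) (w (k - 1) - w' (k - 1))"
        by (simp add: src_def linear_diff[OF linear_L])
      then have "norm (src w k - src w' k) \<le> \<eta> * norm (w (k - 1) - w' (k - 1))" using lip[OF b] by simp
      also have "\<dots> \<le> \<eta> * (Y * a (k - 1))" using Y \<eta> by (intro mult_left_mono) auto
      also have "\<dots> \<le> (\<eta> * Y / \<mu>) * a k" by (rule shift[OF Y(2)])
      finally show ?thesis .
    qed
    then have "norm (T w n - T w' n) \<le> D1 * (\<eta> * Y / \<mu>) * a n"
      unfolding T_def by (intro solve_diff[OF src1[OF w(1)] src1[OF w(2)] nn]) (use \<eta> Y \<mu>_pos in auto)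
    also have "D1 * (\<eta> * Y / \<mu>) = (D1 * \<eta> / \<mu>) * Y" by simp
    also have "(D1 * \<eta> / \<mu>) * Y * a n \<le> 1 / 2 * Y * a n"
      using \<eta> Y a_pos[of n] by (intro mult_right_mono) auto
    finally show ?thesis by simp
  qed
  \<comment> \<open>The iteration is carried out by hand, since the weighted ball is a mere set of
    functions. Convergence is pointwise in \<open>n\<close>, with geometric errors relative to the
    weight.\<close>
  define W where "W j = (T ^^ j) (\<lambda>_. 0)" for j
  have WX: "W j \<in> X" for j
    by (induction j) (use Z in \<open>auto simp: W_def X_def[symmetric] TX\<close>, auto simp: X_def Z)
  have W1: "norm (W (Suc j) n - W j n) \<le> (2 * \<rho> / 2 ^ j) * a n" for j n
  proof (induction j arbitrary: n)
    case 0
    have "norm (W 1 n - W 0 n) \<le> norm (W 1 n) + norm (W 0 n)" by (rule norm_triangle_ineq4)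
    also have "\<dots> \<le> \<rho> * a n + \<rho> * a n" using WX[of 1] WX[of 0] by (intro add_mono) (auto simp: X_def)
    finally show ?case by simp
  next
    case (Suc j)
    have "norm (T (W (Suc j)) n - T (W j) n) \<le> ((2 * \<rho> / 2 ^ j) / 2) * a n"
      by (rule contr[OF WX WX Suc.IH]) (use \<rho> in simp)
    then show ?case by (simp add: W_def)
  qed
  have Wd: "norm (W (j + i) n - W j n) \<le> (4 * \<rho> / 2 ^ j) * a n" for i j n
  proof -
    have "norm (W (j + i) n - W j n) \<le> (4 * \<rho> / 2 ^ j - 4 * \<rho> / 2 ^ (j + i)) * a n"
    proof (induction i)
      case (Suc i)
      have "norm (W (j + Suc i) n - W j n) \<le> norm (W (Suc (j + i)) n - W (j + i) n) + norm (W (j + i) n - W j n)"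
        using norm_triangle_ineq[of "W (Suc (j + i)) n - W (j + i) n" "W (j + i) n - W j n"] by simp
      also have "\<dots> \<le> (2 * \<rho> / 2 ^ (j + i)) * a n + (4 * \<rho> / 2 ^ j - 4 * \<rho> / 2 ^ (j + i)) * a n"
        by (intro add_mono W1 Suc.IH)
      finally show ?case by (simp add: field_simps)
    qed simp
    also have "\<dots> \<le> (4 * \<rho> / 2 ^ j) * a n" using \<rho> a_pos[of n] by (intro mult_right_mono) auto
    finally show ?thesis .
  qed
  have lim0: "(\<lambda>j. (4 * \<rho> / 2 ^ j) * a n) \<longlonglongrightarrow> 0" for n
  proof -
    have "(\<lambda>j. (4 * \<rho> * a n) * (1/2) ^ j) \<longlonglongrightarrow> (4 * \<rho> * a n) * 0"
      by (intro tendsto_mult tendsto_const LIMSEQ_power_zero) simp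
    then show ?thesis by (simp add: power_divide mult_ac)
  qed
  have "Cauchy (\<lambda>j. W j n)" for n
  proof (rule metric_CauchyI)
    fix e :: real assume e: "e > 0"
    obtain N where N: "\<And>j. j \<ge> N \<Longrightarrow> (4 * \<rho> / 2 ^ j) * a n < e / 2"
      using order_tendstoD(2)[OF lim0[of n], of "e/2"] e by (auto simp: eventually_sequentially)
    have close: "dist (W m n) (W N n) < e / 2" if "m \<ge> N" for m
      using Wd[of N "m - N" n] N[of N] that by (simp add: dist_norm)
    show "\<exists>M. \<forall>m\<ge>M. \<forall>k\<ge>M. dist (W m n) (W k n) < e"
      using close dist_triangle_half_l[of _ "W N n" e] by (meson dist_commute_lessI dist_triangle_half_r dist_commute)
  qed
  then have "\<exists>l. (\<lambda>j. W j n) \<longlonglongrightarrow> l" for n by (simp add: Cauchy_convergent_iff convergent_def)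
  then obtain w where w: "\<And>n. (\<lambda>j. W j n) \<longlonglongrightarrow> w n" by metis
  have wX: "w \<in> X"
    unfolding X_def
  proof (intro CollectI allI)
    fix n show "norm (w n) \<le> \<rho> * a n"
      by (rule LIMSEQ_le_const2[OF tendsto_norm[OF w]]) (use WX in \<open>auto simp: X_def\<close>)
  qed
  have wd: "norm (w n - W j n) \<le> (4 * \<rho> / 2 ^ j) * a n" for n j
  proof (rule LIMSEQ_le_const2[OF tendsto_norm[OF tendsto_diff[OF LIMSEQ_ignore_initial_segment[OF w, of j] tendsto_const]]])
    show "\<exists>N. \<forall>i\<ge>N. norm (W (i + j) n - W j n) \<le> (4 * \<rho> / 2 ^ j) * a n"
      using Wd[of j _ n] by (auto simp: add.commute)
  qed
  have "T w n = w n" for n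
  proof (rule LIMSEQ_unique[OF _ LIMSEQ_Suc[OF w]])
    have "(\<lambda>j. W (Suc j) n - T w n) \<longlonglongrightarrow> 0"
    proof (rule Lim_null_comparison[OF always_eventually tendsto_mult_left_zero[OF lim0[of n], of "1/2"]], rule allI)
      fix j
      have "norm (T (W j) n - T w n) \<le> ((4 * \<rho> / 2 ^ j) / 2) * a n"
        by (rule contr[OF WX wX]) (use wd \<rho> in \<open>auto simp: norm_minus_commute\<close>)
      then show "norm (W (Suc j) n - T w n) \<le> (4 * \<rho> / 2 ^ j) * a n * (1/2)" by (simp add: W_def)
    qed
    then show "(\<lambda>j. W (Suc j) n) \<longlonglongrightarrow> T w n" by (rule LIM_zero_cancel)
  qed
  then have Tw: "T w = w" by blast
  have "w (n + 1) = F n (w n)" for n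
  proof -
    have "T w (n + 1) = L n (T w n) + src w (n + 1)"
      unfolding T_def by (rule solve_Suc[OF src1[OF wX] nn])
    then show ?thesis unfolding Tw by (simp add: src_def)
  qed
  then show ?thesis using wX by (auto simp: X_def)
qed

end

section \<open>Weights that decay or grow away from time 0\<close>

context green_kernel
begin

lemma weighted_const: "weighted_green_kernel L Gk D lam B (\<lambda>_. 1) 1"
  by unfold_locales (use lam in auto)

lemma power_ratio:
  assumes \<mu>: "lam < \<mu>" "\<mu> < 1"
  shows "\<mu> ^ nat \<bar>k\<bar> \<le> (1 / \<mu>) ^ nat \<bar>n - k\<bar> * \<mu> ^ nat \<bar>n\<bar>"
    "(1 / \<mu>) ^ nat \<bar>k\<bar> \<le> (1 / \<mu>) ^ nat \<bar>n - k\<bar> * (1 / \<mu>) ^ nat \<bar>n\<bar>"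
proof -
  have p: "\<mu> > 0" using \<mu> lam by linarith
  have "nat \<bar>n\<bar> \<le> nat \<bar>n - k\<bar> + nat \<bar>k\<bar>" by linarith
  then have "\<mu> ^ (nat \<bar>n - k\<bar> + nat \<bar>k\<bar>) \<le> \<mu> ^ nat \<bar>n\<bar>" using p \<mu> by (intro power_decreasing) auto
  then show "\<mu> ^ nat \<bar>k\<bar> \<le> (1 / \<mu>) ^ nat \<bar>n - k\<bar> * \<mu> ^ nat \<bar>n\<bar>"
    using p by (simp add: power_add power_divide field_simps)
  have "nat \<bar>k\<bar> \<le> nat \<bar>n - k\<bar> + nat \<bar>n\<bar>" by linarith
  then have "(1 / \<mu>) ^ nat \<bar>k\<bar> \<le> (1 / \<mu>) ^ (nat \<bar>n - k\<bar> + nat \<bar>n\<bar>)" using p \<mu> by (intro power_increasing) auto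
  then show "(1 / \<mu>) ^ nat \<bar>k\<bar> \<le> (1 / \<mu>) ^ nat \<bar>n - k\<bar> * (1 / \<mu>) ^ nat \<bar>n\<bar>" by (simp add: power_add)
qed

text \<open>The first weight serves for solutions that decay in both time directions, the second for
  sequences controlled on a window only.\<close>

lemma weighted_power:
  assumes "lam < \<mu>" "\<mu> < 1"
  shows "weighted_green_kernel L Gk D lam B (\<lambda>n. \<mu> ^ nat \<bar>n\<bar>) \<mu>"
    "weighted_green_kernel L Gk D lam B (\<lambda>n. (1 / \<mu>) ^ nat \<bar>n\<bar>) \<mu>"
  using assms lam by (unfold_locales; use power_ratio[OF assms] in auto)+

text \<open>The weight \<open>\<mu>\<^sup>-\<^sup>|\<^sup>n\<^sup>|\<close> makes the errors committed at the ends of the window negligible in its middle.\<close>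

lemma window_estimate:
  assumes \<mu>: "lam < \<mu>" "\<mu> < 1" and \<eta>: "\<eta> \<ge> 0" "D * (2 / (1 - lam / \<mu>)) * \<eta> / \<mu> \<le> 1/2" and M: "M \<ge> 0"
    and d: "\<And>n. \<bar>n\<bar> \<le> int N \<Longrightarrow> norm (d n) \<le> M"
    and step: "\<And>n. - int N \<le> n \<Longrightarrow> n < int N \<Longrightarrow> norm (d (n + 1) - L n (d n)) \<le> \<eta> * norm (d n)"
  shows "norm (d 0) \<le> 2 * (D * (2 / (1 - lam / \<mu>))) * ((1 + B) * M) * \<mu> ^ N"
proof -
  interpret W: weighted_green_kernel L Gk D lam B "\<lambda>n. (1 / \<mu>) ^ nat \<bar>n\<bar>" \<mu>
    by (rule weighted_power(2)[OF \<mu>])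
  let ?a = "\<lambda>n. (1 / \<mu>) ^ nat \<bar>n\<bar>"
  have D1: "W.D1 = D * (2 / (1 - lam / \<mu>))" by (simp add: W.D1_def)
  have p: "\<mu> > 0" by (rule W.\<mu>_pos)
  let ?I = "{- int N..int N}"
  \<comment> \<open>The weighted norm of \<open>d\<close> on the window. It is finite because the
    window is, and serves as the a priori bound that will be absorbed.\<close>
  define X where "X = Max ((\<lambda>n. norm (d n) * \<mu> ^ nat \<bar>n\<bar>) ` ?I)"
  have X: "norm (d n) * \<mu> ^ nat \<bar>n\<bar> \<le> X" if "n \<in> ?I" for n
    unfolding X_def by (rule Max_ge) (use that in auto)
  have d0: "norm (d 0) \<le> X" using X[of 0] by simp
  have X0: "X \<ge> 0" using d0 norm_ge_zero order_trans by blast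
  have Xa: "norm (d n) \<le> X * ?a n" if "n \<in> ?I" for n
    using X[OF that] p by (simp add: power_divide field_simps)
  \<comment> \<open>Extension by zero creates two new defects: \<open>d\<close> itself where the
    window begins, and its image under \<open>L\<close> where it ends. Both are at most
    \<open>(1 + B) * M\<close>, and the weight there is at least \<open>(1 / \<mu>) ^ N\<close>, so
    their weighted size is at most \<open>Y\<close>.\<close>
  define w where "w n = (if n \<in> ?I then d n else 0)" for n
  have w: "norm (w n) \<le> X * ?a n" for n
    using Xa X0 p by (auto simp: w_def)
  define Y where "Y = (1 + B) * M * \<mu> ^ N"
  have Y0: "Y \<ge> 0" using B M p by (simp add: Y_def)
  have edge: "Z \<le> Y * ?a k" if "int N \<le> \<bar>k\<bar>" "Z \<le> (1 + B) * M" for Z k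
  proof -
    have "(1 / \<mu>) ^ N \<le> ?a k" using that p \<mu> by (intro power_increasing) auto
    then have "\<mu> ^ N * (1 / \<mu>) ^ N \<le> \<mu> ^ N * ?a k" using p by (intro mult_left_mono) auto
    then have "1 \<le> \<mu> ^ N * ?a k" using p by (simp add: power_divide)
    then have "(1 + B) * M * 1 \<le> (1 + B) * M * (\<mu> ^ N * ?a k)" using B M by (intro mult_left_mono) auto
    then show ?thesis using that(2) by (simp add: Y_def mult_ac)
  qed
  have M1: "M \<le> (1 + B) * M" "B * M \<le> (1 + B) * M" using B M by (auto simp: algebra_simps)
  have defect: "norm (w (n + 1) - L n (w n)) \<le> (\<eta> / \<mu> * X + Y) * ?a (n + 1)" for n
  proof -
    have ineq: "\<eta> / \<mu> * X * ?a (n + 1) \<ge> 0" "Y * ?a (n + 1) \<ge> 0" using \<eta> p X0 Y0 by auto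
    consider "- int N \<le> n" "n < int N" | "n + 1 = - int N" | "n = int N" | "n + 1 < - int N \<or> int N < n" by linarith
    then show ?thesis
    proof cases
      case 1
      have "norm (w (n + 1) - L n (w n)) \<le> \<eta> * norm (d n)" using step[OF 1] 1 by (simp add: w_def)
      also have "\<dots> \<le> \<eta> * (X * ?a n)" using Xa[of n] 1 \<eta> by (intro mult_left_mono) auto
      also have "\<dots> \<le> \<eta> * (X * (1 / \<mu> * ?a (n + 1)))"
        using W.a_Suc(1)[of n] \<eta> X0 by (intro mult_left_mono) auto
      finally show ?thesis using ineq(2) by (simp add: algebra_simps)
    next
      case 2
      have "norm (w (n + 1) - L n (w n)) \<le> M" using 2 d[of "n + 1"] by (simp add: w_def linear_0[OF linear_L])
      then have "norm (w (n + 1) - L n (w n)) \<le> Y * ?a (n + 1)" using M1(1) 2 by (intro edge) auto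
      then show ?thesis using ineq(1) by (simp add: algebra_simps)
    next
      case 3
      have "norm (w (n + 1) - L n (w n)) \<le> B * norm (d n)" using 3 L_le[of n "d n"] by (simp add: w_def)
      also have "\<dots> \<le> B * M" using d[of n] 3 B by (intro mult_left_mono) auto
      finally have "norm (w (n + 1) - L n (w n)) \<le> Y * ?a (n + 1)" using M1(2) 3 by (intro edge) auto
      then show ?thesis using ineq(1) by (simp add: algebra_simps)
    next
      case 4
      then have "w (n + 1) - L n (w n) = 0" by (auto simp: w_def linear_0[OF linear_L])
      then show ?thesis using ineq by (simp add: algebra_simps)
    qed
  qed
  have nn: "\<eta> / \<mu> * X + Y \<ge> 0" using \<eta> p X0 Y0 by simp
  have bd: "norm (w n) \<le> W.D1 * (\<eta> / \<mu> * X + Y) * ?a n" for n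
    by (rule W.defect_bound[OF w X0 defect nn])
  \<comment> \<open>At a point where the maximum is attained, the defect bound reads
    \<open>X \<le> X / 2 + D1 * Y\<close>.\<close>
  have "X \<in> (\<lambda>n. norm (d n) * \<mu> ^ nat \<bar>n\<bar>) ` ?I" unfolding X_def by (rule Max_in) auto
  then obtain n where n: "n \<in> ?I" "X = norm (d n) * \<mu> ^ nat \<bar>n\<bar>" by blast
  have "X \<le> (W.D1 * (\<eta> / \<mu> * X + Y) * ?a n) * \<mu> ^ nat \<bar>n\<bar>"
    using bd[of n] n p by (auto simp: w_def intro!: mult_right_mono)
  also have "\<dots> = W.D1 * (\<eta> / \<mu> * X + Y)" using p by (simp add: power_divide)
  also have "\<dots> = (W.D1 * \<eta> / \<mu>) * X + W.D1 * Y" by (simp add: algebra_simps)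
  also have "\<dots> \<le> 1 / 2 * X + W.D1 * Y"
    using \<eta>(2) X0 unfolding D1 by (intro add_right_mono mult_right_mono)
  finally have "X \<le> 2 * W.D1 * Y" by simp
  from order_trans[OF d0 this] show ?thesis unfolding D1 Y_def by (simp only: mult.assoc)
qed

end

subsection \<open>Integer powers of a diffeomorphism\<close>

definition zpow :: "('a \<Rightarrow> 'a) \<Rightarrow> int \<Rightarrow> 'a \<Rightarrow> 'a" where
  "zpow f n = (if n \<ge> 0 then f ^^ nat n else inv f ^^ nat (- n))"

lemma zpow_0: "zpow f 0 = id"
  by (simp add: zpow_def)

lemma zpow_nat: "zpow f (int n) = f ^^ n" "zpow f (- int n) = inv f ^^ n"
proof -
  show "zpow f (int n) = f ^^ n" by (simp add: zpow_def)
  show "zpow f (- int n) = inv f ^^ n" by (cases "n = 0") (simp_all add: zpow_def)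
qed

lemma zpow_Suc:
  assumes "bij f"
  shows "zpow f (n + 1) = f \<circ> zpow f n" "zpow f (n + 1) = zpow f n \<circ> f"
proof -
  have i: "f (inv f x) = x" "inv f (f x) = x" for x
    using assms by (auto simp: bij_is_surj surj_f_inv_f bij_is_inj)
  have "zpow f (n + 1) = f \<circ> zpow f n \<and> zpow f (n + 1) = zpow f n \<circ> f"
  proof (cases "n \<ge> 0")
    case True
    then have "nat (n + 1) = Suc (nat n)" by simp
    then show ?thesis using True by (simp add: zpow_def funpow_Suc_right del: funpow.simps) (simp flip: funpow_Suc_right)
  next
    case False
    define k where "k = nat (- n - 1)"
    have n: "n = - int (Suc k)" using False by (simp add: k_def)
    have 1: "zpow f n = inv f ^^ Suc k" unfolding n by (rule zpow_nat(2))
    have 2: "zpow f (n + 1) = inv f ^^ k" using zpow_nat(2)[of f k] n by simp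
    have "f \<circ> (inv f ^^ Suc k) = inv f ^^ k" by (simp add: fun_eq_iff i)
    moreover have "(inv f ^^ Suc k) \<circ> f = inv f ^^ k"
      unfolding funpow_Suc_right by (simp add: fun_eq_iff i)
    ultimately show ?thesis unfolding 1 2 by simp
  qed
  then show "zpow f (n + 1) = f \<circ> zpow f n" "zpow f (n + 1) = zpow f n \<circ> f" by auto
qed

text \<open>Backward in time the induction step cancels \<open>f\<close> by injectivity.\<close>

lemma orbit_eq_zpow:
  assumes f: "bij f" and y: "\<And>n. y (n + 1) = f (y n)"
  shows "y n = zpow f n (y 0)"
proof (induction n rule: int_induct[of _ 0])
  case base then show ?case by (simp add: zpow_0)
next
  case (step1 i) then show ?case by (simp add: y zpow_Suc(1)[OF f])
next
  case (step2 i)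
  have "f (y (i - 1)) = f (zpow f (i - 1) (y 0))"
    using y[of "i - 1"] zpow_Suc(1)[OF f, of "i - 1"] step2(2) by simp
  then show ?case using f by (simp add: bij_is_inj inj_eq)
qed

lemma zpow_add:
  assumes f: "bij f"
  shows "zpow f (m + n) x = zpow f m (zpow f n x)"
  using orbit_eq_zpow[OF f, of "\<lambda>m. zpow f (m + n) x" m]
  by (simp add: zpow_Suc(1)[OF f] algebra_simps) (metis (no_types, lifting) add.assoc add.commute comp_apply f zpow_Suc(1))

lemma zpow_in:
  assumes f: "bij f" and S: "f ` S = S" and x: "x \<in> S"
  shows "zpow f n x \<in> S"
proof (induction n rule: int_induct[of _ 0])
  case base then show ?case using x by (simp add: zpow_0)
next
  case (step1 i) then show ?case using S by (auto simp: zpow_Suc(1)[OF f])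
next
  case (step2 i)
  have "f (zpow f (i - 1) x) \<in> f ` S" using zpow_Suc(1)[OF f, of "i - 1"] step2(2) S by simp
  then show ?case using f by (auto simp: bij_is_inj inj_eq)
qed

context smooth_manifold
begin

lemma C1_diffeoD:
  assumes "C1_diffeo A f"
  shows "bij f" "C1_map A f" "C1_map A (inv f)"
  using assms by (auto simp: C1_diffeo_def)

lemma C1_diffeo_inv:
  assumes "C1_diffeo A f" shows "C1_diffeo A (inv f)"
  using assms by (auto simp: C1_diffeo_def bij_imp_bij_inv inv_inv_eq)

lemma C1_map_zpow: "C1_diffeo A f \<Longrightarrow> C1_map A (zpow f n)"
  unfolding zpow_def by (simp add: C1_map_funpow C1_diffeoD)

lemma tderiv_zpow_Suc:
  assumes f: "C1_diffeo A f"
  shows "tderiv A (zpow f (n + 1)) x v = tderiv A f (zpow f n x) (tderiv A (zpow f n) x v)"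
    "tderiv A (zpow f (n + 1)) x v = tderiv A (zpow f n) (f x) (tderiv A f x v)"
  using tderiv_comp[OF C1_map_zpow[OF f] C1_diffeoD(2)[OF f], of n x v]
    tderiv_comp[OF C1_diffeoD(2)[OF f] C1_map_zpow[OF f], of n x v] zpow_Suc[OF C1_diffeoD(1)[OF f], of n]
  by simp_all

lemma tderiv_zpow_0: "tderiv A (zpow f 0) x v = v"
  by (simp only: zpow_0 tderiv_id)

end

subsection \<open>The Green kernel of a hyperbolic set\<close>

context uniform_charts
begin

text \<open>Coordinates on the tangent space at \<open>x\<close> from the chart
  \<open>\<kappa> x\<close>, which come with the uniform constant \<open>C\<close>, in place of the
  chart picked by \<open>chart_at\<close>.\<close>

definition own :: "'a \<Rightarrow> 'e \<Rightarrow> 'e" where "own x = tcoord A (\<kappa> x) x"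
definition disown :: "'a \<Rightarrow> 'e \<Rightarrow> 'e" where "disown x = tchange (\<kappa> x) (chart_at A x) x"

lemma own: "linear (own x)" "linear (disown x)" "own x (disown x a) = a" "disown x (own x v) = v"
  "norm (own x v) \<le> C * rnorm G x v" "rnorm G x v \<le> C * norm (own x v)"
proof -
  show "linear (own x)" unfolding own_def by (rule linear_tcoord[OF \<kappa>])
  show "linear (disown x)" unfolding disown_def by (rule linear_tchange[OF \<kappa>(1) chart_at(1) \<kappa>(2) chart_at(2)])
  show "own x (disown x a) = a" "disown x (own x v) = v" unfolding own_def disown_def using tcoord_inverse[OF \<kappa>] by auto
  show "norm (own x v) \<le> C * rnorm G x v" "rnorm G x v \<le> C * norm (own x v)"
    unfolding own_def using tcoord_norm[OF nbh_self[OF less_imp_le[OF R]]] by blast+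
qed

text \<open>The source is read in the chart of the point of the orbit at time \<open>n\<close>, the
  target in that at time \<open>n + 1\<close>, so that consecutive maps compose.\<close>

definition lin :: "('a \<Rightarrow> 'a) \<Rightarrow> 'a \<Rightarrow> int \<Rightarrow> 'e \<Rightarrow> 'e" where
  "lin f x n = locd (zpow f n x) (f (zpow f n x)) f (zpow f n x)"

lemma lin_own:
  assumes "C1_diffeo A f"
  shows "lin f x n (own (zpow f n x) v) = own (zpow f (n + 1) x) (tderiv A f (zpow f n x) v)"
  unfolding lin_def own_def zpow_Suc(1)[OF C1_diffeoD(1)[OF assms]] comp_apply
  by (rule locd_tcoord[OF C1_diffeoD(2)[OF assms] nbh_self nbh_self, of 0 0]) auto

lemma funpow_deriv_bound:
  assumes f: "C1_map A f" "deriv_bounded A G f K" and K: "K \<ge> 0"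
  shows "rnorm G ((f ^^ n) x) (tderiv A (f ^^ n) x v) \<le> K ^ n * rnorm G x v"
proof (induction n)
  case 0
  show ?case unfolding tderiv_funpow(1)[OF f(1)] by simp
next
  case (Suc n)
  have "rnorm G ((f ^^ Suc n) x) (tderiv A (f ^^ Suc n) x v) \<le> K * rnorm G ((f ^^ n) x) (tderiv A (f ^^ n) x v)"
    unfolding tderiv_funpow(2)[OF f(1)] using f(2) by (simp add: deriv_bounded_def)
  also have "\<dots> \<le> K * (K ^ n * rnorm G x v)" using Suc K by (rule mult_left_mono)
  finally show ?case by (simp only: power_Suc mult.assoc)
qed

text \<open>If \<open>a\<close> is stable and \<open>b\<close> unstable, then after \<open>N\<close> steps \<open>b\<close> dominates \<open>a\<close>, whereas the image of
  \<open>a + b\<close> has grown by a bounded factor: this bounds the angle between the two subspaces.\<close>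

lemma stable_unstable_angle:
  assumes f: "C1_diffeo A f" "deriv_bounded A G f K" and K: "K \<ge> 0"
    and N: "C * C * c * lam ^ N \<le> 1/4"
    and a: "rnorm G ((f ^^ N) x) (tderiv A (f ^^ N) x a) \<le> c * lam ^ N * rnorm G x a"
    and b: "rnorm G x b \<le> c * lam ^ N * rnorm G ((f ^^ N) x) (tderiv A (f ^^ N) x b)"
    and pos: "c \<ge> 0" "lam \<ge> 0"
  shows "norm (own x a) \<le> (C * C * K ^ N + 2) * norm (own x (a + b))"
    "norm (own x b) \<le> (C * C * K ^ N + 2) * norm (own x (a + b))"
proof -
  let ?x' = "(f ^^ N) x" and ?D = "tderiv A (f ^^ N) x"
  have C0: "C \<ge> 0" using C by simp
  have lD: "linear ?D" by (rule linear_tderiv[OF C1_map_funpow[OF C1_diffeoD(2)[OF f(1)]]])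
  have l0: "c * lam ^ N \<ge> 0" using pos by simp
  have "norm (own ?x' (?D a)) \<le> C * (c * lam ^ N * (C * norm (own x a)))"
    using own(5)[of ?x' "?D a"] a own(6)[of x a] C0 l0
    by (meson mult_left_mono order_trans)
  also have "\<dots> = (C * C * c * lam ^ N) * norm (own x a)" by simp
  also have "\<dots> \<le> 1/4 * norm (own x a)" by (rule mult_right_mono[OF N]) simp
  finally have 1: "norm (own ?x' (?D a)) \<le> 1/4 * norm (own x a)" .
  have "norm (own x b) \<le> C * (c * lam ^ N * (C * norm (own ?x' (?D b))))"
    using own(5)[of x b] b own(6)[of ?x' "?D b"] C0 l0
    by (meson mult_left_mono order_trans)
  also have "\<dots> = (C * C * c * lam ^ N) * norm (own ?x' (?D b))" by simp
  also have "\<dots> \<le> 1/4 * norm (own ?x' (?D b))" by (rule mult_right_mono[OF N]) simp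
  finally have 2: "norm (own x b) \<le> 1/4 * norm (own ?x' (?D b))" .
  have "norm (own ?x' (?D (a + b))) \<le> C * (K ^ N * (C * norm (own x (a + b))))"
    using own(5)[of ?x' "?D (a + b)"] funpow_deriv_bound[OF C1_diffeoD(2)[OF f(1)] f(2) K, of N x "a + b"]
      own(6)[of x "a + b"] C0 zero_le_power[OF K, of N]
    by (meson mult_left_mono order_trans)
  then have 3: "norm (own ?x' (?D (a + b))) \<le> C * C * K ^ N * norm (own x (a + b))" by (simp add: mult_ac)
  have "own ?x' (?D b) = own ?x' (?D (a + b)) - own ?x' (?D a)"
    by (simp add: linear_add[OF lD] linear_add[OF own(1)])
  then have 4: "norm (own ?x' (?D b)) \<le> norm (own ?x' (?D (a + b))) + norm (own ?x' (?D a))"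
    by (simp add: norm_triangle_ineq4)
  have "own x a = own x (a + b) - own x b" by (simp add: linear_add[OF own(1)])
  then have 5: "norm (own x a) \<le> norm (own x (a + b)) + norm (own x b)"
    by (simp add: norm_triangle_ineq4)
  let ?Q = "C * C * K ^ N * norm (own x (a + b))"
  have Q0: "?Q \<ge> 0" using C0 K by simp
  \<comment> \<open>Facts 1 to 5 combine to
    \<open>4 * norm b \<le> ?Q + (norm (a + b) + norm b) / 4\<close> in these coordinates;
    multiplication by 4 and absorption of \<open>norm b\<close> give 15.\<close>
  have "15 * norm (own x b) \<le> 4 * ?Q + norm (own x (a + b))" using 1 2 3 4 5 by linarith
  then have "norm (own x b) \<le> ?Q + norm (own x (a + b))" using Q0 norm_ge_zero[of "own x (a + b)"] by linarith
  then show "norm (own x b) \<le> (C * C * K ^ N + 2) * norm (own x (a + b))"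
    "norm (own x a) \<le> (C * C * K ^ N + 2) * norm (own x (a + b))"
    using 5 norm_ge_zero[of "own x (a + b)"] unfolding distrib_right by linarith+
qed

lemma subbundle_subspace:
  assumes "continuous_subbundle A \<Lambda> E" "x \<in> \<Lambda>" shows "subspace (E x)"
proof -
  from bspec[OF assms(1)[unfolded continuous_subbundle_def] assms(2)]
  obtain U k and b :: "nat \<Rightarrow> 'a \<Rightarrow> 'e" where U: "x \<in> U"
    and sp: "\<forall>y\<in>\<Lambda> \<inter> U. inj_on (\<lambda>i. b i y) {..<k} \<and> independent ((\<lambda>i. b i y) ` {..<k}) \<and>
      span ((\<lambda>i. b i y) ` {..<k}) = E y"
    by (elim exE conjE) (rule that)
  have "span ((\<lambda>i. b i x) ` {..<k}) = E x" using bspec[OF sp, of x] U assms(2) by blast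
  then show ?thesis using subspace_span by metis
qed

text \<open>The kernel propagates the stable part of a vector placed at time \<open>k\<close> to
  later times, and minus its unstable part to earlier times. The constant \<open>D\<close> contains
  \<open>c\<close> from the decay, \<open>Q\<close> from the norms of the projections and
  \<open>C * C\<close> from passing between Riemannian and coordinate norms; it is fixed before
  \<open>f\<close>, \<open>\<Lambda>\<close> and \<open>x\<close>.\<close>

lemma hyperbolic_green_kernel:
  assumes lam: "0 < lam" "lam < 1" and c: "c > 0" and K: "K \<ge> 0"
  obtains D where "D > 0"
    "\<And>f \<Lambda> x. C1_diffeo A f \<Longrightarrow> hyperbolic_set A G f lam c \<Lambda> \<Longrightarrow> deriv_bounded A G f K \<Longrightarrow> x \<in> \<Lambda> \<Longrightarrow>
      \<exists>Gk. green_kernel (lin f x) Gk D lam (C * C * K)"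
proof -
  have C0: "C > 0" using C by simp
  \<comment> \<open>The number of steps after which \<open>stable_unstable_angle\<close> applies. It
    depends on \<open>lam\<close>, \<open>c\<close> and \<open>C\<close> only, hence
    \<open>Q\<close> does not depend on \<open>f\<close>.\<close>
  obtain N where N: "lam ^ N < 1 / (4 * C * C * c)"
    using real_arch_pow_inv[of "1 / (4 * C * C * c)" lam] lam C0 c by auto
  then have N4: "C * C * c * lam ^ N \<le> 1/4" using C0 c by (simp add: field_simps)
  define Q where "Q = C * C * K ^ N + 2"
  have Q: "Q > 0" using C0 K by (simp add: Q_def add_nonneg_pos)
  define D where "D = C * C * c * Q"
  have D: "D > 0" using C0 c Q by (simp add: D_def)
  show ?thesis
  proof (rule that[OF D])
    fix f \<Lambda> x assume f: "C1_diffeo A f" and hyp: "hyperbolic_set A G f lam c \<Lambda>" and fK: "deriv_bounded A G f K" and x: "x \<in> \<Lambda>"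
    note bf = C1_diffeoD(1)[OF f] and cf = C1_diffeoD(2)[OF f]
    obtain Es Eu where inv: "f ` \<Lambda> = \<Lambda>"
      and sub: "continuous_subbundle A \<Lambda> Es" "continuous_subbundle A \<Lambda> Eu"
      and split: "\<forall>x\<in>\<Lambda>. Es x \<inter> Eu x = {0} \<and> {u + v |u v. u \<in> Es x \<and> v \<in> Eu x} = UNIV"
      and dinv: "\<forall>x\<in>\<Lambda>. tderiv A f x ` Es x = Es (f x) \<and> tderiv A f x ` Eu x = Eu (f x)"
      and est: "\<forall>x\<in>\<Lambda>. \<forall>n.
           (\<forall>v\<in>Es x. rnorm G ((f ^^ n) x) (tderiv A (f ^^ n) x v) \<le> c * lam ^ n * rnorm G x v) \<and>
           (\<forall>v\<in>Eu x. rnorm G ((inv f ^^ n) x) (tderiv A (inv f ^^ n) x v) \<le> c * lam ^ n * rnorm G x v)"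
      using hyp unfolding hyperbolic_set_def by (elim exE conjE) (rule that)
    have sE: "subspace (Es x)" "subspace (Eu x)" if "x \<in> \<Lambda>" for x using sub that by (auto intro: subbundle_subspace)
    have "\<forall>x v. \<exists>a. x \<in> \<Lambda> \<longrightarrow> a \<in> Es x \<and> v - a \<in> Eu x"
    proof (intro allI)
      fix x v show "\<exists>a. x \<in> \<Lambda> \<longrightarrow> a \<in> Es x \<and> v - a \<in> Eu x"
      proof (cases "x \<in> \<Lambda>")
        case True
        then have "v \<in> {u + v |u v. u \<in> Es x \<and> v \<in> Eu x}" using split by simp
        then obtain a b where "v = a + b" "a \<in> Es x" "b \<in> Eu x" by blast
        then have "a \<in> Es x \<and> v - a \<in> Eu x" by simp
        then show ?thesis by blast
      qed simp
    qed
    then obtain P where P0: "\<forall>x v. x \<in> \<Lambda> \<longrightarrow> P x v \<in> Es x \<and> v - P x v \<in> Eu x" by metis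
    \<comment> \<open>The stable component along the given splitting. Invariance of the splitting
      makes it commute with the derivative of \<open>f\<close>.\<close>
    have P: "P x v \<in> Es x" "v - P x v \<in> Eu x" if "x \<in> \<Lambda>" for x v using P0 that by blast+
    have uniq: "P x v = a" if "x \<in> \<Lambda>" "a \<in> Es x" "v - a \<in> Eu x" for x v a
    proof -
      have "P x v - a \<in> Es x" using subspace_diff[OF sE(1)[OF that(1)] P(1)[OF that(1)] that(2)] .
      moreover have "P x v - a \<in> Eu x" using subspace_diff[OF sE(2)[OF that(1)] that(3) P(2)[OF that(1), of v]] by simp
      ultimately have "P x v - a \<in> {0}" using split that(1) by blast
      then show ?thesis by simp
    qed
    have linP: "linear (P x)" if x: "x \<in> \<Lambda>" for x
    proof (rule linearI)
      fix v w r
      have "v + w - (P x v + P x w) = (v - P x v) + (w - P x w)" by simp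
      then have "v + w - (P x v + P x w) \<in> Eu x" using subspace_add[OF sE(2)[OF x] P(2)[OF x] P(2)[OF x]] by metis
      then show "P x (v + w) = P x v + P x w" by (intro uniq x subspace_add[OF sE(1)[OF x]] P)
      have "r *\<^sub>R v - r *\<^sub>R P x v = r *\<^sub>R (v - P x v)" by (simp add: scaleR_diff_right)
      then have "r *\<^sub>R v - r *\<^sub>R P x v \<in> Eu x" using subspace_scale[OF sE(2)[OF x] P(2)[OF x]] by metis
      then show "P x (r *\<^sub>R v) = r *\<^sub>R P x v" by (intro uniq x subspace_scale[OF sE(1)[OF x]] P)
    qed
    have fx: "f x \<in> \<Lambda>" if "x \<in> \<Lambda>" for x using inv that by blast
    have Pf: "P (f x) (tderiv A f x v) = tderiv A f x (P x v)" if x: "x \<in> \<Lambda>" for x v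
    proof (rule uniq[OF fx[OF x]])
      show "tderiv A f x (P x v) \<in> Es (f x)" using dinv x P(1)[OF x, of v] by blast
      have "tderiv A f x v - tderiv A f x (P x v) = tderiv A f x (v - P x v)" by (simp add: linear_diff[OF linear_tderiv[OF cf]])
      moreover have "tderiv A f x (v - P x v) \<in> tderiv A f x ` Eu x" by (rule imageI[OF P(2)[OF x]])
      ultimately show "tderiv A f x v - tderiv A f x (P x v) \<in> Eu (f x)" using bspec[OF dinv x] by simp
    qed
    have Eun: "tderiv A (f ^^ n) x v \<in> Eu ((f ^^ n) x) \<and> (f ^^ n) x \<in> \<Lambda>" if "x \<in> \<Lambda>" "v \<in> Eu x" for n x v
    proof (induction n)
      case 0 show ?case using that unfolding tderiv_funpow(1)[OF cf] by simp
    next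
      case (Suc n)
      then have "tderiv A f ((f ^^ n) x) (tderiv A (f ^^ n) x v) \<in> Eu (f ((f ^^ n) x))" using dinv by blast
      moreover have "f ((f ^^ n) x) \<in> \<Lambda>" using Suc fx by blast
      moreover have "(f ^^ Suc n) x = f ((f ^^ n) x)" by simp
      ultimately show ?case unfolding tderiv_funpow(2)[OF cf] by metis
    qed
    have ret: "tderiv A (inv f ^^ n) ((f ^^ n) x) (tderiv A (f ^^ n) x v) = v" "(inv f ^^ n) ((f ^^ n) x) = x" for n x v
    proof -
      have id: "inv f ^^ n \<circ> f ^^ n = id"
        using inv_fn_o_fn_is_id[OF bf, of n] inv_fn[OF bf, of n] by (simp add: fun_eq_iff o_def)
      show "(inv f ^^ n) ((f ^^ n) x) = x" using fun_cong[OF id, of x] by simp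
      show "tderiv A (inv f ^^ n) ((f ^^ n) x) (tderiv A (f ^^ n) x v) = v"
        using tderiv_comp[OF C1_map_funpow[OF cf, of n] C1_map_funpow[OF C1_diffeoD(3)[OF f], of n], of x v]
        unfolding id tderiv_id by (rule sym)
    qed
    have angle: "norm (own x (P x v)) \<le> Q * norm (own x v)" "norm (own x (v - P x v)) \<le> Q * norm (own x v)"
      if x: "x \<in> \<Lambda>" for x v
    proof -
      have a: "rnorm G ((f ^^ N) x) (tderiv A (f ^^ N) x (P x v)) \<le> c * lam ^ N * rnorm G x (P x v)"
        using est x P(1)[OF x] by blast
      have b: "rnorm G x (v - P x v) \<le> c * lam ^ N * rnorm G ((f ^^ N) x) (tderiv A (f ^^ N) x (v - P x v))"
        using est Eun[OF x P(2)[OF x, of v], of N] ret(1)[of N x "v - P x v"] ret(2)[of N x] by metis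
      show "norm (own x (P x v)) \<le> Q * norm (own x v)" "norm (own x (v - P x v)) \<le> Q * norm (own x v)"
        using stable_unstable_angle[OF f fK K N4 a b] c lam by (simp_all add: Q_def)
    qed
    let ?x = "\<lambda>n. zpow f n x"
    have xL: "?x n \<in> \<Lambda>" for n by (rule zpow_in[OF bf inv x])
    define V where "V k a = disown (?x k) a" for k a
    define Gk where "Gk n k a = (if k \<le> n
      then own (?x n) (tderiv A (zpow f (n - k)) (?x k) (P (?x k) (V k a)))
      else - own (?x n) (tderiv A (zpow f (n - k)) (?x k) (V k a - P (?x k) (V k a))))" for n k a
    have xx: "zpow f (n - k) (?x k) = ?x n" for n k using zpow_add[OF bf, of "n - k" k x] by simp
    have xs: "?x (k + 1) = f (?x k)" for k by (simp add: zpow_Suc(1)[OF bf])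
    have lown: "own y (u - v) = own y u - own y v" "own y (u + v) = own y u + own y v" "own y (- u) = - own y u" for y u v
      using linear_diff[OF own(1)] linear_add[OF own(1)] linear_neg[OF own(1)] by auto
    have linlin: "linear (lin f x n)" for n
      unfolding lin_def by (rule linear_locd[OF cf nbh_self nbh_self, of 0 0]) auto
    have Vs: "V (k + 1) (lin f x k a) = tderiv A f (?x k) (V k a)" for k a
      using lin_own[OF f, of x k "V k a"] own(3,4) unfolding V_def by metis
    have oV: "own (?x k) (V k a) = a" for k a by (simp add: V_def own)
    have dS: "tderiv A (zpow f (n + 1 - k)) (?x k) v = tderiv A f (?x n) (tderiv A (zpow f (n - k)) (?x k) v)" for n k v
      using tderiv_zpow_Suc(1)[OF f, of "n - k" "?x k" v] xx[of n k] by (simp add: algebra_simps)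
    have dS2: "tderiv A (zpow f (n - k)) (?x k) v = tderiv A (zpow f (n - (k + 1))) (?x (k + 1)) (tderiv A f (?x k) v)" for n k v
      using tderiv_zpow_Suc(2)[OF f, of "n - (k + 1)" "?x k" v] unfolding xs by simp
    have "green_kernel (lin f x) Gk D lam (C * C * K)"
    proof (rule green_kernel.intro)
      show "0 < lam" "lam < 1" "0 < D" "0 \<le> C * C * K" using lam D C0 K by auto
      fix n k :: int and v :: 'e
      show "linear (lin f x n)" by (rule linlin)
      show "norm (lin f x n v) \<le> C * C * K * norm v"
        unfolding lin_def by (rule locd_bound[OF cf fK K nbh_self nbh_self]) (use R in auto)
      show "linear (Gk n k)"
      proof -
        have lV: "linear (V k)" unfolding V_def[abs_def] by (rule own(2))
        have l1: "linear (\<lambda>a. P (?x k) (V k a))" using linear_compose[OF lV linP[OF xL]] by (simp add: o_def)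
        have l2: "linear (\<lambda>a. V k a - P (?x k) (V k a))" by (rule linear_compose_sub[OF lV l1])
        have l3: "linear (\<lambda>v. own (?x n) (tderiv A (zpow f (n - k)) (?x k) v))"
          using linear_compose[OF linear_tderiv[OF C1_map_zpow[OF f]] own(1)] by (simp add: o_def)
        show ?thesis
          using linear_compose[OF l1 l3] linear_compose_neg[OF linear_compose[OF l2 l3]]
          by (cases "k \<le> n") (simp_all add: Gk_def[abs_def] o_def)
      qed
      show "norm (Gk n k v) \<le> D * lam ^ nat \<bar>n - k\<bar> * norm v"
      proof (cases "k \<le> n")
        case True
        define m where "m = nat (n - k)"
        have m: "zpow f (n - k) = f ^^ m" "nat \<bar>n - k\<bar> = m" using True zpow_nat(1)[of f m] by (auto simp: m_def)
        let ?w = "P (?x k) (V k v)"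
        have "rnorm G (?x n) (tderiv A (f ^^ m) (?x k) ?w) \<le> c * lam ^ m * rnorm G (?x k) ?w"
          using est xL P(1)[OF xL] xx[of n k] m by metis
        also have "\<dots> \<le> c * lam ^ m * (C * (Q * norm v))"
          using angle(1)[OF xL, of k "V k v"] own(6)[of "?x k" ?w] C0 c lam unfolding oV
          by (meson mult_left_mono order_trans less_imp_le mult_nonneg_nonneg zero_le_power)
        finally have "C * rnorm G (?x n) (tderiv A (f ^^ m) (?x k) ?w) \<le> C * (c * lam ^ m * (C * (Q * norm v)))"
          using C0 by (intro mult_left_mono) auto
        then show ?thesis
          using own(5)[of "?x n" "tderiv A (f ^^ m) (?x k) ?w"] True unfolding Gk_def m D_def by (simp add: mult_ac)
      next
        case False
        define m where "m = nat (k - n)"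
        have "n - k = - int m" using False by (simp add: m_def)
        then have m: "zpow f (n - k) = inv f ^^ m" "nat \<bar>n - k\<bar> = m" using False zpow_nat(2)[of f m] by (auto simp: m_def)
        let ?w = "V k v - P (?x k) (V k v)"
        have "rnorm G (?x n) (tderiv A (inv f ^^ m) (?x k) ?w) \<le> c * lam ^ m * rnorm G (?x k) ?w"
          using est xL P(2)[OF xL] xx[of n k] m by metis
        also have "\<dots> \<le> c * lam ^ m * (C * (Q * norm v))"
          using angle(2)[OF xL, of k "V k v"] own(6)[of "?x k" ?w] C0 c lam unfolding oV
          by (meson mult_left_mono order_trans less_imp_le mult_nonneg_nonneg zero_le_power)
        finally have "C * rnorm G (?x n) (tderiv A (inv f ^^ m) (?x k) ?w) \<le> C * (c * lam ^ m * (C * (Q * norm v)))"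
          using C0 by (intro mult_left_mono) auto
        then show ?thesis
          using own(5)[of "?x n" "tderiv A (inv f ^^ m) (?x k) ?w"] False unfolding Gk_def m D_def by (simp add: mult_ac)
      qed
      show "Gk (n + 1) k v = lin f x n (Gk n k v) + (if k = n + 1 then v else 0)"
      proof -
        have ln: "lin f x n (own (?x n) (tderiv A (zpow f (n - k)) (?x k) u)) = own (?x (n + 1)) (tderiv A (zpow f (n + 1 - k)) (?x k) u)" for u
          unfolding lin_own[OF f] dS ..
        \<comment> \<open>Away from \<open>k = n + 1\<close> both sides use the same branch. There
          the left side is the stable part of \<open>v\<close> and the propagated kernel is minus
          its unstable part, so they differ by \<open>v\<close>.\<close>
        consider "k \<le> n" | "k = n + 1" | "n + 1 < k" by linarith
        then show ?thesis
        proof cases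
          case 2
          have "lin f x n (Gk n k v) = - own (?x (n + 1)) (tderiv A (zpow f (n + 1 - k)) (?x k) (V k v - P (?x k) (V k v)))"
          proof -
            have nk: "\<not> k \<le> n" using 2 by simp
            show ?thesis unfolding Gk_def if_not_P[OF nk] linear_neg[OF linlin] ln ..
          qed
          also have "\<dots> = - own (?x k) (V k v - P (?x k) (V k v))" using 2 by (simp add: tderiv_zpow_0)
          finally show ?thesis using 2 by (simp add: Gk_def tderiv_zpow_0 lown oV)
        qed (simp_all add: Gk_def ln linear_neg[OF linlin])
      qed
      show "Gk n k v = Gk n (k + 1) (lin f x k v) + (if k = n then v else 0)"
      proof -
        have e1: "tderiv A (zpow f (n - (k + 1))) (?x (k + 1)) (P (?x (k + 1)) (V (k + 1) (lin f x k v)))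
            = tderiv A (zpow f (n - k)) (?x k) (P (?x k) (V k v))"
          unfolding Vs xs Pf[OF xL] using dS2[of n k] unfolding xs by simp
        have e2: "tderiv A (zpow f (n - (k + 1))) (?x (k + 1)) (V (k + 1) (lin f x k v) - P (?x (k + 1)) (V (k + 1) (lin f x k v)))
            = tderiv A (zpow f (n - k)) (?x k) (V k v - P (?x k) (V k v))"
          unfolding Vs xs Pf[OF xL] using dS2[of n k "V k v - P (?x k) (V k v)"] unfolding xs
          by (simp add: linear_diff[OF linear_tderiv[OF cf]])
        consider "k + 1 \<le> n" | "k = n" | "n < k" by linarith
        then show ?thesis
        proof cases
          case 2
          have "Gk n (k + 1) (lin f x k v) = - own (?x n) (V k v - P (?x k) (V k v))"
            unfolding Gk_def e2 using 2 by (simp add: tderiv_zpow_0)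
          then show ?thesis using 2 by (simp add: Gk_def tderiv_zpow_0 lown oV)
        qed (simp_all add: Gk_def e1 e2)
      qed
    qed
    then show "\<exists>Gk. green_kernel (lin f x) Gk D lam (C * C * K)" by blast
  qed
qed

subsection \<open>Shadowing\<close>

text \<open>The mean value inequality on a coordinate ball, which is convex, for the coordinate form
  of \<open>g\<close> minus the derivative of \<open>f\<close> at the centre: by \<open>near\<close>
  its derivative has norm at most \<open>\<eta>\<close>.\<close>

lemma near_lipschitz:
  assumes f: "C1_map A f" and g: "C1_map A g" and near: "near f g s \<eta>" and s: "s \<le> R"
    and y: "y \<in> nbh x s" "y' \<in> nbh x s"
  shows "norm (loc (f x) (g y) - loc (f x) (g y') - locd x (f x) f x (loc x y - loc x y'))
    \<le> \<eta> * norm (loc x y - loc x y')"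
proof -
  let ?c = "\<kappa> x" and ?d = "\<kappa> (f x)"
  let ?L = "locd x (f x) f x"
  let ?H = "\<lambda>u. (cmap ?d \<circ> g \<circ> cinv ?c) (cmap ?c x + u) - ?L u"
  have linL: "linear ?L" by (rule linear_locd[OF f nbh_self nbh_self, of 0 0]) auto
  have in_s: "loc x z \<in> cball 0 s" if "z \<in> nbh x s" for z using nbhD(2)[OF that] by simp
  have "norm (?H (loc x y) - ?H (loc x y')) \<le> \<eta> * norm (loc x y - loc x y')"
  proof (rule differentiable_bound[OF convex_cball])
    fix u :: 'e assume u: "u \<in> cball 0 s"
    define z where "z = unloc x u"
    have z: "z \<in> nbh x s" unfolding z_def by (rule unloc(3)) (use u s in auto)
    have gz: "g z \<in> nbh (f x) R" using near z unfolding near_def by blast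
    have uz: "cmap ?c x + u = cmap ?c z"
      using unloc(2)[of u x] u s unfolding z_def loc_def by (simp add: algebra_simps)
    have d1: "((cmap ?d \<circ> g \<circ> cinv ?c) has_derivative locd x (f x) g z) (at (cmap ?c x + u))"
      unfolding uz locd_def by (rule has_derivative_lderiv[OF g \<kappa>(1) \<kappa>(1) nbhD(1)[OF z] nbhD(1)[OF gz]])
    have "((\<lambda>u. cmap ?c x + u) has_derivative (\<lambda>u. u)) (at u)" by (auto intro!: derivative_eq_intros)
    from has_derivative_compose[OF this d1]
    have "((\<lambda>u. (cmap ?d \<circ> g \<circ> cinv ?c) (cmap ?c x + u)) has_derivative locd x (f x) g z) (at u)" .
    from has_derivative_diff[OF this bounded_linear_imp_has_derivative[of ?L]] linL
    have "(?H has_derivative (\<lambda>a. locd x (f x) g z a - ?L a)) (at u)"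
      by (simp add: linear_conv_bounded_linear)
    then show "(?H has_derivative (\<lambda>a. locd x (f x) g z a - ?L a)) (at u within cball 0 s)"
      by (rule has_derivative_at_withinI)
    show "onorm (\<lambda>a. locd x (f x) g z a - ?L a) \<le> \<eta>"
      by (rule onorm_le) (use near z in \<open>auto simp: near_def\<close>)
  qed (use in_s y in auto)
  moreover have "(cmap ?d \<circ> g \<circ> cinv ?c) (cmap ?c x + loc x z) = cmap ?d (g z)" if "z \<in> nbh x s" for z
    using nbhD(1)[OF that] \<kappa> by (simp add: loc_def cinv_cmap)
  ultimately show ?thesis using y by (simp add: linear_diff[OF linL] loc_def algebra_simps)
qed

text \<open>In displacements from the orbit of \<open>x\<close>, the equation of a
  \<open>g\<close>-orbit is a perturbation of \<open>lin f x\<close>. At displacement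
  \<open>0\<close> its error is the distance from \<open>f\<close> to \<open>g\<close>, at most
  \<open>\<beta>\<close>. The weight is constant, so \<open>\<mu> = 1\<close>; the radius obtained
  is proportional to \<open>\<beta>\<close>.\<close>

lemma ex_shadow:
  assumes f: "C1_diffeo A f" and g: "C1_map A g" and near: "near f g s \<eta>" and s: "s \<le> R" and \<eta>: "\<eta> \<ge> 0"
    and Gk: "green_kernel (lin f x) Gk D lam B" and D1: "D * (2 / (1 - lam)) * \<eta> \<le> 1/2"
    and \<beta>: "\<And>z. norm (loc (f z) (g z)) \<le> \<beta>" "2 * (D * (2 / (1 - lam))) * \<beta> \<le> s"
  shows "\<exists>y. (\<forall>n. y n \<in> nbh (zpow f n x) (2 * (D * (2 / (1 - lam))) * \<beta>)) \<and> (\<forall>n. y (n + 1) = g (y n))"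
proof -
  interpret green_kernel "lin f x" Gk D lam B by (rule Gk)
  interpret W: weighted_green_kernel "lin f x" Gk D lam B "\<lambda>_. 1" 1 by (rule weighted_const)
  have D1e: "W.D1 = D * (2 / (1 - lam))" by (simp add: W.D1_def)
  let ?x = "\<lambda>n. zpow f n x"
  let ?\<rho> = "2 * (D * (2 / (1 - lam))) * \<beta>"
  have xs: "?x (n + 1) = f (?x n)" for n by (simp add: zpow_Suc(1)[OF C1_diffeoD(1)[OF f]])
  have \<beta>0: "\<beta> \<ge> 0" using \<beta>(1) norm_ge_zero order_trans by blast
  have D1p: "D * (2 / (1 - lam)) > 0" using W.D1_pos unfolding D1e .
  have \<rho>0: "?\<rho> \<ge> 0" by (intro mult_nonneg_nonneg less_imp_le[OF D1p] \<beta>0) simp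
  have un: "unloc (?x n) u \<in> nbh (?x n) s" "loc (?x n) (unloc (?x n) u) = u" if "norm u \<le> ?\<rho> * 1" for n u
    using unloc(2,3)[where u=u and x="?x n"] that s \<beta>(2) by auto
  have Z: "norm (0::'e) \<le> ?\<rho> * 1" using \<rho>0 by simp
  have u0: "unloc y 0 = y" for y using unloc_loc[OF \<kappa>(2)] loc_self by metis
  obtain w where w: "\<And>n. norm (w n) \<le> ?\<rho> * 1" "\<And>n. w (n + 1) = loc (?x (n + 1)) (g (unloc (?x n) (w n)))"
  proof -
    have "\<exists>w. (\<forall>n. norm (w n) \<le> ?\<rho> * 1) \<and> (\<forall>n. w (n + 1) = loc (?x (n + 1)) (g (unloc (?x n) (w n))))"
    proof (rule W.ex_perturbed_orbit[OF \<rho>0 \<eta> _ \<beta>0, where F="\<lambda>n u. loc (?x (n + 1)) (g (unloc (?x n) u))"])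
      show "W.D1 * \<eta> / 1 \<le> 1 / 2" using D1 unfolding D1e by simp
      have "d * \<beta> \<le> 2 * d * \<beta> / 2" for d by simp
      then show "W.D1 * \<beta> \<le> ?\<rho> / 2" unfolding D1e .
      show "norm (loc (?x (n + 1)) (g (unloc (?x n) 0))) \<le> \<beta> * 1" for n
        unfolding u0 xs using \<beta>(1) by simp
      fix n and u v :: 'e assume u: "norm u \<le> ?\<rho> * 1" and v: "norm v \<le> ?\<rho> * 1"
      show "norm (loc (?x (n + 1)) (g (unloc (?x n) u)) - loc (?x (n + 1)) (g (unloc (?x n) v)) - lin f x n (u - v)) \<le> \<eta> * norm (u - v)"
        using near_lipschitz[OF C1_diffeoD(2)[OF f] g near s un(1)[OF u] un(1)[OF v]]
        unfolding un(2)[OF u] un(2)[OF v] lin_def xs .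
    qed
    then show ?thesis using that by blast
  qed
  show ?thesis
  proof (intro exI[of _ "\<lambda>n. unloc (?x n) (w n)"] conjI allI)
    show "unloc (?x n) (w n) \<in> nbh (?x n) ?\<rho>" for n
      using w(1)[of n] \<beta>(2) s by (intro unloc(3)) auto
    show "unloc (?x (n + 1)) (w (n + 1)) = g (unloc (?x n) (w n))" for n
    proof -
      have "g (unloc (?x n) (w n)) \<in> nbh (f (?x n)) R" using near un(1)[OF w(1)] unfolding near_def by blast
      then show ?thesis unfolding w(2) xs by (rule unloc_loc[OF nbhD(1)])
    qed
  qed
qed

text \<open>The difference of the two displacement sequences satisfies the linear equation up to a
  relative error \<open>\<eta>\<close>, and on the window it is at most
  \<open>2 * s\<close>.\<close>

lemma window_orbits:
  assumes f: "C1_diffeo A f" and g: "C1_map A g" and near: "near f g s \<eta>" and s: "0 \<le> s" "s \<le> R" and \<eta>: "\<eta> \<ge> 0"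
    and Gk: "green_kernel (lin f x) Gk D lam B"
    and \<mu>: "lam < \<mu>" "\<mu> < 1" "D * (2 / (1 - lam / \<mu>)) * \<eta> / \<mu> \<le> 1/2"
    and y: "\<And>n. \<bar>n\<bar> \<le> int N \<Longrightarrow> y n \<in> nbh (zpow f n x) s" "\<And>n. y (n + 1) = g (y n)"
    and y': "\<And>n. \<bar>n\<bar> \<le> int N \<Longrightarrow> y' n \<in> nbh (zpow f n x) s" "\<And>n. y' (n + 1) = g (y' n)"
  shows "norm (loc x (y 0) - loc x (y' 0)) \<le> 2 * (D * (2 / (1 - lam / \<mu>))) * ((1 + B) * (2 * s)) * \<mu> ^ N"
proof -
  let ?x = "\<lambda>n. zpow f n x"
  let ?d = "\<lambda>n. loc (?x n) (y n) - loc (?x n) (y' n)"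
  have xs: "?x (n + 1) = f (?x n)" for n by (simp add: zpow_Suc(1)[OF C1_diffeoD(1)[OF f]])
  have "norm (?d 0) \<le> 2 * (D * (2 / (1 - lam / \<mu>))) * ((1 + B) * (2 * s)) * \<mu> ^ N"
  proof (rule green_kernel.window_estimate[OF Gk \<mu>(1,2) \<eta> \<mu>(3)])
    show "0 \<le> 2 * s" using s by simp
    show "norm (?d n) \<le> 2 * s" if "\<bar>n\<bar> \<le> int N" for n
      using norm_triangle_ineq4[of "loc (?x n) (y n)" "loc (?x n) (y' n)"] nbhD(2)[OF y(1)[OF that]] nbhD(2)[OF y'(1)[OF that]]
      by linarith
    show "norm (?d (n + 1) - lin f x n (?d n)) \<le> \<eta> * norm (?d n)" if "- int N \<le> n" "n < int N" for n
      unfolding y(2) y'(2) xs lin_def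
      by (rule near_lipschitz[OF C1_diffeoD(2)[OF f] g near s(2) y(1) y'(1)]) (use that in auto)
  qed
  then show ?thesis by (simp add: zpow_0)
qed

lemma unique_orbit:
  assumes f: "C1_diffeo A f" and g: "C1_map A g" and near: "near f g s \<eta>" and s: "0 \<le> s" "s \<le> R" and \<eta>: "\<eta> \<ge> 0"
    and Gk: "green_kernel (lin f x) Gk D lam B"
    and \<mu>: "lam < \<mu>" "\<mu> < 1" "D * (2 / (1 - lam / \<mu>)) * \<eta> / \<mu> \<le> 1/2"
    and y: "\<And>n. y n \<in> nbh (zpow f n x) s" "\<And>n. y (n + 1) = g (y n)"
    and y': "\<And>n. y' n \<in> nbh (zpow f n x) s" "\<And>n. y' (n + 1) = g (y' n)"
  shows "y 0 = y' 0"
proof -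
  have "lam > 0" by (rule green_kernel.lam(1)[OF Gk])
  let ?Y = "2 * (D * (2 / (1 - lam / \<mu>))) * ((1 + B) * (2 * s))"
  have "(\<lambda>N. ?Y * \<mu> ^ N) \<longlonglongrightarrow> ?Y * 0"
    using \<mu> \<open>lam > 0\<close> by (intro tendsto_mult tendsto_const LIMSEQ_power_zero) auto
  moreover have "norm (loc x (y 0) - loc x (y' 0)) \<le> ?Y * \<mu> ^ N" for N
    by (rule window_orbits[OF f g near s \<eta> Gk \<mu> y y'])
  ultimately have "norm (loc x (y 0) - loc x (y' 0)) \<le> ?Y * 0" by (intro LIMSEQ_le_const) auto
  then have "loc x (y 0) = loc x (y' 0)" by simp
  then show ?thesis using nbhD(1)[OF y(1)[of 0]] nbhD(1)[OF y'(1)[of 0]] loc_inj by (simp add: zpow_0)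
qed

text \<open>Changing the base point costs \<open>C * C\<close>: one factor to bound the length of a
  coordinate segment in the chart at \<open>z\<close>, one to read this length in the chart at
  \<open>x\<close>.\<close>

lemma nbh_trans:
  assumes y: "y \<in> nbh z b" and b: "b \<le> R" and a: "a + C * (C * b) < R"
  shows "z \<in> nbh x a \<Longrightarrow> y \<in> nbh x (a + C * (C * b))" "y \<in> nbh x a \<Longrightarrow> z \<in> nbh x (a + C * (C * b))"
proof -
  have b0: "b \<ge> 0" using nbhD(2)[OF y] norm_ge_zero order_trans by blast
  note zb = nbh_self[OF b0, of z]
  have C0: "C \<ge> 0" using C by simp
  have d: "C * norm (loc z y - loc z z) \<le> C * b" "C * norm (loc z z - loc z y) \<le> C * b"
    using nbhD(2)[OF y] C0 by (auto simp: loc_self intro: mult_left_mono)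
  have end_in: "v \<in> nbh x (a + C * (C * b))"
    if \<gamma>: "pw_C1_curve A \<gamma>" "\<gamma> 0 = u" "\<gamma> 1 = v" "curve_length A G \<gamma> \<le> C * b" and u: "u \<in> nbh x a" for \<gamma> u v
  proof -
    have l: "C * curve_length A G \<gamma> \<le> C * (C * b)" using \<gamma>(4) C0 by (rule mult_left_mono)
    have "v \<in> nbh x (a + C * curve_length A G \<gamma>)"
      using stays(3)[OF \<gamma>(1), of x a 1] \<gamma>(2,3) u l a by simp
    then show ?thesis by (rule nbh_mono[rotated]) (use l in simp)
  qed
  show "y \<in> nbh x (a + C * (C * b))" if "z \<in> nbh x a"
  proof -
    obtain \<gamma> where "pw_C1_curve A \<gamma>" "\<gamma> 0 = z" "\<gamma> 1 = y" "curve_length A G \<gamma> \<le> C * norm (loc z y - loc z z)"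
      using segment[OF b zb y] by blast
    then show ?thesis using end_in[of \<gamma> z y] d(1) that by linarith
  qed
  show "z \<in> nbh x (a + C * (C * b))" if "y \<in> nbh x a"
  proof -
    obtain \<gamma> where "pw_C1_curve A \<gamma>" "\<gamma> 0 = y" "\<gamma> 1 = z" "curve_length A G \<gamma> \<le> C * norm (loc z z - loc z y)"
      using segment[OF b y zb] by blast
    then show ?thesis using end_in[of \<gamma> y z] d(2) that by linarith
  qed
qed

text \<open>The curve starts at \<open>y\<close>, so it is followed first in the chart centred at
  \<open>y\<close>, at the cost of one factor \<open>C\<close>. Exchanging the roles of the two
  points by \<open>nbh_trans\<close> costs two more.\<close>

lemma riem_dist_nbh:
  assumes "riem_dist A G y x < ennreal \<delta>" "C * (C * (C * \<delta>)) < R"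
  shows "y \<in> nbh x (C * (C * (C * \<delta>)))"
proof -
  obtain \<gamma> where "\<gamma> \<in> curves A y x" and len: "curve_length A G \<gamma> < \<delta>"
    using assms(1) unfolding riem_dist_less_iff by blast
  then have \<gamma>: "pw_C1_curve A \<gamma>" "\<gamma> 0 = y" "\<gamma> 1 = x" by (auto simp: curves_def pathstart_def pathfinish_def)
  have \<delta>0: "\<delta> > 0" using len curve_length_nonneg[of \<gamma>] by linarith
  have l: "C * curve_length A G \<gamma> \<le> C * \<delta>" using len C by (intro mult_left_mono) auto
  have "1 * (C * \<delta>) \<le> C * (C * \<delta>)" "1 * (C * (C * \<delta>)) \<le> C * (C * (C * \<delta>))" using C \<delta>0 by (intro mult_right_mono; simp)+
  then have CR: "C * \<delta> \<le> R" "C * \<delta> < R" using assms(2) by linarith+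
  have "x \<in> nbh y (0 + C * curve_length A G \<gamma>)"
    using stays(3)[OF \<gamma>(1), of y 0 1] \<gamma>(2,3) nbh_self[of 0 y] l CR by simp
  then have "x \<in> nbh y (C * \<delta>)" by (rule nbh_mono[rotated]) (use l in simp)
  from nbh_trans(2)[OF this CR(1), of 0 x] nbh_self[of 0 x] assms(2) show ?thesis by simp
qed

lemma nbh_riem_dist:
  assumes "y \<in> nbh x t" "t \<le> R" "C * t < \<delta>"
  shows "riem_dist A G y x < ennreal \<delta>"
proof -
  have t0: "t \<ge> 0" using nbhD(2)[OF assms(1)] norm_ge_zero order_trans by blast
  obtain \<gamma> where "\<gamma> \<in> curves A y x" "curve_length A G \<gamma> \<le> C * norm (loc x x - loc x y)"
    using segment[OF assms(2) assms(1) nbh_self[OF t0]] by blast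
  moreover have "C * norm (loc x x - loc x y) \<le> C * t"
    using nbhD(2)[OF assms(1)] C by (auto simp: loc_self intro: mult_left_mono)
  ultimately show ?thesis unfolding riem_dist_less_iff using assms(3) by force
qed

text \<open>Given a tolerance, a window is fixed on which two \<open>g\<close>-orbits near the orbit
  of \<open>x\<close> agree at time 0 up to that tolerance. If \<open>x'\<close> is so close to
  \<open>x\<close> that their \<open>f\<close>-orbits stay together during this window, then the
  orbit of \<open>h x'\<close> is such an orbit too.\<close>

lemma shadow_continuous:
  assumes f: "C1_diffeo A f" and g: "C1_map A g" and near: "near f g s \<eta>" and s: "0 < s" "s \<le> R" and \<eta>: "\<eta> \<ge> 0"
    and \<Lambda>: "f ` \<Lambda> = \<Lambda>"
    and Gk: "\<And>x. x \<in> \<Lambda> \<Longrightarrow> \<exists>Gk. green_kernel (lin f x) Gk D lam B"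
    and \<mu>: "lam < \<mu>" "\<mu> < 1" "D * (2 / (1 - lam / \<mu>)) * \<eta> / \<mu> \<le> 1/2"
    and h: "\<And>x. x \<in> \<Lambda> \<Longrightarrow> h x \<in> nbh x \<rho>" "\<And>x. x \<in> \<Lambda> \<Longrightarrow> h (f x) = g (h x)"
    and \<rho>: "\<rho> \<le> s" "s / 2 + C * (C * \<rho>) < s"
  shows "continuous_on \<Lambda> h"
  unfolding continuous_on_topological
proof (intro ballI allI impI)
  fix x U assume x: "x \<in> \<Lambda>" and U: "open U" "h x \<in> U"
  note bf = C1_diffeoD(1)[OF f]
  have \<rho>R: "\<rho> \<le> R" using \<rho> s by simp
  have hx: "h x \<in> cdom (\<kappa> x)" using nbhD(1)[OF h(1)[OF x]] .
  have "open (cmap (\<kappa> x) ` (U \<inter> cdom (\<kappa> x)))"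
    by (rule open_cmap_image[OF \<kappa>(1)]) (use U chart_open(1)[OF \<kappa>(1)] in auto)
  moreover have "cmap (\<kappa> x) (h x) \<in> cmap (\<kappa> x) ` (U \<inter> cdom (\<kappa> x))" using U hx by auto
  ultimately obtain e where e: "e > 0" "ball (cmap (\<kappa> x) (h x)) e \<subseteq> cmap (\<kappa> x) ` (U \<inter> cdom (\<kappa> x))"
    using openE by blast
  have inU: "y \<in> U" if y: "y \<in> cdom (\<kappa> x)" "norm (loc x (h x) - loc x y) < e" for y
  proof -
    have "cmap (\<kappa> x) y \<in> ball (cmap (\<kappa> x) (h x)) e" using y(2) by (simp add: loc_def dist_norm)
    then obtain z where "z \<in> U" "z \<in> cdom (\<kappa> x)" "cmap (\<kappa> x) y = cmap (\<kappa> x) z" using e(2) by blast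
    then show ?thesis using y(1) cinv_cmap[OF \<kappa>(1)] by metis
  qed
  obtain Gk where Gk: "green_kernel (lin f x) Gk D lam B" using Gk[OF x] by blast
  have "lam > 0" by (rule green_kernel.lam(1)[OF Gk])
  let ?Y = "2 * (D * (2 / (1 - lam / \<mu>))) * ((1 + B) * (2 * s))"
  have "(\<lambda>N. ?Y * \<mu> ^ N) \<longlonglongrightarrow> ?Y * 0"
    using \<mu> \<open>lam > 0\<close> by (intro tendsto_mult tendsto_const LIMSEQ_power_zero) auto
  then have "eventually (\<lambda>N. ?Y * \<mu> ^ N < e) sequentially" using e(1) by (intro order_tendstoD(2)) auto
  then obtain N where N: "?Y * \<mu> ^ N < e" by (auto simp: eventually_sequentially)
  obtain O' where O: "\<And>z. open (O' z) \<and> z \<in> O' z \<and> O' z \<subseteq> nbh z (s / 2)"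
    using open_nbh[of "s / 2"] s by (metis half_gt_zero)
  \<comment> \<open>Only finitely many iterates are constrained, so \<open>V\<close> is open. Of the
    tube of radius \<open>s\<close>, half is for the distance of the two \<open>f\<close>-orbits and
    the rest for that of \<open>h x'\<close> from \<open>x'\<close>.\<close>
  define V where "V = (\<Inter>n\<in>{- int N..int N}. zpow f n -` O' (zpow f n x))"
  show "\<exists>V. open V \<and> x \<in> V \<and> (\<forall>y\<in>\<Lambda>. y \<in> V \<longrightarrow> h y \<in> U)"
  proof (intro exI[of _ V] conjI ballI impI)
    show "open V" unfolding V_def
      by (intro open_INT ballI open_vimage C1_map_continuous[OF C1_map_zpow[OF f]]) (use O in auto)
    show "x \<in> V" using O by (simp add: V_def)
    fix x' assume x': "x' \<in> \<Lambda>" "x' \<in> V"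
    have xL: "zpow f n x \<in> \<Lambda>" "zpow f n x' \<in> \<Lambda>" for n using zpow_in[OF bf \<Lambda>] x x' by auto
    have step: "h (zpow f (n + 1) z) = g (h (zpow f n z))" if "z \<in> \<Lambda>" for n z
      using h(2)[OF zpow_in[OF bf \<Lambda> that]] by (simp add: zpow_Suc(1)[OF bf])
    have y1: "h (zpow f n x) \<in> nbh (zpow f n x) s" for n by (rule nbh_mono[OF \<rho>(1) h(1)[OF xL(1)]])
    have y2: "h (zpow f n x') \<in> nbh (zpow f n x) s" if n: "\<bar>n\<bar> \<le> int N" for n
    proof -
      have "n \<in> {- int N..int N}" using n by auto
      then have "zpow f n x' \<in> nbh (zpow f n x) (s / 2)" using x'(2) O unfolding V_def by blast
      from nbh_trans(1)[OF h(1)[OF xL(2)] \<rho>R _ this] \<rho>(2) s(2)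
      have "h (zpow f n x') \<in> nbh (zpow f n x) (s / 2 + C * (C * \<rho>))" by linarith
      then show ?thesis by (rule nbh_mono[rotated]) (use \<rho>(2) in simp)
    qed
    have "norm (loc x (h (zpow f 0 x)) - loc x (h (zpow f 0 x'))) \<le> ?Y * \<mu> ^ N"
      by (rule window_orbits[OF f g near less_imp_le[OF s(1)] s(2) \<eta> Gk \<mu>, where y="\<lambda>n. h (zpow f n x)" and y'="\<lambda>n. h (zpow f n x')"])
         (use y1 y2 step x x' in auto)
    then show "h x' \<in> U" using N nbhD(1)[OF y2[of 0]] by (intro inU) (auto simp: zpow_0)
  qed
qed

text \<open>If \<open>h x = h x'\<close>, the orbits of \<open>x\<close> and \<open>x'\<close> under
  \<open>f\<close> stay near a common \<open>g\<close>-orbit, hence near each other for all times.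
  Uniqueness of orbits in a tube, with \<open>f\<close> itself in place of \<open>g\<close>, then is
  expansivity.\<close>

lemma shadow_injective:
  assumes f: "C1_diffeo A f" and g: "C1_diffeo A g" and near: "near f f s \<eta>" and s: "0 < s" "s \<le> R" and \<eta>: "\<eta> \<ge> 0"
    and \<Lambda>: "f ` \<Lambda> = \<Lambda>"
    and Gk: "\<And>x. x \<in> \<Lambda> \<Longrightarrow> \<exists>Gk. green_kernel (lin f x) Gk D lam B"
    and \<mu>: "lam < \<mu>" "\<mu> < 1" "D * (2 / (1 - lam / \<mu>)) * \<eta> / \<mu> \<le> 1/2"
    and h: "\<And>x. x \<in> \<Lambda> \<Longrightarrow> h x \<in> nbh x \<rho>" "\<And>x. x \<in> \<Lambda> \<Longrightarrow> h (f x) = g (h x)"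
    and \<rho>: "\<rho> + C * (C * \<rho>) < s"
  shows "inj_on h \<Lambda>"
proof (rule inj_onI)
  fix x x' assume x: "x \<in> \<Lambda>" and x': "x' \<in> \<Lambda>" and eq: "h x = h x'"
  note bf = C1_diffeoD(1)[OF f] and bg = C1_diffeoD(1)[OF g]
  have orb: "h (zpow f n z) = zpow g n (h z)" if "z \<in> \<Lambda>" for n z
    using orbit_eq_zpow[OF bg, of "\<lambda>n. h (zpow f n z)" n] h(2)[OF zpow_in[OF bf \<Lambda> that]]
    by (simp add: zpow_Suc(1)[OF bf] zpow_0)
  have \<rho>0: "\<rho> \<ge> 0" using nbhD(2)[OF h(1)[OF x]] norm_ge_zero order_trans by blast
  have "0 \<le> C * (C * \<rho>)" using C \<rho>0 by simp
  then have \<rho>R: "\<rho> \<le> R" "\<rho> + C * (C * \<rho>) < R" using \<rho> s by linarith+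
  obtain Gk where Gk: "green_kernel (lin f x) Gk D lam B" using Gk[OF x] by blast
  have "zpow f n x' \<in> nbh (zpow f n x) s" for n
  proof -
    have "h (zpow f n x') \<in> nbh (zpow f n x) \<rho>"
      using h(1)[OF zpow_in[OF bf \<Lambda> x], of n] eq orb[OF x] orb[OF x'] by simp
    from nbh_trans(2)[OF h(1)[OF zpow_in[OF bf \<Lambda> x']] \<rho>R(1) \<rho>R(2) this] show ?thesis
      by (rule nbh_mono[rotated]) (use \<rho> in simp)
  qed
  moreover have "zpow f n x \<in> nbh (zpow f n x) s" for n using s by (intro nbh_self) simp
  ultimately have "zpow f 0 x = zpow f 0 x'"
    by (intro unique_orbit[OF f C1_diffeoD(2)[OF f] near less_imp_le[OF s(1)] s(2) \<eta> Gk \<mu>, where y="\<lambda>n. zpow f n x" and y'="\<lambda>n. zpow f n x'"])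
       (simp_all add: zpow_Suc(1)[OF bf])
  then show "x = x'" by (simp add: zpow_0)
qed

end

subsection \<open>Continuity of invariant subbundles\<close>

text \<open>Makes inequalities between norms of iterated derivatives closed conditions on pairs of a
  point and a coordinate vector.\<close>

lemma (in riemannian) continuous_on_rnorm_tderiv:
  fixes p :: "'t::t2_space \<Rightarrow> 'a"
  assumes F: "C1_map A F" and c: "c \<in> A" and p: "continuous_on T p" "\<And>t. t \<in> T \<Longrightarrow> p t \<in> cdom c"
    and \<sigma>: "continuous_on T \<sigma>"
  shows "continuous_on T (\<lambda>t. rnorm G (F (p t)) (tderiv A F (p t) (tchange c (chart_at A (p t)) (p t) (\<sigma> t))))"
    (is "continuous_on T ?r")
proof (rule continuous_on_locallyI)
  fix t0 assume t0: "t0 \<in> T"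
  let ?d = "chart_at A (F (p t0))"
  have Fp: "continuous_on T (\<lambda>t. F (p t))"
    by (rule continuous_on_compose2[OF C1_map_continuous[OF F] p(1)]) simp
  from continuous_on_open_invariant[THEN iffD1, OF Fp, rule_format, OF chart_open(1)[OF chart_at(1)[of "F (p t0)"]]]
  obtain U where U: "open U" "U \<inter> T = (\<lambda>t. F (p t)) -` cdom ?d \<inter> T" by blast
  have t0U: "t0 \<in> U" using U(2) t0 chart_at(2)[of "F (p t0)"] by blast
  have d: "F (p t) \<in> cdom ?d" if "t \<in> T \<inter> U" for t using U(2) that by blast
  have sub: "T \<inter> U \<subseteq> T" by blast
  let ?l = "\<lambda>t. lderiv c ?d F (p t) (\<sigma> t)"
  have l: "continuous_on (T \<inter> U) ?l"
    by (rule continuous_on_lderiv[OF F c chart_at(1) continuous_on_subset[OF p(1) sub] _ d continuous_on_subset[OF \<sigma> sub]])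
       (use p(2) in auto)
  have pc: "continuous_on (T \<inter> U) (\<lambda>t. cmap ?d (F (p t)))"
    by (rule continuous_on_compose2[OF continuous_on_cmap[OF chart_at(1)] continuous_on_subset[OF Fp sub]]) (use d in auto)
  have "continuous_on (T \<inter> U) (\<lambda>t. chart_metric A G ?d (cmap ?d (F (p t))) (?l t) (?l t))"
  proof (rule continuous_on_bilinear_family[where B="\<lambda>t. chart_metric A G ?d (cmap ?d (F (p t)))", OF _ _ l l])
    show "bilinear (chart_metric A G ?d (cmap ?d (F (p t))))" if "t \<in> T \<inter> U" for t
      by (rule chart_metric_bilinear[OF chart_at(1)]) (use d[OF that] in auto)
    show "continuous_on (T \<inter> U) (\<lambda>t. chart_metric A G ?d (cmap ?d (F (p t))) u v)" for u v
      by (rule continuous_on_compose2[OF continuous_on_chart_metric[OF chart_at(1)] pc]) (use d in auto)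
  qed
  then have "continuous_on (T \<inter> U) (\<lambda>t. sqrt (chart_metric A G ?d (cmap ?d (F (p t))) (?l t) (?l t)))"
    by (rule continuous_on_real_sqrt)
  moreover have "sqrt (chart_metric A G ?d (cmap ?d (F (p t))) (?l t) (?l t)) = ?r t" if t: "t \<in> T \<inter> U" for t
  proof -
    have pt: "p t \<in> cdom c" using p(2) t by blast
    have "?l t = tcoord A ?d (F (p t)) (tderiv A F (p t) (tchange c (chart_at A (p t)) (p t) (\<sigma> t)))"
      unfolding tcoord_tderiv[OF F c chart_at(1) pt d[OF t]] tcoord_inverse(1)[OF c pt] ..
    then show ?thesis using rnorm_chart[OF chart_at(1) d[OF t]] by simp
  qed
  ultimately have "continuous_on (T \<inter> U) ?r" by (rule continuous_on_eq)
  then show "\<exists>U. open U \<and> t0 \<in> U \<and> continuous_on (T \<inter> U) ?r" using U(1) t0U by blast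
qed

context uniform_charts
begin

abbreviation (input) "T\<kappa> z y \<equiv> tcoord A (\<kappa> z) y"
abbreviation (input) "U\<kappa> z y \<equiv> tchange (\<kappa> z) (chart_at A y) y"

text \<open>Near \<open>y\<^sub>0\<close> the map \<open>P P\<^sub>0 + (1 - P) (1 - P\<^sub>0)\<close>, where \<open>P\<^sub>0\<close> is the projection at \<open>y\<^sub>0\<close>, is invertible and
  carries the subspaces at \<open>y\<^sub>0\<close> to those at \<open>y\<close>; the frame is the image of a basis at \<open>y\<^sub>0\<close>.\<close>

lemma continuous_subbundleI:
  assumes sub: "\<And>y. y \<in> \<Lambda> \<Longrightarrow> subspace (E y)" "\<And>y. y \<in> \<Lambda> \<Longrightarrow> subspace (F y)"
    and int: "\<And>y. y \<in> \<Lambda> \<Longrightarrow> E y \<inter> F y = {0}"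
    and P: "\<And>y v. y \<in> \<Lambda> \<Longrightarrow> P y v \<in> E y" "\<And>y v. y \<in> \<Lambda> \<Longrightarrow> v - P y v \<in> F y"
    and cont: "\<And>y0 a. y0 \<in> \<Lambda> \<Longrightarrow> continuous_on (\<Lambda> \<inter> nbh y0 R) (\<lambda>y. T\<kappa> y0 y (P y (U\<kappa> y0 y a)))"
  shows "continuous_subbundle A \<Lambda> E"
  unfolding continuous_subbundle_def
proof (intro ballI)
  fix y0 assume y0: "y0 \<in> \<Lambda>"
  let ?c = "\<kappa> y0"
  have uniq: "P y v = a" if "y \<in> \<Lambda>" "a \<in> E y" "v - a \<in> F y" for y v a
  proof -
    have "P y v - a \<in> E y" using subspace_diff[OF sub(1)[OF that(1)] P(1)[OF that(1)] that(2)] .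
    moreover have "P y v - a \<in> F y" using subspace_diff[OF sub(2)[OF that(1)] that(3) P(2)[OF that(1), of v]] by simp
    ultimately have "P y v - a \<in> {0}" using int[OF that(1)] by blast
    then show ?thesis by simp
  qed
  have linP: "linear (P y)" if y: "y \<in> \<Lambda>" for y
  proof (rule linearI)
    fix v w r
    have "v + w - (P y v + P y w) = (v - P y v) + (w - P y w)" by simp
    then have "v + w - (P y v + P y w) \<in> F y" using subspace_add[OF sub(2)[OF y] P(2)[OF y] P(2)[OF y]] by metis
    then show "P y (v + w) = P y v + P y w" by (intro uniq y subspace_add[OF sub(1)[OF y]] P)
    have "r *\<^sub>R v - r *\<^sub>R P y v = r *\<^sub>R (v - P y v)" by (simp add: scaleR_diff_right)
    then have "r *\<^sub>R v - r *\<^sub>R P y v \<in> F y" using subspace_scale[OF sub(2)[OF y] P(2)[OF y]] by metis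
    then show "P y (r *\<^sub>R v) = r *\<^sub>R P y v" by (intro uniq y subspace_scale[OF sub(1)[OF y]] P)
  qed
  let ?N = "\<Lambda> \<inter> nbh y0 R"
  have N: "y \<in> \<Lambda>" "y \<in> cdom ?c" if "y \<in> ?N" for y using that nbhD(1) by auto
  have y0N: "y0 \<in> ?N" using y0 R by (auto intro: nbh_self)
  have TU: "T\<kappa> y0 y (U\<kappa> y0 y a) = a" "U\<kappa> y0 y (T\<kappa> y0 y v) = v" if "y \<in> ?N" for y a v
    using tcoord_inverse[OF \<kappa>(1) N(2)[OF that]] by auto
  have linT: "linear (T\<kappa> y0 y)" "linear (U\<kappa> y0 y)" if "y \<in> ?N" for y
    using linear_tcoord[OF \<kappa>(1) N(2)[OF that]] linear_tchange[OF \<kappa>(1) chart_at(1) N(2)[OF that] chart_at(2)] by auto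
  define Q where "Q y a = T\<kappa> y0 y (P y (U\<kappa> y0 y a))" for y a
  have linQ: "linear (Q y)" if "y \<in> ?N" for y
    using linear_compose[OF linear_compose[OF linT(2)[OF that] linP[OF N(1)[OF that]]] linT(1)[OF that]]
    by (simp add: Q_def[abs_def] o_def)
  have UQ: "U\<kappa> y0 y (Q y a) = P y (U\<kappa> y0 y a)" if "y \<in> ?N" for y a by (simp add: Q_def TU[OF that])
  have Pid: "P y v = v" if "y \<in> \<Lambda>" "v \<in> E y" for y v
    using uniq[OF that] subspace_0[OF sub(2)[OF that(1)]] by simp
  have QQ: "Q y0 (Q y0 a) = Q y0 a" for a
    unfolding Q_def TU[OF y0N] Pid[OF y0 P(1)[OF y0]] ..
  define \<Phi> where "\<Phi> y a = Q y (Q y0 a) + ((a - Q y0 a) - Q y (a - Q y0 a))" for y a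
  have lin\<Phi>: "linear (\<Phi> y)" if y: "y \<in> ?N" for y
  proof -
    have l2: "linear (\<lambda>a. a - Q y0 a)" by (rule linear_compose_sub[OF linear_ident linQ[OF y0N]])
    have l1: "linear (\<lambda>a. Q y (Q y0 a))" "linear (\<lambda>a. Q y (a - Q y0 a))"
      using linear_compose[OF linQ[OF y0N] linQ[OF y]] linear_compose[OF l2 linQ[OF y]] by (simp_all add: o_def)
    show ?thesis unfolding \<Phi>_def[abs_def] by (rule linear_compose_add[OF l1(1) linear_compose_sub[OF l2 l1(2)]])
  qed
  have \<Phi>0: "\<Phi> y0 a = a" for a
    by (simp add: \<Phi>_def QQ linear_diff[OF linQ[OF y0N]])
  have c\<Phi>: "continuous_on ?N (\<lambda>y. \<Phi> y a)" for a
    unfolding \<Phi>_def Q_def by (intro continuous_on_add continuous_on_diff continuous_on_const cont[OF y0])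
  define e where "e y = (\<Sum>b\<in>Basis. norm (\<Phi> y b - b))" for y
  have ce: "continuous_on ?N e" unfolding e_def by (intro continuous_on_sum continuous_on_norm continuous_on_diff c\<Phi> continuous_on_const)
  have e0: "e y0 = 0" by (simp add: e_def \<Phi>0)
  from continuous_on_open_invariant[THEN iffD1, OF ce, rule_format, OF open_lessThan[of "1/2"]]
  obtain V where V: "open V" "V \<inter> ?N = e -` {..<1/2} \<inter> ?N" by (elim exE conjE) (rule that)
  obtain W where W: "open W" "y0 \<in> W" "W \<subseteq> nbh y0 R" using open_nbh[OF R, of y0] by blast
  have y0V: "y0 \<in> V" using V(2) y0N e0 by auto
  let ?U = "V \<inter> W"
  have UN: "y \<in> ?N" "e y < 1/2" if "y \<in> \<Lambda> \<inter> ?U" for y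
  proof -
    show "y \<in> ?N" using that W by blast
    then show "e y < 1/2" using that V(2) by blast
  qed
  have inj\<Phi>: "inj (\<Phi> y)" if y: "y \<in> \<Lambda> \<inter> ?U" for y
  proof (rule linear_injective_0[OF lin\<Phi>[OF UN(1)[OF y]], THEN iffD2], intro allI impI)
    fix a assume a: "\<Phi> y a = 0"
    have "norm (\<Phi> y a - a) \<le> e y * norm a"
      unfolding e_def by (rule onorm_basis_bound[OF lin\<Phi>[OF UN(1)[OF y]] linear_ident])
    also have "\<dots> \<le> 1/2 * norm a" using UN(2)[OF y] by (intro mult_right_mono) auto
    finally show "a = 0" using a by simp
  qed
  define S0 where "S0 = T\<kappa> y0 y0 ` E y0"
  have QS0: "Q y0 a = a" if "a \<in> S0" for a
    using that Pid[OF y0] unfolding S0_def Q_def by (auto simp: TU[OF y0N])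
  have S0Q: "Q y0 a \<in> S0" for a unfolding S0_def Q_def using P(1)[OF y0] by blast
  have sS0: "subspace S0" unfolding S0_def by (rule linear_subspace_image[OF linT(1)[OF y0N] sub(1)[OF y0]])
  obtain Bs where Bs: "Bs \<subseteq> S0" "independent Bs" "S0 \<subseteq> span Bs" by (rule basis_exists[of S0]) (rule that)
  have spB: "span Bs = S0" using Bs sS0 by (intro subset_antisym span_minimal) auto
  have finB: "finite Bs" by (rule independent_imp_finite[OF Bs(2)])
  obtain \<phi> where \<phi>: "bij_betw \<phi> {0..<card Bs} Bs" using ex_bij_betw_nat_finite[OF finB] by blast
  let ?k = "card Bs"
  let ?b = "\<lambda>i y. U\<kappa> y0 y (\<Phi> y (\<phi> i))"
  have \<Psi>: "linear (\<lambda>a. U\<kappa> y0 y (\<Phi> y a))" "inj (\<lambda>a. U\<kappa> y0 y (\<Phi> y a))" if y: "y \<in> \<Lambda> \<inter> ?U" for y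
  proof -
    show "linear (\<lambda>a. U\<kappa> y0 y (\<Phi> y a))" using linear_compose[OF lin\<Phi>[OF UN(1)[OF y]] linT(2)[OF UN(1)[OF y]]] by (simp add: o_def)
    show "inj (\<lambda>a. U\<kappa> y0 y (\<Phi> y a))"
    proof (rule injI)
      fix a b assume "U\<kappa> y0 y (\<Phi> y a) = U\<kappa> y0 y (\<Phi> y b)"
      then have "\<Phi> y a = \<Phi> y b" using TU(1)[OF UN(1)[OF y]] by metis
      then show "a = b" using inj\<Phi>[OF y] by (simp add: inj_eq)
    qed
  qed
  have \<Psi>S0: "(\<lambda>a. U\<kappa> y0 y (\<Phi> y a)) ` S0 = E y" if y: "y \<in> \<Lambda> \<inter> ?U" for y
  proof (intro subset_antisym subsetI)
    note yN = UN(1)[OF y] and yL = N(1)[OF UN(1)[OF y]]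
    have \<Phi>S: "\<Phi> y a = Q y a" if "a \<in> S0" for a
      using QS0[OF that] linear_0[OF linQ[OF yN]] by (simp add: \<Phi>_def)
    fix v
    show "v \<in> E y" if "v \<in> (\<lambda>a. U\<kappa> y0 y (\<Phi> y a)) ` S0"
      using that P(1)[OF yL] by (auto simp: \<Phi>S UQ[OF yN])
    show "v \<in> (\<lambda>a. U\<kappa> y0 y (\<Phi> y a)) ` S0" if v: "v \<in> E y"
    proof -
      have "surj (\<Phi> y)" using linear_injective_imp_surjective[OF lin\<Phi>[OF yN] inj\<Phi>[OF y]] by simp
      then obtain a where a: "\<Phi> y a = T\<kappa> y0 y v" by (metis surjD)
      \<comment> \<open>\<open>?a1\<close> is carried into \<open>E y\<close> and \<open>?a2\<close>
        into \<open>F y\<close>. Since \<open>v\<close> lies in \<open>E y\<close>, the second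
        contribution vanishes, and \<open>?a1\<close> alone is mapped to \<open>v\<close>.\<close>
      let ?a1 = "Q y0 a" and ?a2 = "a - Q y0 a"
      have "v = U\<kappa> y0 y (\<Phi> y a)" using a TU(2)[OF yN] by simp
      also have "\<dots> = P y (U\<kappa> y0 y ?a1) + (U\<kappa> y0 y ?a2 - P y (U\<kappa> y0 y ?a2))"
        unfolding \<Phi>_def linear_add[OF linT(2)[OF yN]] linear_diff[OF linT(2)[OF yN], of ?a2] UQ[OF yN] ..
      finally have eq: "v = P y (U\<kappa> y0 y ?a1) + (U\<kappa> y0 y ?a2 - P y (U\<kappa> y0 y ?a2))" .
      have "v - P y (U\<kappa> y0 y ?a1) \<in> E y" by (rule subspace_diff[OF sub(1)[OF yL] v P(1)[OF yL]])
      moreover have "v - P y (U\<kappa> y0 y ?a1) \<in> F y" using P(2)[OF yL, of "U\<kappa> y0 y ?a2"] eq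
        by (metis add_diff_cancel_left')
      ultimately have "v - P y (U\<kappa> y0 y ?a1) \<in> {0}" using int[OF yL] by blast
      then have "v = U\<kappa> y0 y (\<Phi> y ?a1)" by (simp add: \<Phi>S[OF S0Q] UQ[OF yN])
      then show ?thesis using S0Q by blast
    qed
  qed
  show "\<exists>U k (b :: nat \<Rightarrow> 'a \<Rightarrow> 'e). open U \<and> y0 \<in> U \<and>
        (\<forall>i<k. \<forall>c\<in>A. continuous_on (\<Lambda> \<inter> U \<inter> cdom c) (\<lambda>y. tcoord A c y (b i y))) \<and>
        (\<forall>y\<in>\<Lambda> \<inter> U. inj_on (\<lambda>i. b i y) {..<k} \<and> independent ((\<lambda>i. b i y) ` {..<k}) \<and>
           span ((\<lambda>i. b i y) ` {..<k}) = E y)"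
  proof (rule exI[of _ ?U], rule exI[of _ ?k], rule exI[of _ ?b], intro conjI allI impI ballI)
    show "open ?U" "y0 \<in> ?U" using V W y0V by auto
    show "continuous_on (\<Lambda> \<inter> ?U \<inter> cdom c) (\<lambda>y. tcoord A c y (?b i y))" if c: "c \<in> A" for i c
    proof -
      have sub2: "\<Lambda> \<inter> ?U \<inter> cdom c \<subseteq> ?N" using W by blast
      have "continuous_on (\<Lambda> \<inter> ?U \<inter> cdom c) (\<lambda>y. lderiv ?c c id y (\<Phi> y (\<phi> i)))"
        by (rule continuous_on_lderiv[OF C1_map_id \<kappa>(1) c continuous_on_id _ _ continuous_on_subset[OF c\<Phi> sub2]])
           (use N(2)[OF subsetD[OF sub2]] in auto)
      then show ?thesis
      proof (rule continuous_on_eq)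
        fix y assume y: "y \<in> \<Lambda> \<inter> ?U \<inter> cdom c"
        show "lderiv ?c c id y (\<Phi> y (\<phi> i)) = tcoord A c y (?b i y)"
          unfolding tcoord_def tchange_lderiv[symmetric]
          using tchange_tchange[OF \<kappa>(1) chart_at(1) c N(2)[OF subsetD[OF sub2 y]] chart_at(2)] y by simp
      qed
    qed
    fix y assume y: "y \<in> \<Lambda> \<inter> ?U"
    have inj\<phi>: "inj_on \<phi> {..<?k}" and img: "\<phi> ` {..<?k} = Bs" using \<phi> by (auto simp: bij_betw_def atLeast0LessThan)
    have "(\<lambda>i. ?b i y) ` {..<?k} = (\<lambda>a. U\<kappa> y0 y (\<Phi> y a)) ` \<phi> ` {..<?k}" by (simp only: image_image)
    then have im: "(\<lambda>i. ?b i y) ` {..<?k} = (\<lambda>a. U\<kappa> y0 y (\<Phi> y a)) ` Bs" unfolding img .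
    show "inj_on (\<lambda>i. ?b i y) {..<?k}"
      using comp_inj_on[OF inj\<phi> inj_on_subset[OF \<Psi>(2)[OF y] subset_UNIV]] by (simp add: o_def)
    show "independent ((\<lambda>i. ?b i y) ` {..<?k})"
      unfolding im by (rule linear_independent_injective_image[OF \<Psi>(1)[OF y] Bs(2) inj_on_subset[OF \<Psi>(2)[OF y] subset_UNIV]])
    show "span ((\<lambda>i. ?b i y) ` {..<?k}) = E y"
      unfolding im linear_span_image[OF \<Psi>(1)[OF y]] spB \<Psi>S0[OF y] ..
  qed
qed

subsection \<open>Hyperbolicity of the perturbed set\<close>

text \<open>The prospective stable subspace of \<open>g\<close> at \<open>y\<close>; with
  \<open>inv g\<close> in place of \<open>g\<close>, the unstable one. Boundedness instead of a
  decay rate makes subspace and invariance properties immediate, as no constant has to be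
  preserved.\<close>

definition bvec :: "('a \<Rightarrow> 'a) \<Rightarrow> 'a \<Rightarrow> 'e set" where
  "bvec g y = {v. \<exists>M. \<forall>n. norm (own ((g ^^ n) y) (tderiv A (g ^^ n) y v)) \<le> M}"

lemma subspace_bvec:
  assumes g: "C1_map A g"
  shows "subspace (bvec g y)"
proof -
  have l: "linear (\<lambda>v. own ((g ^^ n) y) (tderiv A (g ^^ n) y v))" for n
    using linear_compose[OF linear_tderiv[OF C1_map_funpow[OF g]] own(1)] by (simp add: o_def)
  show ?thesis
  proof (rule subspaceI)
    show "0 \<in> bvec g y" using linear_0[OF l] by (auto simp: bvec_def)
    fix v w r assume "v \<in> bvec g y"
    then obtain M1 where M1: "\<And>n. norm (own ((g ^^ n) y) (tderiv A (g ^^ n) y v)) \<le> M1" by (auto simp: bvec_def)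
    have "norm (own ((g ^^ n) y) (tderiv A (g ^^ n) y (r *\<^sub>R v))) \<le> \<bar>r\<bar> * M1" for n
      using M1[of n] by (simp add: linear_cmul[OF l] mult_left_mono)
    then show "r *\<^sub>R v \<in> bvec g y" by (auto simp: bvec_def)
    assume "w \<in> bvec g y"
    then obtain M2 where M2: "\<And>n. norm (own ((g ^^ n) y) (tderiv A (g ^^ n) y w)) \<le> M2" by (auto simp: bvec_def)
    have "norm (own ((g ^^ n) y) (tderiv A (g ^^ n) y (v + w))) \<le> M1 + M2" for n
      unfolding linear_add[OF l] using norm_triangle_mono[OF M1 M2] .
    then show "v + w \<in> bvec g y" by (auto simp: bvec_def)
  qed
qed

lemma bvec_tderiv:
  assumes g: "C1_diffeo A g"
  shows "tderiv A g y ` bvec g y = bvec g (g y)"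
proof (intro subset_antisym subsetI)
  note bg = C1_diffeoD(1)[OF g] and cg = C1_diffeoD(2)[OF g]
  have shift: "own ((g ^^ Suc n) y) (tderiv A (g ^^ Suc n) y v) = own ((g ^^ n) (g y)) (tderiv A (g ^^ n) (g y) (tderiv A g y v))" for n v
  proof -
    have "(g ^^ Suc n) y = (g ^^ n) (g y)" by (simp add: funpow_swap1)
    then show ?thesis unfolding tderiv_funpow(3)[OF cg] by metis
  qed
  fix w
  show "w \<in> bvec g (g y)" if w: "w \<in> tderiv A g y ` bvec g y"
  proof -
    obtain v M where v: "w = tderiv A g y v" "\<And>n. norm (own ((g ^^ n) y) (tderiv A (g ^^ n) y v)) \<le> M"
      using w by (auto simp: bvec_def)
    show ?thesis unfolding bvec_def v(1) using v(2)[of "Suc _"] unfolding shift by blast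
  qed
  show "w \<in> tderiv A g y ` bvec g y" if w: "w \<in> bvec g (g y)"
  proof -
    obtain M where M: "\<And>n. norm (own ((g ^^ n) (g y)) (tderiv A (g ^^ n) (g y) w)) \<le> M" using w by (auto simp: bvec_def)
    define v where "v = tderiv A (inv g) (g y) w"
    have wv: "w = tderiv A g y v"
      using tderiv_inv(2)[OF g, of "g y" w] bg by (simp add: v_def bij_is_inj)
    have "norm (own ((g ^^ n) y) (tderiv A (g ^^ n) y v)) \<le> max M (norm (own y v))" for n
    proof (cases n)
      case 0
      show ?thesis unfolding 0 tderiv_funpow(1)[OF cg] by simp
    next
      case (Suc m)
      show ?thesis unfolding Suc shift wv[symmetric] using M[of m] by simp
    qed
    then have "v \<in> bvec g y" by (auto simp: bvec_def)
    then show ?thesis using wv by blast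
  qed
qed

lemma bvec_inv_tderiv:
  assumes g: "C1_diffeo A g"
  shows "tderiv A g y ` bvec (inv g) y = bvec (inv g) (g y)"
proof -
  have "tderiv A (inv g) (g y) ` bvec (inv g) (g y) = bvec (inv g) y"
    using bvec_tderiv[OF C1_diffeo_inv[OF g], of "g y"] C1_diffeoD(1)[OF g] by (simp add: bij_is_inj)
  then have "tderiv A g y ` bvec (inv g) y = tderiv A g y ` tderiv A (inv g) (g y) ` bvec (inv g) (g y)" by simp
  also have "\<dots> = bvec (inv g) (g y)"
    using tderiv_inv(2)[OF g, of "g y"] C1_diffeoD(1)[OF g] by (simp add: image_image bij_is_inj)
  finally show ?thesis .
qed

lemma bvecI:
  assumes "\<And>n. rnorm G ((g ^^ n) y) (tderiv A (g ^^ n) y v) \<le> M * \<mu> ^ n" and "0 \<le> \<mu>" "\<mu> \<le> 1" "M \<ge> 0"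
  shows "v \<in> bvec g y"
proof -
  have "norm (own ((g ^^ n) y) (tderiv A (g ^^ n) y v)) \<le> C * M" for n
  proof -
    have "M * \<mu> ^ n \<le> M * 1" using assms(2-4) by (intro mult_left_mono power_le_one) auto
    then have "C * rnorm G ((g ^^ n) y) (tderiv A (g ^^ n) y v) \<le> C * M"
      using assms(1)[of n] C by (intro mult_left_mono) auto
    then show ?thesis using own(5) order_trans by blast
  qed
  then show ?thesis by (auto simp: bvec_def)
qed

lemma inj_locd:
  assumes g: "C1_diffeo A g" and y: "y \<in> nbh x s" "g y \<in> nbh z t" and eq: "locd x z g y a = locd x z g y b"
  shows "a = b"
proof -
  obtain v w where v: "tcoord A (\<kappa> x) y v = a" and w: "tcoord A (\<kappa> x) y w = b"
    using tcoord_onto[OF y(1)] by metis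
  have "tcoord A (\<kappa> z) (g y) (tderiv A g y v) = tcoord A (\<kappa> z) (g y) (tderiv A g y w)"
    using eq unfolding v[symmetric] w[symmetric] locd_tcoord[OF C1_diffeoD(2)[OF g] y] .
  then have "tderiv A g y v = tderiv A g y w"
    using tcoord_inverse(2)[OF \<kappa>(1) nbhD(1)[OF y(2)]] by metis
  then have "v = w" using tderiv_inv(1)[OF g, of y] by metis
  then show ?thesis using v w by simp
qed

text \<open>Both parts view the derivative of \<open>g\<close> along its orbit as an
  \<open>\<eta>\<close>-perturbation of that of \<open>f\<close>. A vector bounded in both
  directions vanishes by the window estimate with \<open>N\<close> tending to infinity. To split
  \<open>v\<close>, an impulse \<open>v\<close> is inserted at time 0: the decaying solution is the
  stable part from then on, and minus the unstable part before. In \<open>E\<close>, the summand 1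
  is the impulse itself and \<open>2 * D1\<close> bounds the solution.\<close>

lemma perturbed_dichotomy:
  assumes f: "C1_diffeo A f" and g: "C1_diffeo A g" and near: "near f g s \<eta>" and s: "0 \<le> s" "s \<le> R" and \<eta>: "\<eta> \<ge> 0"
    and Gk: "green_kernel (lin f x) Gk D lam B"
    and \<mu>: "lam < \<mu>" "\<mu> < 1" "D * (2 / (1 - lam / \<mu>)) * \<eta> / \<mu> \<le> 1/2"
    and y: "\<And>n. zpow g n y \<in> nbh (zpow f n x) s"
    and E: "E = C * C * (1 + 2 * (D * (2 / (1 - lam / \<mu>))))"
  shows "bvec g y \<inter> bvec (inv g) y = {0}"
    "\<exists>a. a \<in> bvec g y \<and> v - a \<in> bvec (inv g) y \<and>
      (\<forall>n. rnorm G ((g ^^ n) y) (tderiv A (g ^^ n) y a) \<le> E * \<mu> ^ n * rnorm G y v) \<and>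
      (\<forall>n. rnorm G ((inv g ^^ n) y) (tderiv A (inv g ^^ n) y (v - a)) \<le> E * \<mu> ^ n * rnorm G y v)"
proof -
  note bf = C1_diffeoD(1)[OF f] and bg = C1_diffeoD(1)[OF g] and cg = C1_diffeoD(2)[OF g]
  interpret green_kernel "lin f x" Gk D lam B by (rule Gk)
  interpret W: weighted_green_kernel "lin f x" Gk D lam B "\<lambda>n. \<mu> ^ nat \<bar>n\<bar>" \<mu> by (rule weighted_power(1)[OF \<mu>(1,2)])
  let ?D1 = "D * (2 / (1 - lam / \<mu>))"
  have D1e: "W.D1 = ?D1" by (simp add: W.D1_def)
  have D1p: "?D1 > 0" using W.D1_pos unfolding D1e .
  have \<mu>0: "\<mu> > 0" by (rule W.\<mu>_pos)
  have C0: "C \<ge> 0" using C by simp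
  let ?x = "\<lambda>n. zpow f n x" and ?y = "\<lambda>n. zpow g n y"
  have xs: "?x (n + 1) = f (?x n)" and ys: "?y (n + 1) = g (?y n)" for n
    by (simp_all add: zpow_Suc(1)[OF bf] zpow_Suc(1)[OF bg])
  have yR: "?y n \<in> nbh (?x n) R" for n by (rule nbh_mono[OF s(2) y])
  have gy: "g (?y n) \<in> nbh (f (?x n)) s" for n using y[of "n + 1"] unfolding xs ys .
  define z where "z v n = tcoord A (\<kappa> (?x n)) (?y n) (tderiv A (zpow g n) y v)" for v n
  define L' where "L' n = locd (?x n) (f (?x n)) g (?y n)" for n
  have linL': "linear (L' n)" for n unfolding L'_def by (rule linear_locd[OF cg y gy])
  have zS: "z v (n + 1) = L' n (z v n)" for v n
    unfolding z_def L'_def locd_tcoord[OF cg y gy] tderiv_zpow_Suc(1)[OF g] xs ys ..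
  have nearL: "norm (L' n a - lin f x n a) \<le> \<eta> * norm a" for n a
    using near y[of n] unfolding near_def L'_def lin_def by blast
  have injL: "L' n a = L' n b \<Longrightarrow> a = b" for n a b
    unfolding L'_def by (rule inj_locd[OF g y gy])
  have z0: "z v 0 = tcoord A (\<kappa> x) y v" for v by (simp add: z_def zpow_0[of f] zpow_0[of g] tderiv_id)
  have yR0: "y \<in> nbh x R" using yR[of 0] by (simp add: zpow_0)
  have linz: "linear (\<lambda>v. z v n)" for n
    unfolding z_def using linear_compose[OF linear_tderiv[OF C1_map_zpow[OF g]] linear_tcoord[OF \<kappa>(1) nbhD(1)[OF y]]]
    by (simp add: o_def)
  have z_rnorm: "norm (z v n) \<le> C * rnorm G (?y n) (tderiv A (zpow g n) y v)"
    "rnorm G (?y n) (tderiv A (zpow g n) y v) \<le> C * norm (z v n)" for v n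
    unfolding z_def by (rule tcoord_norm[OF yR])+
  have z_inj: "v = 0" if "z v 0 = 0" for v
  proof -
    have "rnorm G y v \<le> C * norm (z v 0)" using z_rnorm(2)[of 0 v] by (simp only: zpow_0 tderiv_id id_apply)
    then have "rnorm G y v \<le> 0" using that by simp
    then show ?thesis using G(3)[of v y] by (auto simp: rnorm_def)
  qed
  show "bvec g y \<inter> bvec (inv g) y = {0}"
  proof -
    have "v = 0" if v: "v \<in> bvec g y" "v \<in> bvec (inv g) y" for v
    proof -
      obtain M1 M2 where M1: "\<And>n. norm (own ((g ^^ n) y) (tderiv A (g ^^ n) y v)) \<le> M1"
        and M2: "\<And>n. norm (own ((inv g ^^ n) y) (tderiv A (inv g ^^ n) y v)) \<le> M2" using v by (auto simp: bvec_def)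
      define M where "M = C * (C * max M1 M2)"
      have own_le: "norm (own (?y n) (tderiv A (zpow g n) y v)) \<le> max M1 M2" for n
        using M1[of "nat n"] M2[of "nat (- n)"] by (cases "n \<ge> 0") (auto simp: zpow_def)
      have zM: "norm (z v n) \<le> M" for n
      proof -
        have "rnorm G (?y n) (tderiv A (zpow g n) y v) \<le> C * max M1 M2"
          using own(6)[of "?y n" "tderiv A (zpow g n) y v"] mult_left_mono[OF own_le C0] by (rule order_trans)
        from order_trans[OF z_rnorm(1) mult_left_mono[OF this C0]] show ?thesis by (simp add: M_def)
      qed
      have M0: "M \<ge> 0" using zM[of 0] norm_ge_zero order_trans by blast
      let ?Y = "2 * ?D1 * ((1 + B) * M)"
      have step: "norm (z v (n + 1) - lin f x n (z v n)) \<le> \<eta> * norm (z v n)" for n unfolding zS by (rule nearL)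
      have "norm (z v 0) \<le> ?Y * \<mu> ^ N" for N
        by (rule window_estimate[OF \<mu>(1,2) \<eta> \<mu>(3) M0, where d="z v"]) (use zM step in auto)
      moreover have "(\<lambda>N. ?Y * \<mu> ^ N) \<longlonglongrightarrow> ?Y * 0"
        using \<mu> \<mu>0 by (intro tendsto_mult tendsto_const LIMSEQ_power_zero) auto
      ultimately have "norm (z v 0) \<le> ?Y * 0" by (intro LIMSEQ_le_const) auto
      then have "z v 0 = 0" by simp
      then show ?thesis by (rule z_inj)
    qed
    moreover have "0 \<in> bvec g y" "0 \<in> bvec (inv g) y"
      using subspace_0 subspace_bvec cg C1_diffeoD(3)[OF g] by blast+
    ultimately show ?thesis by blast
  qed
  let ?a = "z v 0"
  have a: "norm ?a \<le> C * rnorm G y v" using z_rnorm(1)[of v 0] by (simp only: zpow_0 tderiv_id id_apply)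
  \<comment> \<open>The index \<open>- 1\<close> makes the impulse appear in \<open>w 0\<close>,
    where the weight is 1.\<close>
  let ?F = "\<lambda>n u. L' n u + (if n = - 1 then ?a else 0)"
  have "\<exists>w. (\<forall>n. norm (w n) \<le> (2 * ?D1 * norm ?a) * \<mu> ^ nat \<bar>n\<bar>) \<and> (\<forall>n. w (n + 1) = ?F n (w n))"
  proof (rule W.ex_perturbed_orbit[OF _ \<eta> _ norm_ge_zero])
    show "0 \<le> 2 * ?D1 * norm ?a" by (intro mult_nonneg_nonneg less_imp_le[OF D1p]) auto
    show "W.D1 * \<eta> / \<mu> \<le> 1/2" unfolding D1e by (rule \<mu>(3))
    have "d * m \<le> 2 * d * m / 2" for d m :: real by simp
    then show "W.D1 * norm ?a \<le> 2 * ?D1 * norm ?a / 2" unfolding D1e .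
    show "norm (?F n 0) \<le> norm ?a * \<mu> ^ nat \<bar>n + 1\<bar>" for n
      using \<mu>0 by (simp add: linear_0[OF linL'])
    show "norm (?F n u - ?F n u' - lin f x n (u - u')) \<le> \<eta> * norm (u - u')" for n u u'
      using nearL[of n "u - u'"] by (simp add: linear_diff[OF linL'])
  qed
  then obtain w where w: "\<And>n. norm (w n) \<le> (2 * ?D1 * norm ?a) * \<mu> ^ nat \<bar>n\<bar>" "\<And>n. w (n + 1) = ?F n (w n)" by blast
  \<comment> \<open>The stable part of \<open>v\<close> is the vector whose coordinates are the
    value of the solution just after the impulse.\<close>
  obtain sv where sv: "tcoord A (\<kappa> x) y sv = w 0" using tcoord_onto[OF yR0] by blast
  have fwd: "z sv (int n) = w (int n)" for n
  proof (induction n)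
    case 0 then show ?case by (simp add: z0 sv)
  next
    case (Suc n)
    have "z sv (int n + 1) = w (int n + 1)" unfolding zS w(2) Suc by simp
    then show ?case by (simp add: add.commute)
  qed
  have z_diff: "z (v - sv) 0 = ?a - w 0" using linear_diff[OF linz[of 0], of v sv] fwd[of 0] by simp
  \<comment> \<open>At time 0 the unstable part is \<open>?a - w 0\<close>, minus the image of
    \<open>w (- 1)\<close>. Before that, \<open>- w\<close> obeys the homogeneous equation, and
    injectivity of \<open>L'\<close> carries the identity backward.\<close>
  have bwd: "z (v - sv) (- int (Suc n)) = - w (- int (Suc n))" for n
  proof (induction n)
    case 0
    have "L' (- 1) (z (v - sv) (- 1)) = z (v - sv) 0" using zS[of "v - sv" "- 1"] by simp
    also have "\<dots> = - L' (- 1) (w (- 1))" using z_diff w(2)[of "- 1"] by simp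
    also have "\<dots> = L' (- 1) (- w (- 1))" by (simp add: linear_neg[OF linL'])
    finally show ?case using injL by simp
  next
    case (Suc n)
    let ?m = "- int (Suc (Suc n))"
    have m: "?m + 1 = - int (Suc n)" "?m \<noteq> - 1" by auto
    have "L' ?m (z (v - sv) ?m) = z (v - sv) (- int (Suc n))" using zS[of "v - sv" ?m] unfolding m by simp
    also have "\<dots> = - L' ?m (w ?m)" using Suc w(2)[of ?m] m(2) unfolding m(1) by simp
    also have "\<dots> = L' ?m (- w ?m)" by (simp add: linear_neg[OF linL'])
    finally show ?case by (rule injL)
  qed
  have E0: "E \<ge> 0" unfolding E using C0 D1p by (intro mult_nonneg_nonneg) auto
  have lift: "rnorm G (?y n) (tderiv A (zpow g n) y u) \<le> E * \<mu> ^ nat \<bar>n\<bar> * rnorm G y v"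
    if "norm (z u n) \<le> (1 + 2 * ?D1) * norm ?a * \<mu> ^ nat \<bar>n\<bar>" for u n
  proof -
    have "rnorm G (?y n) (tderiv A (zpow g n) y u) \<le> C * norm (z u n)" by (rule z_rnorm(2))
    also have "\<dots> \<le> C * ((1 + 2 * ?D1) * (C * rnorm G y v) * \<mu> ^ nat \<bar>n\<bar>)"
      using that a C0 D1p \<mu>0
      by (intro mult_left_mono[OF order_trans[OF that mult_right_mono[OF mult_left_mono]]]) auto
    also have "\<dots> = E * \<mu> ^ nat \<bar>n\<bar> * rnorm G y v" by (simp add: E mult_ac)
    finally show ?thesis .
  qed
  have w': "norm (w n) \<le> (1 + 2 * ?D1) * norm ?a * \<mu> ^ nat \<bar>n\<bar>" for n
  proof -
    have "2 * ?D1 * norm ?a * \<mu> ^ nat \<bar>n\<bar> \<le> (1 + 2 * ?D1) * norm ?a * \<mu> ^ nat \<bar>n\<bar>"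
      using \<mu>0 by (intro mult_right_mono) auto
    then show ?thesis using w(1)[of n] by linarith
  qed
  have est1: "rnorm G ((g ^^ n) y) (tderiv A (g ^^ n) y sv) \<le> E * \<mu> ^ n * rnorm G y v" for n
    using lift[where u=sv and n="int n"] w'[of "int n"] unfolding fwd zpow_nat by simp
  have est2: "rnorm G ((inv g ^^ n) y) (tderiv A (inv g ^^ n) y (v - sv)) \<le> E * \<mu> ^ n * rnorm G y v" for n
  proof (cases n)
    case 0
    have "norm (z (v - sv) 0) \<le> norm ?a + norm (w 0)" unfolding z_diff by (rule norm_triangle_ineq4)
    also have "\<dots> \<le> (1 + 2 * ?D1) * norm ?a * \<mu> ^ nat \<bar>0\<bar>" using w(1)[of 0] by (simp add: distrib_right)
    finally have "rnorm G (?y 0) (tderiv A (zpow g 0) y (v - sv)) \<le> E * \<mu> ^ nat \<bar>0\<bar> * rnorm G y v" by (rule lift)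
    then show ?thesis using 0 by (simp add: zpow_def)
  next
    case (Suc m)
    have "norm (z (v - sv) (- int n)) \<le> (1 + 2 * ?D1) * norm ?a * \<mu> ^ nat \<bar>- int n\<bar>"
      using w'[of "- int n"] bwd[of m] unfolding Suc by simp
    from lift[OF this] show ?thesis unfolding zpow_nat by simp
  qed
  have nn: "E * rnorm G y v \<ge> 0" using E0 rnorm_nonneg by simp
  show "\<exists>a. a \<in> bvec g y \<and> v - a \<in> bvec (inv g) y \<and>
      (\<forall>n. rnorm G ((g ^^ n) y) (tderiv A (g ^^ n) y a) \<le> E * \<mu> ^ n * rnorm G y v) \<and>
      (\<forall>n. rnorm G ((inv g ^^ n) y) (tderiv A (inv g ^^ n) y (v - a)) \<le> E * \<mu> ^ n * rnorm G y v)"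
  proof (intro exI[of _ sv] conjI allI est1 est2)
    show "sv \<in> bvec g y"
      by (rule bvecI[where M="E * rnorm G y v" and \<mu>=\<mu>]) (use est1 nn \<mu>0 \<mu> in \<open>auto simp: mult_ac\<close>)
    show "v - sv \<in> bvec (inv g) y"
      by (rule bvecI[where M="E * rnorm G y v" and \<mu>=\<mu>]) (use est2 nn \<mu>0 \<mu> in \<open>auto simp: mult_ac\<close>)
  qed
qed

text \<open>The splitting is pointwise at first. Its continuity comes from the uniform constant
  \<open>E\<close>: bounded vectors are those that satisfy countably many closed estimates, so the
  projection has a closed graph in a compact product and is continuous.\<close>

lemma hyperbolic_image:
  assumes f: "C1_diffeo A f" and g: "C1_diffeo A g" and near: "near f g s \<eta>" and s: "0 \<le> s" "s \<le> R" and \<eta>: "\<eta> \<ge> 0"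
    and \<Lambda>: "f ` \<Lambda> = \<Lambda>" "compact \<Lambda>"
    and Gk: "\<And>x. x \<in> \<Lambda> \<Longrightarrow> \<exists>Gk. green_kernel (lin f x) Gk D lam B"
    and \<mu>: "lam < \<mu>" "\<mu> < 1" "D * (2 / (1 - lam / \<mu>)) * \<eta> / \<mu> \<le> 1/2" and lam: "lam > 0" and D: "D > 0"
    and h: "continuous_on \<Lambda> h" "\<And>x. x \<in> \<Lambda> \<Longrightarrow> h x \<in> nbh x s" "\<And>x. x \<in> \<Lambda> \<Longrightarrow> h (f x) = g (h x)"
  shows "\<exists>c'. hyperbolic_set A G g \<mu> c' (h ` \<Lambda>)"
proof -
  note bf = C1_diffeoD(1)[OF f] and bg = C1_diffeoD(1)[OF g] and cg = C1_diffeoD(2)[OF g] and ci = C1_diffeoD(3)[OF g]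
  let ?\<Lambda> = "h ` \<Lambda>"
  define E where "E = C * C * (1 + 2 * (D * (2 / (1 - lam / \<mu>))))"
  have \<mu>0: "\<mu> > 0" using \<mu> lam by linarith
  have E0: "E > 0"
    unfolding E_def using C D \<mu> \<mu>0 lam by (intro mult_pos_pos add_pos_nonneg mult_nonneg_nonneg divide_nonneg_nonneg) auto
  have c\<Lambda>: "compact ?\<Lambda>" by (rule compact_continuous_image[OF h(1) \<Lambda>(2)])
  have orb: "zpow g n (h x) \<in> nbh (zpow f n x) s" if x: "x \<in> \<Lambda>" for x n
  proof -
    have "h (zpow f n x) = zpow g n (h x)"
      using orbit_eq_zpow[OF bg, of "\<lambda>n. h (zpow f n x)" n] h(3)[OF zpow_in[OF bf \<Lambda>(1) x]]
      by (simp add: zpow_Suc(1)[OF bf] zpow_0)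
    then show ?thesis using h(2)[OF zpow_in[OF bf \<Lambda>(1) x], of n] by simp
  qed
  have dich: "bvec g y \<inter> bvec (inv g) y = {0}"
    "\<exists>a. a \<in> bvec g y \<and> v - a \<in> bvec (inv g) y \<and>
      (\<forall>n. rnorm G ((g ^^ n) y) (tderiv A (g ^^ n) y a) \<le> E * \<mu> ^ n * rnorm G y v) \<and>
      (\<forall>n. rnorm G ((inv g ^^ n) y) (tderiv A (inv g ^^ n) y (v - a)) \<le> E * \<mu> ^ n * rnorm G y v)"
    if y: "y \<in> ?\<Lambda>" for y v
  proof -
    obtain x where x: "x \<in> \<Lambda>" "y = h x" using y by blast
    obtain Gk where Gk: "green_kernel (lin f x) Gk D lam B" using Gk[OF x(1)] by blast
    note * = perturbed_dichotomy[OF f g near s \<eta> Gk \<mu> orb[OF x(1)] E_def]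
    show "bvec g y \<inter> bvec (inv g) y = {0}" unfolding x(2) by (rule *(1))
    show "\<exists>a. a \<in> bvec g y \<and> v - a \<in> bvec (inv g) y \<and>
      (\<forall>n. rnorm G ((g ^^ n) y) (tderiv A (g ^^ n) y a) \<le> E * \<mu> ^ n * rnorm G y v) \<and>
      (\<forall>n. rnorm G ((inv g ^^ n) y) (tderiv A (inv g ^^ n) y (v - a)) \<le> E * \<mu> ^ n * rnorm G y v)"
      unfolding x(2) by (rule *(2))
  qed
  \<comment> \<open>A choice, but by the trivial intersection in \<open>dich\<close> it is the
    projection onto \<open>bvec g y\<close> along \<open>bvec (inv g) y\<close>.\<close>
  define P where "P y v = (SOME a. a \<in> bvec g y \<and> v - a \<in> bvec (inv g) y \<and>
      (\<forall>n. rnorm G ((g ^^ n) y) (tderiv A (g ^^ n) y a) \<le> E * \<mu> ^ n * rnorm G y v) \<and>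
      (\<forall>n. rnorm G ((inv g ^^ n) y) (tderiv A (inv g ^^ n) y (v - a)) \<le> E * \<mu> ^ n * rnorm G y v))" for y v
  have P: "P y v \<in> bvec g y" "v - P y v \<in> bvec (inv g) y"
      "rnorm G ((g ^^ n) y) (tderiv A (g ^^ n) y (P y v)) \<le> E * \<mu> ^ n * rnorm G y v"
      "rnorm G ((inv g ^^ n) y) (tderiv A (inv g ^^ n) y (v - P y v)) \<le> E * \<mu> ^ n * rnorm G y v"
    if "y \<in> ?\<Lambda>" for y v n
    using someI_ex[OF dich(2)[OF that, of v]] unfolding P_def[symmetric] by blast+
  have sub: "subspace (bvec g y)" "subspace (bvec (inv g) y)" for y by (rule subspace_bvec[OF cg], rule subspace_bvec[OF ci])
  have uniq: "P y v = a" if "y \<in> ?\<Lambda>" "a \<in> bvec g y" "v - a \<in> bvec (inv g) y" for y v a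
  proof -
    have "P y v - a \<in> bvec g y" using subspace_diff[OF sub(1) P(1)[OF that(1)] that(2)] .
    moreover have "P y v - a \<in> bvec (inv g) y" using subspace_diff[OF sub(2) that(3) P(2)[OF that(1), of v]] by simp
    ultimately have "P y v - a \<in> {0}" using dich(1)[OF that(1)] by blast
    then show ?thesis by simp
  qed
  \<comment> \<open>A bounded vector is its own projection and therefore obeys the estimate with the
    fixed constant \<open>E\<close>. An existential bound thus turns into an intersection of closed
    conditions.\<close>
  have char1: "v \<in> bvec g y \<longleftrightarrow> (\<forall>n. rnorm G ((g ^^ n) y) (tderiv A (g ^^ n) y v) \<le> E * \<mu> ^ n * rnorm G y v)" if y: "y \<in> ?\<Lambda>" for y v
  proof
    assume "v \<in> bvec g y"
    then have "P y v = v" using uniq[OF y] subspace_0[OF sub(2)] by simp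
    then show "\<forall>n. rnorm G ((g ^^ n) y) (tderiv A (g ^^ n) y v) \<le> E * \<mu> ^ n * rnorm G y v" using P(3)[OF y, of _ v] by simp
  next
    assume "\<forall>n. rnorm G ((g ^^ n) y) (tderiv A (g ^^ n) y v) \<le> E * \<mu> ^ n * rnorm G y v"
    then show "v \<in> bvec g y"
      by (intro bvecI[where M="E * rnorm G y v" and \<mu>=\<mu>]) (use E0 rnorm_nonneg \<mu>0 \<mu> in \<open>auto simp: mult_ac\<close>)
  qed
  have char2: "v \<in> bvec (inv g) y \<longleftrightarrow> (\<forall>n. rnorm G ((inv g ^^ n) y) (tderiv A (inv g ^^ n) y v) \<le> E * \<mu> ^ n * rnorm G y v)" if y: "y \<in> ?\<Lambda>" for y v
  proof
    assume "v \<in> bvec (inv g) y"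
    then have "P y v = 0" using uniq[OF y, of 0 v] subspace_0[OF sub(1)] by simp
    then show "\<forall>n. rnorm G ((inv g ^^ n) y) (tderiv A (inv g ^^ n) y v) \<le> E * \<mu> ^ n * rnorm G y v" using P(4)[OF y, of _ v] by simp
  next
    assume "\<forall>n. rnorm G ((inv g ^^ n) y) (tderiv A (inv g ^^ n) y v) \<le> E * \<mu> ^ n * rnorm G y v"
    then show "v \<in> bvec (inv g) y"
      by (intro bvecI[where M="E * rnorm G y v" and \<mu>=\<mu>]) (use E0 rnorm_nonneg \<mu>0 \<mu> in \<open>auto simp: mult_ac\<close>)
  qed
  have contP: "continuous_on (?\<Lambda> \<inter> nbh y0 R) (\<lambda>y. T\<kappa> y0 y (P y (U\<kappa> y0 y a)))" for y0 a
  proof -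
    let ?c = "\<kappa> y0"
    have nbh_eq: "nbh y0 R = cinv ?c ` cball (cmap ?c y0) R"
    proof (intro subset_antisym subsetI)
      fix y assume y: "y \<in> nbh y0 R"
      show "y \<in> cinv ?c ` cball (cmap ?c y0) R"
        using nbhD(3)[OF y] cinv_cmap[OF \<kappa>(1) nbhD(1)[OF y]] by (metis image_eqI)
    next
      fix y assume "y \<in> cinv ?c ` cball (cmap ?c y0) R"
      then obtain z where z: "z \<in> cball (cmap ?c y0) R" "y = cinv ?c z" by blast
      note zi = subsetD[OF \<kappa>_ball z(1)]
      have "cinv ?c z \<in> cdom ?c" "cmap ?c (cinv ?c z) = z" by (rule cinv_in[OF zi], rule cmap_cinv[OF zi])
      then show "y \<in> nbh y0 R" using z by (simp add: nbh_def loc_def dist_norm norm_minus_commute)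
    qed
    have "compact (nbh y0 R)"
      unfolding nbh_eq by (rule compact_continuous_image[OF continuous_on_subset[OF continuous_on_cinv[OF \<kappa>(1)] \<kappa>_ball] compact_cball])
    then have cN: "compact (?\<Lambda> \<inter> nbh y0 R)" by (intro compact_Int_closed c\<Lambda> compact_imp_closed)
    have cc: "continuous_on (?\<Lambda> \<inter> nbh y0 R) (cmap ?c)"
      by (rule continuous_on_subset[OF continuous_on_cmap[OF \<kappa>(1)]]) (use nbhD(1) in auto)
    \<comment> \<open>The base points are replaced by their coordinates, so that the graph lies in a
      product of Euclidean spaces.\<close>
    define S where "S = cmap ?c ` (?\<Lambda> \<inter> nbh y0 R)"
    have cS: "compact S" unfolding S_def by (rule compact_continuous_image[OF cc cN])
    have Sp: "cinv ?c z \<in> ?\<Lambda>" "cinv ?c z \<in> nbh y0 R" "z \<in> cmap ?c ` cdom ?c" if z: "z \<in> S" for z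
    proof -
      obtain y where "y \<in> ?\<Lambda>" "y \<in> nbh y0 R" "z = cmap ?c y" using z unfolding S_def by blast
      then show "cinv ?c z \<in> ?\<Lambda>" "cinv ?c z \<in> nbh y0 R" "z \<in> cmap ?c ` cdom ?c"
        using cinv_cmap[OF \<kappa>(1) nbhD(1)] nbhD(1) by auto
    qed
    let ?p = "\<lambda>z. cinv ?c z"
    define q where "q z = T\<kappa> y0 (?p z) (P (?p z) (U\<kappa> y0 (?p z) a))" for z
    let ?\<rho> = "C * (E * (C * norm a))"
    have TU: "T\<kappa> y0 (?p z) (U\<kappa> y0 (?p z) u) = u" "U\<kappa> y0 (?p z) (T\<kappa> y0 (?p z) v) = v" if "z \<in> S" for z u v
      using tcoord_inverse[OF \<kappa>(1) nbhD(1)[OF Sp(2)[OF that]]] by auto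
    have q_le: "norm (q z) \<le> ?\<rho>" if z: "z \<in> S" for z
    proof -
      have "rnorm G (?p z) (P (?p z) (U\<kappa> y0 (?p z) a)) \<le> E * rnorm G (?p z) (U\<kappa> y0 (?p z) a)"
        using P(3)[OF Sp(1)[OF z], of 0] unfolding tderiv_funpow(1)[OF cg] by simp
      also have "\<dots> \<le> E * (C * norm a)"
        using tcoord_norm(2)[OF Sp(2)[OF z], of "U\<kappa> y0 (?p z) a"] E0 unfolding TU[OF z] by (intro mult_left_mono) auto
      finally have "C * rnorm G (?p z) (P (?p z) (U\<kappa> y0 (?p z) a)) \<le> ?\<rho>" using C by (intro mult_left_mono) auto
      then show ?thesis unfolding q_def using tcoord_norm(1)[OF Sp(2)[OF z]] order_trans by blast
    qed
    let ?T = "S \<times> cball (0 :: 'e) ?\<rho>"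
    let ?r = "\<lambda>F t u. rnorm G (F (?p (fst t))) (tderiv A F (?p (fst t)) (U\<kappa> y0 (?p (fst t)) u))"
    have cp: "continuous_on ?T (\<lambda>t. ?p (fst t))"
      by (rule continuous_on_compose2[OF continuous_on_cinv[OF \<kappa>(1)] continuous_on_fst[OF continuous_on_id]]) (use Sp(3) in auto)
    have cr: "continuous_on ?T (\<lambda>t. ?r F t (u t))" if "C1_map A F" "continuous_on ?T u" for F u
      by (rule continuous_on_rnorm_tderiv[OF that(1) \<kappa>(1) cp _ that(2)]) (use nbhD(1)[OF Sp(2)] in auto)
    have cT: "closed ?T" by (intro closed_Times compact_imp_closed cS compact_cball)
    have clos: "closed {t \<in> ?T. ?r F t (u t) \<le> k * ?r id t (u t)}" if F: "C1_map A F" and u: "continuous_on ?T u" for F u k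
    proof -
      have "continuous_on ?T (\<lambda>t. ?r F t (u t) - k * ?r id t (u t))"
        by (intro continuous_on_diff continuous_on_mult continuous_on_const cr F u C1_map_id)
      from continuous_closed_preimage[OF this cT closed_atMost[of 0]]
      have "closed (?T \<inter> (\<lambda>t. ?r F t (u t) - k * ?r id t (u t)) -` {..0})" .
      moreover have "?T \<inter> (\<lambda>t. ?r F t (u t) - k * ?r id t (u t)) -` {..0} = {t \<in> ?T. ?r F t (u t) \<le> k * ?r id t (u t)}" by auto
      ultimately show ?thesis by simp
    qed
    have u1: "continuous_on ?T snd" and u2: "continuous_on ?T (\<lambda>t. a - snd t)"
      by (intro continuous_on_diff continuous_on_const continuous_on_snd continuous_on_id)+
    \<comment> \<open>A pair \<open>(z, u)\<close> lies on the graph exactly if \<open>u\<close>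
      obeys the stable estimates and \<open>a - u\<close> the unstable ones. The ball of radius
      \<open>?\<rho>\<close>, which contains all values of \<open>q\<close>, provides
      compactness.\<close>
    have graph: "(\<lambda>z. (z, q z)) ` S =
        ?T \<inter> (\<Inter>n. {t \<in> ?T. ?r (g ^^ n) t (snd t) \<le> (E * \<mu> ^ n) * ?r id t (snd t)})
           \<inter> (\<Inter>n. {t \<in> ?T. ?r (inv g ^^ n) t (a - snd t) \<le> (E * \<mu> ^ n) * ?r id t (a - snd t)})" (is "?L = ?R")
    proof (intro subset_antisym subsetI)
      have lU: "U\<kappa> y0 (?p z) (a - u) = U\<kappa> y0 (?p z) a - U\<kappa> y0 (?p z) u" if "z \<in> S" for z u
        by (rule linear_diff[OF linear_tchange[OF \<kappa>(1) chart_at(1) nbhD(1)[OF Sp(2)[OF that]] chart_at(2)]])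
      fix t
      show "t \<in> ?R" if tL: "t \<in> ?L"
      proof -
        obtain z where z: "z \<in> S" "t = (z, q z)" using tL by blast
        have Uq: "U\<kappa> y0 (?p z) (q z) = P (?p z) (U\<kappa> y0 (?p z) a)" unfolding q_def TU(2)[OF z(1)] ..
        have "P (?p z) (U\<kappa> y0 (?p z) a) \<in> bvec g (?p z)" "U\<kappa> y0 (?p z) a - P (?p z) (U\<kappa> y0 (?p z) a) \<in> bvec (inv g) (?p z)"
          by (rule P[OF Sp(1)[OF z(1)]])+
        then show ?thesis
          unfolding char1[OF Sp(1)[OF z(1)]] char2[OF Sp(1)[OF z(1)]] z(2)
          using z(1) q_le[OF z(1)] by (simp add: lU[OF z(1)] Uq tderiv_id)
      qed
      show "t \<in> ?L" if t: "t \<in> ?R"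
      proof -
        obtain z u where zu: "t = (z, u)" by (cases t)
        have z: "z \<in> S" using t zu by auto
        have "U\<kappa> y0 (?p z) u \<in> bvec g (?p z)"
          unfolding char1[OF Sp(1)[OF z]] using t zu by (simp add: tderiv_id)
        moreover have "U\<kappa> y0 (?p z) a - U\<kappa> y0 (?p z) u \<in> bvec (inv g) (?p z)"
          unfolding char2[OF Sp(1)[OF z]] lU[OF z, symmetric] using t zu by (simp add: tderiv_id)
        ultimately have "P (?p z) (U\<kappa> y0 (?p z) a) = U\<kappa> y0 (?p z) u" by (rule uniq[OF Sp(1)[OF z]])
        then have "q z = u" unfolding q_def by (simp add: TU[OF z])
        then show ?thesis using z zu by blast
      qed
    qed
    have "closed ((\<lambda>z. (z, q z)) ` S)"
      unfolding graph
      by (intro closed_Int closed_INT ballI cT clos u1 u2 C1_map_funpow cg ci)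
    then have "closedin (top_of_set ?T) ((\<lambda>z. (z, q z)) ` S)" by (rule closed_subset[rotated]) (use q_le in auto)
    then have "continuous_on S q"
      by (subst continuous_closed_graph_eq[OF compact_cball[of 0 ?\<rho>]]) (use q_le in auto)
    then have "continuous_on (?\<Lambda> \<inter> nbh y0 R) (\<lambda>y. q (cmap ?c y))"
      by (rule continuous_on_compose2[OF _ cc]) (simp add: S_def)
    then show ?thesis
      by (rule continuous_on_eq) (use nbhD(1) in \<open>auto simp: q_def cinv_cmap \<kappa>\<close>)
  qed
  have sb1: "continuous_subbundle A ?\<Lambda> (bvec g)"
    by (rule continuous_subbundleI[where F="bvec (inv g)" and P=P, OF sub dich(1) P(1,2) contP])
  have sb2: "continuous_subbundle A ?\<Lambda> (bvec (inv g))"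
  proof (rule continuous_subbundleI[where F="bvec g" and P="\<lambda>y v. v - P y v", OF sub(2,1)])
    show "bvec (inv g) y \<inter> bvec g y = {0}" if "y \<in> ?\<Lambda>" for y using dich(1)[OF that] by blast
    show "v - (v - P y v) \<in> bvec g y" if "y \<in> ?\<Lambda>" for y v using P(1)[OF that, of v] by simp
    show "continuous_on (?\<Lambda> \<inter> nbh y0 R) (\<lambda>y. T\<kappa> y0 y (U\<kappa> y0 y a - P y (U\<kappa> y0 y a)))" for y0 a
    proof -
      have "continuous_on (?\<Lambda> \<inter> nbh y0 R) (\<lambda>y. a - T\<kappa> y0 y (P y (U\<kappa> y0 y a)))"
        by (intro continuous_on_diff continuous_on_const contP)
      then show ?thesis
      proof (rule continuous_on_eq)
        fix y assume "y \<in> ?\<Lambda> \<inter> nbh y0 R"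
        then have y: "y \<in> cdom (\<kappa> y0)" using nbhD(1) by blast
        show "a - T\<kappa> y0 y (P y (U\<kappa> y0 y a)) = T\<kappa> y0 y (U\<kappa> y0 y a - P y (U\<kappa> y0 y a))"
          by (simp add: linear_diff[OF linear_tcoord[OF \<kappa>(1) y]] tcoord_inverse[OF \<kappa>(1) y])
      qed
    qed
  qed (rule P(2))
  have ginv: "g ` ?\<Lambda> = ?\<Lambda>"
  proof -
    have "g ` ?\<Lambda> = h ` f ` \<Lambda>" unfolding image_image using h(3) by (intro image_cong) auto
    then show ?thesis unfolding \<Lambda>(1) .
  qed
  have sum: "{u + v |u v. u \<in> bvec g y \<and> v \<in> bvec (inv g) y} = UNIV" if y: "y \<in> ?\<Lambda>" for y
  proof -
    have "v \<in> {u + v |u v. u \<in> bvec g y \<and> v \<in> bvec (inv g) y}" for v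
      using P(1,2)[OF y, of v] by (intro CollectI exI[of _ "P y v"] exI[of _ "v - P y v"]) simp
    then show ?thesis by blast
  qed
  have est: "rnorm G ((g ^^ n) y) (tderiv A (g ^^ n) y v) \<le> E * \<mu> ^ n * rnorm G y v"
    if "y \<in> ?\<Lambda>" "v \<in> bvec g y" for y v n using char1[OF that(1)] that(2) by blast
  have est_inv: "rnorm G ((inv g ^^ n) y) (tderiv A (inv g ^^ n) y v) \<le> E * \<mu> ^ n * rnorm G y v"
    if "y \<in> ?\<Lambda>" "v \<in> bvec (inv g) y" for y v n using char2[OF that(1)] that(2) by blast
  have "hyperbolic_set A G g \<mu> E ?\<Lambda>"
    unfolding hyperbolic_set_def
    by (rule conjI[OF \<mu>0 conjI[OF \<mu>(2) conjI[OF E0 conjI[OF c\<Lambda> conjI[OF ginv]]]]],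
        rule exI[of _ "bvec g"], rule exI[of _ "bvec (inv g)"])
       (intro conjI sb1 sb2 ballI allI dich(1) sum bvec_tderiv[OF g] bvec_inv_tderiv[OF g] est est_inv; assumption)
  then show ?thesis by blast
qed

end

subsection \<open>Structural stability\<close>

lemma hyperbolic_setD:
  assumes "hyperbolic_set A G f lam c \<Lambda>"
  shows "0 < lam" "lam < 1" "0 < c" "compact \<Lambda>" "f ` \<Lambda> = \<Lambda>"
proof -
  note h1 = assms[unfolded hyperbolic_set_def]
  note h2 = conjunct2[OF h1] note h3 = conjunct2[OF h2] note h4 = conjunct2[OF h3] note h5 = conjunct2[OF h4]
  show "0 < lam" "lam < 1" "0 < c" "compact \<Lambda>" "f ` \<Lambda> = \<Lambda>"
    by (rule conjunct1[OF h1], rule conjunct1[OF h2], rule conjunct1[OF h3], rule conjunct1[OF h4], rule conjunct1[OF h5])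
qed

text \<open>The model space has a basis vector, so some tangent vector has positive length and a
  negative \<open>K\<close> is impossible.\<close>

lemma (in riemannian) deriv_bounded_nonneg:
  assumes "deriv_bounded A G f K" shows "K \<ge> 0"
proof -
  obtain b :: 'e where b: "b \<in> Basis" using nonempty_Basis by blast
  then have "G undefined b b > 0" by (intro G(3)) auto
  then have "rnorm G undefined b > 0" by (simp add: rnorm_def)
  moreover have "0 \<le> K * rnorm G undefined b"
    using assms rnorm_nonneg order_trans unfolding deriv_bounded_def by blast
  ultimately show ?thesis by (simp add: zero_le_mult_iff)
qed

context uniform_charts
begin

text \<open>The sizes are chosen from \<open>lam\<close>, \<open>c\<close>, \<open>K\<close> and
  \<open>\<omega>\<close> before \<open>f\<close> is given. In the last clause the set
  \<open>\<Lambda>' g\<close> is the same for all \<open>\<mu>\<close>; only the closeness of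
  \<open>g\<close> needed for the rate \<open>\<mu>\<close> varies.\<close>

lemma structural_stability:
  assumes lam: "0 < lam" "lam < 1" and c: "c > 0" and K: "K \<ge> 0"
    and \<omega>: "\<And>\<eta>. \<eta> > 0 \<Longrightarrow> \<exists>r>0. \<omega> r \<le> ennreal \<eta>"
  shows "\<exists>\<epsilon> \<delta>. \<epsilon> > 0 \<and> \<delta> > 0 \<and> (\<forall>f \<Lambda>. C1_diffeo A f \<longrightarrow> hyperbolic_set A G f lam c \<Lambda> \<longrightarrow> deriv_bounded A G f K \<longrightarrow>
      deriv_modulus A G f = \<omega> \<longrightarrow>
      (\<exists>\<Lambda>' h.
         (\<forall>g. C1_diffeo A g \<longrightarrow> C1_dist A G f g < ennreal \<epsilon> \<longrightarrow>
            (\<exists>\<mu> c'. lam < \<mu> \<and> \<mu> < 1 \<and> hyperbolic_set A G g \<mu> c' (\<Lambda>' g)) \<and>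
            close_conjugacy A G \<delta> f \<Lambda> g (\<Lambda>' g) (h g) \<and>
            (\<forall>\<Lambda>'' h''. close_conjugacy A G \<delta> f \<Lambda> g \<Lambda>'' h'' \<longrightarrow> \<Lambda>'' = \<Lambda>' g)) \<and>
         (\<forall>\<eta>>0. \<exists>\<rho>>0. \<forall>g. C1_diffeo A g \<longrightarrow> C1_dist A G f g < ennreal \<rho> \<longrightarrow>
            (\<forall>x\<in>\<Lambda>. riem_dist A G (h g x) x < ennreal \<eta>)) \<and>
         (\<forall>\<mu>. lam < \<mu> \<longrightarrow> \<mu> < 1 \<longrightarrow> (\<exists>\<rho>>0. \<forall>g. C1_diffeo A g \<longrightarrow> C1_dist A G f g < ennreal \<rho> \<longrightarrow>
            (\<exists>c'. hyperbolic_set A G g \<mu> c' (\<Lambda>' g))))))"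
proof -
  obtain D where D: "D > 0" and green: "\<And>f \<Lambda> x. C1_diffeo A f \<Longrightarrow> hyperbolic_set A G f lam c \<Lambda> \<Longrightarrow> deriv_bounded A G f K \<Longrightarrow> x \<in> \<Lambda> \<Longrightarrow>
      \<exists>Gk. green_kernel (lin f x) Gk D lam (C * C * K)"
    by (rule hyperbolic_green_kernel[OF lam c K]) (rule that)
  have C0: "C > 0" using C by simp
  define D1 where "D1 \<mu> = D * (2 / (1 - lam / \<mu>))" for \<mu>
  have D1: "D1 \<mu> > 0" if "lam < \<mu>" for \<mu> using D lam that by (simp add: D1_def)
  \<comment> \<open>The largest Lipschitz constant for which the equation weighted with
    \<open>\<mu>\<close> contracts by \<open>1/2\<close>.\<close>
  define \<eta>' where "\<eta>' \<mu> = \<mu> / (2 * D1 \<mu>)" for \<mu>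
  have \<eta>': "\<eta>' \<mu> > 0" "D1 \<mu> * \<eta>' \<mu> / \<mu> \<le> 1/2" if "lam < \<mu>" for \<mu>
    using D1[OF that] lam that by (auto simp: \<eta>'_def field_simps)
  define \<mu>0 where "\<mu>0 = (1 + lam) / 2"
  have \<mu>0: "lam < \<mu>0" "\<mu>0 < 1" using lam by (auto simp: \<mu>0_def)
  define Dc where "Dc = D * (2 / (1 - lam))"
  have Dc: "Dc > 0" using D lam by (simp add: Dc_def)
  \<comment> \<open>\<open>Dc\<close> is \<open>D1\<close> at \<open>\<mu> = 1\<close>. It is at
    most \<open>D1 \<mu>0\<close>, so the Lipschitz constant chosen for \<open>\<mu>0\<close> also
    serves the unweighted equation used for existence.\<close>
  have "lam \<le> lam / \<mu>0" using \<mu>0 lam by (simp add: field_simps)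
  then have "2 / (1 - lam) \<le> 2 / (1 - lam / \<mu>0)"
    using \<mu>0 lam by (intro divide_left_mono mult_pos_pos) auto
  then have "Dc \<le> D1 \<mu>0" unfolding Dc_def D1_def using D by (intro mult_left_mono) auto
  then have "Dc * \<eta>' \<mu>0 \<le> D1 \<mu>0 * \<eta>' \<mu>0" using \<eta>'(1)[OF \<mu>0(1)] by (intro mult_right_mono) auto
  also have "\<dots> = \<mu>0 / 2" unfolding \<eta>'_def using D1[OF \<mu>0(1)] by simp
  finally have Dc\<eta>: "Dc * \<eta>' \<mu>0 \<le> 1/2" using \<mu>0 by simp
  obtain s \<epsilon>1 where s: "s > 0" "s \<le> R" and \<epsilon>1: "\<epsilon>1 > 0"
    and nearf: "\<And>f. C1_map A f \<Longrightarrow> deriv_bounded A G f K \<Longrightarrow> deriv_modulus A G f = \<omega> \<Longrightarrow> near f f s (\<eta>' \<mu>0)"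
    and nearg: "\<And>f g. C1_map A f \<Longrightarrow> deriv_bounded A G f K \<Longrightarrow> deriv_modulus A G f = \<omega> \<Longrightarrow> C1_map A g \<Longrightarrow>
       C1_dist A G f g < ennreal \<epsilon>1 \<Longrightarrow> near f g s (\<eta>' \<mu>0)"
    and disp: "\<And>f g x \<rho>. C1_map A f \<Longrightarrow> deriv_bounded A G f K \<Longrightarrow> C1_map A g \<Longrightarrow> \<rho> \<le> \<epsilon>1 \<Longrightarrow>
       C1_dist A G f g < ennreal \<rho> \<Longrightarrow> norm (loc (f x) (g x)) \<le> C * \<rho>"
    by (rule ex_near[OF K _ \<eta>'(1)[OF \<mu>0(1)]]) (rule \<omega>, assumption, rule that)
  \<comment> \<open>By \<open>riem_dist_nbh\<close>, points at distance below
    \<open>\<delta>\<close> lie in coordinate balls of radius \<open>C ^ 3 * \<delta>\<close>,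
    within the tube of radius \<open>s\<close> in which orbits are unique.\<close>
  obtain \<delta> where \<delta>: "\<delta> > 0" "\<delta> * (C * C * C) < s" using ex_small[of s 1 1 1 "C * C * C" 0 0 0] s by auto
  \<comment> \<open>\<open>\<rho>1\<close> bounds the displacement of the conjugacy. The three
    conditions are those for its injectivity, its continuity and its distance to the
    identity.\<close>
  obtain \<rho>1 where \<rho>1: "\<rho>1 > 0" "\<rho>1 * (1 + C * C) < s" "\<rho>1 * (C * C) < s / 2" "\<rho>1 * C < \<delta>"
    using ex_small[of s "s / 2" \<delta> 1 "1 + C * C" "C * C" C 0] s \<delta> by auto
  obtain \<epsilon>2 where \<epsilon>2: "\<epsilon>2 > 0" "\<epsilon>2 * (2 * Dc * C) < \<rho>1"
    using ex_small[of \<rho>1 1 1 1 "2 * Dc * C" 0 0 0] \<rho>1 by auto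
  define \<epsilon> where "\<epsilon> = min \<epsilon>1 \<epsilon>2"
  have \<epsilon>: "\<epsilon> > 0" "\<epsilon> \<le> \<epsilon>1" "\<epsilon> \<le> \<epsilon>2" using \<epsilon>1 \<epsilon>2 by (auto simp: \<epsilon>_def)
  have \<rho>s: "\<rho>1 + C * (C * \<rho>1) < s" "s / 2 + C * (C * \<rho>1) < s" "C * \<rho>1 < \<delta>"
    using \<rho>1 by (auto simp: algebra_simps)
  have "0 \<le> C * (C * \<rho>1)" using C0 \<rho>1 by simp
  then have \<rho>1s: "\<rho>1 \<le> s" "\<rho>1 \<le> R" using \<rho>s s by linarith+
  have r_le: "2 * Dc * (C * \<rho>) \<le> \<rho>1" if "\<rho> \<le> \<epsilon>" for \<rho>
  proof -
    have "\<rho> * (2 * Dc * C) \<le> \<epsilon>2 * (2 * Dc * C)" using that \<epsilon> Dc C0 by (intro mult_right_mono) auto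
    then show ?thesis using \<epsilon>2(2) by (simp add: mult_ac)
  qed
  have \<delta>3: "C * (C * (C * \<delta>)) \<le> s" "C * (C * (C * \<delta>)) < R" using \<delta>(2) s by (auto simp: mult_ac)
  show ?thesis
  proof (rule exI[of _ \<epsilon>], rule exI[of _ \<delta>], intro conjI allI impI \<epsilon>(1) \<delta>(1))
    fix f \<Lambda> assume f: "C1_diffeo A f" and hyp: "hyperbolic_set A G f lam c \<Lambda>" and fK: "deriv_bounded A G f K"
      and f\<omega>: "deriv_modulus A G f = \<omega>"
    note bf = C1_diffeoD(1)[OF f] and cf = C1_diffeoD(2)[OF f]
    have \<Lambda>: "f ` \<Lambda> = \<Lambda>" "compact \<Lambda>" by (rule hyperbolic_setD[OF hyp])+
    note Gk = green[OF f hyp fK]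
    define shadow where "shadow g x y \<longleftrightarrow> (\<forall>n. y n \<in> nbh (zpow f n x) s) \<and> (\<forall>n. y (n + 1) = g (y n))" for g x and y :: "int \<Rightarrow> 'a"
    \<comment> \<open>For \<open>g\<close> close to \<open>f\<close> and \<open>x\<close> in
      \<open>\<Lambda>\<close> the choice does not matter at time 0, by \<open>unique_orbit\<close>;
      elsewhere the value is arbitrary.\<close>
    define h where "h g x = (SOME y. shadow g x y) 0" for g x
    define good where "good g \<rho> \<longleftrightarrow> C1_diffeo A g \<and> C1_dist A G f g < ennreal \<rho>" for g \<rho>
    have good_mono: "good g \<sigma>" if "good g \<rho>" "\<rho> \<le> \<sigma>" for g \<rho> \<sigma>
      using that ennreal_leI[OF that(2)] order_less_le_trans unfolding good_def by blast
    have goodD: "C1_diffeo A g" "C1_map A g" "near f g s (\<eta>' \<mu>0)" if "good g \<epsilon>" for g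
      using that C1_diffeoD(2) nearg[OF cf fK f\<omega>] good_mono[OF that \<epsilon>(2)] unfolding good_def by blast+
    have \<eta>0: "\<eta>' \<mu>0 \<ge> 0" using \<eta>'(1)[OF \<mu>0(1)] by simp
    have h_eq: "h g x = y 0" if g: "good g \<epsilon>" and x: "x \<in> \<Lambda>" and y: "shadow g x y" for g x y
    proof -
      define y' where "y' = (SOME y. shadow g x y)"
      have y': "shadow g x y'" unfolding y'_def by (rule someI[of "shadow g x", OF y])
      obtain Gk where Gk: "green_kernel (lin f x) Gk D lam (C * C * K)" using Gk[OF x] by blast
      have "y' 0 = y 0"
        by (rule unique_orbit[OF f goodD(2,3)[OF g] less_imp_le[OF s(1)] s(2) \<eta>0 Gk \<mu>0 \<eta>'(2)[OF \<mu>0(1), unfolded D1_def]])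
           (use y y' in \<open>auto simp: shadow_def\<close>)
      then show ?thesis by (simp add: h_def y'_def)
    qed
    have ex: "\<exists>y. shadow g x y \<and> y 0 \<in> nbh x (2 * Dc * (C * \<rho>))" if g: "good g \<rho>" and \<rho>: "\<rho> \<le> \<epsilon>" and x: "x \<in> \<Lambda>" for g x \<rho>
    proof -
      note g\<epsilon> = goodD[OF good_mono[OF g \<rho>]]
      obtain Gk where Gk: "green_kernel (lin f x) Gk D lam (C * C * K)" using Gk[OF x] by blast
      have d: "norm (loc (f z) (g z)) \<le> C * \<rho>" for z
        using disp[OF cf fK g\<epsilon>(2)] \<rho> \<epsilon>(2) g unfolding good_def by auto
      have "\<exists>y. (\<forall>n. y n \<in> nbh (zpow f n x) (2 * (D * (2 / (1 - lam))) * (C * \<rho>))) \<and> (\<forall>n. y (n + 1) = g (y n))"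
        by (rule ex_shadow[OF f g\<epsilon>(2,3) s(2) \<eta>0 Gk Dc\<eta>[unfolded Dc_def] d])
           (use r_le[OF \<rho>] \<rho>1s in \<open>simp add: Dc_def\<close>)
      then obtain y where y: "\<And>n. y n \<in> nbh (zpow f n x) (2 * Dc * (C * \<rho>))" "\<And>n. y (n + 1) = g (y n)"
        unfolding Dc_def by blast
      have "y n \<in> nbh (zpow f n x) s" for n by (rule nbh_mono[OF _ y(1)]) (use r_le[OF \<rho>] \<rho>1s in linarith)
      then have "shadow g x y" using y(2) by (simp add: shadow_def)
      moreover have "y 0 \<in> nbh x (2 * Dc * (C * \<rho>))" using y(1)[of 0] by (simp only: zpow_0 id_apply)
      ultimately show ?thesis by blast
    qed
    have h_nbh: "h g x \<in> nbh x (2 * Dc * (C * \<rho>))" if "good g \<rho>" "\<rho> \<le> \<epsilon>" "x \<in> \<Lambda>" for g x \<rho>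
      using ex[OF that] h_eq[OF good_mono[OF that(1,2)] that(3)] by metis
    have h1: "h g x \<in> nbh x \<rho>1" if "good g \<epsilon>" "x \<in> \<Lambda>" for g x
      by (rule nbh_mono[OF r_le[of \<epsilon>] h_nbh[OF that(1) _ that(2)]]) auto
    have h2: "h g (f x) = g (h g x)" if g: "good g \<epsilon>" and x: "x \<in> \<Lambda>" for g x
    proof -
      obtain y where y: "shadow g x y" using ex[OF g order_refl x] by blast
      have z: "zpow f n (f x) = zpow f (n + 1) x" for n by (simp add: zpow_Suc(2)[OF bf])
      have "shadow g (f x) (\<lambda>n. y (n + 1))" using y unfolding shadow_def z by blast
      from h_eq[OF g _ this] have "h g (f x) = y (0 + 1)" using \<Lambda>(1) x by auto
      also have "\<dots> = g (y 0)" using y unfolding shadow_def by blast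
      finally show ?thesis by (simp only: h_eq[OF g x y])
    qed
    have h_cont: "continuous_on \<Lambda> (h g)" if g: "good g \<epsilon>" for g
      by (rule shadow_continuous[OF f goodD(2,3)[OF g] s \<eta>0 \<Lambda>(1) Gk \<mu>0 \<eta>'(2)[OF \<mu>0(1), unfolded D1_def] h1[OF g] h2[OF g] \<rho>1s(1) \<rho>s(2)])
    have h_inj: "inj_on (h g) \<Lambda>" if g: "good g \<epsilon>" for g
      by (rule shadow_injective[OF f goodD(1)[OF g] nearf[OF cf fK f\<omega>] s \<eta>0 \<Lambda>(1) Gk \<mu>0 \<eta>'(2)[OF \<mu>0(1), unfolded D1_def] h1[OF g] h2[OF g] \<rho>s(1)])
    \<comment> \<open>For a rate closer to \<open>lam\<close> the derivative of \<open>g\<close>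
      must be closer to that of \<open>f\<close>, which holds only in a smaller tube of radius
      \<open>s'\<close>. The same \<open>h g\<close> lies in it once the displacement, linear in
      \<open>\<rho>\<close>, is small.\<close>
    have hyp_\<mu>: "\<exists>\<rho>>0. \<rho> \<le> \<epsilon> \<and> (\<forall>g. good g \<rho> \<longrightarrow> (\<exists>c'. hyperbolic_set A G g \<mu> c' (h g ` \<Lambda>)))" if \<mu>: "lam < \<mu>" "\<mu> < 1" for \<mu>
    proof -
      obtain s' \<epsilon>' where s': "s' > 0" "s' \<le> R" and \<epsilon>': "\<epsilon>' > 0"
        and near': "\<And>f g. C1_map A f \<Longrightarrow> deriv_bounded A G f K \<Longrightarrow> deriv_modulus A G f = \<omega> \<Longrightarrow> C1_map A g \<Longrightarrow>
           C1_dist A G f g < ennreal \<epsilon>' \<Longrightarrow> near f g s' (\<eta>' \<mu>)"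
        by (rule ex_near[OF K _ \<eta>'(1)[OF \<mu>(1)]]) (rule \<omega>, assumption, rule that)
      obtain \<rho>' where \<rho>': "\<rho>' > 0" "\<rho>' * (2 * Dc * C) < s'"
        using ex_small[of s' 1 1 1 "2 * Dc * C" 0 0 0] s' by auto
      define \<rho> where "\<rho> = min \<rho>' (min \<epsilon> \<epsilon>')"
      have \<rho>: "\<rho> > 0" "\<rho> \<le> \<rho>'" "\<rho> \<le> \<epsilon>" "\<rho> \<le> \<epsilon>'" using \<rho>' \<epsilon> \<epsilon>' by (auto simp: \<rho>_def)
      have "\<rho> * (2 * Dc * C) \<le> \<rho>' * (2 * Dc * C)" using \<rho> Dc C0 by (intro mult_right_mono) auto
      then have \<rho>s': "2 * Dc * (C * \<rho>) \<le> s'" using \<rho>'(2) by (simp add: mult_ac)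
      have "\<exists>c'. hyperbolic_set A G g \<mu> c' (h g ` \<Lambda>)" if g: "good g \<rho>" for g
      proof (rule hyperbolic_image[OF f _ _ less_imp_le[OF s'(1)] s'(2) _ \<Lambda> Gk \<mu> \<eta>'(2)[OF \<mu>(1), unfolded D1_def] lam(1) D])
        note g\<epsilon> = good_mono[OF g \<rho>(3)]
        show "C1_diffeo A g" by (rule goodD(1)[OF g\<epsilon>])
        show "near f g s' (\<eta>' \<mu>)"
          using near'[OF cf fK f\<omega> goodD(2)[OF g\<epsilon>]] good_mono[OF g \<rho>(4)] unfolding good_def by blast
        show "0 \<le> \<eta>' \<mu>" using \<eta>'(1)[OF \<mu>(1)] by simp
        show "continuous_on \<Lambda> (h g)" by (rule h_cont[OF g\<epsilon>])
        show "h g x \<in> nbh x s'" if "x \<in> \<Lambda>" for x by (rule nbh_mono[OF \<rho>s' h_nbh[OF g \<rho>(3) that]])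
        show "h g (f x) = g (h g x)" if "x \<in> \<Lambda>" for x by (rule h2[OF g\<epsilon> that])
      qed
      then show ?thesis using \<rho> by blast
    qed
    have hyp0: "\<exists>c'. hyperbolic_set A G g \<mu>0 c' (h g ` \<Lambda>)" if g: "good g \<epsilon>" for g
    proof (rule hyperbolic_image[OF f goodD(1,3)[OF g] less_imp_le[OF s(1)] s(2) \<eta>0 \<Lambda> Gk \<mu>0 \<eta>'(2)[OF \<mu>0(1), unfolded D1_def] lam(1) D h_cont[OF g]])
      show "h g x \<in> nbh x s" if "x \<in> \<Lambda>" for x by (rule nbh_mono[OF \<rho>1s(1) h1[OF g that]])
    qed (simp_all add: h2[OF g])
    show "\<exists>\<Lambda>' h.
         (\<forall>g. C1_diffeo A g \<longrightarrow> C1_dist A G f g < ennreal \<epsilon> \<longrightarrow>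
            (\<exists>\<mu> c'. lam < \<mu> \<and> \<mu> < 1 \<and> hyperbolic_set A G g \<mu> c' (\<Lambda>' g)) \<and>
            close_conjugacy A G \<delta> f \<Lambda> g (\<Lambda>' g) (h g) \<and>
            (\<forall>\<Lambda>'' h''. close_conjugacy A G \<delta> f \<Lambda> g \<Lambda>'' h'' \<longrightarrow> \<Lambda>'' = \<Lambda>' g)) \<and>
         (\<forall>\<eta>>0. \<exists>\<rho>>0. \<forall>g. C1_diffeo A g \<longrightarrow> C1_dist A G f g < ennreal \<rho> \<longrightarrow>
            (\<forall>x\<in>\<Lambda>. riem_dist A G (h g x) x < ennreal \<eta>)) \<and>
         (\<forall>\<mu>. lam < \<mu> \<longrightarrow> \<mu> < 1 \<longrightarrow> (\<exists>\<rho>>0. \<forall>g. C1_diffeo A g \<longrightarrow> C1_dist A G f g < ennreal \<rho> \<longrightarrow>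
            (\<exists>c'. hyperbolic_set A G g \<mu> c' (\<Lambda>' g))))"
    proof (rule exI[of _ "\<lambda>g. h g ` \<Lambda>"], rule exI[of _ h], intro conjI allI impI)
      fix g assume "C1_diffeo A g" "C1_dist A G f g < ennreal \<epsilon>"
      then have g: "good g \<epsilon>" by (simp add: good_def)
      show "\<exists>\<mu> c'. lam < \<mu> \<and> \<mu> < 1 \<and> hyperbolic_set A G g \<mu> c' (h g ` \<Lambda>)" using hyp0[OF g] \<mu>0 by blast
      show "close_conjugacy A G \<delta> f \<Lambda> g (h g ` \<Lambda>) (h g)"
        unfolding close_conjugacy_def
      proof (intro conjI ballI)
        show "\<exists>k. homeomorphism \<Lambda> (h g ` \<Lambda>) (h g) k"
          by (rule homeomorphism_compact[OF \<Lambda>(2) h_cont[OF g] refl h_inj[OF g]])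
        show "riem_dist A G (h g x) x < ennreal \<delta>" if "x \<in> \<Lambda>" for x
          by (rule nbh_riem_dist[OF h1[OF g that] \<rho>1s(2) \<rho>s(3)])
        show "h g (f x) = g (h g x)" if "x \<in> \<Lambda>" for x by (rule h2[OF g that])
      qed
      \<comment> \<open>By the choice of \<open>\<delta>\<close>, any competing conjugacy carries
        \<open>f\<close>-orbits to shadowing orbits, hence agrees with \<open>h g\<close> at every
        point of \<open>\<Lambda>\<close>.\<close>
      fix \<Lambda>'' h'' assume cc: "close_conjugacy A G \<delta> f \<Lambda> g \<Lambda>'' h''"
      then have img: "\<Lambda>'' = h'' ` \<Lambda>" and d: "\<And>x. x \<in> \<Lambda> \<Longrightarrow> riem_dist A G (h'' x) x < ennreal \<delta>"
        and conj: "\<And>x. x \<in> \<Lambda> \<Longrightarrow> h'' (f x) = g (h'' x)"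
        unfolding close_conjugacy_def homeomorphism_def by blast+
      have "h'' x = h g x" if x: "x \<in> \<Lambda>" for x
      proof -
        have xL: "zpow f n x \<in> \<Lambda>" for n by (rule zpow_in[OF bf \<Lambda>(1) x])
        have "h'' (zpow f n x) \<in> nbh (zpow f n x) s" for n
          by (rule nbh_mono[OF \<delta>3(1) riem_dist_nbh[OF d[OF xL] \<delta>3(2)]])
        moreover have "h'' (zpow f (n + 1) x) = g (h'' (zpow f n x))" for n
          using conj[OF xL, of n] by (simp add: zpow_Suc(1)[OF bf])
        ultimately have "shadow g x (\<lambda>n. h'' (zpow f n x))" by (simp add: shadow_def)
        from h_eq[OF g x this] show ?thesis by (simp only: zpow_0 id_apply)
      qed
      then show "\<Lambda>'' = h g ` \<Lambda>" unfolding img by (rule image_cong[OF refl])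
    next
      fix \<eta> :: real assume \<eta>: "\<eta> > 0"
      obtain \<rho>' where \<rho>': "\<rho>' > 0" "\<rho>' * (2 * Dc * C * C) < \<eta>"
        using ex_small[of \<eta> 1 1 1 "2 * Dc * C * C" 0 0 0] \<eta> by auto
      define \<rho> where "\<rho> = min \<rho>' \<epsilon>"
      have \<rho>: "\<rho> > 0" "\<rho> \<le> \<rho>'" "\<rho> \<le> \<epsilon>" using \<rho>' \<epsilon> by (auto simp: \<rho>_def)
      have "\<rho> * (2 * Dc * C * C) \<le> \<rho>' * (2 * Dc * C * C)" using \<rho> Dc C0 by (intro mult_right_mono) auto
      then have \<rho>\<eta>: "C * (2 * Dc * (C * \<rho>)) < \<eta>" using \<rho>'(2) by (simp add: mult_ac)
      have "riem_dist A G (h g x) x < ennreal \<eta>" if "good g \<rho>" "x \<in> \<Lambda>" for g x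
        by (rule nbh_riem_dist[OF h_nbh[OF that(1) \<rho>(3) that(2)] _ \<rho>\<eta>]) (use r_le[OF \<rho>(3)] \<rho>1s in linarith)
      then show "\<exists>\<rho>>0. \<forall>g. C1_diffeo A g \<longrightarrow> C1_dist A G f g < ennreal \<rho> \<longrightarrow> (\<forall>x\<in>\<Lambda>. riem_dist A G (h g x) x < ennreal \<eta>)"
        using \<rho>(1) unfolding good_def by blast
    next
      fix \<mu> assume "lam < \<mu>" "\<mu> < 1"
      from hyp_\<mu>[OF this] show "\<exists>\<rho>>0. \<forall>g. C1_diffeo A g \<longrightarrow> C1_dist A G f g < ennreal \<rho> \<longrightarrow> (\<exists>c'. hyperbolic_set A G g \<mu> c' (h g ` \<Lambda>))"
        unfolding good_def by blast
    qed
  qed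
qed

end

text \<open>After \<open>structural_stability\<close>, what remains is a matter of choice:
  \<open>\<epsilon>\<^sub>0\<close> and \<open>\<delta>\<^sub>0\<close> become functions of the
  data, and each \<open>g\<close> is given a single exponent that has to meet every tolerance
  \<open>\<eta>\<close> in the limit.\<close>

theorem proposition3p1:
  fixes A :: "('a::t2_space, 'e::euclidean_space) chart set"
    and G :: "'a \<Rightarrow> 'e \<Rightarrow> 'e \<Rightarrow> real"
  assumes M: "compact_riemannian_manifold A G"
  shows "\<exists>\<epsilon>\<^sub>0 \<delta>\<^sub>0 :: real \<Rightarrow> real \<Rightarrow> real \<Rightarrow> real \<Rightarrow> (real \<Rightarrow> ennreal) \<Rightarrow> real.
    \<forall>(f :: 'a \<Rightarrow> 'a) \<Lambda> lam c K K'.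
      C1_diffeo A f \<and> hyperbolic_set A G f lam c \<Lambda> \<and>
      deriv_bounded A G f K \<and> deriv_bounded A G (inv f) K' \<longrightarrow>
      (let \<epsilon> = \<epsilon>\<^sub>0 lam c K K' (deriv_modulus A G f);
           \<delta> = \<delta>\<^sub>0 lam c K K' (deriv_modulus A G f)
       in \<epsilon> > 0 \<and> \<delta> > 0 \<and>
          (\<exists>(\<Lambda>' :: ('a \<Rightarrow> 'a) \<Rightarrow> 'a set) (h :: ('a \<Rightarrow> 'a) \<Rightarrow> 'a \<Rightarrow> 'a) (lam' :: ('a \<Rightarrow> 'a) \<Rightarrow> real).
             (\<forall>g. C1_diffeo A g \<and> C1_dist A G f g < ennreal \<epsilon> \<longrightarrow>
                lam < lam' g \<and> lam' g < 1 \<and>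
                (\<exists>c'. hyperbolic_set A G g (lam' g) c' (\<Lambda>' g)) \<and>
                close_conjugacy A G \<delta> f \<Lambda> g (\<Lambda>' g) (h g) \<and>
                (\<forall>\<Lambda>'' \<mu> c'' h''.
                   hyperbolic_set A G g \<mu> c'' \<Lambda>'' \<and> close_conjugacy A G \<delta> f \<Lambda> g \<Lambda>'' h'' \<longrightarrow>
                   \<Lambda>'' = \<Lambda>' g)) \<and>
             (\<forall>\<eta>>0. \<exists>\<rho>>0. \<forall>g. C1_diffeo A g \<and> C1_dist A G f g < ennreal \<rho> \<longrightarrow>
                (\<forall>x\<in>\<Lambda>. riem_dist A G (h g x) x < ennreal \<eta>)) \<and>
             (\<forall>\<eta>>0. \<exists>\<rho>>0. \<forall>g. C1_diffeo A g \<and> 0 < C1_dist A G f g \<and>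
                C1_dist A G f g < ennreal \<rho> \<longrightarrow> \<bar>lam' g - lam\<bar> < \<eta>)))"
proof -
  interpret riemannian A G
    using M by unfold_locales (auto simp: compact_riemannian_manifold_def)
  have cM: "compact (UNIV :: 'a set)" using M by (simp add: compact_riemannian_manifold_def)
  obtain \<kappa> R C where UC: "uniform_charts A G \<kappa> R C" using ex_uniform_charts[OF cM] by blast
  interpret U: uniform_charts A G \<kappa> R C by (rule UC)
  define Stable where "Stable \<epsilon> \<delta> f \<Lambda> lam \<Lambda>' h \<longleftrightarrow>
         (\<forall>g. C1_diffeo A g \<longrightarrow> C1_dist A G f g < ennreal \<epsilon> \<longrightarrow>
            (\<exists>\<mu> c'. lam < \<mu> \<and> \<mu> < 1 \<and> hyperbolic_set A G g \<mu> c' (\<Lambda>' g)) \<and>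
            close_conjugacy A G \<delta> f \<Lambda> g (\<Lambda>' g) (h g) \<and>
            (\<forall>\<Lambda>'' h''. close_conjugacy A G \<delta> f \<Lambda> g \<Lambda>'' h'' \<longrightarrow> \<Lambda>'' = \<Lambda>' g)) \<and>
         (\<forall>\<eta>>0. \<exists>\<rho>>0. \<forall>g. C1_diffeo A g \<longrightarrow> C1_dist A G f g < ennreal \<rho> \<longrightarrow>
            (\<forall>x\<in>\<Lambda>. riem_dist A G (h g x) x < ennreal \<eta>)) \<and>
         (\<forall>\<mu>. lam < \<mu> \<longrightarrow> \<mu> < 1 \<longrightarrow> (\<exists>\<rho>>0. \<forall>g. C1_diffeo A g \<longrightarrow> C1_dist A G f g < ennreal \<rho> \<longrightarrow>
            (\<exists>c'. hyperbolic_set A G g \<mu> c' (\<Lambda>' g))))"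
    for \<epsilon> \<delta> f \<Lambda> lam and \<Lambda>' :: "('a \<Rightarrow> 'a) \<Rightarrow> 'a set" and h :: "('a \<Rightarrow> 'a) \<Rightarrow> 'a \<Rightarrow> 'a"
  define Works where "Works lam c K \<omega> p \<longleftrightarrow> (\<forall>f \<Lambda>. C1_diffeo A f \<longrightarrow> hyperbolic_set A G f lam c \<Lambda> \<longrightarrow> deriv_bounded A G f K \<longrightarrow>
      deriv_modulus A G f = \<omega> \<longrightarrow> fst p > 0 \<and> snd p > 0 \<and> (\<exists>\<Lambda>' h. Stable (fst p) (snd p) f \<Lambda> lam \<Lambda>' h))"
    for lam c K \<omega> and p :: "real \<times> real"
  \<comment> \<open>The data are arbitrary here, and \<open>\<omega>\<close> need not be small near
    0. If some \<open>f\<close> realises them, that \<open>f\<close> shows \<open>\<omega>\<close>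
    to be a genuine modulus; otherwise any pair works vacuously.\<close>
  have "\<exists>p. Works lam c K \<omega> p" for lam c K \<omega>
  proof (cases "\<exists>f \<Lambda>. C1_diffeo A f \<and> hyperbolic_set A G f lam c \<Lambda> \<and> deriv_bounded A G f K \<and> deriv_modulus A G f = \<omega>")
    case True
    then obtain f \<Lambda> where f: "C1_diffeo A f" "hyperbolic_set A G f lam c \<Lambda>" "deriv_bounded A G f K" "deriv_modulus A G f = \<omega>" by blast
    have lam: "0 < lam" "lam < 1" "0 < c" by (rule hyperbolic_setD[OF f(2)])+
    have K: "K \<ge> 0" by (rule deriv_bounded_nonneg[OF f(3)])
    have \<omega>: "\<exists>r>0. \<omega> r \<le> ennreal \<eta>" if "\<eta> > 0" for \<eta>
      using U.deriv_modulus_tendsto_0[OF C1_diffeoD(2)[OF f(1)] f(3) K that] unfolding f(4) .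
    obtain \<epsilon> \<delta> where e: "\<epsilon> > 0" "\<delta> > 0" "\<forall>f \<Lambda>. C1_diffeo A f \<longrightarrow> hyperbolic_set A G f lam c \<Lambda> \<longrightarrow> deriv_bounded A G f K \<longrightarrow>
      deriv_modulus A G f = \<omega> \<longrightarrow> (\<exists>\<Lambda>' h. Stable \<epsilon> \<delta> f \<Lambda> lam \<Lambda>' h)"
      using U.structural_stability[OF lam K \<omega>] unfolding Stable_def[symmetric] by blast
    then have "Works lam c K \<omega> (\<epsilon>, \<delta>)" by (simp add: Works_def)
    then show ?thesis by blast
  next
    case False
    then have "Works lam c K \<omega> (1, 1)" unfolding Works_def by blast
    then show ?thesis by blast
  qed
  then obtain p where p: "\<And>lam c K \<omega>. Works lam c K \<omega> (p lam c K \<omega>)" by metis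
  show ?thesis
  proof (rule exI[of _ "\<lambda>lam c K K' \<omega>. fst (p lam c K \<omega>)"], rule exI[of _ "\<lambda>lam c K K' \<omega>. snd (p lam c K \<omega>)"],
      intro allI impI, unfold Let_def, elim conjE)
    fix f \<Lambda> lam c K K' assume f: "C1_diffeo A f" "hyperbolic_set A G f lam c \<Lambda>" "deriv_bounded A G f K"
    define \<epsilon> where "\<epsilon> = fst (p lam c K (deriv_modulus A G f))"
    define \<delta> where "\<delta> = snd (p lam c K (deriv_modulus A G f))"
    have lam: "lam < 1" by (rule hyperbolic_setD[OF f(2)])
    have pos: "\<epsilon> > 0" "\<delta> > 0" and "\<exists>\<Lambda>' h. Stable \<epsilon> \<delta> f \<Lambda> lam \<Lambda>' h"
      using p[of lam c K "deriv_modulus A G f", unfolded Works_def, rule_format, OF f refl]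
      unfolding \<epsilon>_def[symmetric] \<delta>_def[symmetric] by blast+
    then obtain \<Lambda>' h where S: "Stable \<epsilon> \<delta> f \<Lambda> lam \<Lambda>' h" by blast
    note S1 = conjunct1[OF S[unfolded Stable_def], rule_format]
    note S2 = conjunct1[OF conjunct2[OF S[unfolded Stable_def]], rule_format]
    note S3 = conjunct2[OF conjunct2[OF S[unfolded Stable_def]], rule_format]
    define Ex where "Ex g = {m. lam < m \<and> m < 1 \<and> (\<exists>c'. hyperbolic_set A G g m c' (\<Lambda>' g))}" for g
    have bdd: "bdd_below (Ex g)" for g unfolding Ex_def by (rule bdd_belowI[of _ lam]) auto
    txt \<open>The infimum of the admissible exponents need not be attained, so \<open>lam' g\<close> exceeds it by less than the
      distance of \<open>f\<close> and \<open>g\<close>; this leaves no constraint when the distance is \<open>0\<close>.\<close>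
    define lam' where "lam' g = (SOME m. m \<in> Ex g \<and> (0 < C1_dist A G f g \<longrightarrow> m < Inf (Ex g) + enn2real (C1_dist A G f g)))" for g
    have lam': "lam' g \<in> Ex g \<and> (0 < C1_dist A G f g \<longrightarrow> lam' g < Inf (Ex g) + enn2real (C1_dist A G f g))"
      if g: "C1_diffeo A g" "C1_dist A G f g < ennreal \<epsilon>" for g
    proof -
      obtain m where m: "m \<in> Ex g" using S1[OF g] unfolding Ex_def by blast
      have "\<exists>m. m \<in> Ex g \<and> (0 < C1_dist A G f g \<longrightarrow> m < Inf (Ex g) + enn2real (C1_dist A G f g))"
      proof (cases "0 < C1_dist A G f g")
        case True
        have "C1_dist A G f g < top" using g(2) by (rule less_trans) simp
        then have "enn2real (C1_dist A G f g) > 0" using True by (simp add: enn2real_positive_iff)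
        then have "Inf (Ex g) < Inf (Ex g) + enn2real (C1_dist A G f g)" by simp
        then show ?thesis using cInf_lessD[of "Ex g"] m by blast
      qed (use m in blast)
      then show ?thesis unfolding lam'_def by (rule someI_ex)
    qed
    show "0 < fst (p lam c K (deriv_modulus A G f)) \<and> 0 < snd (p lam c K (deriv_modulus A G f)) \<and>
          (\<exists>(\<Lambda>' :: ('a \<Rightarrow> 'a) \<Rightarrow> 'a set) (h :: ('a \<Rightarrow> 'a) \<Rightarrow> 'a \<Rightarrow> 'a) (lam' :: ('a \<Rightarrow> 'a) \<Rightarrow> real).
             (\<forall>g. C1_diffeo A g \<and> C1_dist A G f g < ennreal (fst (p lam c K (deriv_modulus A G f))) \<longrightarrow>
                lam < lam' g \<and> lam' g < 1 \<and>
                (\<exists>c'. hyperbolic_set A G g (lam' g) c' (\<Lambda>' g)) \<and>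
                close_conjugacy A G (snd (p lam c K (deriv_modulus A G f))) f \<Lambda> g (\<Lambda>' g) (h g) \<and>
                (\<forall>\<Lambda>'' \<mu> c'' h''.
                   hyperbolic_set A G g \<mu> c'' \<Lambda>'' \<and> close_conjugacy A G (snd (p lam c K (deriv_modulus A G f))) f \<Lambda> g \<Lambda>'' h'' \<longrightarrow>
                   \<Lambda>'' = \<Lambda>' g)) \<and>
             (\<forall>\<eta>>0. \<exists>\<rho>>0. \<forall>g. C1_diffeo A g \<and> C1_dist A G f g < ennreal \<rho> \<longrightarrow>
                (\<forall>x\<in>\<Lambda>. riem_dist A G (h g x) x < ennreal \<eta>)) \<and>
             (\<forall>\<eta>>0. \<exists>\<rho>>0. \<forall>g. C1_diffeo A g \<and> 0 < C1_dist A G f g \<and>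
                C1_dist A G f g < ennreal \<rho> \<longrightarrow> \<bar>lam' g - lam\<bar> < \<eta>))"
      unfolding \<epsilon>_def[symmetric] \<delta>_def[symmetric]
    proof (rule conjI[OF pos(1) conjI[OF pos(2)]], rule exI[of _ \<Lambda>'], rule exI[of _ h], rule exI[of _ lam'],
        intro conjI[OF _ conjI] allI impI)
      fix g assume g: "C1_diffeo A g \<and> C1_dist A G f g < ennreal \<epsilon>"
      note g' = conjunct1[OF g] conjunct2[OF g]
      have "lam' g \<in> Ex g" using lam'[OF g'] by blast
      then show "lam < lam' g" "lam' g < 1" "\<exists>c'. hyperbolic_set A G g (lam' g) c' (\<Lambda>' g)"
        unfolding Ex_def by blast+
      show "close_conjugacy A G \<delta> f \<Lambda> g (\<Lambda>' g) (h g)" using S1[OF g'] by blast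
      show "\<Lambda>'' = \<Lambda>' g" if "hyperbolic_set A G g \<mu> c'' \<Lambda>'' \<and> close_conjugacy A G \<delta> f \<Lambda> g \<Lambda>'' h''" for \<Lambda>'' \<mu> c'' h''
        using S1[OF g'] that by blast
    next
      fix \<eta> :: real assume "\<eta> > 0"
      from S2[OF this] show "\<exists>\<rho>>0. \<forall>g. C1_diffeo A g \<and> C1_dist A G f g < ennreal \<rho> \<longrightarrow> (\<forall>x\<in>\<Lambda>. riem_dist A G (h g x) x < ennreal \<eta>)"
        by blast
    next
      fix \<eta> :: real assume \<eta>: "\<eta> > 0"
      \<comment> \<open>\<open>\<mu>\<close> stays below 1 and exceeds \<open>lam\<close> by at most
        \<open>\<eta> / 2\<close>. The other half of \<open>\<eta>\<close> pays for the excess of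
        \<open>lam' g\<close> over the infimum, which is below the distance of \<open>f\<close> and
        \<open>g\<close>.\<close>
      define \<mu> where "\<mu> = min (lam + \<eta> / 2) ((1 + lam) / 2)"
      have \<mu>: "lam < \<mu>" "\<mu> < 1" "\<mu> \<le> lam + \<eta> / 2" using \<eta> lam by (auto simp: \<mu>_def min_less_iff_disj)
      obtain \<rho>\<mu> where \<rho>\<mu>: "\<rho>\<mu> > 0" "\<And>g. C1_diffeo A g \<Longrightarrow> C1_dist A G f g < ennreal \<rho>\<mu> \<Longrightarrow> \<exists>c'. hyperbolic_set A G g \<mu> c' (\<Lambda>' g)"
        using S3[OF \<mu>(1,2)] by blast
      define \<rho> where "\<rho> = min \<rho>\<mu> (min \<epsilon> (\<eta> / 2))"
      have \<rho>: "\<rho> > 0" "\<rho> \<le> \<rho>\<mu>" "\<rho> \<le> \<epsilon>" "\<rho> \<le> \<eta> / 2" using \<rho>\<mu> pos \<eta> by (auto simp: \<rho>_def)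
      have "\<bar>lam' g - lam\<bar> < \<eta>" if g: "C1_diffeo A g" "0 < C1_dist A G f g" "C1_dist A G f g < ennreal \<rho>" for g
      proof -
        have le: "C1_dist A G f g < ennreal r" if "\<rho> \<le> r" for r
          using g(3) ennreal_leI[OF that] by (rule less_le_trans)
        note l = lam'[OF g(1) le[OF \<rho>(3)]]
        have "\<mu> \<in> Ex g" using \<rho>\<mu>(2)[OF g(1) le[OF \<rho>(2)]] \<mu> unfolding Ex_def by blast
        then have "Inf (Ex g) \<le> \<mu>" by (rule cInf_lower[OF _ bdd])
        moreover have "enn2real (C1_dist A G f g) \<le> \<eta> / 2"
          by (rule enn2real_leI) (use \<eta> less_imp_le[OF le[OF \<rho>(4)]] in auto)
        ultimately have "lam' g < lam + \<eta>" using l g(2) \<mu>(3) by auto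
        moreover have "lam < lam' g" using l unfolding Ex_def by blast
        ultimately show ?thesis by simp
      qed
      then show "\<exists>\<rho>>0. \<forall>g. C1_diffeo A g \<and> 0 < C1_dist A G f g \<and> C1_dist A G f g < ennreal \<rho> \<longrightarrow> \<bar>lam' g - lam\<bar> < \<eta>"
        using \<rho>(1) by blast
    qed
  qed
qed

end
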